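(* Let $f$ satisfy hypotheses $(\mathcal F_1)$–$(\mathcal F_5)$ (listed in the context). If $a^{\frac{N-4}{2}}b>C_2(N)$, then there exists $\lambda^*:=\lambda^*(a,b)\in(0,\lambda_0^* )$ such that if $\lambda\in(0,\lambda^* )$, then $(\mathcal P_\lambda)$ has no non-zero solution. Moreover, for $\lambda>0$, there exists $u\in H_0^1(\Omega)\setminus\{0\}$ such that $\Phi_\lambda'(u)u=0$ if, and only if, $\lambda\ge\lambda^*$.
   Context: $N>4$ is an integer, $2^*=\frac{2N}{N-2}$, $\Omega\subseteq\mathbb R^N$ is a bounded domain, $a,b$ are positive numbers, $\lambda>0$ is a (positive) parameter. $H_0^1(\Omega)$ has norm $\|u\|=(\int_\Omega|\nabla u|^2dx)^{1/2}$ and $\|u\|_q$ is the $L^q(\Omega)$ norm. $S_N=\inf_{u\in H_0^1(\Omega)\setminus\{0\}}\|u\|^2/\|u\|_{2^*}^2$, $C_1(N)=\frac{4(N-4)^{\frac{N-4}{2}}}{N^{\frac{N-2}{2}}S_N^{\frac N2}}$, $C_2(N)=\frac{2(N-4)^{\frac{N-4}{2}}}{(N-2)^{\frac{N-2}{2}}S_N^{\frac N2}}$; one has $C_1(N)<C_2(N)$. Problem $(\mathcal P_\lambda)$: $-\left(a+b\int_\Omega|\nabla u|^2dx\right)\Delta u=|u|^{2^*-2}u+\lambda f(x,u)$ in $\Omega$, $u=0$ on $\partial\Omega$. Solutions are weak solutions, i.e. critical points in $H_0^1(\Omega)$ of the energy functional $\Phi_\lambda(u)=\frac a2\|u\|^2+\frac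 b4\|u\|^4-\frac1{2^*}\|u\|_{2^*}^{2^*}-\lambda\int_\Omega F(x,u)dx$, where $F(x,v)=\int_0^vf(x,t)dt$. Hypotheses on $f$: $(\mathcal F_1)$ $f:\Omega\times\mathbb R\to\mathbb R$ is a Carathéodory function with $f(x,0)=0$ for a.a. $x\in\Omega$. $(\mathcal F_2)$ $f(x,v)>0$ for every $v>0$ and a.a. $x\in\Omega$, $f(x,v)<0$ for every $v<0$ and a.a. $x\in\Omega$; moreover there exist $\mu>0$ and an open interval $I\subset(0,+\infty)$ such that $f(x,v)\ge\mu>0$ for a.a. $x\in\Omega$ and every $v\in I$. $(\mathcal F_3)$ There exist $c>0$, $p\in(2,2^* )$ such that $|f(x,v)|\le c(1+|v|^{p-1})$ for every $v\in\mathbb R$ and a.a. $x\in\Omega$. $(\mathcal F_4)$ $f(x,v)=o(|v|)$ as $v\to0$, uniformly in $x\in\Omega$. $(\mathcal F_5)$ For each $u\in H_0^1(\Omega)\setminus\{0\}$, the function $(0,\infty)\ni t\mapsto\int_\Omega f(x,tu(x))dx$ is $C^1$. Definition of $\lambda_0^*$: for $u\in H_0^1(\Omega)\setminus\{0\}$ let $\psi_{\lambda,u}(t)=\Phi_\lambda(tu)$, $t>0$. When $a^{\frac{N-4}{2}}b\ge C_1(N)$, for every such $u$ there is a unique $\lambda_0(u)>0$ for which, with $\lambda=\lambda_0(u)$, there exists $t>0$ with $\psi_{\lambda,u}(t)=0$, $\psi_{\lambda,u}'(t)=0$ and $\psi_{\lambda,u}(t)=\inf_{s>0}\psi_{\lambda,u}(s)$.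 Then $\lambda_0^*=\lambda_0^*(a,b)=\inf_{u\in H_0^1(\Omega)\setminus\{0\}}\lambda_0(u)$. *)

theory Defs
  imports "HOL-Analysis.Analysis"
begin

section \<open>Sobolev spaces\<close>

text \<open>
  Elements of Lebesgue and Sobolev spaces on \<open>\<Omega>\<close> are represented by functions on the whole space.
  Values outside \<open>\<Omega>\<close> are irrelevant, because all integrals are taken with respect to
  \<^term>\<open>lebesgue_on \<Omega>\<close>, and two functions represent the same element iff they agree almost everywhere
  on \<open>\<Omega>\<close>.
\<close>

definition bounded_domain :: "'a::euclidean_space set \<Rightarrow> bool" where
  "bounded_domain \<Omega> \<longleftrightarrow> open \<Omega> \<and> connected \<Omega> \<and> bounded \<Omega> \<and> \<Omega> \<noteq> {}"

definition partial_deriv :: "'a::euclidean_space \<Rightarrow> ('a \<Rightarrow> real) \<Rightarrow> 'a \<Rightarrow> real" where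
  "partial_deriv i \<phi> x = frechet_derivative \<phi> (at x) i"

primrec Ck :: "nat \<Rightarrow> ('a::euclidean_space \<Rightarrow> real) \<Rightarrow> bool" where
  "Ck 0 \<phi> \<longleftrightarrow> continuous_on UNIV \<phi>"
| "Ck (Suc k) \<phi> \<longleftrightarrow> \<phi> differentiable_on UNIV \<and> (\<forall>i\<in>Basis. Ck k (partial_deriv i \<phi>))"

definition test_functions :: "'a::euclidean_space set \<Rightarrow> ('a \<Rightarrow> real) set" where
  "test_functions \<Omega> =
     {\<phi>. (\<forall>k. Ck k \<phi>) \<and> compact (closure {x. \<phi> x \<noteq> 0}) \<and> closure {x. \<phi> x \<noteq> 0} \<subseteq> \<Omega>}"

definition L2 :: "'a::euclidean_space set \<Rightarrow> ('a \<Rightarrow> 'b::euclidean_space) set" where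
  "L2 \<Omega> = {u. u \<in> borel_measurable (lebesgue_on \<Omega>) \<and>
              integrable (lebesgue_on \<Omega>) (\<lambda>x. (norm (u x))\<^sup>2)}"

definition is_weak_gradient :: "'a::euclidean_space set \<Rightarrow> ('a \<Rightarrow> real) \<Rightarrow> ('a \<Rightarrow> 'a) \<Rightarrow> bool" where
  "is_weak_gradient \<Omega> u g \<longleftrightarrow>
     (\<forall>\<phi>\<in>test_functions \<Omega>. \<forall>i\<in>Basis.
        (LINT x|lebesgue_on \<Omega>. u x * partial_deriv i \<phi> x) =
        - (LINT x|lebesgue_on \<Omega>. (g x \<bullet> i) * \<phi> x))"

definition H1 :: "'a::euclidean_space set \<Rightarrow> ('a \<Rightarrow> real) set" where
  "H1 \<Omega> = {u \<in> L2 \<Omega>. \<exists>g\<in>L2 \<Omega>. is_weak_gradient \<Omega> u g}"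

text \<open>The choice below is unique up to null sets, for \<open>u\<close> in \<^term>\<open>H1 \<Omega>\<close>.\<close>

definition weak_grad :: "'a::euclidean_space set \<Rightarrow> ('a \<Rightarrow> real) \<Rightarrow> 'a \<Rightarrow> 'a" where
  "weak_grad \<Omega> u = (SOME g. g \<in> L2 \<Omega> \<and> is_weak_gradient \<Omega> u g)"

definition H1_norm :: "'a::euclidean_space set \<Rightarrow> ('a \<Rightarrow> real) \<Rightarrow> real" where
  "H1_norm \<Omega> u = sqrt ((LINT x|lebesgue_on \<Omega>. (u x)\<^sup>2) +
                       (LINT x|lebesgue_on \<Omega>. (norm (weak_grad \<Omega> u x))\<^sup>2))"

text \<open>The closure of the test functions in \<^term>\<open>H1 \<Omega>\<close>.\<close>

definition H10 :: "'a::euclidean_space set \<Rightarrow> ('a \<Rightarrow> real) set" where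
  "H10 \<Omega> = {u \<in> H1 \<Omega>. \<exists>\<phi>. (\<forall>k::nat. \<phi> k \<in> test_functions \<Omega>) \<and>
                (\<lambda>k. H1_norm \<Omega> (\<lambda>x. \<phi> k x - u x)) \<longlonglongrightarrow> 0}"

definition H10_nonzero :: "'a::euclidean_space set \<Rightarrow> ('a \<Rightarrow> real) set" where
  "H10_nonzero \<Omega> = {u \<in> H10 \<Omega>. \<not> (AE x in lebesgue_on \<Omega>. u x = 0)}"

definition H10_norm :: "'a::euclidean_space set \<Rightarrow> ('a \<Rightarrow> real) \<Rightarrow> real" where
  "H10_norm \<Omega> u = sqrt (LINT x|lebesgue_on \<Omega>. (norm (weak_grad \<Omega> u x))\<^sup>2)"

definition Lq_norm :: "'a::euclidean_space set \<Rightarrow> real \<Rightarrow> ('a \<Rightarrow> real) \<Rightarrow> real" where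
  "Lq_norm \<Omega> q u = (LINT x|lebesgue_on \<Omega>. \<bar>u x\<bar> powr q) powr (1 / q)"

text \<open>\<open>L\<close> is the Frechet derivative at \<open>u\<close> of the functional \<open>\<Phi>\<close> on \<^term>\<open>H10 \<Omega>\<close>, normed by
  \<^term>\<open>H10_norm \<Omega>\<close>. The library's derivative is not applicable, since \<^term>\<open>H10 \<Omega>\<close> is not a type.\<close>

definition has_H10_derivative ::
  "'a::euclidean_space set \<Rightarrow> (('a \<Rightarrow> real) \<Rightarrow> real) \<Rightarrow> (('a \<Rightarrow> real) \<Rightarrow> real) \<Rightarrow> ('a \<Rightarrow> real) \<Rightarrow> bool"
where
  "has_H10_derivative \<Omega> \<Phi> L u \<longleftrightarrow>
     (\<forall>v\<in>H10 \<Omega>. \<forall>w\<in>H10 \<Omega>. L (\<lambda>x. v x + w x) = L v + L w) \<and>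
     (\<forall>c. \<forall>v\<in>H10 \<Omega>. L (\<lambda>x. c * v x) = c * L v) \<and>
     (\<exists>K. \<forall>v\<in>H10 \<Omega>. \<bar>L v\<bar> \<le> K * H10_norm \<Omega> v) \<and>
     (\<forall>\<epsilon>>0. \<exists>\<delta>>0. \<forall>v\<in>H10 \<Omega>. H10_norm \<Omega> v < \<delta> \<longrightarrow>
        \<bar>\<Phi> (\<lambda>x. u x + v x) - \<Phi> u - L v\<bar> \<le> \<epsilon> * H10_norm \<Omega> v)"

section \<open>Constants\<close>

definition crit_exp :: "nat \<Rightarrow> real" where
  "crit_exp N = 2 * real N / (real N - 2)"

definition Sobolev_const :: "'a::euclidean_space set \<Rightarrow> real" where
  "Sobolev_const \<Omega> =
     (INF u\<in>H10_nonzero \<Omega>. (H10_norm \<Omega> u)\<^sup>2 / (Lq_norm \<Omega> (crit_exp DIM('a)) u)\<^sup>2)"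

definition C2 :: "'a::euclidean_space set \<Rightarrow> real" where
  "C2 \<Omega> = (let N = real DIM('a) in
     2 * (N - 4) powr ((N - 4) / 2) /
     ((N - 2) powr ((N - 2) / 2) * Sobolev_const \<Omega> powr (N / 2)))"

section \<open>Hypotheses on the nonlinearity\<close>

definition F1 :: "'a::euclidean_space set \<Rightarrow> ('a \<Rightarrow> real \<Rightarrow> real) \<Rightarrow> bool" where
  "F1 \<Omega> f \<longleftrightarrow>
     (\<forall>v. (\<lambda>x. f x v) \<in> borel_measurable (lebesgue_on \<Omega>)) \<and>
     (AE x in lebesgue_on \<Omega>. continuous_on UNIV (f x)) \<and>
     (AE x in lebesgue_on \<Omega>. f x 0 = 0)"

definition F2 :: "'a::euclidean_space set \<Rightarrow> ('a \<Rightarrow> real \<Rightarrow> real) \<Rightarrow> bool" where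
  "F2 \<Omega> f \<longleftrightarrow>
     (AE x in lebesgue_on \<Omega>. \<forall>v>0. f x v > 0) \<and>
     (AE x in lebesgue_on \<Omega>. \<forall>v<0. f x v < 0) \<and>
     (\<exists>\<mu>>0. \<exists>I. open I \<and> is_interval I \<and> I \<noteq> {} \<and> I \<subseteq> {0<..} \<and>
        (AE x in lebesgue_on \<Omega>. \<forall>v\<in>I. f x v \<ge> \<mu>))"

definition F3 :: "'a::euclidean_space set \<Rightarrow> ('a \<Rightarrow> real \<Rightarrow> real) \<Rightarrow> bool" where
  "F3 \<Omega> f \<longleftrightarrow>
     (\<exists>c>0. \<exists>p. 2 < p \<and> p < crit_exp DIM('a) \<and>
        (AE x in lebesgue_on \<Omega>. \<forall>v. \<bar>f x v\<bar> \<le> c * (1 + \<bar>v\<bar> powr (p - 1))))"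

definition F4 :: "'a::euclidean_space set \<Rightarrow> ('a \<Rightarrow> real \<Rightarrow> real) \<Rightarrow> bool" where
  "F4 \<Omega> f \<longleftrightarrow> uniform_limit \<Omega> (\<lambda>v x. f x v / \<bar>v\<bar>) (\<lambda>x. 0) (at 0)"

definition F5 :: "'a::euclidean_space set \<Rightarrow> ('a \<Rightarrow> real \<Rightarrow> real) \<Rightarrow> bool" where
  "F5 \<Omega> f \<longleftrightarrow>
     (\<forall>u\<in>H10_nonzero \<Omega>. (\<lambda>t. LINT x|lebesgue_on \<Omega>. f x (t * u x)) C1_differentiable_on {0<..})"

section \<open>The energy functional and the extremal parameter\<close>

definition primitive :: "('a \<Rightarrow> real \<Rightarrow> real) \<Rightarrow> 'a \<Rightarrow> real \<Rightarrow> real" where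
  "primitive f x v = (LBINT t=0..v. f x t)"

definition energy ::
  "'a::euclidean_space set \<Rightarrow> real \<Rightarrow> real \<Rightarrow> ('a \<Rightarrow> real \<Rightarrow> real) \<Rightarrow> real \<Rightarrow> ('a \<Rightarrow> real) \<Rightarrow> real"
where
  "energy \<Omega> a b f lam u =
     a / 2 * (H10_norm \<Omega> u)\<^sup>2 + b / 4 * (H10_norm \<Omega> u) ^ 4
     - 1 / crit_exp DIM('a) * Lq_norm \<Omega> (crit_exp DIM('a)) u powr crit_exp DIM('a)
     - lam * (LINT x|lebesgue_on \<Omega>. primitive f x (u x))"

text \<open>Weak solutions of
  \<open>- (a + b \<integral>|\<nabla>u|\<^sup>2) \<Delta>u = |u| powr (2* - 2) u + lam f(x,u)\<close> in \<open>\<Omega>\<close>, \<open>u = 0\<close> on the boundary,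
  i.e. critical points of the energy.\<close>

definition weak_solution ::
  "'a::euclidean_space set \<Rightarrow> real \<Rightarrow> real \<Rightarrow> ('a \<Rightarrow> real \<Rightarrow> real) \<Rightarrow> real \<Rightarrow> ('a \<Rightarrow> real) \<Rightarrow> bool"
where
  "weak_solution \<Omega> a b f lam u \<longleftrightarrow>
     u \<in> H10 \<Omega> \<and> has_H10_derivative \<Omega> (energy \<Omega> a b f lam) (\<lambda>v. 0) u"

definition fiber ::
  "'a::euclidean_space set \<Rightarrow> real \<Rightarrow> real \<Rightarrow> ('a \<Rightarrow> real \<Rightarrow> real) \<Rightarrow> real \<Rightarrow> ('a \<Rightarrow> real) \<Rightarrow> real \<Rightarrow> real"
where
  "fiber \<Omega> a b f lam u t = energy \<Omega> a b f lam (\<lambda>x. t * u x)"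

text \<open>The infimum is taken in the extended reals, so that it is meaningful without a boundedness
  condition.\<close>

definition lambda0 ::
  "'a::euclidean_space set \<Rightarrow> real \<Rightarrow> real \<Rightarrow> ('a \<Rightarrow> real \<Rightarrow> real) \<Rightarrow> ('a \<Rightarrow> real) \<Rightarrow> real"
where
  "lambda0 \<Omega> a b f u = (THE lam. lam > 0 \<and> (\<exists>t>0.
     fiber \<Omega> a b f lam u t = 0 \<and>
     (fiber \<Omega> a b f lam u has_real_derivative 0) (at t) \<and>
     ereal (fiber \<Omega> a b f lam u t) = (INF s\<in>{0<..}. ereal (fiber \<Omega> a b f lam u s))))"

definition lambda0_star ::
  "'a::euclidean_space set \<Rightarrow> real \<Rightarrow> real \<Rightarrow> ('a \<Rightarrow> real \<Rightarrow> real) \<Rightarrow> real"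
where
  "lambda0_star \<Omega> a b f = (INF u\<in>H10_nonzero \<Omega>. lambda0 \<Omega> a b f u)"

end

theory Submission
  imports Defs "HOL-Complex_Analysis.Great_Picard"
begin

text \<open>
  Testing the equation with \<open>u\<close> itself gives \<open>num u = lam * D u\<close>, where
  \<open>num u = a * (nrm u)\<^sup>2 + b * nrm u ^ 4 - (\<integral>|u| powr q)\<close> with the critical exponent \<open>q\<close> and
  \<open>(nrm u)\<^sup>2 = (\<integral>|\<nabla>u|\<^sup>2)\<close>,
  and \<open>D u = (\<integral>f x (u x) * u x) > 0\<close>. Hence the threshold is the infimum \<open>Lam\<close> of \<open>num / D\<close>. By the weighted
  arithmetic-geometric mean inequality, \<open>C2\<close> is the value beyond which \<open>num\<close> is coercive and, by a
  Brezis--Lieb argument, weakly lower semicontinuous. Since \<open>D\<close> is weakly continuous by Rellich's theorem and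
  the subcritical growth of \<open>f\<close>, the infimum is attained. Along the ray through a minimizer \<open>num / D\<close> is
  continuous and tends to infinity, so it takes every value \<open>lam \<ge> Lam\<close>. Finally, the energy with parameter
  \<open>Lam\<close> is nondecreasing along rays and bounded below by a positive constant on small spheres, whereas the one
  with parameter \<open>lambda0 u\<close> has a zero on the ray through \<open>u\<close>; this separates \<open>lambda0 u\<close> from \<open>Lam\<close>
  uniformly in \<open>u\<close>.
\<close>

section \<open>Hoelder and Gagliardo inequalities\<close>

text \<open>The obstacle is the critical exponent: \<open>H10 \<Omega>\<close> embeds into the
  \<open>q\<close>-integrable functions, but not compactly, so \<open>Pq\<close> is not weakly
  continuous and part of \<open>Pq (u n)\<close> may stay in the differences
  \<open>w = u n - v\<close> to the weak limit. The gradient energy lost at the same time pays for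
  it: weak convergence splits \<open>(nrm (u n))\<^sup>2\<close> into
  \<open>(nrm w)\<^sup>2 + (nrm v)\<^sup>2\<close> up to an error tending to \<open>0\<close>, and
  the inequality behind \<open>C2\<close>, applied to \<open>w\<close>, says that
  \<open>a * (nrm w)\<^sup>2 + b * nrm w ^ 4\<close> is at least
  \<open>(1 + \<delta>) * Pq w\<close>. Applied to \<open>u\<close> itself it yields coercivity. The
  slack \<open>\<delta>\<close> comes from the strict inequality assumed for \<open>C2\<close>; it
  absorbs the error of splitting \<open>Pq\<close> and leaves a multiple of
  \<open>(nrm u)\<^sup>2 + nrm u ^ 4\<close> below \<open>num u\<close>. As \<open>N > 4\<close>
  means \<open>q < 4\<close>, the bound \<open>\<eta> * V\<^sup>2 + B * V powr p\<close> of
  \<open>D\<close>, with \<open>\<eta>\<close> as small as wished, loses against these powers for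
  small and for large \<open>V\<close>. Hence \<open>num u \<le> lam * D u\<close> confines
  \<open>nrm u\<close> to a band away from \<open>0\<close> and infinity, which keeps minimizing
  sequences bounded and their limits nonzero.\<close>

lemma Holder_integral:
  fixes f g :: "'a \<Rightarrow> real"
  assumes pq: "p > 1" "q > 1" "1 / p + 1 / q = 1"
    and [measurable]: "f \<in> borel_measurable M" "g \<in> borel_measurable M"
    and fi: "integrable M (\<lambda>x. \<bar>f x\<bar> powr p)" and gi: "integrable M (\<lambda>x. \<bar>g x\<bar> powr q)"
  shows "integrable M (\<lambda>x. f x * g x)"
    and "(LINT x|M. \<bar>f x * g x\<bar>)
          \<le> (LINT x|M. \<bar>f x\<bar> powr p) powr (1 / p) * (LINT x|M. \<bar>g x\<bar> powr q) powr (1 / q)"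
proof -
  have young: "\<bar>f x * g x\<bar> \<le> \<bar>f x\<bar> powr p / p + \<bar>g x\<bar> powr q / q" for x
    using Youngs_inequality[OF pq, of "\<bar>f x\<bar>" "\<bar>g x\<bar>"] by (simp add: abs_mult)
  show int: "integrable M (\<lambda>x. f x * g x)"
  proof (rule Bochner_Integration.integrable_bound)
    show "integrable M (\<lambda>x. \<bar>f x\<bar> powr p / p + \<bar>g x\<bar> powr q / q)"
      using fi gi by auto
    show "AE x in M. norm (f x * g x) \<le> norm (\<bar>f x\<bar> powr p / p + \<bar>g x\<bar> powr q / q)"
      using young pq by (auto intro!: AE_I2 order_trans[OF young])
  qed measurable
  define A where "A = (LINT x|M. \<bar>f x\<bar> powr p)"
  define B where "B = (LINT x|M. \<bar>g x\<bar> powr q)"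
  have AB: "A \<ge> 0" "B \<ge> 0" by (auto simp: A_def B_def)
  show "(LINT x|M. \<bar>f x * g x\<bar>)
          \<le> (LINT x|M. \<bar>f x\<bar> powr p) powr (1 / p) * (LINT x|M. \<bar>g x\<bar> powr q) powr (1 / q)"
  proof (cases "A = 0 \<or> B = 0")
    case True
    then have "AE x in M. f x * g x = 0"
    proof
      assume "A = 0"
      then have "AE x in M. \<bar>f x\<bar> powr p = 0"
        unfolding A_def using integral_nonneg_eq_0_iff_AE[OF fi] by auto
      then show ?thesis by eventually_elim auto
    next
      assume "B = 0"
      then have "AE x in M. \<bar>g x\<bar> powr q = 0"
        unfolding B_def using integral_nonneg_eq_0_iff_AE[OF gi] by auto
      then show ?thesis by eventually_elim auto
    qed
    then have "(LINT x|M. \<bar>f x * g x\<bar>) = 0"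
      by (intro integral_eq_zero_AE) auto
    then show ?thesis by simp
  next
    case False
    with AB have pos: "A > 0" "B > 0" by auto
    \<comment> \<open>Young's inequality is applied to \<open>f\<close> and \<open>g\<close> divided
      by their norms; the right side then integrates to \<open>1 / p + 1 / q = 1\<close>.\<close>
    define \<alpha> where "\<alpha> = A powr (1 / p)"
    define \<beta> where "\<beta> = B powr (1 / q)"
    have ab: "\<alpha> > 0" "\<beta> > 0" "\<alpha> powr p = A" "\<beta> powr q = B"
      using pos pq by (auto simp: \<alpha>_def \<beta>_def powr_powr)
    have pw: "\<bar>f x * g x\<bar> \<le> \<alpha> * \<beta> * (\<bar>f x\<bar> powr p / (p * A) + \<bar>g x\<bar> powr q / (q * B))" for x
    proof -
      have "\<bar>f x\<bar> / \<alpha> * (\<bar>g x\<bar> / \<beta>) \<le> (\<bar>f x\<bar> / \<alpha>) powr p / p + (\<bar>g x\<bar> / \<beta>) powr q / q"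
        by (rule Youngs_inequality[OF pq]) (use ab in auto)
      also have "\<dots> = \<bar>f x\<bar> powr p / (p * A) + \<bar>g x\<bar> powr q / (q * B)"
        using ab by (simp add: powr_divide mult.commute)
      finally show ?thesis
        using ab by (simp add: field_simps abs_mult)
    qed
    have "(LINT x|M. \<bar>f x * g x\<bar>)
        \<le> (LINT x|M. \<alpha> * \<beta> * (\<bar>f x\<bar> powr p / (p * A) + \<bar>g x\<bar> powr q / (q * B)))"
      using int fi gi pw by (intro integral_mono) auto
    also have "\<dots> = \<alpha> * \<beta> * (A / (p * A) + B / (q * B))"
      using fi gi by (simp add: A_def B_def)
    also have "\<dots> = \<alpha> * \<beta>"
      using pos pq by simp
    finally show ?thesis by (simp add: \<alpha>_def \<beta>_def A_def B_def)
  qed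
qed

text \<open>Dominated convergence with a dominating function that may move with \<open>n\<close>:
  the part of \<open>\<bar>h n x\<bar>\<close> above \<open>k n x\<close> is dominated by the fixed
  \<open>G\<close>, so its integral tends to \<open>0\<close>, while \<open>k n\<close> eventually
  contributes at most \<open>\<epsilon>\<close>. This serves growth up to the critical power, where
  the natural bound contains \<open>\<bar>u n x\<bar> powr q\<close> and no common majorant is at
  hand.\<close>

lemma tendsto_integral_abs_0:
  fixes h :: "nat \<Rightarrow> 'a \<Rightarrow> real"
  assumes [measurable]: "\<And>n. h n \<in> borel_measurable M"
    and lim: "AE x in M. (\<lambda>n. h n x) \<longlonglongrightarrow> 0"
    and dom: "\<And>\<epsilon>. \<epsilon> > 0 \<Longrightarrow> \<exists>k G. integrable M G \<and>
       (\<forall>n. integrable M (k n) \<and> (AE x in M. 0 \<le> k n x \<and> \<bar>h n x\<bar> \<le> k n x + G x)) \<and>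
       (\<forall>\<^sub>F n in sequentially. (LINT x|M. k n x) \<le> \<epsilon>)"
  shows "integrable M (h n)" "(\<lambda>n. LINT x|M. \<bar>h n x\<bar>) \<longlonglongrightarrow> 0"
proof -
  show hint: "integrable M (h n)" for n
  proof -
    obtain k G where k: "integrable M G" "integrable M (k n)"
      "AE x in M. 0 \<le> k n x \<and> \<bar>h n x\<bar> \<le> k n x + G x"
      using dom[OF zero_less_one] by blast
    from k(3) have "AE x in M. norm (h n x) \<le> norm (k n x + G x)"
      by eventually_elim auto
    then show ?thesis
      by (rule Bochner_Integration.integrable_bound[rotated 2]) (use k in auto)
  qed
  show "(\<lambda>n. LINT x|M. \<bar>h n x\<bar>) \<longlonglongrightarrow> 0"
  proof (rule LIMSEQ_I)
    fix r :: real assume "r > 0"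
    then obtain k G where G: "integrable M G" and k: "\<And>n. integrable M (k n)"
      "\<And>n. AE x in M. 0 \<le> k n x \<and> \<bar>h n x\<bar> \<le> k n x + G x"
      and ev: "\<forall>\<^sub>F n in sequentially. (LINT x|M. k n x) \<le> r / 2"
      using dom[OF half_gt_zero[OF \<open>r > 0\<close>]] by blast
    define m where "m n x = max 0 (\<bar>h n x\<bar> - k n x)" for n x
    have [measurable]: "k n \<in> borel_measurable M" for n
      using k(1) by auto
    have mm[measurable]: "m n \<in> borel_measurable M" for n
      unfolding m_def by measurable
    have mb: "AE x in M. norm (m n x) \<le> \<bar>G x\<bar>" for n
      using k(2)[of n] by eventually_elim (auto simp: m_def)
    have mint: "integrable M (m n)" for n
      by (rule Bochner_Integration.integrable_bound[OF integrable_abs[OF G]]) (use mb in auto)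
    have "(\<lambda>n. LINT x|M. m n x) \<longlonglongrightarrow> (LINT x|M. 0)"
    proof (rule integral_dominated_convergence)
      show "integrable M (\<lambda>x. \<bar>G x\<bar>)" using G by auto
      have "AE x in M. \<forall>n. 0 \<le> k n x" using k(2) by (subst AE_all_countable) (auto simp: AE_conj_iff)
      then show "AE x in M. (\<lambda>n. m n x) \<longlonglongrightarrow> 0"
        using lim
      proof eventually_elim
        case (elim x)
        have "(\<lambda>n. \<bar>h n x\<bar>) \<longlonglongrightarrow> 0" using elim(2) tendsto_rabs_zero by blast
        from tendsto_const this show ?case
          by (rule tendsto_sandwich[rotated 2])
             (use elim(1) in \<open>auto simp: m_def intro!: always_eventually\<close>)
      qed
    qed (use mb in auto)
    then have "\<forall>\<^sub>F n in sequentially. (LINT x|M. m n x) < r / 2"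
      using \<open>r > 0\<close> by (auto dest: order_tendstoD(2)[where a="r/2"])
    then have "\<forall>\<^sub>F n in sequentially. norm ((LINT x|M. \<bar>h n x\<bar>) - 0) < r"
      using ev
    proof eventually_elim
      case (elim n)
      have "(LINT x|M. \<bar>h n x\<bar>) \<le> (LINT x|M. m n x + k n x)"
        by (rule integral_mono) (use hint mint k in \<open>auto simp: m_def\<close>)
      also have "\<dots> = (LINT x|M. m n x) + (LINT x|M. k n x)"
        using mint k by simp
      finally have "(LINT x|M. \<bar>h n x\<bar>) < r" using elim by simp
      then show ?case by simp
    qed
    then show "\<exists>N. \<forall>n\<ge>N. norm ((LINT x|M. \<bar>h n x\<bar>) - 0) < r"
      by (simp add: eventually_sequentially)
  qed
qed

text \<open>Unlike \<open>0 powr 0 = 0\<close>, \<open>epow 0 0 = 1\<close>, so that factors with exponent \<open>0\<close> drop out of products.\<close>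

definition epow :: "ennreal \<Rightarrow> real \<Rightarrow> ennreal" where
  "epow x p = (if p = 0 then 1 else if x = top then top else ennreal (enn2real x powr p))"

lemma epow_measurable[measurable]:
  assumes [measurable]: "f \<in> borel_measurable M"
  shows "(\<lambda>x. epow (f x) p) \<in> borel_measurable M"
  unfolding epow_def by measurable

lemma epow_simps[simp]:
  "epow x 0 = 1" "p > 0 \<Longrightarrow> epow 0 p = 0" "p > 0 \<Longrightarrow> epow top p = top" "epow x 1 = x"
  by (auto simp: epow_def less_top)

lemma epow_add:
  assumes "p \<ge> 0" "q \<ge> 0"
  shows "epow x (p + q) = epow x p * epow x q"
  using assms by (auto simp: epow_def powr_add ennreal_mult'' ennreal_mult_eq_top_iff)

lemma epow_ennreal: "r \<ge> 0 \<Longrightarrow> p > 0 \<Longrightarrow> epow (ennreal r) p = ennreal (r powr p)"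
  by (auto simp: epow_def)

lemma epow_mono: "p \<ge> 0 \<Longrightarrow> x \<le> y \<Longrightarrow> epow x p \<le> epow y p"
  by (auto simp: epow_def top_unique intro!: ennreal_leI powr_mono2 enn2real_mono simp: less_top)

lemma epow_prod: "finite I \<Longrightarrow> p \<ge> 0 \<Longrightarrow> (\<And>i. i \<in> I \<Longrightarrow> q i \<ge> 0) \<Longrightarrow>
    (\<Prod>i\<in>I. epow x (q i)) = epow x (\<Sum>i\<in>I. q i)"
  by (induction I rule: finite_induct) (auto simp: epow_add sum_nonneg)

lemma epow_eq_0_iff: "epow x p = 0 \<longleftrightarrow> p \<noteq> 0 \<and> x = 0"
  by (auto simp: epow_def enn2real_eq_0_iff)

text \<open>On finite positive values this is convexity of \<open>exp\<close> at the logarithms. An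
  infinite value of positive weight makes the right side infinite, a zero value of positive weight
  makes the left side vanish. Weights \<open>0\<close> contribute the factor \<open>1\<close> and
  are removed first by passing to \<open>J\<close>.\<close>

lemma epow_AMGM:
  assumes "finite I" "\<And>i. i \<in> I \<Longrightarrow> p i \<ge> 0" "(\<Sum>i\<in>I. p i) = 1"
  shows "(\<Prod>i\<in>I. epow (a i) (p i)) \<le> (\<Sum>i\<in>I. ennreal (p i) * a i)"
proof -
  define J where "J = {i\<in>I. p i > 0}"
  have J: "finite J" "J \<subseteq> I" using assms(1) by (auto simp: J_def)
  have sJ: "(\<Sum>i\<in>J. p i) = 1"
    unfolding assms(3)[symmetric] J_def
    by (rule sum.mono_neutral_left) (use assms(1,2) in \<open>auto simp: not_less order.antisym\<close>)
  have pJ: "(\<Prod>i\<in>I. epow (a i) (p i)) = (\<Prod>i\<in>J. epow (a i) (p i))"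
    by (rule prod.mono_neutral_right) (use assms(1,2) in \<open>force simp: J_def\<close>)+
  have le: "(\<Sum>i\<in>J. ennreal (p i) * a i) \<le> (\<Sum>i\<in>I. ennreal (p i) * a i)"
    using J assms by (intro sum_mono2) auto
  consider (top) i where "i \<in> J" "a i = top" | (zero) i where "i \<in> J" "a i = 0"
    | (fin) "\<And>i. i \<in> J \<Longrightarrow> a i \<noteq> top" "\<And>i. i \<in> J \<Longrightarrow> a i \<noteq> 0" by blast
  then show ?thesis
  proof cases
    case top
    then have "ennreal (p i) * a i = top"
      by (auto simp: J_def ennreal_mult_eq_top_iff)
    moreover have "ennreal (p i) * a i \<le> (\<Sum>i\<in>J. ennreal (p i) * a i)"
      using top J by (intro member_le_sum) auto
    ultimately have "(\<Sum>i\<in>J. ennreal (p i) * a i) = top" by (simp add: top_unique)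
    then show ?thesis using le by (simp add: top_unique)
  next
    case zero
    then have "(\<Prod>i\<in>J. epow (a i) (p i)) = 0"
      using J(1) by (intro prod_zero) (auto simp: epow_eq_0_iff J_def intro!: bexI[of _ i])
    then show ?thesis unfolding pJ by (metis zero_le)
  next
    case fin
    define r where "r i = enn2real (a i)" for i
    have r: "r i > 0" "a i = ennreal (r i)" if "i \<in> J" for i
      using fin(1,2)[OF that] by (auto simp: r_def enn2real_positive_iff less_top zero_less_iff_neq_zero)
    have "exp (\<Sum>i\<in>J. p i *\<^sub>R ln (r i)) \<le> (\<Sum>i\<in>J. p i * exp (ln (r i)))"
      by (rule convex_on_sum[OF J(1) _ exp_convex])
         (use sJ in \<open>auto simp: J_def simp del: Collect_empty_eq\<close>)
    moreover have "exp (\<Sum>i\<in>J. p i *\<^sub>R ln (r i)) = (\<Prod>i\<in>J. r i powr p i)"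
    proof -
      have "exp (\<Sum>i\<in>J. p i *\<^sub>R ln (r i)) = (\<Prod>i\<in>J. exp (p i * ln (r i)))"
        by (simp add: exp_sum[OF J(1)])
      also have "\<dots> = (\<Prod>i\<in>J. r i powr p i)"
        by (rule prod.cong) (use r(1) in \<open>force simp: powr_def\<close>)+
      finally show ?thesis .
    qed
    moreover have "(\<Sum>i\<in>J. p i * exp (ln (r i))) = (\<Sum>i\<in>J. p i * r i)"
      using r(1) by (intro sum.cong) auto
    ultimately have *: "(\<Prod>i\<in>J. r i powr p i) \<le> (\<Sum>i\<in>J. p i * r i)" by simp
    have "(\<Prod>i\<in>J. epow (a i) (p i)) = (\<Prod>i\<in>J. ennreal (r i powr p i))"
      by (intro prod.cong) (use r in \<open>auto simp: J_def epow_ennreal less_imp_le\<close>)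
    also have "\<dots> = ennreal (\<Prod>i\<in>J. r i powr p i)"
      by (rule prod_ennreal) auto
    also have "\<dots> \<le> ennreal (\<Sum>i\<in>J. p i * r i)" using * by (rule ennreal_leI)
    also have "\<dots> = (\<Sum>i\<in>J. ennreal (p i * r i))"
      by (rule sum_ennreal[symmetric]) (use r in \<open>auto simp: J_def less_imp_le\<close>)
    also have "\<dots> = (\<Sum>i\<in>J. ennreal (p i) * a i)"
      by (intro sum.cong) (use r in \<open>auto simp: J_def less_imp_le ennreal_mult\<close>)
    finally show ?thesis using le by (simp add: pJ)
  qed
qed

lemma epow_cmult:
  assumes "c > 0" "p \<ge> 0"
  shows "epow (ennreal c * x) p = ennreal (c powr p) * epow x p"
  using assms by (auto simp: epow_def ennreal_mult_eq_top_iff enn2real_mult powr_mult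
      ennreal_mult ennreal_mult_top)

text \<open>After division of each function by its integral, the pointwise inequality
  \<open>epow_AMGM\<close> integrates to the sum of the weights, which is \<open>1\<close>. A
  vanishing integral of positive weight makes the product vanish almost everywhere; an infinite one,
  when none of positive weight vanishes, makes the right side infinite.\<close>

lemma Holder_nn_integral_prod:
  assumes I: "finite I" "\<And>i. i \<in> I \<Longrightarrow> p i \<ge> 0" "(\<Sum>i\<in>I. p i) = 1"
    and f: "\<And>i. i \<in> I \<Longrightarrow> f i \<in> borel_measurable M"
  shows "(\<integral>\<^sup>+x. (\<Prod>i\<in>I. epow (f i x) (p i)) \<partial>M) \<le> (\<Prod>i\<in>I. epow (\<integral>\<^sup>+x. f i x \<partial>M) (p i))"
proof -
  define A where "A i = (\<integral>\<^sup>+x. f i x \<partial>M)" for i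
  consider (zero) i where "i \<in> I" "p i > 0" "A i = 0"
    | (top) i where "i \<in> I" "p i > 0" "A i = top" "\<And>j. j \<in> I \<Longrightarrow> p j > 0 \<Longrightarrow> A j \<noteq> 0"
    | (fin) "\<And>i. i \<in> I \<Longrightarrow> p i > 0 \<Longrightarrow> A i \<noteq> top \<and> A i \<noteq> 0" by blast
  then have "(\<integral>\<^sup>+x. (\<Prod>i\<in>I. epow (f i x) (p i)) \<partial>M) \<le> (\<Prod>i\<in>I. epow (A i) (p i))"
  proof cases
    case zero
    then have "AE x in M. f i x = 0"
      using nn_integral_0_iff_AE[OF f[OF zero(1)]] by (auto simp: A_def)
    then have "AE x in M. (\<Prod>i\<in>I. epow (f i x) (p i)) = 0"
      by eventually_elim (use zero I in \<open>auto simp: epow_eq_0_iff intro!: bexI[of _ i]\<close>)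
    then have "(\<integral>\<^sup>+x. (\<Prod>i\<in>I. epow (f i x) (p i)) \<partial>M) = (\<integral>\<^sup>+x. 0 \<partial>M)"
      by (rule nn_integral_cong_AE)
    then show ?thesis by simp
  next
    case top
    have "(\<Prod>j\<in>I. epow (A j) (p j)) = top"
    proof -
      have "(\<Prod>j\<in>I - {i}. epow (A j) (p j)) \<noteq> 0"
        using I top(4) by (force simp: epow_eq_0_iff)
      then show ?thesis
        using top I(1) by (simp add: prod.remove[OF I(1) top(1)] ennreal_top_mult)
    qed
    then show ?thesis by simp
  next
    case fin
    \<comment> \<open>For weight \<open>0\<close> the integral may be \<open>0\<close> or infinite;
      any positive value will do there, because the exponent \<open>0\<close> turns every factor
      into \<open>1\<close>.\<close>
    define r where "r i = (if p i > 0 then enn2real (A i) else 1)" for i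
    have r: "r i > 0" "p i > 0 \<Longrightarrow> A i = ennreal (r i)" if "i \<in> I" for i
      using fin[OF that] by (auto simp: r_def enn2real_positive_iff less_top zero_less_iff_neq_zero)
    have eq: "epow (f i x) (p i) = ennreal (r i powr p i) * epow (ennreal (1 / r i) * f i x) (p i)"
      if "i \<in> I" for i x
    proof -
      have "ennreal (r i powr p i) * ennreal ((1 / r i) powr p i) = ennreal 1"
        using r(1)[OF that] by (simp add: ennreal_mult[symmetric] powr_divide)
      then show ?thesis
        using r(1)[OF that] I(2)[OF that] by (simp add: epow_cmult mult.assoc[symmetric])
    qed
    have [measurable]: "(\<lambda>x. ennreal (1 / r i) * f i x) \<in> borel_measurable M" if "i \<in> I" for i
      using f[OF that] by measurable
    have "(\<integral>\<^sup>+x. (\<Prod>i\<in>I. epow (f i x) (p i)) \<partial>M)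
       = (\<integral>\<^sup>+x. (\<Prod>i\<in>I. ennreal (r i powr p i)) * (\<Prod>i\<in>I. epow (ennreal (1 / r i) * f i x) (p i)) \<partial>M)"
      by (intro nn_integral_cong) (simp add: prod.distrib[symmetric] eq)
    also have "\<dots> \<le> (\<integral>\<^sup>+x. (\<Prod>i\<in>I. ennreal (r i powr p i)) * (\<Sum>i\<in>I. ennreal (p i) * (ennreal (1 / r i) * f i x)) \<partial>M)"
      by (intro nn_integral_mono mult_left_mono epow_AMGM I) auto
    also have "\<dots> = (\<Prod>i\<in>I. ennreal (r i powr p i)) * (\<Sum>i\<in>I. ennreal (p i) * (ennreal (1 / r i) * A i))"
      unfolding A_def using f
      by (subst nn_integral_cmult, measurable) (subst nn_integral_sum, auto simp: nn_integral_cmult)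
    also have "(\<Sum>i\<in>I. ennreal (p i) * (ennreal (1 / r i) * A i)) = (\<Sum>i\<in>I. ennreal (p i))"
    proof (rule sum.cong)
      fix i assume i: "i \<in> I"
      show "ennreal (p i) * (ennreal (1 / r i) * A i) = ennreal (p i)"
      proof (cases "p i > 0")
        case True
        then show ?thesis using r[OF i] by (simp add: ennreal_mult[symmetric])
      next
        case False
        then have "p i = 0" using I(2)[OF i] by simp
        then show ?thesis by simp
      qed
    qed simp
    also have "\<dots> = 1" using I by (simp add: sum_ennreal)
    also have "(\<Prod>i\<in>I. ennreal (r i powr p i)) = (\<Prod>i\<in>I. epow (A i) (p i))"
    proof (rule prod.cong)
      fix i assume i: "i \<in> I"
      show "ennreal (r i powr p i) = epow (A i) (p i)"
      proof (cases "p i > 0")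
        case True
        then show ?thesis using r[OF i] by (simp add: epow_ennreal)
      next
        case False
        then have "p i = 0" using I(2)[OF i] by simp
        then show ?thesis using r(1)[OF i] by simp
      qed
    qed simp
    finally show ?thesis by simp
  qed
  then show ?thesis by (simp add: A_def)
qed

text \<open>The exponents are such that integrating out one coordinate with Hoelder's inequality reproduces the
  statement for the remaining ones. For \<open>p = 1 / (card J - 1)\<close> the factor \<open>h\<close> disappears from the left-hand
  side, which gives Gagliardo's inequality.\<close>

lemma Gagliardo_product:
  fixes J :: "'i set" and h :: "('i \<Rightarrow> real) \<Rightarrow> ennreal" and p :: real
  assumes "finite J" "h \<in> borel_measurable (\<Pi>\<^sub>M i\<in>J. lborel)"
    and "p \<ge> 0" "(real (card J) - 1) * p \<le> 1"
  shows "(\<integral>\<^sup>+x. epow (h x) (1 - (real (card J) - 1) * p) *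
            (\<Prod>i\<in>J. epow (\<integral>\<^sup>+t. h (x(i := t)) \<partial>lborel) p) \<partial>(\<Pi>\<^sub>M i\<in>J. lborel))
         \<le> epow (\<integral>\<^sup>+x. h x \<partial>(\<Pi>\<^sub>M i\<in>J. lborel)) (1 + p)"
  using assms
proof (induction J arbitrary: h rule: finite_induct)
  case empty
  interpret product_sigma_finite "\<lambda>_::'i. lborel :: real measure" ..
  show ?case by (simp add: nn_integral_empty)
next
  case (insert j J)
  interpret product_sigma_finite "\<lambda>_::'i. lborel :: real measure" ..
  define k where "k = real (card J)"
  have cI: "real (card (insert j J)) = k + 1" using insert.hyps by (simp add: k_def)
  have kp: "k * p \<le> 1" using insert.prems(3) by (simp add: cI)
  note hm[measurable] = insert.prems(1)
  define H where "H x = (\<integral>\<^sup>+t. h (x(j := t)) \<partial>lborel)" for x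
  have hm2[measurable]: "(\<lambda>(x, t). h (x(j := t))) \<in> borel_measurable ((\<Pi>\<^sub>M i\<in>J. lborel) \<Otimes>\<^sub>M lborel)"
    by measurable
  have Hm[measurable]: "H \<in> borel_measurable (\<Pi>\<^sub>M i\<in>J. lborel)"
    unfolding H_def by measurable
  have Tm[measurable]: "(\<lambda>x. \<integral>\<^sup>+t. h (x(i := t)) \<partial>lborel) \<in> borel_measurable (\<Pi>\<^sub>M i\<in>insert j J. lborel)"
    if "i \<in> insert j J" for i
  proof -
    have [measurable]: "(\<lambda>(x::'i \<Rightarrow> real, t). x(i := t)) \<in> (\<Pi>\<^sub>M i\<in>insert j J. lborel) \<Otimes>\<^sub>M lborel \<rightarrow>\<^sub>M (\<Pi>\<^sub>M i\<in>insert j J. lborel)"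
      unfolding split_beta'
      by (rule measurable_fun_upd[where J="insert j J"]) (use that in auto)
    show ?thesis by measurable
  qed
  have "(\<integral>\<^sup>+x. epow (h x) (1 - k * p) *
            (\<Prod>i\<in>insert j J. epow (\<integral>\<^sup>+t. h (x(i := t)) \<partial>lborel) p) \<partial>(\<Pi>\<^sub>M i\<in>insert j J. lborel))
     = (\<integral>\<^sup>+x. \<integral>\<^sup>+y. epow (h (x(j := y))) (1 - k * p) *
            (\<Prod>i\<in>insert j J. epow (\<integral>\<^sup>+t. h (x(j := y, i := t)) \<partial>lborel) p) \<partial>lborel \<partial>(\<Pi>\<^sub>M i\<in>J. lborel))"
    by (subst product_nn_integral_insert[OF insert.hyps]) (auto intro!: borel_measurable_prod)
  also have "\<dots> \<le> (\<integral>\<^sup>+x. epow (H x) (1 - (k - 1) * p) *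
            (\<Prod>i\<in>J. epow (\<integral>\<^sup>+t. H (x(i := t)) \<partial>lborel) p) \<partial>(\<Pi>\<^sub>M i\<in>J. lborel))"
  proof (rule nn_integral_mono)
    fix x assume x: "x \<in> space (\<Pi>\<^sub>M i\<in>J. lborel :: real measure)"
    have hy[measurable]: "(\<lambda>y. h (x(j := y))) \<in> borel_measurable lborel"
      using measurable_compose_Pair1[OF x hm2] by simp
    \<comment> \<open>Hoelder is applied in the new variable \<open>y\<close> alone:
      \<open>h\<close> is the factor for \<open>j\<close>, with exponent \<open>1 - k * p\<close>,
      and each partial integral in an old direction has exponent \<open>p\<close>; these sum to
      \<open>1\<close>. The partial integral in direction \<open>j\<close> is \<open>H x\<close>,
      does not depend on \<open>y\<close> and leaves the integral. Together with the Hoelder factor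
      for \<open>j\<close> it gives \<open>H x\<close> the exponent
      \<open>p + (1 - k * p) = 1 - (k - 1) * p\<close> of the induction hypothesis.\<close>
    define F where "F i y = (if i = j then h (x(j := y)) else \<integral>\<^sup>+t. h (x(j := y, i := t)) \<partial>lborel)" for i y
    define e where "e i = (if i = j then 1 - k * p else p)" for i
    have pm: "(\<lambda>(y, t). h (x(j := y, i := t))) \<in> borel_measurable (lborel \<Otimes>\<^sub>M lborel)" if i: "i \<in> J" for i
    proof -
      have 1: "(\<lambda>y. x(j := y)) \<in> lborel \<rightarrow>\<^sub>M (\<Pi>\<^sub>M i\<in>insert j J. lborel)"
        by (rule measurable_fun_upd[where J=J]) (use x in auto)
      have [measurable]: "(\<lambda>(y, t). x(j := y, i := t)) \<in> lborel \<Otimes>\<^sub>M lborel \<rightarrow>\<^sub>M (\<Pi>\<^sub>M i\<in>insert j J. lborel)"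
        unfolding split_beta'
        by (rule measurable_fun_upd[where J="insert j J"]) (use i 1 in auto)
      show ?thesis by measurable
    qed
    have Fm: "F i \<in> borel_measurable lborel" if "i \<in> insert j J" for i
    proof (cases "i = j")
      case True
      then have "F i = (\<lambda>y. h (x(j := y)))" by (auto simp: F_def)
      then show ?thesis using hy by simp
    next
      case False
      with that have "i \<in> J" by simp
      from pm[OF this] have [measurable]: "(\<lambda>(y, t). h (x(j := y, i := t))) \<in> borel_measurable (lborel \<Otimes>\<^sub>M lborel)" .
      show ?thesis using False unfolding F_def by simp
    qed
    have Fint: "(\<integral>\<^sup>+y. F i y \<partial>lborel) = (\<integral>\<^sup>+t. H (x(i := t)) \<partial>lborel)" if i: "i \<in> J" for i
    proof -
      have ij: "i \<noteq> j" using i insert.hyps by auto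
      have "(\<integral>\<^sup>+y. F i y \<partial>lborel) = (\<integral>\<^sup>+y. \<integral>\<^sup>+t. h (x(j := y, i := t)) \<partial>lborel \<partial>lborel)"
        using ij by (simp add: F_def)
      also have "\<dots> = (\<integral>\<^sup>+t. \<integral>\<^sup>+y. h (x(j := y, i := t)) \<partial>lborel \<partial>lborel)"
        by (rule lborel_pair.Fubini'[symmetric]) (use pm[OF i] in simp)
      also have "\<dots> = (\<integral>\<^sup>+t. H (x(i := t)) \<partial>lborel)"
        using ij by (simp add: H_def fun_upd_twist)
      finally show ?thesis .
    qed
    have "(\<integral>\<^sup>+y. epow (h (x(j := y))) (1 - k * p) *
            (\<Prod>i\<in>insert j J. epow (\<integral>\<^sup>+t. h (x(j := y, i := t)) \<partial>lborel) p) \<partial>lborel)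
        = (\<integral>\<^sup>+y. epow (H x) p * (\<Prod>i\<in>insert j J. epow (F i y) (e i)) \<partial>lborel)"
    proof (rule nn_integral_cong)
      fix y
      have "(\<Prod>i\<in>J. epow (\<integral>\<^sup>+t. h (x(j := y, i := t)) \<partial>lborel) p) = (\<Prod>i\<in>J. epow (F i y) (e i))"
        by (rule prod.cong) (use insert.hyps in \<open>auto simp: F_def e_def\<close>)
      then show "epow (h (x(j := y))) (1 - k * p) *
            (\<Prod>i\<in>insert j J. epow (\<integral>\<^sup>+t. h (x(j := y, i := t)) \<partial>lborel) p)
          = epow (H x) p * (\<Prod>i\<in>insert j J. epow (F i y) (e i))"
        using insert.hyps by (simp add: H_def) (simp add: F_def e_def mult_ac)
    qed
    also have "\<dots> = epow (H x) p * (\<integral>\<^sup>+y. (\<Prod>i\<in>insert j J. epow (F i y) (e i)) \<partial>lborel)"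
      by (rule nn_integral_cmult) (use Fm in \<open>auto intro!: borel_measurable_prod\<close>)
    also have "\<dots> \<le> epow (H x) p * (\<Prod>i\<in>insert j J. epow (\<integral>\<^sup>+y. F i y \<partial>lborel) (e i))"
    proof (intro mult_left_mono Holder_nn_integral_prod)
      have "(\<Sum>i\<in>J. e i) = k * p"
        using insert.hyps by (subst sum.cong[of J J e "\<lambda>_. p"]) (auto simp: e_def k_def)
      then show "(\<Sum>i\<in>insert j J. e i) = 1"
        using insert.hyps by (simp add: e_def)
    qed (use insert.hyps kp Fm insert.prems in \<open>auto simp: e_def\<close>)
    also have "(\<Prod>i\<in>insert j J. epow (\<integral>\<^sup>+y. F i y \<partial>lborel) (e i))
        = epow (H x) (1 - k * p) * (\<Prod>i\<in>J. epow (\<integral>\<^sup>+t. H (x(i := t)) \<partial>lborel) p)"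
    proof -
      have "(\<Prod>i\<in>J. epow (\<integral>\<^sup>+y. F i y \<partial>lborel) (e i)) = (\<Prod>i\<in>J. epow (\<integral>\<^sup>+t. H (x(i := t)) \<partial>lborel) p)"
        by (rule prod.cong) (use insert.hyps Fint in \<open>auto simp: e_def\<close>)
      then show ?thesis
        using insert.hyps by (simp add: F_def e_def H_def)
    qed
    also have "epow (H x) p * (epow (H x) (1 - k * p) * (\<Prod>i\<in>J. epow (\<integral>\<^sup>+t. H (x(i := t)) \<partial>lborel) p))
       = epow (H x) (1 - (k - 1) * p) * (\<Prod>i\<in>J. epow (\<integral>\<^sup>+t. H (x(i := t)) \<partial>lborel) p)"
    proof -
      have "epow (H x) (1 - (k - 1) * p) = epow (H x) (p + (1 - k * p))"
        by (simp add: algebra_simps)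
      also have "\<dots> = epow (H x) p * epow (H x) (1 - k * p)"
        using kp insert.prems by (intro epow_add) auto
      finally show ?thesis by (simp add: mult.assoc)
    qed
    finally show "(\<integral>\<^sup>+y. epow (h (x(j := y))) (1 - k * p) *
            (\<Prod>i\<in>insert j J. epow (\<integral>\<^sup>+t. h (x(j := y, i := t)) \<partial>lborel) p) \<partial>lborel)
       \<le> epow (H x) (1 - (k - 1) * p) * (\<Prod>i\<in>J. epow (\<integral>\<^sup>+t. H (x(i := t)) \<partial>lborel) p)" .
  qed
  also have "\<dots> \<le> epow (\<integral>\<^sup>+x. H x \<partial>(\<Pi>\<^sub>M i\<in>J. lborel)) (1 + p)"
  proof -
    have "(k - 1) * p \<le> 1" using kp insert.prems(2) by (simp add: algebra_simps)
    then show ?thesis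
      using insert.IH[OF Hm insert.prems(2)] by (simp add: k_def fun_upd_def)
  qed
  also have "(\<integral>\<^sup>+x. H x \<partial>(\<Pi>\<^sub>M i\<in>J. lborel)) = (\<integral>\<^sup>+x. h x \<partial>(\<Pi>\<^sub>M i\<in>insert j J. lborel))"
    unfolding H_def by (rule product_nn_integral_insert[symmetric]) (use insert.hyps in auto)
  finally show ?case by (simp add: cI)
qed

section \<open>Square-integrable functions\<close>

text \<open>An arbitrary measure is allowed because the estimates for test functions are made with
  \<open>lborel\<close>, on the space as well as on lines, and only then carried over to
  \<open>lebesgue_on \<Omega>\<close>.\<close>

definition sqint :: "'a measure \<Rightarrow> ('a \<Rightarrow> 'b::euclidean_space) \<Rightarrow> bool" where
  "sqint M u \<longleftrightarrow> u \<in> borel_measurable M \<and> integrable M (\<lambda>x. (norm (u x))\<^sup>2)"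

definition l2i :: "'a measure \<Rightarrow> ('a \<Rightarrow> 'b::euclidean_space) \<Rightarrow> ('a \<Rightarrow> 'b) \<Rightarrow> real" where
  "l2i M u v = (LINT x|M. u x \<bullet> v x)"

definition l2n :: "'a measure \<Rightarrow> ('a \<Rightarrow> 'b::euclidean_space) \<Rightarrow> real" where
  "l2n M u = sqrt (LINT x|M. (norm (u x))\<^sup>2)"

lemma sqint_measurable: "sqint M u \<Longrightarrow> u \<in> borel_measurable M"
  by (simp add: sqint_def)

lemma sqint_integrable: "sqint M u \<Longrightarrow> integrable M (\<lambda>x. (norm (u x))\<^sup>2)"
  by (simp add: sqint_def)

lemma l2n_nonneg[simp]: "l2n M u \<ge> 0"
  by (simp add: l2n_def)

lemma l2n_sq: "(l2n M u)\<^sup>2 = (LINT x|M. (norm (u x))\<^sup>2)"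
  by (simp add: l2n_def)

lemma l2i_self: "l2i M u u = (l2n M u)\<^sup>2"
  by (simp add: l2n_sq l2i_def dot_square_norm)

lemma l2n_cong_AE: "u \<in> borel_measurable M \<Longrightarrow> v \<in> borel_measurable M \<Longrightarrow> AE x in M. u x = v x \<Longrightarrow> l2n M u = l2n M v"
  unfolding l2n_def by (intro arg_cong[where f=sqrt] integral_cong_AE) auto

lemma l2i_cong_AE:
  assumes [measurable]: "u \<in> borel_measurable M" "v \<in> borel_measurable M" "u' \<in> borel_measurable M" "v' \<in> borel_measurable M"
    and "AE x in M. u x = u' x" "AE x in M. v x = v' x"
  shows "l2i M u v = l2i M u' v'"
  unfolding l2i_def by (rule integral_cong_AE) (use assms(5,6) in auto)

lemma sqint_mult_norm:
  assumes "sqint M u" "sqint M v"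
  shows "integrable M (\<lambda>x. norm (u x) * norm (v x))"
    and "(LINT x|M. norm (u x) * norm (v x)) \<le> l2n M u * l2n M v"
proof -
  have [measurable]: "u \<in> borel_measurable M" "v \<in> borel_measurable M"
    using assms by (auto simp: sqint_def)
  have *: "integrable M (\<lambda>x. \<bar>norm (u x)\<bar> powr 2)" "integrable M (\<lambda>x. \<bar>norm (v x)\<bar> powr 2)"
    using assms by (auto simp: sqint_def)
  show "integrable M (\<lambda>x. norm (u x) * norm (v x))"
    using Holder_integral(1)[OF _ _ _ _ _ *] by simp
  show "(LINT x|M. norm (u x) * norm (v x)) \<le> l2n M u * l2n M v"
    using Holder_integral(2)[OF _ _ _ _ _ *] by (simp add: l2n_def powr_half_sqrt)
qed

lemma sqint_inner:
  assumes "sqint M u" "sqint M v"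
  shows "integrable M (\<lambda>x. u x \<bullet> v x)" and "\<bar>l2i M u v\<bar> \<le> l2n M u * l2n M v"
proof -
  have [measurable]: "u \<in> borel_measurable M" "v \<in> borel_measurable M"
    using assms by (auto simp: sqint_def)
  show int: "integrable M (\<lambda>x. u x \<bullet> v x)"
    by (rule Bochner_Integration.integrable_bound[OF sqint_mult_norm(1)[OF assms]])
       (auto intro!: AE_I2 Cauchy_Schwarz_ineq2)
  have "\<bar>l2i M u v\<bar> \<le> (LINT x|M. \<bar>u x \<bullet> v x\<bar>)"
    unfolding l2i_def by (rule integral_abs_bound)
  also have "\<dots> \<le> (LINT x|M. norm (u x) * norm (v x))"
    by (rule integral_mono) (use int sqint_mult_norm(1)[OF assms] in \<open>auto intro: Cauchy_Schwarz_ineq2\<close>)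
  also have "\<dots> \<le> l2n M u * l2n M v" by (rule sqint_mult_norm(2)[OF assms])
  finally show "\<bar>l2i M u v\<bar> \<le> l2n M u * l2n M v" .
qed

lemma sqint_add: 
  assumes "sqint M u" "sqint M v"
  shows "sqint M (\<lambda>x. u x + v x)"
proof -
  have [measurable]: "u \<in> borel_measurable M" "v \<in> borel_measurable M"
    using assms by (auto simp: sqint_def)
  have "(norm (u x + v x))\<^sup>2 = (norm (u x))\<^sup>2 + 2 * (u x \<bullet> v x) + (norm (v x))\<^sup>2" for x
    by (simp add: power2_norm_eq_inner inner_add inner_commute)
  then show ?thesis
    using assms sqint_inner(1)[OF assms] by (auto simp: sqint_def)
qed

lemma sqint_scaleR: 
  assumes "sqint M u"
  shows "sqint M (\<lambda>x. c *\<^sub>R u x)"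
proof -
  have [measurable]: "u \<in> borel_measurable M"
    using assms by (auto simp: sqint_def)
  show ?thesis using assms by (auto simp: sqint_def power_mult_distrib)
qed

lemma sqint_diff: "sqint M u \<Longrightarrow> sqint M v \<Longrightarrow> sqint M (\<lambda>x. u x - v x)"
  using sqint_add[of M u "\<lambda>x. (-1) *\<^sub>R v x"] sqint_scaleR[of M v "-1"] by simp

lemma sqint_zero[simp]: "sqint M (\<lambda>x. 0)"
  by (simp add: sqint_def)

lemma sqint_cmult:
  fixes u :: "'a \<Rightarrow> real"
  shows "sqint M u \<Longrightarrow> sqint M (\<lambda>x. c * u x)"
  using sqint_scaleR[of M u c] by simp

lemma sqint_norm: "sqint M u \<Longrightarrow> sqint M (\<lambda>x. norm (u x))"
  by (auto simp: sqint_def)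

lemma sqint_inner_right:
  assumes "sqint M u"
  shows "sqint M (\<lambda>x. u x \<bullet> e)"
proof -
  have [measurable]: "u \<in> borel_measurable M"
    using assms by (auto simp: sqint_def)
  have "integrable M (\<lambda>x. (norm (u x))\<^sup>2 * (norm e)\<^sup>2)"
    using assms by (auto simp: sqint_def)
  then have "integrable M (\<lambda>x. (u x \<bullet> e)\<^sup>2)"
    by (rule Bochner_Integration.integrable_bound)
       (auto intro!: AE_I2 simp: power_mult_distrib[symmetric] Cauchy_Schwarz_ineq2 abs_le_square_iff[symmetric])
  then show ?thesis by (simp add: sqint_def)
qed

lemma l2i_commute: "l2i M u v = l2i M v u"
  by (simp add: l2i_def inner_commute)

lemma l2i_add_left: "sqint M u \<Longrightarrow> sqint M v \<Longrightarrow> sqint M w \<Longrightarrow> l2i M (\<lambda>x. u x + v x) w = l2i M u w + l2i M v w"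
  by (simp add: l2i_def inner_add_left sqint_inner)

lemma l2i_scaleR_left: "l2i M (\<lambda>x. c *\<^sub>R u x) w = c * l2i M u w"
  by (simp add: l2i_def)

lemma l2i_diff_left: "sqint M u \<Longrightarrow> sqint M v \<Longrightarrow> sqint M w \<Longrightarrow> l2i M (\<lambda>x. u x - v x) w = l2i M u w - l2i M v w"
  by (simp add: l2i_def inner_diff_left sqint_inner)

lemma l2n_scaleR: "l2n M (\<lambda>x. c *\<^sub>R u x) = \<bar>c\<bar> * l2n M u"
  by (simp add: l2n_def power_mult_distrib real_sqrt_mult)

lemma l2n_minus_commute: "l2n M (\<lambda>x. u x - v x) = l2n M (\<lambda>x. v x - u x)"
  by (simp add: l2n_def norm_minus_commute)

lemma l2n_add_sq:
  assumes "sqint M u" "sqint M v"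
  shows "(l2n M (\<lambda>x. u x + v x))\<^sup>2 = (l2n M u)\<^sup>2 + 2 * l2i M u v + (l2n M v)\<^sup>2"
proof -
  have "(l2n M (\<lambda>x. u x + v x))\<^sup>2 = l2i M u (\<lambda>x. u x + v x) + l2i M v (\<lambda>x. u x + v x)"
    unfolding l2i_self[symmetric] by (rule l2i_add_left) (use assms in \<open>auto intro: sqint_add\<close>)
  also have "l2i M u (\<lambda>x. u x + v x) = (l2n M u)\<^sup>2 + l2i M u v"
    unfolding l2i_self[symmetric] l2i_commute[of M u "\<lambda>x. u x + v x"] l2i_commute[of M u v]
    by (rule l2i_add_left) (use assms in auto)
  also have "l2i M v (\<lambda>x. u x + v x) = l2i M u v + (l2n M v)\<^sup>2"
    unfolding l2i_self[symmetric] l2i_commute[of M v "\<lambda>x. u x + v x"]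
    by (rule l2i_add_left) (use assms in auto)
  finally show ?thesis by simp
qed

lemma l2n_diff_sq:
  assumes "sqint M u" "sqint M v"
  shows "(l2n M (\<lambda>x. u x - v x))\<^sup>2 = (l2n M u)\<^sup>2 - 2 * l2i M u v + (l2n M v)\<^sup>2"
  using l2n_add_sq[OF assms(1) sqint_scaleR[OF assms(2), of "-1"]] l2n_scaleR[of M "-1" v]
    l2i_scaleR_left[of M "-1" v u]
  by (simp add: l2i_commute[of M u])

lemma l2n_triangle:
  assumes "sqint M u" "sqint M v"
  shows "l2n M (\<lambda>x. u x + v x) \<le> l2n M u + l2n M v"
proof -
  have "(l2n M (\<lambda>x. u x + v x))\<^sup>2 \<le> (l2n M u + l2n M v)\<^sup>2"
    using sqint_inner(2)[OF assms] l2n_add_sq[OF assms] by (simp add: power2_sum)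
  then show ?thesis by (rule power2_le_imp_le) auto
qed

lemma l2n_triangle3:
  assumes "sqint M u" "sqint M v" "sqint M w"
  shows "l2n M (\<lambda>x. u x - w x) \<le> l2n M (\<lambda>x. u x - v x) + l2n M (\<lambda>x. v x - w x)"
  using l2n_triangle[of M "\<lambda>x. u x - v x" "\<lambda>x. v x - w x"] assms by (simp add: sqint_diff)

lemma l2n_diff_abs:
  assumes "sqint M u" "sqint M v"
  shows "\<bar>l2n M u - l2n M v\<bar> \<le> l2n M (\<lambda>x. u x - v x)"
proof -
  have "l2n M u \<le> l2n M (\<lambda>x. u x - v x) + l2n M v"
    using l2n_triangle[OF sqint_diff[OF assms] assms(2)] by simp
  moreover have "l2n M v \<le> l2n M (\<lambda>x. u x - v x) + l2n M u"
    using l2n_triangle[OF sqint_diff[OF assms(2,1)] assms(1)] l2n_minus_commute[of M u v] by simp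
  ultimately show ?thesis by linarith
qed

lemma l2n_tendsto:
  assumes "\<And>n. sqint M (u n)" "sqint M v" "(\<lambda>n. l2n M (\<lambda>x. u n x - v x)) \<longlonglongrightarrow> 0"
  shows "(\<lambda>n. l2n M (u n)) \<longlonglongrightarrow> l2n M v"
proof -
  have "(\<lambda>n. l2n M (u n) - l2n M v) \<longlonglongrightarrow> 0"
    by (rule Lim_null_comparison[OF always_eventually assms(3)]) (use l2n_diff_abs assms in auto)
  then show ?thesis by (simp add: LIM_zero_iff)
qed

lemma l2i_tendsto:
  assumes "\<And>n. sqint M (u n)" "sqint M v" "(\<lambda>n. l2n M (\<lambda>x. u n x - v x)) \<longlonglongrightarrow> 0" "sqint M w"
  shows "(\<lambda>n. l2i M (u n) w) \<longlonglongrightarrow> l2i M v w"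
proof -
  have "(\<lambda>n. l2i M (u n) w - l2i M v w) \<longlonglongrightarrow> 0"
  proof (rule Lim_null_comparison[OF always_eventually])
    show "\<forall>n. norm (l2i M (u n) w - l2i M v w) \<le> l2n M (\<lambda>x. u n x - v x) * l2n M w"
    proof
      fix n
      show "norm (l2i M (u n) w - l2i M v w) \<le> l2n M (\<lambda>x. u n x - v x) * l2n M w"
        using sqint_inner(2)[OF sqint_diff[OF assms(1)[of n] assms(2)] assms(4)]
          l2i_diff_left[OF assms(1)[of n] assms(2,4)] by simp
    qed
    show "(\<lambda>n. l2n M (\<lambda>x. u n x - v x) * l2n M w) \<longlonglongrightarrow> 0"
      using tendsto_mult_right[OF assms(3), of "l2n M w"] by simp
  qed
  then show ?thesis by (simp add: LIM_zero_iff)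
qed

section \<open>Completeness of the space of square-integrable functions\<close>

lemma fast_Cauchy_subseq:
  fixes d :: "nat \<Rightarrow> nat \<Rightarrow> real"
  assumes "\<And>e. e > 0 \<Longrightarrow> \<exists>N. \<forall>m\<ge>N. \<forall>n\<ge>N. d m n < e"
  obtains r :: "nat \<Rightarrow> nat" where "strict_mono r" "\<And>k m n. m \<ge> r k \<Longrightarrow> n \<ge> r k \<Longrightarrow> d m n < (1/2)^k"
proof -
  have "\<exists>N. \<forall>k. \<forall>m\<ge>N k. \<forall>n\<ge>N k. d m n < (1/2)^k"
    using assms[of "(1/2)^k" for k] by (intro choice allI) auto
  then obtain N :: "nat \<Rightarrow> nat" where N: "\<And>k m n. m \<ge> N k \<Longrightarrow> n \<ge> N k \<Longrightarrow> d m n < (1/2)^k" by blast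
  \<comment> \<open>Summing all thresholds up to \<open>k\<close> makes \<open>r\<close> dominate
    \<open>N k\<close>; the summand \<open>k\<close> makes it strictly increasing.\<close>
  define r where "r k = k + (\<Sum>j\<le>k. N j)" for k
  have "strict_mono r"
    by (rule strict_monoI_Suc) (simp add: r_def)
  moreover have "N k \<le> r k" for k
    using member_le_sum[of k "{..k}" N] by (simp add: r_def)
  ultimately show thesis
    using that[of r] N by (meson order_trans)
qed

text \<open>The Riesz--Fischer argument. Along a fast subsequence the increments are summable almost
  everywhere, since on a finite measure space their integrals are bounded by their quadratic norms.
  Fatou's lemma in the second index turns the Cauchy property into convergence of the whole
  sequence.\<close>

theorem (in finite_measure) l2_complete:
  fixes u :: "nat \<Rightarrow> 'a \<Rightarrow> 'b::euclidean_space"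
  assumes u: "\<And>n. sqint M (u n)"
    and Cauchy: "\<And>e. e > 0 \<Longrightarrow> \<exists>N. \<forall>m\<ge>N. \<forall>n\<ge>N. l2n M (\<lambda>x. u m x - u n x) < e"
  obtains v r where "sqint M v" "strict_mono r" "AE x in M. (\<lambda>n. u (r n) x) \<longlonglongrightarrow> v x"
    "(\<lambda>n. l2n M (\<lambda>x. u n x - v x)) \<longlonglongrightarrow> 0"
proof -
  have um[measurable]: "u n \<in> borel_measurable M" for n using u by (auto simp: sqint_def)
  obtain r where r: "strict_mono r"
    and rk: "\<And>k m n. m \<ge> r k \<Longrightarrow> n \<ge> r k \<Longrightarrow> l2n M (\<lambda>x. u m x - u n x) < (1/2)^k"
    using fast_Cauchy_subseq[of "\<lambda>m n. l2n M (\<lambda>x. u m x - u n x)"] Cauchy by blast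
  define d where "d k x = norm (u (r (Suc k)) x - u (r k) x)" for k x
  have dm[measurable]: "d k \<in> borel_measurable M" for k unfolding d_def by measurable
  have d2: "sqint M (d k)" for k
    unfolding d_def by (intro sqint_norm sqint_diff u)
  have one: "sqint M (\<lambda>x. 1::real)" by (simp add: sqint_def)
  have di: "(\<integral>\<^sup>+x. ennreal (d k x) \<partial>M) \<le> ennreal ((1/2)^k * l2n M (\<lambda>x. 1::real))" for k
  proof -
    have i: "integrable M (d k)" using sqint_mult_norm(1)[OF d2 one, of k] by (simp add: d_def[abs_def])
    have "(\<integral>\<^sup>+x. ennreal (d k x) \<partial>M) = ennreal (LINT x|M. d k x)"
      by (rule nn_integral_eq_integral[OF i]) (simp add: d_def)
    also have "(LINT x|M. d k x) \<le> l2n M (d k) * l2n M (\<lambda>x. 1::real)"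
      using sqint_mult_norm(2)[OF d2 one, of k] by (simp add: d_def)
    also have "l2n M (d k) * l2n M (\<lambda>x. 1::real) \<le> (1/2)^k * l2n M (\<lambda>x. 1::real)"
    proof (rule mult_right_mono)
      have "l2n M (d k) = l2n M (\<lambda>x. u (r (Suc k)) x - u (r k) x)"
        by (simp add: l2n_def d_def)
      also have "\<dots> < (1/2)^k"
        using strict_mono_less_eq[OF r] by (intro rk) auto
      finally show "l2n M (d k) \<le> (1/2)^k" by simp
    qed simp
    finally show ?thesis using ennreal_leI by blast
  qed
  have "(\<integral>\<^sup>+x. (\<Sum>k. ennreal (d k x)) \<partial>M) = (\<Sum>k. (\<integral>\<^sup>+x. ennreal (d k x) \<partial>M))"
    by (rule nn_integral_suminf) measurable
  also have "\<dots> \<le> (\<Sum>k. ennreal ((1/2)^k * l2n M (\<lambda>x. 1::real)))"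
    by (intro suminf_le di) auto
  also have "\<dots> = ennreal (\<Sum>k. (1/2)^k * l2n M (\<lambda>x. 1::real))"
    by (rule suminf_ennreal2) (auto intro!: summable_mult2 summable_geometric)
  also have "\<dots> < \<infinity>" by simp
  finally have "(\<integral>\<^sup>+x. (\<Sum>k. ennreal (d k x)) \<partial>M) \<noteq> \<infinity>" by simp
  then have "AE x in M. (\<Sum>k. ennreal (d k x)) \<noteq> \<infinity>"
    by (intro nn_integral_PInf_AE) auto
  then have conv: "AE x in M. convergent (\<lambda>n. u (r n) x)"
  proof eventually_elim
    case (elim x)
    then have "summable (\<lambda>k. norm (u (r (Suc k)) x - u (r k) x))"
      by (intro summable_suminf_not_top) (auto simp: d_def)
    then have "summable (\<lambda>k. u (r (Suc k)) x - u (r k) x)"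
      by (rule summable_norm_cancel)
    then have "convergent (\<lambda>n. \<Sum>k<n. u (r (Suc k)) x - u (r k) x)"
      by (simp add: summable_iff_convergent)
    then have "convergent (\<lambda>n. u (r n) x - u (r 0) x)"
      using sum_lessThan_telescope[of "\<lambda>k. u (r k) x"] by simp
    then have "convergent (\<lambda>n. (u (r n) x - u (r 0) x) + u (r 0) x)"
      by (intro convergent_add convergent_const)
    then show ?case by simp
  qed
  define v where "v x = lim (\<lambda>n. u (r n) x)" for x
  have vm[measurable]: "v \<in> borel_measurable M"
    unfolding v_def by (rule borel_measurable_lim_metric) measurable
  have lim: "AE x in M. (\<lambda>n. u (r n) x) \<longlonglongrightarrow> v x"
    using conv by eventually_elim (simp add: v_def convergent_LIMSEQ_iff)
  have bound: "(\<integral>\<^sup>+x. ennreal ((norm (u n x - v x))\<^sup>2) \<partial>M) \<le> ennreal (((1/2)^k)\<^sup>2)" if "n \<ge> r k" for n k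
  proof -
    have "(\<integral>\<^sup>+x. ennreal ((norm (u n x - v x))\<^sup>2) \<partial>M)
        = (\<integral>\<^sup>+x. liminf (\<lambda>m. ennreal ((norm (u n x - u (r m) x))\<^sup>2)) \<partial>M)"
    proof (rule nn_integral_cong_AE)
      show "AE x in M. ennreal ((norm (u n x - v x))\<^sup>2) = liminf (\<lambda>m. ennreal ((norm (u n x - u (r m) x))\<^sup>2))"
        using lim
      proof eventually_elim
        case (elim x)
        have "(\<lambda>m. ennreal ((norm (u n x - u (r m) x))\<^sup>2)) \<longlonglongrightarrow> ennreal ((norm (u n x - v x))\<^sup>2)"
          by (intro tendsto_ennrealI tendsto_intros elim)
        then show ?case by (intro lim_imp_Liminf[symmetric]) auto
      qed
    qed
    also have "\<dots> \<le> liminf (\<lambda>m. \<integral>\<^sup>+x. ennreal ((norm (u n x - u (r m) x))\<^sup>2) \<partial>M)"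
      by (rule nn_integral_liminf) measurable
    also have "\<dots> \<le> ennreal (((1/2)^k)\<^sup>2)"
    proof (rule Liminf_le)
      show "\<forall>\<^sub>F m in sequentially. (\<integral>\<^sup>+x. ennreal ((norm (u n x - u (r m) x))\<^sup>2) \<partial>M) \<le> ennreal (((1/2)^k)\<^sup>2)"
        using eventually_ge_at_top[of k]
      proof eventually_elim
        case (elim m)
        have "(\<integral>\<^sup>+x. ennreal ((norm (u n x - u (r m) x))\<^sup>2) \<partial>M) = ennreal ((l2n M (\<lambda>x. u n x - u (r m) x))\<^sup>2)"
          unfolding l2n_sq
          by (rule nn_integral_eq_integral) (use sqint_diff[OF u u] in \<open>auto simp: sqint_def\<close>)
        also have "\<dots> \<le> ennreal (((1/2)^k)\<^sup>2)"
          using rk[OF that, of "r m"] elim strict_mono_less_eq[OF r]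
          by (intro ennreal_leI power_mono) auto
        finally show ?case .
      qed
    qed simp
    finally show ?thesis .
  qed
  have sq: "sqint M (\<lambda>x. u n x - v x)" if "n \<ge> r k" for n k
    using bound[OF that] by (auto simp: sqint_def intro!: integrableI_bounded le_less_trans[OF bound[OF that]])
  have l2: "l2n M (\<lambda>x. u n x - v x) \<le> (1/2)^k" if "n \<ge> r k" for n k
  proof -
    have "ennreal ((l2n M (\<lambda>x. u n x - v x))\<^sup>2) \<le> ennreal (((1/2)^k)\<^sup>2)"
      unfolding l2n_sq
      by (subst nn_integral_eq_integral[symmetric]) (use sq[OF that] bound[OF that] in \<open>auto simp: sqint_def\<close>)
    then have "(l2n M (\<lambda>x. u n x - v x))\<^sup>2 \<le> ((1/2)^k)\<^sup>2" by (subst (asm) ennreal_le_iff) auto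
    then show ?thesis by (rule power2_le_imp_le) auto
  qed
  have "sqint M v"
    using sqint_diff[OF u[of "r 0"] sq[of 0 "r 0"]] by simp
  moreover have "(\<lambda>n. l2n M (\<lambda>x. u n x - v x)) \<longlonglongrightarrow> 0"
  proof (rule LIMSEQ_I)
    fix e :: real assume "e > 0"
    then obtain k where "(1/2)^k < e" using real_arch_pow_inv[of e "1/2"] by auto
    then have "\<forall>n\<ge>r k. norm (l2n M (\<lambda>x. u n x - v x) - 0) < e" using l2 le_less_trans by fastforce
    then show "\<exists>N. \<forall>n\<ge>N. norm (l2n M (\<lambda>x. u n x - v x) - 0) < e" by blast
  qed
  ultimately show thesis using that r lim by blast
qed

section \<open>Test functions\<close>

lemma partial_deriv_eq: "(\<phi> has_derivative D) (at x) \<Longrightarrow> partial_deriv i \<phi> x = D i"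
  by (simp add: partial_deriv_def frechet_derivative_at[symmetric])

lemma Ck_SucI:
  assumes "\<And>x. (\<phi> has_derivative D x) (at x)" "\<And>i. i \<in> Basis \<Longrightarrow> Ck k (\<lambda>x. D x i)"
  shows "Ck (Suc k) \<phi>"
proof -
  have "partial_deriv i \<phi> = (\<lambda>x. D x i)" for i
    using partial_deriv_eq[OF assms(1)] by (intro ext)
  then show ?thesis
    using assms by (auto simp: differentiable_on_def differentiable_def)
qed

lemma Ck_Suc_has_derivative:
  assumes "Ck (Suc k) \<phi>"
  shows "(\<phi> has_derivative frechet_derivative \<phi> (at x)) (at x)"
  using assms by (simp add: differentiable_on_def frechet_derivative_works[symmetric])

lemma Ck_Suc_imp: "Ck (Suc k) \<phi> \<Longrightarrow> Ck k \<phi>"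
  by (induction k arbitrary: \<phi>) (auto intro: differentiable_imp_continuous_on)

lemma Ck_const: "Ck k (\<lambda>x. c)"
proof (induction k arbitrary: c)
  case (Suc k)
  show ?case by (rule Ck_SucI[where D="\<lambda>x h. 0"]) (use Suc in auto)
qed simp

lemma Ck_add: "Ck k \<phi> \<Longrightarrow> Ck k \<psi> \<Longrightarrow> Ck k (\<lambda>x. \<phi> x + \<psi> x)"
proof (induction k arbitrary: \<phi> \<psi>)
  case (Suc k)
  show ?case
  proof (rule Ck_SucI)
    show "((\<lambda>x. \<phi> x + \<psi> x) has_derivative
        (\<lambda>h. frechet_derivative \<phi> (at x) h + frechet_derivative \<psi> (at x) h)) (at x)" for x
      by (intro has_derivative_add Ck_Suc_has_derivative[OF Suc.prems(1)] Ck_Suc_has_derivative[OF Suc.prems(2)])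
  qed (use Suc in \<open>auto simp: partial_deriv_def[symmetric]\<close>)
qed (auto intro: continuous_on_add)

lemma Ck_mult: "Ck k \<phi> \<Longrightarrow> Ck k \<psi> \<Longrightarrow> Ck k (\<lambda>x. \<phi> x * \<psi> x)"
proof (induction k arbitrary: \<phi> \<psi>)
  case (Suc k)
  show ?case
  proof (rule Ck_SucI)
    show "((\<lambda>x. \<phi> x * \<psi> x) has_derivative
        (\<lambda>h. \<phi> x * frechet_derivative \<psi> (at x) h + frechet_derivative \<phi> (at x) h * \<psi> x)) (at x)" for x
      by (intro has_derivative_mult Ck_Suc_has_derivative[OF Suc.prems(1)] Ck_Suc_has_derivative[OF Suc.prems(2)])
    fix i :: 'a assume "i \<in> Basis"
    then show "Ck k (\<lambda>x. \<phi> x * frechet_derivative \<psi> (at x) i + frechet_derivative \<phi> (at x) i * \<psi> x)"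
      using Suc.prems unfolding partial_deriv_def[symmetric]
      by (intro Ck_add Suc.IH) (auto intro: Ck_Suc_imp simp del: Ck.simps, auto)
  qed
qed (auto intro: continuous_on_mult)

lemma Ck_prod: "(\<And>i. i \<in> I \<Longrightarrow> Ck k (\<phi> i)) \<Longrightarrow> Ck k (\<lambda>x. \<Prod>i\<in>I. \<phi> i x)"
  by (induction I rule: infinite_finite_induct) (auto intro: Ck_const Ck_mult)

text \<open>For \<open>m = 0\<close> this is the standard smooth function that vanishes on the
  negative half-line. The powers of \<open>t\<close> in the denominator make the family closed under
  differentiation, and letting \<open>c\<close> tend to \<open>0\<close> gives the indicator of the
  positive half-line.\<close>

definition hexp :: "real \<Rightarrow> nat \<Rightarrow> real \<Rightarrow> real" where
  "hexp c m t = (if t > 0 then exp (- c / t) / t ^ m else 0)"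

lemma hexp_tendsto_0:
  assumes "c > 0"
  shows "(hexp c m \<longlongrightarrow> 0) (at_right 0)"
proof -
  have lim: "((\<lambda>x. (c * x) ^ m / exp (c * x)) \<longlongrightarrow> 0) at_top"
    by (rule filterlim_compose[OF tendsto_power_div_exp_0])
       (use assms in \<open>auto intro!: filterlim_tendsto_pos_mult_at_top filterlim_ident\<close>)
  have "((\<lambda>x. (1 / c) ^ m * ((c * x) ^ m / exp (c * x))) \<longlongrightarrow> (1 / c) ^ m * 0) at_top"
    by (intro tendsto_mult_left lim)
  then have "((\<lambda>x. (1 / c) ^ m * ((c * x) ^ m / exp (c * x))) \<longlongrightarrow> 0) at_top" by simp
  moreover have "\<forall>\<^sub>F x in at_top. hexp c m (inverse x) = (1 / c) ^ m * ((c * x) ^ m / exp (c * x))"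
    using eventually_gt_at_top[of 0]
    by eventually_elim
       (use assms in \<open>auto simp: hexp_def exp_minus power_mult_distrib divide_simps power_inverse\<close>)
  ultimately show ?thesis
    unfolding filterlim_at_right_to_top using tendsto_cong by fast
qed

lemma hexp_deriv:
  assumes "c > 0"
  shows "(hexp c m has_real_derivative (c * hexp c (m + 2) t - real m * hexp c (m + 1) t)) (at t)"
proof -
  consider "t > 0" | "t < 0" | "t = 0" by linarith
  then show ?thesis
  proof cases
    case 1
    have "((\<lambda>t. exp (- c / t) / t ^ m) has_real_derivative
        (exp (- c / t) * (c / t\<^sup>2) * t ^ m - exp (- c / t) * (real m * t ^ (m - 1))) / (t ^ m * t ^ m)) (at t)"
      using 1 by (auto intro!: derivative_eq_intros simp: power2_eq_square)
    also have "(exp (- c / t) * (c / t\<^sup>2) * t ^ m - exp (- c / t) * (real m * t ^ (m - 1))) / (t ^ m * t ^ m)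
        = c * hexp c (m + 2) t - real m * hexp c (m + 1) t"
      using 1 by (cases m) (auto simp: hexp_def field_simps power2_eq_square)
    finally show ?thesis
      by (rule has_field_derivative_transform_within_open[of _ _ _ "{0<..}"])
         (use 1 in \<open>auto simp: hexp_def\<close>)
  next
    case 2
    have "((\<lambda>t. 0) has_real_derivative 0) (at t)" by simp
    then have "(hexp c m has_real_derivative 0) (at t)"
      by (rule has_field_derivative_transform_within_open[of _ _ _ "{..<0}"])
         (use 2 in \<open>auto simp: hexp_def\<close>)
    then show ?thesis using 2 by (simp add: hexp_def)
  next
    case 3
    \<comment> \<open>At \<open>0\<close> the right difference quotient is
      \<open>hexp c (m + 1) h\<close>, again a member of the family, which tends to
      \<open>0\<close>.\<close>
    have "((\<lambda>h. (hexp c m (0 + h) - hexp c m 0) / h) \<longlongrightarrow> 0) (at 0)"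
    proof (rule filterlim_split_at)
      show "((\<lambda>h. (hexp c m (0 + h) - hexp c m 0) / h) \<longlongrightarrow> 0) (at_left 0)"
        by (rule tendsto_eventually) (auto simp: eventually_at_filter hexp_def)
      have "\<forall>\<^sub>F h in at_right 0. (hexp c m (0 + h) - hexp c m 0) / h = hexp c (m + 1) h"
        by (auto simp: eventually_at_filter hexp_def)
      then show "((\<lambda>h. (hexp c m (0 + h) - hexp c m 0) / h) \<longlongrightarrow> 0) (at_right 0)"
        using hexp_tendsto_0[OF assms, of "m + 1"] tendsto_cong by fast
    qed
    then show ?thesis using 3 by (simp add: DERIV_def hexp_def)
  qed
qed

text \<open>The induction closes because \<open>m\<close> is arbitrary: the derivative of
  \<open>hexp c m\<close> is a combination of \<open>hexp c (m + 2)\<close> and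
  \<open>hexp c (m + 1)\<close>.\<close>

lemma Ck_hexp_affine:
  fixes i :: "'a::euclidean_space"
  assumes "c > 0"
  shows "Ck k (\<lambda>x. hexp c m (s * (x \<bullet> i) + \<alpha>))"
proof (induction k arbitrary: m)
  case 0
  have "isCont (hexp c m) t" for t
    using DERIV_isCont[OF hexp_deriv[OF assms]] .
  then have "continuous_on UNIV (hexp c m)" by (simp add: continuous_on_eq_continuous_at)
  then show ?case
    by (auto intro!: continuous_on_compose2[of UNIV "hexp c m"] continuous_intros)
next
  case (Suc k)
  show ?case
  proof (rule Ck_SucI)
    fix x :: 'a
    have "((\<lambda>x. hexp c m (s * (x \<bullet> i) + \<alpha>)) has_derivative
        (\<lambda>h. (s * (h \<bullet> i)) * (c * hexp c (m + 2) (s * (x \<bullet> i) + \<alpha>) - real m * hexp c (m + 1) (s * (x \<bullet> i) + \<alpha>)))) (at x)"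
    proof -
      have "(hexp c m has_derivative (\<lambda>h. h * (c * hexp c (m + 2) t - real m * hexp c (m + 1) t))) (at t)" for t
        using hexp_deriv[OF assms, of m t] by (simp add: has_field_derivative_def mult_commute_abs)
      moreover have "((\<lambda>x. s * (x \<bullet> i) + \<alpha>) has_derivative (\<lambda>h. s * (h \<bullet> i))) (at x)"
        by (auto intro!: derivative_eq_intros)
      ultimately show ?thesis by (rule has_derivative_compose[rotated])
    qed
    then show "((\<lambda>x. hexp c m (s * (x \<bullet> i) + \<alpha>)) has_derivative
        (\<lambda>h. (s * (h \<bullet> i)) * (c * hexp c (m + 2) (s * (x \<bullet> i) + \<alpha>) + (- real m) * hexp c (m + 1) (s * (x \<bullet> i) + \<alpha>)))) (at x)"
      by simp
  next
    fix j :: 'a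
    show "Ck k (\<lambda>x. (s * (j \<bullet> i)) * (c * hexp c (m + 2) (s * (x \<bullet> i) + \<alpha>) + (- real m) * hexp c (m + 1) (s * (x \<bullet> i) + \<alpha>)))"
      by (intro Ck_mult Ck_add Ck_const Suc.IH)
  qed
qed

text \<open>One one-sided cutoff for each face of the box; the signs and the factor \<open>1\<close>
  are written out to match \<open>Ck_hexp_affine\<close>. The parameter \<open>c\<close> lets these
  bumps approximate the indicator of the open box.\<close>

definition box_bump :: "real \<Rightarrow> 'a::euclidean_space \<Rightarrow> 'a \<Rightarrow> 'a \<Rightarrow> real" where
  "box_bump c l r x = (\<Prod>i\<in>Basis. hexp c 0 (1 * (x \<bullet> i) + (- (l \<bullet> i))) * hexp c 0 ((-1) * (x \<bullet> i) + r \<bullet> i))"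

lemma box_bump_Ck: "c > 0 \<Longrightarrow> Ck k (box_bump c l r)"
  unfolding box_bump_def[abs_def] by (intro Ck_prod Ck_mult Ck_hexp_affine)

lemma box_bump_pos_iff: "0 < box_bump c l r x \<longleftrightarrow> x \<in> box l r"
proof
  assume "x \<in> box l r"
  then show "0 < box_bump c l r x"
    unfolding box_bump_def by (intro prod_pos) (auto simp: hexp_def mem_box)
next
  assume *: "0 < box_bump c l r x"
  show "x \<in> box l r"
  proof (rule ccontr)
    assume "x \<notin> box l r"
    then obtain i where i: "i \<in> Basis" "\<not> (l \<bullet> i < x \<bullet> i \<and> x \<bullet> i < r \<bullet> i)" by (auto simp: mem_box)
    then have "hexp c 0 (1 * (x \<bullet> i) + (- (l \<bullet> i))) * hexp c 0 ((-1) * (x \<bullet> i) + r \<bullet> i) = 0"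
      by (auto simp: hexp_def)
    then have "box_bump c l r x = 0"
      unfolding box_bump_def using i by (intro prod_zero) auto
    with * show False by simp
  qed
qed

lemma box_bump_nonneg: "0 \<le> box_bump c l r x"
  unfolding box_bump_def by (intro prod_nonneg) (auto simp: hexp_def)

lemma box_bump_le_1: "c > 0 \<Longrightarrow> box_bump c l r x \<le> 1"
  unfolding box_bump_def by (intro prod_le_1) (auto simp: hexp_def intro!: mult_le_one)

lemma box_bump_tendsto: "(\<lambda>n. box_bump (1 / real (Suc n)) l r x) \<longlonglongrightarrow> indicator (box l r) x"
proof (cases "x \<in> box l r")
  case True
  have h: "(\<lambda>n. hexp (1 / real (Suc n)) 0 t) \<longlonglongrightarrow> 1" if "t > 0" for t
  proof -
    have "(\<lambda>n. exp (- (1 / t) * (1 / real (Suc n)))) \<longlonglongrightarrow> exp (- (1 / t) * 0)"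
      by (intro tendsto_intros LIMSEQ_Suc lim_1_over_n)
    then show ?thesis using that by (simp add: hexp_def mult.commute)
  qed
  have "(\<lambda>n. box_bump (1 / real (Suc n)) l r x) \<longlonglongrightarrow> (\<Prod>i\<in>(Basis::'a set). 1 * 1)"
    unfolding box_bump_def
    by (intro tendsto_prod tendsto_mult h) (use True in \<open>auto simp: mem_box\<close>)
  then show ?thesis using True by simp
next
  case False
  then have "box_bump c l r x = 0" for c
    using box_bump_pos_iff[of c l r x] box_bump_nonneg[of c l r x] by linarith
  then show ?thesis using False by simp
qed

section \<open>Test functions and their classical gradients\<close>

abbreviation supp :: "('a::euclidean_space \<Rightarrow> real) \<Rightarrow> 'a set" where
  "supp \<phi> \<equiv> closure {x. \<phi> x \<noteq> 0}"

lemma test_functionsI: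
  assumes "\<And>k. Ck k \<phi>" "compact K" "{x. \<phi> x \<noteq> 0} \<subseteq> K" "K \<subseteq> \<Omega>"
  shows "\<phi> \<in> test_functions \<Omega>"
proof -
  have "supp \<phi> \<subseteq> K" using assms by (intro closure_minimal compact_imp_closed)
  moreover from this have "compact (supp \<phi>)"
    using compact_Int_closed[OF assms(2), of "supp \<phi>"] by (simp add: Int_absorb1)
  ultimately show ?thesis
    unfolding test_functions_def using assms by blast
qed

lemma box_bump_test:
  assumes "c > 0" "cbox l r \<subseteq> \<Omega>"
  shows "box_bump c l r \<in> test_functions \<Omega>"
proof (rule test_functionsI[where K="cbox l r"])
  show "{x. box_bump c l r x \<noteq> 0} \<subseteq> cbox l r"
    using box_bump_pos_iff[of c l r] box_bump_nonneg[of c l r] box_subset_cbox[of l r]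
    by (auto simp: less_le)
qed (use assms box_bump_Ck in auto)

lemma test_Ck: "\<phi> \<in> test_functions \<Omega> \<Longrightarrow> Ck k \<phi>"
  by (simp add: test_functions_def)

lemma test_supp: "\<phi> \<in> test_functions \<Omega> \<Longrightarrow> compact (supp \<phi>)" "\<phi> \<in> test_functions \<Omega> \<Longrightarrow> supp \<phi> \<subseteq> \<Omega>"
  by (simp_all add: test_functions_def)

lemma not_in_supp: "x \<notin> supp \<phi> \<Longrightarrow> \<phi> x = 0"
  using closure_subset[of "{x. \<phi> x \<noteq> 0}"] by blast

lemma test_zero_outside: "\<phi> \<in> test_functions \<Omega> \<Longrightarrow> x \<notin> \<Omega> \<Longrightarrow> \<phi> x = 0"
  using test_supp(2) not_in_supp by blast

lemma test_continuous: "\<phi> \<in> test_functions \<Omega> \<Longrightarrow> continuous_on UNIV \<phi>"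
  using test_Ck[of \<phi> \<Omega> 0] by simp

lemma test_measurable: "\<phi> \<in> test_functions \<Omega> \<Longrightarrow> \<phi> \<in> borel_measurable borel"
  by (intro borel_measurable_continuous_onI test_continuous)

lemma test_differentiable: "\<phi> \<in> test_functions \<Omega> \<Longrightarrow> \<phi> differentiable at x"
  using test_Ck[of \<phi> \<Omega> "Suc 0"] by (simp add: differentiable_on_def)

lemma partial_deriv_zero:
  assumes "x \<notin> supp \<phi>"
  shows "partial_deriv i \<phi> x = 0"
proof -
  have "((\<lambda>x. 0) has_derivative (\<lambda>h. 0)) (at x)" by simp
  then have "(\<phi> has_derivative (\<lambda>h. 0)) (at x)"
  proof (rule has_derivative_transform_within_open)
    show "open (- supp \<phi>)" by (rule open_Compl[OF closed_closure])
    show "x \<in> - supp \<phi>" using assms by blast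
    show "0 = \<phi> y" if "y \<in> - supp \<phi>" for y
      using not_in_supp[of y \<phi>] that by (metis ComplD)
  qed
  then show ?thesis by (rule partial_deriv_eq)
qed

lemma test_partial:
  assumes "\<phi> \<in> test_functions \<Omega>" "i \<in> Basis"
  shows "partial_deriv i \<phi> \<in> test_functions \<Omega>"
proof (rule test_functionsI[OF _ test_supp(1)[OF assms(1)] _ test_supp(2)[OF assms(1)]])
  show "Ck k (partial_deriv i \<phi>)" for k
    using test_Ck[OF assms(1), of "Suc k"] assms(2) by simp
  show "{x. partial_deriv i \<phi> x \<noteq> 0} \<subseteq> supp \<phi>"
    using partial_deriv_zero by blast
qed

lemma test_add:
  assumes "\<phi> \<in> test_functions \<Omega>" "\<psi> \<in> test_functions \<Omega>"
  shows "(\<lambda>x. \<phi> x + \<psi> x) \<in> test_functions \<Omega>"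
proof (rule test_functionsI[where K="supp \<phi> \<union> supp \<psi>"])
  show "{x. \<phi> x + \<psi> x \<noteq> 0} \<subseteq> supp \<phi> \<union> supp \<psi>"
  proof
    fix x assume "x \<in> {x. \<phi> x + \<psi> x \<noteq> 0}"
    then have "\<phi> x \<noteq> 0 \<or> \<psi> x \<noteq> 0" by auto
    then show "x \<in> supp \<phi> \<union> supp \<psi>"
      using not_in_supp[of x \<phi>] not_in_supp[of x \<psi>] by blast
  qed
  show "Ck k (\<lambda>x. \<phi> x + \<psi> x)" for k
    using test_Ck[OF assms(1)] test_Ck[OF assms(2)] by (rule Ck_add)
  show "compact (supp \<phi> \<union> supp \<psi>)"
    using test_supp(1)[OF assms(1)] test_supp(1)[OF assms(2)] by (rule compact_Un)
  show "supp \<phi> \<union> supp \<psi> \<subseteq> \<Omega>"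
    using test_supp(2)[OF assms(1)] test_supp(2)[OF assms(2)] by blast
qed

lemma test_mult:
  assumes "\<phi> \<in> test_functions \<Omega>" "\<And>k. Ck k \<psi>"
  shows "(\<lambda>x. \<phi> x * \<psi> x) \<in> test_functions \<Omega>"
proof (rule test_functionsI[OF _ test_supp(1)[OF assms(1)] _ test_supp(2)[OF assms(1)]])
  show "{x. \<phi> x * \<psi> x \<noteq> 0} \<subseteq> supp \<phi>"
  proof
    fix x assume "x \<in> {x. \<phi> x * \<psi> x \<noteq> 0}"
    then have "\<phi> x \<noteq> 0" by auto
    then show "x \<in> supp \<phi>" using not_in_supp[of x \<phi>] by blast
  qed
qed (use assms in \<open>auto intro: Ck_mult test_Ck\<close>)

lemma test_cmult: "\<phi> \<in> test_functions \<Omega> \<Longrightarrow> (\<lambda>x. c * \<phi> x) \<in> test_functions \<Omega>"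
  using test_mult[of \<phi> \<Omega> "\<lambda>x. c"] by (simp add: Ck_const mult.commute)

definition cgrad :: "('a::euclidean_space \<Rightarrow> real) \<Rightarrow> 'a \<Rightarrow> 'a" where
  "cgrad \<phi> x = (\<Sum>i\<in>Basis. partial_deriv i \<phi> x *\<^sub>R i)"

lemma cgrad_inner_Basis: "i \<in> Basis \<Longrightarrow> cgrad \<phi> x \<bullet> i = partial_deriv i \<phi> x"
  by (simp add: cgrad_def)

lemma has_derivative_cgrad:
  assumes "\<phi> differentiable at x"
  shows "(\<phi> has_derivative (\<lambda>h. cgrad \<phi> x \<bullet> h)) (at x)"
proof -
  have lin: "linear (frechet_derivative \<phi> (at x))"
    using assms by (rule linear_frechet_derivative)
  have "frechet_derivative \<phi> (at x) h = cgrad \<phi> x \<bullet> h" for h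
  proof -
    have "frechet_derivative \<phi> (at x) h = frechet_derivative \<phi> (at x) (\<Sum>i\<in>Basis. (h \<bullet> i) *\<^sub>R i)"
      by (simp add: euclidean_representation)
    also have "\<dots> = (\<Sum>i\<in>Basis. (h \<bullet> i) * frechet_derivative \<phi> (at x) i)"
      using lin by (simp add: linear_sum linear_scale)
    also have "\<dots> = cgrad \<phi> x \<bullet> h"
      by (simp add: cgrad_def inner_sum_left partial_deriv_def inner_commute[of h] mult.commute)
    finally show ?thesis .
  qed
  then have "frechet_derivative \<phi> (at x) = (\<lambda>h. cgrad \<phi> x \<bullet> h)" by (rule ext)
  then show ?thesis using assms by (metis frechet_derivative_works)
qed

lemma line_derivative:
  assumes "\<phi> \<in> test_functions \<Omega>"
  shows "((\<lambda>t. \<phi> (x + t *\<^sub>R z)) has_real_derivative (cgrad \<phi> (x + s *\<^sub>R z) \<bullet> z)) (at s within S)"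
proof -
  have "((\<lambda>t. \<phi> (x + t *\<^sub>R z)) has_derivative (\<lambda>h. cgrad \<phi> (x + s *\<^sub>R z) \<bullet> (h *\<^sub>R z))) (at s within S)"
    by (rule has_derivative_compose[of "\<lambda>t. x + t *\<^sub>R z" "\<lambda>h. h *\<^sub>R z" s S \<phi>,
          OF _ has_derivative_cgrad[OF test_differentiable[OF assms]]])
       (auto intro!: derivative_eq_intros)
  then show ?thesis by (simp add: has_field_derivative_def mult_commute_abs)
qed

lemma cgrad_continuous: "\<phi> \<in> test_functions \<Omega> \<Longrightarrow> continuous_on UNIV (cgrad \<phi>)"
  unfolding cgrad_def[abs_def]
  by (intro continuous_on_sum continuous_on_scaleR test_continuous[OF test_partial] continuous_on_const) auto

lemma cgrad_measurable: "\<phi> \<in> test_functions \<Omega> \<Longrightarrow> cgrad \<phi> \<in> borel_measurable borel"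
  by (intro borel_measurable_continuous_onI cgrad_continuous)

lemma cgrad_zero: "x \<notin> supp \<phi> \<Longrightarrow> cgrad \<phi> x = 0"
  by (simp add: cgrad_def partial_deriv_zero)

lemma cgrad_add:
  assumes "\<phi> \<in> test_functions \<Omega>" "\<psi> \<in> test_functions \<Omega>"
  shows "cgrad (\<lambda>x. \<phi> x + \<psi> x) x = cgrad \<phi> x + cgrad \<psi> x"
proof -
  have "((\<lambda>x. \<phi> x + \<psi> x) has_derivative (\<lambda>h. cgrad \<phi> x \<bullet> h + cgrad \<psi> x \<bullet> h)) (at x)"
    by (intro has_derivative_add has_derivative_cgrad test_differentiable[OF assms(1)] test_differentiable[OF assms(2)])
  from partial_deriv_eq[OF this] show ?thesis
    by (subst euclidean_eq_iff) (simp add: cgrad_inner_Basis inner_add_left)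
qed

lemma cgrad_cmult:
  assumes "\<phi> \<in> test_functions \<Omega>"
  shows "cgrad (\<lambda>x. c * \<phi> x) x = c *\<^sub>R cgrad \<phi> x"
proof -
  have "((\<lambda>x. c * \<phi> x) has_derivative (\<lambda>h. c * (cgrad \<phi> x \<bullet> h))) (at x)"
    by (intro has_derivative_mult_right has_derivative_cgrad test_differentiable[OF assms])
  from partial_deriv_eq[OF this] show ?thesis
    by (subst euclidean_eq_iff) (simp add: cgrad_inner_Basis)
qed

lemma integrable_compact_support:
  fixes g :: "'a::euclidean_space \<Rightarrow> 'b::{banach, second_countable_topology}"
  assumes "continuous_on UNIV g" "compact K" "\<And>x. x \<notin> K \<Longrightarrow> g x = 0"
  shows "integrable lborel g"
proof -
  have "integrable lborel (\<lambda>x. indicator K x *\<^sub>R g x)"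
    using assms by (intro borel_integrable_compact) (auto intro: continuous_on_subset)
  moreover have "(\<lambda>x. indicator K x *\<^sub>R g x) = g"
    using assms(3) by (auto simp: indicator_def)
  ultimately show ?thesis by simp
qed

lemma bounded_compact_support:
  fixes g :: "'a::euclidean_space \<Rightarrow> 'b::real_normed_vector"
  assumes "continuous_on UNIV g" "compact K" "\<And>x. x \<notin> K \<Longrightarrow> g x = 0"
  obtains B where "B > 0" "\<And>x. norm (g x) \<le> B"
proof -
  have "bounded (g ` K)"
    using assms by (intro compact_imp_bounded compact_continuous_image) (auto intro: continuous_on_subset)
  then obtain B where "B > 0" "\<And>x. x \<in> K \<Longrightarrow> norm (g x) \<le> B"
    unfolding bounded_pos by auto
  then show thesis using that[of B] assms(3) by (metis less_imp_le norm_zero)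
qed

lemma integral_lborel_translation:
  fixes g :: "'a::euclidean_space \<Rightarrow> 'b::{banach, second_countable_topology}"
  assumes [measurable]: "g \<in> borel_measurable borel"
  shows "(LINT x|lborel. g (z + x)) = (LINT x|lborel. g x)"
  by (subst (2) lborel_distr_plus[of z, symmetric]) (subst integral_distr, auto)

lemma nn_integral_lborel_translation:
  fixes g :: "'a::euclidean_space \<Rightarrow> ennreal"
  assumes [measurable]: "g \<in> borel_measurable borel"
  shows "(\<integral>\<^sup>+x. g (z + x) \<partial>lborel) = (\<integral>\<^sup>+x. g x \<partial>lborel)"
  by (subst (2) lborel_distr_plus[of z, symmetric]) (subst nn_integral_distr, auto)

text \<open>By translation invariance all difference quotients have integral \<open>0\<close>, and
  they converge to the partial derivative boundedly and within a fixed compact set.\<close>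

lemma integral_partial_deriv_zero:
  assumes \<phi>: "\<phi> \<in> test_functions \<Omega>" and i: "i \<in> Basis"
  shows "(LINT x|lborel. partial_deriv i \<phi> x) = 0"
proof -
  note [measurable] = test_measurable[OF \<phi>] test_measurable[OF test_partial[OF \<phi> i]]
  define \<tau> where "\<tau> n = 1 / real (Suc n)" for n
  have \<tau>: "0 < \<tau> n" "\<tau> n \<le> 1" for n by (auto simp: \<tau>_def)
  have \<tau>0: "\<tau> \<longlonglongrightarrow> 0" unfolding \<tau>_def by (intro LIMSEQ_Suc lim_1_over_n)
  define D where "D n x = (\<phi> (x + \<tau> n *\<^sub>R i) - \<phi> x) / \<tau> n" for n x
  obtain B where B: "B > 0" "\<And>x. norm (partial_deriv i \<phi> x) \<le> B"
    using bounded_compact_support[OF test_continuous[OF test_partial[OF \<phi> i]] test_supp(1)[OF \<phi>] partial_deriv_zero]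
    by blast
  \<comment> \<open>The support enlarged by the unit ball: since all steps \<open>\<tau> n\<close>
    are at most \<open>1\<close>, outside \<open>K\<close> every difference quotient
    vanishes.\<close>
  define K where "K = {x + y |x y. x \<in> supp \<phi> \<and> y \<in> cball (0::'a) 1}"
  have K: "compact K" unfolding K_def by (intro compact_sums test_supp(1)[OF \<phi>] compact_cball)
  have KI: "x \<in> K" if "x + t *\<^sub>R i \<in> supp \<phi>" "0 \<le> t" "t \<le> 1" for x t
    unfolding K_def using that i
    by (intro CollectI exI[of _ "x + t *\<^sub>R i"] exI[of _ "- t *\<^sub>R i"]) auto
  have Dint: "(LINT x|lborel. D n x) = 0" for n
  proof -
    have int: "integrable lborel \<phi>"
      by (rule integrable_compact_support[OF test_continuous[OF \<phi>] test_supp(1)[OF \<phi>]]) (rule not_in_supp)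
    have int2: "integrable lborel (\<lambda>x. \<phi> (x + \<tau> n *\<^sub>R i))"
    proof (rule integrable_compact_support[OF _ K])
      show "continuous_on UNIV (\<lambda>x. \<phi> (x + \<tau> n *\<^sub>R i))"
        by (rule continuous_on_compose2[OF test_continuous[OF \<phi>]]) (auto intro!: continuous_intros)
      show "\<phi> (x + \<tau> n *\<^sub>R i) = 0" if "x \<notin> K" for x
        using KI[of x "\<tau> n"] \<tau>[of n] that not_in_supp[of "x + \<tau> n *\<^sub>R i" \<phi>] less_imp_le by blast
    qed
    have "(LINT x|lborel. D n x) = ((LINT x|lborel. \<phi> (x + \<tau> n *\<^sub>R i)) - (LINT x|lborel. \<phi> x)) / \<tau> n"
      unfolding D_def using int int2 by simp
    also have "(LINT x|lborel. \<phi> (x + \<tau> n *\<^sub>R i)) = (LINT x|lborel. \<phi> x)"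
      using integral_lborel_translation[of \<phi> "\<tau> n *\<^sub>R i"] by (simp add: add.commute)
    finally show ?thesis by simp
  qed
  have "(\<lambda>n. LINT x|lborel. D n x) \<longlonglongrightarrow> (LINT x|lborel. partial_deriv i \<phi> x)"
  proof (rule integral_dominated_convergence[where w="\<lambda>x. B * indicator K x"])
    have "emeasure lborel K < \<infinity>" using K by (rule emeasure_compact_finite)
    moreover have "K \<in> sets borel" using K by (simp add: borel_compact)
    ultimately show "integrable lborel (\<lambda>x. B * indicator K x)"
      by (intro integrable_mult_right integrable_real_indicator) auto
    show "AE x in lborel. (\<lambda>n. D n x) \<longlonglongrightarrow> partial_deriv i \<phi> x"
    proof (rule AE_I2)
      fix x
      have "((\<lambda>t. \<phi> (x + t *\<^sub>R i)) has_real_derivative partial_deriv i \<phi> x) (at 0)"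
        using line_derivative[OF \<phi>, of x i 0 UNIV] by (simp add: cgrad_inner_Basis[OF i])
      then have l: "((\<lambda>h. (\<phi> (x + h *\<^sub>R i) - \<phi> x) / h) \<longlongrightarrow> partial_deriv i \<phi> x) (at 0)"
        by (simp add: DERIV_def)
      have "filterlim \<tau> (at 0) sequentially"
        unfolding filterlim_at using \<tau>0 \<tau>(1) by (auto intro!: always_eventually simp: less_imp_neq[OF \<tau>(1), symmetric])
      from filterlim_compose[OF l this] show "(\<lambda>n. D n x) \<longlonglongrightarrow> partial_deriv i \<phi> x"
        by (simp add: D_def[abs_def] o_def)
    qed
    show "AE x in lborel. norm (D n x) \<le> B * indicator K x" for n
    proof (rule AE_I2)
      fix x
      have "\<exists>z. 0 < z \<and> z < \<tau> n \<and> \<phi> (x + \<tau> n *\<^sub>R i) - \<phi> (x + 0 *\<^sub>R i) = (\<tau> n - 0) * (cgrad \<phi> (x + z *\<^sub>R i) \<bullet> i)"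
        by (rule MVT2[OF \<tau>(1)]) (use line_derivative[OF \<phi>, of x i _ UNIV] in auto)
      then obtain z where z: "0 < z" "z < \<tau> n" "D n x = partial_deriv i \<phi> (x + z *\<^sub>R i)"
        using \<tau>(1)[of n] by (auto simp: D_def cgrad_inner_Basis[OF i])
      show "norm (D n x) \<le> B * indicator K x"
      proof (cases "x \<in> K")
        case True then show ?thesis using B z by simp
      next
        case False
        then have "x + z *\<^sub>R i \<notin> supp \<phi>" using KI[of x z] z \<tau>(2)[of n] by auto
        then show ?thesis using z partial_deriv_zero by (simp add: False)
      qed
    qed
  qed (auto simp: D_def[abs_def])
  then show ?thesis by (simp add: Dint LIMSEQ_const_iff)
qed

lemma integration_by_parts_test:
  assumes \<phi>: "\<phi> \<in> test_functions \<Omega>" and \<psi>: "\<psi> \<in> test_functions \<Omega>" and i: "i \<in> Basis"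
  shows "(LINT x|lborel. \<phi> x * partial_deriv i \<psi> x) = - (LINT x|lborel. partial_deriv i \<phi> x * \<psi> x)"
proof -
  have "((\<lambda>x. \<phi> x * \<psi> x) has_derivative (\<lambda>h. \<phi> x * (cgrad \<psi> x \<bullet> h) + (cgrad \<phi> x \<bullet> h) * \<psi> x)) (at x)" for x
    by (intro has_derivative_mult has_derivative_cgrad test_differentiable[OF \<phi>] test_differentiable[OF \<psi>])
  from partial_deriv_eq[OF this, of i] i
  have eq: "partial_deriv i (\<lambda>x. \<phi> x * \<psi> x) x = \<phi> x * partial_deriv i \<psi> x + partial_deriv i \<phi> x * \<psi> x" for x
    by (simp add: cgrad_inner_Basis)
  have 1: "integrable lborel (\<lambda>x. \<phi> x * partial_deriv i \<psi> x)"
    by (rule integrable_compact_support[OF _ test_supp(1)[OF \<phi>]])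
       (auto intro!: continuous_on_mult test_continuous[OF \<phi>] test_continuous[OF test_partial[OF \<psi> i]] dest: not_in_supp)
  have 2: "integrable lborel (\<lambda>x. partial_deriv i \<phi> x * \<psi> x)"
    by (rule integrable_compact_support[OF _ test_supp(1)[OF \<psi>]])
       (auto intro!: continuous_on_mult test_continuous[OF \<psi>] test_continuous[OF test_partial[OF \<phi> i]] dest: not_in_supp)
  have "(LINT x|lborel. partial_deriv i (\<lambda>x. \<phi> x * \<psi> x) x) = 0"
    by (intro integral_partial_deriv_zero[OF test_mult[OF \<phi>] i] test_Ck[OF \<psi>])
  then show ?thesis using 1 2 by (simp add: eq)
qed

section \<open>The Sobolev inequality for test functions\<close>

lemma abs_powr_deriv:
  fixes s :: real
  assumes "\<gamma> > 1"
  shows "((\<lambda>s. \<bar>s\<bar> powr \<gamma>) has_real_derivative \<gamma> * (\<bar>s\<bar> powr (\<gamma> - 1) * sgn s)) (at s)"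
proof -
  consider "s > 0" | "s < 0" | "s = 0" by linarith
  then show ?thesis
  proof cases
    case 1
    have "((\<lambda>s. s powr \<gamma>) has_real_derivative \<gamma> * s powr (\<gamma> - 1)) (at s)"
      using 1 by (rule has_real_derivative_powr)
    then have "((\<lambda>s. \<bar>s\<bar> powr \<gamma>) has_real_derivative \<gamma> * s powr (\<gamma> - 1)) (at s)"
      by (rule has_field_derivative_transform_within_open[of _ _ _ "{0<..}"]) (use 1 in auto)
    then show ?thesis using 1 by simp
  next
    case 2
    have "((\<lambda>s. (- s) powr \<gamma>) has_real_derivative (\<gamma> * (- s) powr (\<gamma> - 1)) * (-1)) (at s)"
      by (rule DERIV_chain2[of "\<lambda>s. s powr \<gamma>", OF has_real_derivative_powr])
         (use 2 in \<open>auto intro!: derivative_eq_intros\<close>)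
    then have "((\<lambda>s. \<bar>s\<bar> powr \<gamma>) has_real_derivative (\<gamma> * (- s) powr (\<gamma> - 1)) * (-1)) (at s)"
      by (rule has_field_derivative_transform_within_open[of _ _ _ "{..<0}"]) (use 2 in auto)
    then show ?thesis using 2 by simp
  next
    case 3
    have "((\<lambda>h. \<bar>h\<bar> powr (\<gamma> - 1)) \<longlongrightarrow> \<bar>0\<bar> powr (\<gamma> - 1)) (at (0::real))"
      by (intro tendsto_intros) (use assms in auto)
    then have l: "((\<lambda>h. \<bar>h\<bar> powr (\<gamma> - 1)) \<longlongrightarrow> 0) (at (0::real))" by simp
    have "((\<lambda>h. (\<bar>0 + h\<bar> powr \<gamma> - \<bar>0\<bar> powr \<gamma>) / h) \<longlongrightarrow> 0) (at (0::real))"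
    proof (rule Lim_null_comparison[OF _ l])
      have "norm ((\<bar>0 + h\<bar> powr \<gamma> - \<bar>0\<bar> powr \<gamma>) / h) \<le> \<bar>h\<bar> powr (\<gamma> - 1)" if "h \<noteq> 0" for h :: real
        using that by (simp add: powr_diff)
      then show "\<forall>\<^sub>F h in at (0::real). norm ((\<bar>0 + h\<bar> powr \<gamma> - \<bar>0\<bar> powr \<gamma>) / h) \<le> \<bar>h\<bar> powr (\<gamma> - 1)"
        by (auto simp: eventually_at_filter)
    qed
    then show ?thesis using 3 by (simp add: DERIV_def)
  qed
qed

lemma continuous_signed_powr:
  assumes "q > 0"
  shows "continuous_on UNIV (\<lambda>s::real. \<bar>s\<bar> powr q * sgn s)"
proof -
  have "\<bar>s\<bar> powr q * sgn s = (max s 0) powr q - (max (- s) 0) powr q" for s :: real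
    by (auto simp: sgn_if max_def)
  moreover have "continuous_on UNIV (\<lambda>s::real. (max s 0) powr q - (max (- s) 0) powr q)"
    by (intro continuous_intros continuous_on_powr' continuous_on_max) (use assms in auto)
  ultimately show ?thesis by simp
qed

text \<open>The fundamental theorem of calculus for \<open>\<bar>\<phi>\<bar> powr \<gamma>\<close>
  on the line through \<open>x\<close> in direction \<open>i\<close>, started at a point so far away
  that \<open>\<phi>\<close> vanishes there. The condition \<open>\<gamma> > 1\<close> makes this
  power continuously differentiable across the zeros of \<open>\<phi>\<close>.\<close>

lemma powr_le_line_integral:
  fixes \<phi> :: "'a::euclidean_space \<Rightarrow> real"
  assumes \<phi>: "\<phi> \<in> test_functions \<Omega>" and \<gamma>: "\<gamma> > 1" and i: "i \<in> Basis"
  shows "ennreal (\<bar>\<phi> x\<bar> powr \<gamma>)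
     \<le> (\<integral>\<^sup>+t. ennreal (\<gamma> * \<bar>\<phi> (x + t *\<^sub>R i)\<bar> powr (\<gamma> - 1) * norm (cgrad \<phi> (x + t *\<^sub>R i))) \<partial>lborel)"
proof -
  note [measurable] = test_measurable[OF \<phi>] cgrad_measurable[OF \<phi>]
  obtain R where R: "R > 0" "\<phi> (x + (- R) *\<^sub>R i) = 0"
  proof -
    obtain B where B: "\<And>y. y \<in> supp \<phi> \<Longrightarrow> norm y \<le> B"
      using compact_imp_bounded[OF test_supp(1)[OF \<phi>]] by (auto simp: bounded_iff)
    define R where "R = \<bar>B\<bar> + norm x + 1"
    have "norm (x + (- R) *\<^sub>R i) \<ge> norm (R *\<^sub>R i) - norm x"
      using norm_triangle_ineq2[of "R *\<^sub>R i" x] by (simp add: norm_minus_commute)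
    then have "norm (x + (- R) *\<^sub>R i) > B"
      using i by (auto simp: R_def)
    then have "x + (- R) *\<^sub>R i \<notin> supp \<phi>" using B by force
    then have "\<phi> (x + (- R) *\<^sub>R i) = 0" by (rule not_in_supp)
    then show thesis using that[of R] by (simp add: R_def add_nonneg_pos)
  qed
  define G where "G t = \<bar>\<phi> (x + t *\<^sub>R i)\<bar> powr \<gamma>" for t
  define g where "g t = \<gamma> * (\<bar>\<phi> (x + t *\<^sub>R i)\<bar> powr (\<gamma> - 1) * sgn (\<phi> (x + t *\<^sub>R i))) * (cgrad \<phi> (x + t *\<^sub>R i) \<bullet> i)" for t
  have line: "continuous_on UNIV (\<lambda>t::real. x + t *\<^sub>R i)" by (intro continuous_intros)
  have cg: "continuous_on UNIV g"
  proof -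
    have 1: "continuous_on UNIV (\<lambda>t. \<phi> (x + t *\<^sub>R i))"
      by (rule continuous_on_compose2[OF test_continuous[OF \<phi>] line]) auto
    have 2: "continuous_on UNIV (\<lambda>t. cgrad \<phi> (x + t *\<^sub>R i))"
      by (rule continuous_on_compose2[OF cgrad_continuous[OF \<phi>] line]) auto
    have 3: "continuous_on UNIV (\<lambda>t. \<bar>\<phi> (x + t *\<^sub>R i)\<bar> powr (\<gamma> - 1) * sgn (\<phi> (x + t *\<^sub>R i)))"
      by (rule continuous_on_compose2[OF continuous_signed_powr 1]) (use \<gamma> in auto)
    show ?thesis unfolding g_def by (intro continuous_on_mult continuous_on_inner continuous_on_const 2 3)
  qed
  have "(G has_real_derivative g t) (at t within S)" for t S
    unfolding G_def g_def
    by (rule DERIV_chain2[OF abs_powr_deriv[OF \<gamma>] line_derivative[OF \<phi>]])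
  then have "has_bochner_integral lborel (\<lambda>t. g t * indicator {-R..0} t) (G 0 - G (- R))"
    using R(1) cg by (intro has_bochner_integral_FTC_Icc_real[where F=G])
      (auto simp: continuous_on_eq_continuous_at)
  then have gi: "integrable lborel (\<lambda>t. g t * indicator {-R..0} t)"
    and geq: "(LINT t|lborel. g t * indicator {-R..0} t) = \<bar>\<phi> x\<bar> powr \<gamma>"
    using R(2) by (auto simp: has_bochner_integral_iff G_def)
  have "ennreal (\<bar>\<phi> x\<bar> powr \<gamma>) \<le> ennreal (LINT t|lborel. norm (g t * indicator {-R..0} t))"
    unfolding geq[symmetric] by (intro ennreal_leI integral_mono gi integrable_norm) auto
  also have "\<dots> = (\<integral>\<^sup>+t. norm (g t * indicator {-R..0} t) \<partial>lborel)"
    by (intro nn_integral_eq_integral[symmetric] integrable_norm gi) auto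
  also have "\<dots> \<le> (\<integral>\<^sup>+t. ennreal (\<gamma> * \<bar>\<phi> (x + t *\<^sub>R i)\<bar> powr (\<gamma> - 1) * norm (cgrad \<phi> (x + t *\<^sub>R i))) \<partial>lborel)"
  proof (intro nn_integral_mono ennreal_leI)
    fix t
    have "norm (g t * indicator {-R..0} t) \<le> norm (g t)"
      by (auto simp: indicator_def)
    also have "\<dots> = \<gamma> * \<bar>\<phi> (x + t *\<^sub>R i)\<bar> powr (\<gamma> - 1) * (\<bar>sgn (\<phi> (x + t *\<^sub>R i))\<bar> * \<bar>cgrad \<phi> (x + t *\<^sub>R i) \<bullet> i\<bar>)"
      using \<gamma> by (simp add: g_def abs_mult)
    also have "\<dots> \<le> \<gamma> * \<bar>\<phi> (x + t *\<^sub>R i)\<bar> powr (\<gamma> - 1) * (1 * norm (cgrad \<phi> (x + t *\<^sub>R i)))"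
      using \<gamma> Cauchy_Schwarz_ineq2[of "cgrad \<phi> (x + t *\<^sub>R i)" i] i
      by (intro mult_left_mono mult_mono) (auto simp: sgn_if)
    finally show "norm (g t * indicator {-R..0} t) \<le> \<gamma> * \<bar>\<phi> (x + t *\<^sub>R i)\<bar> powr (\<gamma> - 1) * norm (cgrad \<phi> (x + t *\<^sub>R i))"
      by simp
  qed
  finally show ?thesis .
qed

text \<open>The power of \<open>\<psi>\<close> on the left is a product of \<open>n\<close> equal
  factors, one for each coordinate direction; bounding each by the line integral in its own
  direction leaves the integrand of \<open>Gagliardo_product\<close>. The map \<open>e\<close>
  identifies coordinate functions with points and carries the product measure to
  \<open>lborel\<close>.\<close>

lemma Gagliardo_lborel:
  fixes h \<psi> :: "'a::euclidean_space \<Rightarrow> real"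
  assumes N: "DIM('a) \<ge> 2"
    and [measurable]: "h \<in> borel_measurable borel" "\<psi> \<in> borel_measurable borel"
    and nn: "\<And>x. h x \<ge> 0" "\<And>x. \<psi> x \<ge> 0"
    and le: "\<And>x i. i \<in> Basis \<Longrightarrow> ennreal (\<psi> x) \<le> (\<integral>\<^sup>+t. ennreal (h (x + t *\<^sub>R i)) \<partial>lborel)"
  shows "(\<integral>\<^sup>+x. ennreal (\<psi> x powr (real DIM('a) / (real DIM('a) - 1))) \<partial>lborel)
     \<le> epow (\<integral>\<^sup>+x. ennreal (h x) \<partial>lborel) (real DIM('a) / (real DIM('a) - 1))"
proof -
  define n where "n = real DIM('a)"
  have n: "n \<ge> 2" using N by (simp add: n_def)
  define p where "p = 1 / (n - 1)"
  have p: "p > 0" "(n - 1) * p = 1" "1 + p = n / (n - 1)" "n * p = n / (n - 1)"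
    using n by (auto simp: p_def field_simps)
  define e where "e f = (\<Sum>b\<in>Basis. f b *\<^sub>R b)" for f :: "'a \<Rightarrow> real"
  let ?P = "\<Pi>\<^sub>M b\<in>(Basis::'a set). (lborel::real measure)"
  have em[measurable]: "e \<in> ?P \<rightarrow>\<^sub>M borel"
    unfolding e_def by measurable
  have tr: "(\<integral>\<^sup>+x. g x \<partial>lborel) = (\<integral>\<^sup>+f. g (e f) \<partial>?P)" if [measurable]: "g \<in> borel_measurable borel" for g :: "'a \<Rightarrow> ennreal"
    unfolding e_def by (subst lborel_eq) (subst nn_integral_distr, use em in \<open>auto simp: e_def[abs_def]\<close>)
  have eupd: "e (f(i := t)) = e f + (t - f i) *\<^sub>R i" if "i \<in> Basis" for f i t
  proof (subst euclidean_eq_iff, rule ballI)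
    fix b :: 'a assume b: "b \<in> Basis"
    show "e (f(i := t)) \<bullet> b = (e f + (t - f i) *\<^sub>R i) \<bullet> b"
      using b that by (simp add: e_def inner_add_left inner_Basis)
  qed
  have T: "ennreal (\<psi> (e f)) \<le> (\<integral>\<^sup>+t. ennreal (h (e (f(i := t)))) \<partial>lborel)" if i: "i \<in> Basis" for f i
  proof -
    have "(\<integral>\<^sup>+t. ennreal (h (e (f(i := t)))) \<partial>lborel) = (\<integral>\<^sup>+t. ennreal (h (e f + (- f i + t) *\<^sub>R i)) \<partial>lborel)"
      by (simp add: eupd[OF i])
    also have "\<dots> = (\<integral>\<^sup>+t. ennreal (h (e f + t *\<^sub>R i)) \<partial>lborel)"
      by (rule nn_integral_lborel_translation) measurable
    finally show ?thesis using le[OF i] by simp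
  qed
  have "(\<integral>\<^sup>+x. ennreal (\<psi> x powr (n / (n - 1))) \<partial>lborel) = (\<integral>\<^sup>+f. ennreal (\<psi> (e f) powr (n / (n - 1))) \<partial>?P)"
    by (rule tr) measurable
  also have "\<dots> \<le> (\<integral>\<^sup>+f. epow (ennreal (h (e f))) (1 - (real (card (Basis::'a set)) - 1) * p) *
      (\<Prod>i\<in>Basis. epow (\<integral>\<^sup>+t. ennreal (h (e (f(i := t)))) \<partial>lborel) p) \<partial>?P)"
  proof (rule nn_integral_mono)
    fix f
    have "ennreal (\<psi> (e f) powr (n / (n - 1))) = epow (ennreal (\<psi> (e f))) (\<Sum>i\<in>(Basis::'a set). p)"
      using nn(2) n p by (subst epow_ennreal[symmetric]) (auto simp: n_def[symmetric])
    also have "\<dots> = (\<Prod>i\<in>(Basis::'a set). epow (ennreal (\<psi> (e f))) p)"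
      by (rule epow_prod[symmetric]) (use p in auto)
    also have "\<dots> \<le> (\<Prod>i\<in>Basis. epow (\<integral>\<^sup>+t. ennreal (h (e (f(i := t)))) \<partial>lborel) p)"
      by (intro prod_mono_ennreal epow_mono T) (use p in auto)
    finally show "ennreal (\<psi> (e f) powr (n / (n - 1))) \<le> epow (ennreal (h (e f))) (1 - (real (card (Basis::'a set)) - 1) * p) *
      (\<Prod>i\<in>Basis. epow (\<integral>\<^sup>+t. ennreal (h (e (f(i := t)))) \<partial>lborel) p)"
      using p(2) by (simp add: n_def)
  qed
  also have "\<dots> \<le> epow (\<integral>\<^sup>+f. ennreal (h (e f)) \<partial>?P) (1 + p)"
    by (rule Gagliardo_product) (use p in \<open>auto simp: n_def\<close>)
  also have "(\<integral>\<^sup>+f. ennreal (h (e f)) \<partial>?P) = (\<integral>\<^sup>+x. ennreal (h x) \<partial>lborel)"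
    by (rule tr[symmetric]) measurable
  finally show ?thesis by (simp add: p(3) n_def)
qed

lemma test_powr_integrable:
  assumes \<phi>: "\<phi> \<in> test_functions \<Omega>" and "q > 0"
  shows "integrable lborel (\<lambda>x. \<bar>\<phi> x\<bar> powr q)"
proof (rule integrable_compact_support[OF _ test_supp(1)[OF \<phi>]])
  show "continuous_on UNIV (\<lambda>x. \<bar>\<phi> x\<bar> powr q)"
    by (intro continuous_on_powr' continuous_on_rabs test_continuous[OF \<phi>] continuous_on_const) (use assms in auto)
qed (auto dest: not_in_supp)

lemma sqint_compact_support:
  fixes g :: "'a::euclidean_space \<Rightarrow> 'b::euclidean_space"
  assumes "continuous_on UNIV g" "compact K" "\<And>x. x \<notin> K \<Longrightarrow> g x = 0"
  shows "sqint lborel g"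
  unfolding sqint_def
proof
  show "g \<in> borel_measurable lborel"
    using borel_measurable_continuous_onI[OF assms(1)] by simp
  show "integrable lborel (\<lambda>x. (norm (g x))\<^sup>2)"
    by (rule integrable_compact_support[OF _ assms(2)]) (use assms(1,3) in \<open>auto intro!: continuous_intros\<close>)
qed

lemma sqint_cgrad: "\<phi> \<in> test_functions \<Omega> \<Longrightarrow> sqint lborel (cgrad \<phi>)"
  by (rule sqint_compact_support[OF cgrad_continuous test_supp(1)]) (auto intro: cgrad_zero)

lemma sqint_test: "\<phi> \<in> test_functions \<Omega> \<Longrightarrow> sqint lborel \<phi>"
  by (rule sqint_compact_support[OF test_continuous test_supp(1)]) (auto dest: not_in_supp)

text \<open>Gagliardo's inequality is applied to \<open>\<bar>\<phi>\<bar> powr \<gamma>\<close>.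
  The value of \<open>\<gamma>\<close> is determined by
  \<open>\<gamma> * (n / (n - 1)) = 2 * (\<gamma> - 1)\<close>, and both sides then equal
  \<open>q\<close>: the left side of Gagliardo's inequality is \<open>X\<close>, and Cauchy--Schwarz
  applied to its right side reproduces \<open>X\<close> with an exponent below \<open>1\<close>. The
  resulting constant is \<open>\<gamma>\<close>.\<close>

theorem Sobolev_test:
  fixes \<phi> :: "'a::euclidean_space \<Rightarrow> real"
  assumes N: "DIM('a) > 2" and \<phi>: "\<phi> \<in> test_functions \<Omega>"
  shows "(LINT x|lborel. \<bar>\<phi> x\<bar> powr crit_exp DIM('a))
    \<le> (2 * (real DIM('a) - 1) / (real DIM('a) - 2) * l2n lborel (cgrad \<phi>)) powr crit_exp DIM('a)"
proof -
  define n where "n = real DIM('a)"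
  have n: "n > 2" using N by (simp add: n_def)
  define \<gamma> where "\<gamma> = 2 * (n - 1) / (n - 2)"
  define q where "q = crit_exp DIM('a)"
  have q: "q = 2 * n / (n - 2)" "q > 0" using n by (auto simp: q_def crit_exp_def n_def)
  have \<gamma>: "\<gamma> > 1" "\<gamma> * (n / (n - 1)) = q" "2 * (\<gamma> - 1) = q"
  proof -
    show "\<gamma> > 1" "2 * (\<gamma> - 1) = q" using n by (auto simp: \<gamma>_def q field_simps)
    show "\<gamma> * (n / (n - 1)) = q"
      unfolding \<gamma>_def q(1) times_divide_times_eq
      by (subst frac_eq_eq) (use n in \<open>simp, simp, simp add: algebra_simps\<close>)
  qed
  note [measurable] = test_measurable[OF \<phi>] cgrad_measurable[OF \<phi>]
  define X where "X = (LINT x|lborel. \<bar>\<phi> x\<bar> powr q)"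
  have X0: "X \<ge> 0" by (auto simp: X_def)
  define G where "G = l2n lborel (cgrad \<phi>)"
  define h where "h x = \<gamma> * \<bar>\<phi> x\<bar> powr (\<gamma> - 1) * norm (cgrad \<phi> x)" for x
  have sq: "(\<bar>s\<bar> powr (\<gamma> - 1))\<^sup>2 = \<bar>s\<bar> powr q" for s :: real
    using \<gamma>(3) by (simp add: power2_eq_square powr_add[symmetric])
  have u: "sqint lborel (\<lambda>x. \<bar>\<phi> x\<bar> powr (\<gamma> - 1))"
    using test_powr_integrable[OF \<phi> q(2)] by (simp add: sqint_def sq)
  have g: "sqint lborel (cgrad \<phi>)" by (rule sqint_cgrad[OF \<phi>])
  have un: "l2n lborel (\<lambda>x. \<bar>\<phi> x\<bar> powr (\<gamma> - 1)) = sqrt X"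
    by (simp add: l2n_def X_def sq)
  have hi: "integrable lborel h"
    using integrable_mult_right[OF sqint_mult_norm(1)[OF u g], of \<gamma>] by (simp add: h_def[abs_def] mult.assoc)
  have hle: "(LINT x|lborel. h x) \<le> \<gamma> * (sqrt X * G)"
  proof -
    have "(LINT x|lborel. h x) = \<gamma> * (LINT x|lborel. norm (\<bar>\<phi> x\<bar> powr (\<gamma> - 1)) * norm (cgrad \<phi> x))"
      by (simp add: h_def[abs_def] mult.assoc)
    also have "\<dots> \<le> \<gamma> * (sqrt X * G)"
      using sqint_mult_norm(2)[OF u g] \<gamma> by (intro mult_left_mono) (auto simp: un G_def)
    finally show ?thesis .
  qed
  have h0: "h x \<ge> 0" for x using \<gamma> by (simp add: h_def)
  have "ennreal X = (\<integral>\<^sup>+x. ennreal ((\<bar>\<phi> x\<bar> powr \<gamma>) powr (n / (n - 1))) \<partial>lborel)"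
    unfolding X_def powr_powr \<gamma>(2)
    by (rule nn_integral_eq_integral[symmetric]) (use test_powr_integrable[OF \<phi> q(2)] in auto)
  also have "\<dots> \<le> epow (\<integral>\<^sup>+x. ennreal (h x) \<partial>lborel) (n / (n - 1))"
    unfolding n_def
  proof (rule Gagliardo_lborel)
    show "ennreal (\<bar>\<phi> x\<bar> powr \<gamma>) \<le> (\<integral>\<^sup>+t. ennreal (h (x + t *\<^sub>R i)) \<partial>lborel)" if "i \<in> Basis" for x i
      unfolding h_def by (rule powr_le_line_integral[OF \<phi> \<gamma>(1) that])
    show "h \<in> borel_measurable borel" using hi by auto
  qed (use N h0 in auto)
  also have "(\<integral>\<^sup>+x. ennreal (h x) \<partial>lborel) = ennreal (LINT x|lborel. h x)"
    by (rule nn_integral_eq_integral[OF hi]) (use h0 in auto)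
  also have "epow \<dots> (n / (n - 1)) = ennreal ((LINT x|lborel. h x) powr (n / (n - 1)))"
    by (rule epow_ennreal) (use h0 n in \<open>auto intro!: integral_nonneg_AE\<close>)
  finally have "X \<le> (LINT x|lborel. h x) powr (n / (n - 1))"
    by (subst (asm) ennreal_le_iff) auto
  also have "\<dots> \<le> (\<gamma> * (sqrt X * G)) powr (n / (n - 1))"
    by (rule powr_mono2) (use h0 n hle in \<open>auto intro!: integral_nonneg_AE\<close>)
  also have "\<dots> = (\<gamma> * G) powr (n / (n - 1)) * X powr (n / (2 * (n - 1)))"
  proof -
    have "\<gamma> * (sqrt X * G) = (\<gamma> * G) * X powr (1/2)" using X0 by (simp add: powr_half_sqrt)
    moreover have "(1/2) * (n / (n - 1)) = n / (2 * (n - 1))" by simp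
    moreover have "(X powr (1/2)) powr (n / (n - 1)) = X powr ((1/2) * (n / (n - 1)))"
      by (rule powr_powr)
    ultimately show ?thesis using \<gamma>(1) by (simp only: powr_mult)
  qed
  finally have main: "X \<le> (\<gamma> * G) powr (n / (n - 1)) * X powr (n / (2 * (n - 1)))" .
  \<comment> \<open>The power of \<open>X\<close> on the right of \<open>main\<close> is divided
    out, which is legitimate because \<open>X\<close> is finite; the exponent that remains on the
    left is \<open>1 / \<gamma>\<close>.\<close>
  have "X \<le> (\<gamma> * G) powr q"
  proof (cases "X = 0")
    case False
    with X0 have X: "X > 0" by simp
    have "X powr (1 - n / (2 * (n - 1))) = X / X powr (n / (2 * (n - 1)))"
      using X by (simp add: powr_diff)
    also have "\<dots> \<le> (\<gamma> * G) powr (n / (n - 1))"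
      using main X by (simp add: divide_le_eq)
    finally have "(X powr (1 - n / (2 * (n - 1)))) powr \<gamma> \<le> ((\<gamma> * G) powr (n / (n - 1))) powr \<gamma>"
      using \<gamma>(1) by (intro powr_mono2) auto
    moreover have "(1 - n / (2 * (n - 1))) * \<gamma> = 1"
    proof -
      have "1 - n / (2 * (n - 1)) = (n - 2) / (2 * (n - 1))" using n by (simp add: field_simps)
      then show ?thesis using n by (simp add: \<gamma>_def)
    qed
    moreover have "n / (n - 1) * \<gamma> = q" using \<gamma>(2) by (simp add: mult.commute)
    ultimately show ?thesis using X by (simp add: powr_powr)
  qed simp
  then show ?thesis by (simp add: X_def q_def G_def \<gamma>_def n_def)
qed

section \<open>Rellich's compactness theorem\<close>

text \<open>The difference is the integral of the derivative along the segment from \<open>x\<close>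
  to \<open>z + x\<close>. Cauchy--Schwarz on the unit interval moves the square inside, and after
  exchanging the integrals translation invariance removes the dependence on
  \<open>t\<close>.\<close>

lemma translation_estimate:
  fixes \<phi> :: "'a::euclidean_space \<Rightarrow> real"
  assumes \<phi>: "\<phi> \<in> test_functions \<Omega>"
  shows "(\<integral>\<^sup>+x. ennreal ((\<phi> (z + x) - \<phi> x)\<^sup>2) \<partial>lborel) \<le> ennreal ((norm z)\<^sup>2 * (l2n lborel (cgrad \<phi>))\<^sup>2)"
proof -
  note [measurable] = test_measurable[OF \<phi>] cgrad_measurable[OF \<phi>]
  have pw: "ennreal ((\<phi> (z + x) - \<phi> x)\<^sup>2)
      \<le> (\<integral>\<^sup>+t. ennreal ((norm z)\<^sup>2 * (norm (cgrad \<phi> (t *\<^sub>R z + x)))\<^sup>2) * indicator {0..1} t \<partial>lborel)" for x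
  proof -
    define g where "g t = cgrad \<phi> (x + t *\<^sub>R z) \<bullet> z" for t
    have cg: "continuous_on UNIV g"
      unfolding g_def
      by (intro continuous_on_inner continuous_on_const continuous_on_compose2[OF cgrad_continuous[OF \<phi>]])
         (auto intro!: continuous_intros)
    have b: "has_bochner_integral lborel (\<lambda>t. g t * indicator {0..1} t) (\<phi> (x + 1 *\<^sub>R z) - \<phi> (x + 0 *\<^sub>R z))"
      by (intro has_bochner_integral_FTC_Icc_real[where F="\<lambda>t. \<phi> (x + t *\<^sub>R z)"])
         (use cg line_derivative[OF \<phi>] in \<open>auto simp: g_def continuous_on_eq_continuous_at\<close>)
    have s1: "sqint lborel (\<lambda>t. g t * indicator {0..1} t)"
      unfolding sqint_def
    proof
      have "integrable lborel (\<lambda>t. indicator {0..1::real} t *\<^sub>R (g t)\<^sup>2)"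
        by (intro borel_integrable_compact continuous_intros continuous_on_subset[OF cg]) auto
      moreover have "(\<lambda>t. indicator {0..1::real} t *\<^sub>R (g t)\<^sup>2) = (\<lambda>t. (norm (g t * indicator {0..1} t))\<^sup>2)"
        by (auto simp: indicator_def)
      ultimately show "integrable lborel (\<lambda>t. (norm (g t * indicator {0..1} t))\<^sup>2)" by simp
      show "(\<lambda>t. g t * indicator {0..1} t) \<in> borel_measurable lborel"
        using b by (auto simp: has_bochner_integral_iff)
    qed
    have "(\<lambda>t. (norm (indicator {0..1::real} t :: real))\<^sup>2) = indicator {0..1}" by (auto simp: indicator_def)
    then have s2: "sqint lborel (indicator {0..1::real} :: real \<Rightarrow> real)"
      and n2: "l2n lborel (indicator {0..1::real} :: real \<Rightarrow> real) = 1"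
      by (simp_all add: sqint_def l2n_def)
    have "\<phi> (z + x) - \<phi> x = l2i lborel (\<lambda>t. g t * indicator {0..1} t) (indicator {0..1})"
      using has_bochner_integral_integral_eq[OF b]
      by (simp add: l2i_def add.commute mult.assoc indicator_inter_arith[symmetric])
    then have "\<bar>\<phi> (z + x) - \<phi> x\<bar> \<le> l2n lborel (\<lambda>t. g t * indicator {0..1} t)"
      using sqint_inner(2)[OF s1 s2] n2 by simp
    then have "(\<phi> (z + x) - \<phi> x)\<^sup>2 \<le> (l2n lborel (\<lambda>t. g t * indicator {0..1} t))\<^sup>2"
      by (metis abs_ge_zero power2_abs power_mono)
    then have "ennreal ((\<phi> (z + x) - \<phi> x)\<^sup>2) \<le> (\<integral>\<^sup>+t. ennreal ((norm (g t * indicator {0..1} t))\<^sup>2) \<partial>lborel)"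
      unfolding l2n_sq
      by (subst nn_integral_eq_integral) (use s1 in \<open>auto simp: sqint_def ennreal_leI\<close>)
    also have "\<dots> \<le> (\<integral>\<^sup>+t. ennreal ((norm z)\<^sup>2 * (norm (cgrad \<phi> (t *\<^sub>R z + x)))\<^sup>2) * indicator {0..1} t \<partial>lborel)"
    proof (rule nn_integral_mono)
      fix t
      have "(g t)\<^sup>2 \<le> (norm z * norm (cgrad \<phi> (t *\<^sub>R z + x)))\<^sup>2"
        unfolding g_def using Cauchy_Schwarz_ineq2[of "cgrad \<phi> (x + t *\<^sub>R z)" z]
        by (intro abs_le_square_iff[THEN iffD1]) (simp add: abs_mult add.commute mult.commute)
      then show "ennreal ((norm (g t * indicator {0..1} t))\<^sup>2)
          \<le> ennreal ((norm z)\<^sup>2 * (norm (cgrad \<phi> (t *\<^sub>R z + x)))\<^sup>2) * indicator {0..1} t"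
        by (auto simp: indicator_def power_mult_distrib intro!: ennreal_leI)
    qed
    finally show ?thesis .
  qed
  have "(\<integral>\<^sup>+x. ennreal ((\<phi> (z + x) - \<phi> x)\<^sup>2) \<partial>lborel)
    \<le> (\<integral>\<^sup>+x. \<integral>\<^sup>+t. ennreal ((norm z)\<^sup>2 * (norm (cgrad \<phi> (t *\<^sub>R z + x)))\<^sup>2) * indicator {0..1} t \<partial>lborel \<partial>lborel)"
    by (intro nn_integral_mono pw)
  also have "\<dots> = (\<integral>\<^sup>+t. \<integral>\<^sup>+x. ennreal ((norm z)\<^sup>2 * (norm (cgrad \<phi> (t *\<^sub>R z + x)))\<^sup>2) * indicator {0..1} t \<partial>lborel \<partial>lborel)"
    by (rule lborel_pair.Fubini') measurable
  also have "\<dots> = (\<integral>\<^sup>+t. ennreal ((norm z)\<^sup>2 * (l2n lborel (cgrad \<phi>))\<^sup>2) * indicator {0..1::real} t \<partial>lborel)"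
  proof (rule nn_integral_cong)
    fix t :: real
    have "(\<integral>\<^sup>+x. ennreal ((norm z)\<^sup>2 * (norm (cgrad \<phi> (t *\<^sub>R z + x)))\<^sup>2) * indicator {0..1} t \<partial>lborel)
        = (\<integral>\<^sup>+x. ennreal ((norm z)\<^sup>2 * (norm (cgrad \<phi> (t *\<^sub>R z + x)))\<^sup>2) \<partial>lborel) * indicator {0..1} t"
      by (rule nn_integral_multc) measurable
    also have "(\<integral>\<^sup>+x. ennreal ((norm z)\<^sup>2 * (norm (cgrad \<phi> (t *\<^sub>R z + x)))\<^sup>2) \<partial>lborel)
        = (\<integral>\<^sup>+x. ennreal ((norm z)\<^sup>2 * (norm (cgrad \<phi> x))\<^sup>2) \<partial>lborel)"
      by (rule nn_integral_lborel_translation[of "\<lambda>x. ennreal ((norm z)\<^sup>2 * (norm (cgrad \<phi> x))\<^sup>2)"]) measurable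
    also have "\<dots> = ennreal (LINT x|lborel. (norm z)\<^sup>2 * (norm (cgrad \<phi> x))\<^sup>2)"
      by (rule nn_integral_eq_integral) (use sqint_integrable[OF sqint_cgrad[OF \<phi>]] in auto)
    also have "(LINT x|lborel. (norm z)\<^sup>2 * (norm (cgrad \<phi> x))\<^sup>2) = (norm z)\<^sup>2 * (l2n lborel (cgrad \<phi>))\<^sup>2"
      by (simp add: l2n_sq)
    finally show "(\<integral>\<^sup>+x. ennreal ((norm z)\<^sup>2 * (norm (cgrad \<phi> (t *\<^sub>R z + x)))\<^sup>2) * indicator {0..1} t \<partial>lborel)
      = ennreal ((norm z)\<^sup>2 * (l2n lborel (cgrad \<phi>))\<^sup>2) * indicator {0..1} t" .
  qed
  also have "\<dots> = ennreal ((norm z)\<^sup>2 * (l2n lborel (cgrad \<phi>))\<^sup>2)"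
    by (subst nn_integral_cmult_indicator) auto
  finally show ?thesis .
qed

text \<open>\<open>cell k x\<close> is \<open>2 ^ k\<close> times the lower corner of the dyadic cube of side \<open>(1/2) ^ k\<close> that contains \<open>x\<close>.\<close>

definition cell :: "nat \<Rightarrow> 'a::euclidean_space \<Rightarrow> 'a" where
  "cell k x = (\<Sum>i\<in>Basis. of_int \<lfloor>2 ^ k * (x \<bullet> i)\<rfloor> *\<^sub>R i)"

definition cellset :: "nat \<Rightarrow> 'a::euclidean_space \<Rightarrow> 'a set" where
  "cellset k c = {y. cell k y = c}"

lemma cell_measurable[measurable]: "cell k \<in> borel_measurable borel"
  unfolding cell_def[abs_def] by measurable

lemma cellset_measurable[measurable]: "cellset k c \<in> sets borel"
  unfolding cellset_def by measurable

lemma cell_eq_iff: "cell k x = cell k y \<longleftrightarrow> (\<forall>i\<in>Basis. \<lfloor>2 ^ k * (x \<bullet> i)\<rfloor> = \<lfloor>2 ^ k * (y \<bullet> i)\<rfloor>)"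
  by (subst euclidean_eq_iff) (simp add: cell_def)

lemma countable_range_cell: "countable (range (cell k :: 'a \<Rightarrow> 'a::euclidean_space))"
proof (rule countable_subset)
  show "range (cell k :: 'a \<Rightarrow> 'a) \<subseteq> (\<lambda>c. \<Sum>i\<in>Basis. c i *\<^sub>R i) ` (Basis \<rightarrow>\<^sub>E \<int>)"
  proof safe
    fix x :: 'a
    show "cell k x \<in> (\<lambda>c. \<Sum>i\<in>Basis. c i *\<^sub>R i) ` (Basis \<rightarrow>\<^sub>E \<int>)"
      by (rule image_eqI[where x="restrict (\<lambda>i. of_int \<lfloor>2 ^ k * (x \<bullet> i)\<rfloor>) Basis"])
         (auto simp: cell_def)
  qed
  show "countable ((\<lambda>c. \<Sum>i\<in>Basis. c i *\<^sub>R i) ` (Basis \<rightarrow>\<^sub>E (\<int>::real set)) :: 'a set)"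
    by (intro countable_image countable_PiE finite_Basis countable_int)
qed

lemma cell_diff:
  assumes "cell k x = cell k y" "i \<in> Basis"
  shows "\<bar>(y - x) \<bullet> i\<bar> \<le> (1/2) ^ k"
proof -
  have "\<lfloor>2 ^ k * (x \<bullet> i)\<rfloor> = \<lfloor>2 ^ k * (y \<bullet> i)\<rfloor>" using assms by (auto simp: cell_eq_iff)
  then have "\<bar>2 ^ k * (y \<bullet> i) - 2 ^ k * (x \<bullet> i)\<bar> \<le> 1" by linarith
  then have "2 ^ k * \<bar>(y - x) \<bullet> i\<bar> \<le> 1"
    by (simp add: inner_diff_left right_diff_distrib[symmetric] abs_mult)
  then show ?thesis by (simp add: power_one_over field_simps)
qed

text \<open>An open box inside and a closed box around the half-open cube suffice, so its exact
  volume is never computed.\<close>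

lemma cellset_measure:
  fixes x :: "'a::euclidean_space"
  shows "emeasure lborel (cellset k (cell k x)) < \<infinity>"
    and "measure lborel (cellset k (cell k x)) \<ge> (1/2) ^ (k * DIM('a))"
proof -
  define l where "l = (1/2) ^ k *\<^sub>R cell k x"
  define u where "u = (\<Sum>i\<in>Basis. ((1/2) ^ k * (of_int \<lfloor>2 ^ k * (x \<bullet> i)\<rfloor> + 1)) *\<^sub>R i)"
  have li: "l \<bullet> i = (1/2) ^ k * of_int \<lfloor>2 ^ k * (x \<bullet> i)\<rfloor>"
    and ui: "u \<bullet> i = (1/2) ^ k * (of_int \<lfloor>2 ^ k * (x \<bullet> i)\<rfloor> + 1)" if "i \<in> Basis" for i
    using that by (auto simp: l_def u_def cell_def)
  have "cellset k (cell k x) \<subseteq> cbox (x - (\<Sum>i\<in>Basis. (1/2)^k *\<^sub>R i)) (x + (\<Sum>i\<in>Basis. (1/2)^k *\<^sub>R i))"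
  proof
    fix y assume "y \<in> cellset k (cell k x)"
    then have "cell k x = cell k y" by (simp add: cellset_def)
    from cell_diff[OF this] show "y \<in> cbox (x - (\<Sum>i\<in>Basis. (1/2)^k *\<^sub>R i)) (x + (\<Sum>i\<in>Basis. (1/2)^k *\<^sub>R i))"
      by (force simp: mem_box inner_diff_left inner_add_left inner_sum_left_Basis abs_le_iff)
  qed
  then have "emeasure lborel (cellset k (cell k x)) \<le> emeasure lborel (cbox (x - (\<Sum>i\<in>Basis. (1/2)^k *\<^sub>R i)) (x + (\<Sum>i\<in>Basis. (1/2)^k *\<^sub>R i)))"
    by (rule emeasure_mono) auto
  also have "\<dots> < \<infinity>" by (rule emeasure_compact_finite[OF compact_cbox])
  finally show fin: "emeasure lborel (cellset k (cell k x)) < \<infinity>" .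
  have "box l u \<subseteq> cellset k (cell k x)"
  proof
    fix y assume y: "y \<in> box l u"
    have "\<lfloor>2 ^ k * (y \<bullet> i)\<rfloor> = \<lfloor>2 ^ k * (x \<bullet> i)\<rfloor>" if i: "i \<in> Basis" for i
    proof -
      have "(1/2) ^ k * of_int \<lfloor>2 ^ k * (x \<bullet> i)\<rfloor> < y \<bullet> i" "y \<bullet> i < (1/2) ^ k * (of_int \<lfloor>2 ^ k * (x \<bullet> i)\<rfloor> + 1)"
        using y i by (auto simp: mem_box li ui)
      then have "of_int \<lfloor>2 ^ k * (x \<bullet> i)\<rfloor> < 2 ^ k * (y \<bullet> i)" "2 ^ k * (y \<bullet> i) < of_int \<lfloor>2 ^ k * (x \<bullet> i)\<rfloor> + 1"
        by (auto simp: power_one_over field_simps)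
      then show ?thesis by linarith
    qed
    then show "y \<in> cellset k (cell k x)" by (simp add: cellset_def cell_eq_iff)
  qed
  then have "measure lborel (box l u) \<le> measure lborel (cellset k (cell k x))"
    using fin by (intro measure_mono_fmeasurable) (auto simp: fmeasurable_def)
  moreover have "measure lborel (box l u) = (1/2) ^ (k * DIM('a))"
  proof -
    have "l \<bullet> b \<le> u \<bullet> b" if "b \<in> Basis" for b
      using li[OF that] ui[OF that] by simp
    then have "measure lborel (box l u) = (\<Prod>b\<in>Basis. (u - l) \<bullet> b)"
      by (simp add: measure_lborel_box_eq)
    also have "\<dots> = (\<Prod>b\<in>(Basis::'a set). (1/2) ^ k)"
      by (intro prod.cong) (auto simp: inner_diff_left li ui algebra_simps)
    finally show ?thesis by (simp add: power_mult[symmetric])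
  qed
  ultimately show "measure lborel (cellset k (cell k x)) \<ge> (1/2) ^ (k * DIM('a))" by simp
qed

definition cell_avg :: "nat \<Rightarrow> ('a::euclidean_space \<Rightarrow> real) \<Rightarrow> 'a \<Rightarrow> real" where
  "cell_avg k \<phi> x = (LINT y|lborel. indicator (cellset k (cell k x)) y * \<phi> y) / measure lborel (cellset k (cell k x))"

text \<open>As \<open>cell k\<close> has a countable range with Borel fibres, every function of
  \<open>cell k x\<close> is measurable in \<open>x\<close>; this is how \<open>cell_avg\<close>
  becomes measurable.\<close>

lemma cell_measurable_countable: "cell k \<in> borel \<rightarrow>\<^sub>M count_space (range (cell k))"
proof (rule measurable_count_space_eq_countable[THEN iffD2, OF countable_range_cell], safe)
  fix a :: 'a
  have "cell k -` {cell k a} \<inter> space borel = cellset k (cell k a)"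
    by (auto simp: cellset_def)
  then show "cell k -` {cell k a} \<inter> space borel \<in> sets borel" by simp
qed auto

lemma cell_avg_measurable[measurable]: "cell_avg k \<phi> \<in> borel_measurable borel"
proof -
  have "(\<lambda>c. (LINT y|lborel. indicator (cellset k c) y * \<phi> y) / measure lborel (cellset k c)) \<circ> cell k
      \<in> borel_measurable borel"
    by (rule measurable_comp[OF cell_measurable_countable]) simp
  then show ?thesis by (simp add: cell_avg_def[abs_def] o_def)
qed

text \<open>By Cauchy--Schwarz the squared deviation from the cube average is at most the average of
  \<open>(\<phi> x - \<phi> y)\<^sup>2\<close> over the cube. Writing \<open>y = z + x\<close>, the
  shift \<open>z\<close> ranges in the fixed cube \<open>C\<close> of side \<open>2 * h\<close>, so
  that Fubini reduces the estimate to \<open>translation_estimate\<close>. The inverse cube volume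
  \<open>2 ^ (k * n)\<close>, the volume \<open>(2 * h) ^ n\<close> of \<open>C\<close> and the
  bound \<open>n * h\<^sup>2\<close> of the squared shifts multiply to the stated constant.\<close>

lemma cell_avg_estimate:
  fixes \<phi> :: "'a::euclidean_space \<Rightarrow> real"
  assumes \<phi>: "\<phi> \<in> test_functions \<Omega>"
  shows "(\<integral>\<^sup>+x. ennreal ((\<phi> x - cell_avg k \<phi> x)\<^sup>2) \<partial>lborel)
     \<le> ennreal (2 ^ DIM('a) * real DIM('a) * ((1/2) ^ k)\<^sup>2 * (l2n lborel (cgrad \<phi>))\<^sup>2)"
proof -
  note [measurable] = test_measurable[OF \<phi>]
  define n where "n = DIM('a)"
  define h :: real where "h = (1/2) ^ k"
  define G where "G = l2n lborel (cgrad \<phi>)"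
  have h: "h > 0" by (simp add: h_def)
  define c :: 'a where "c = (\<Sum>i\<in>Basis. h *\<^sub>R i)"
  have c: "c \<bullet> i = h" if "i \<in> Basis" for i using that by (simp add: c_def)
  define C :: "'a set" where "C = cbox (- c) c"
  have \<phi>i: "integrable lborel \<phi>"
    by (rule integrable_compact_support[OF test_continuous[OF \<phi>] test_supp(1)[OF \<phi>]]) (rule not_in_supp)
  obtain B where B: "B > 0" "\<And>x. norm (\<phi> x) \<le> B"
    using bounded_compact_support[OF test_continuous[OF \<phi>] test_supp(1)[OF \<phi>]] not_in_supp by blast
  have pw: "ennreal ((\<phi> x - cell_avg k \<phi> x)\<^sup>2) \<le> ennreal (2 ^ (k * n)) * (\<integral>\<^sup>+z. indicator C z * ennreal ((\<phi> (z + x) - \<phi> x)\<^sup>2) \<partial>lborel)" for x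
  proof -
    define S where "S = cellset k (cell k x)"
    define V where "V = measure lborel S"
    have Sm[measurable]: "S \<in> sets borel" by (simp add: S_def)
    have V: "V \<ge> (1/2) ^ (k * n)" and Sfin: "emeasure lborel S < \<infinity>"
      using cellset_measure[of k x] by (auto simp: V_def S_def n_def)
    have V0: "V > 0" by (rule less_le_trans[OF _ V]) simp
    have iS: "integrable lborel (indicator S :: 'a \<Rightarrow> real)"
      using Sfin by (intro integrable_real_indicator) auto
    have i1: "integrable lborel (\<lambda>y. indicator S y * \<phi> y)"
      using integrable_mult_indicator[OF _ \<phi>i, of S] by simp
    have i2: "integrable lborel (\<lambda>y. indicator S y * \<phi> x)" using iS by simp
    have s1: "sqint lborel (\<lambda>y. indicator S y * (\<phi> x - \<phi> y))"
      unfolding sqint_def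
    proof
      show "integrable lborel (\<lambda>y. (norm (indicator S y * (\<phi> x - \<phi> y)))\<^sup>2)"
      proof (rule Bochner_Integration.integrable_bound[OF integrable_mult_right[OF iS, of "(2 * B)\<^sup>2"]])
        show "AE y in lborel. norm ((norm (indicator S y * (\<phi> x - \<phi> y)))\<^sup>2) \<le> norm ((2 * B)\<^sup>2 * indicator S y)"
        proof (rule AE_I2)
          fix y
          have "\<bar>\<phi> x - \<phi> y\<bar> \<le> 2 * B" using B(2)[of x] B(2)[of y] by auto
          then have "(\<phi> x - \<phi> y)\<^sup>2 \<le> (2 * B)\<^sup>2" using B(1) by (intro abs_le_square_iff[THEN iffD1]) auto
          then show "norm ((norm (indicator S y * (\<phi> x - \<phi> y)))\<^sup>2) \<le> norm ((2 * B)\<^sup>2 * indicator S y)"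
            by (auto simp: indicator_def)
        qed
      qed measurable
    qed measurable
    have s2: "sqint lborel (indicator S :: 'a \<Rightarrow> real)"
    proof -
      have "(\<lambda>t. (norm (indicator S t :: real))\<^sup>2) = indicator S" by (auto simp: indicator_def)
      then show ?thesis using iS by (simp add: sqint_def)
    qed
    have n2: "(l2n lborel (indicator S :: 'a \<Rightarrow> real))\<^sup>2 = V"
    proof -
      have "(\<lambda>t. (norm (indicator S t :: real))\<^sup>2) = indicator S" by (auto simp: indicator_def)
      then show ?thesis by (simp add: l2n_sq V_def)
    qed
    have "\<phi> x - cell_avg k \<phi> x = ((LINT y|lborel. indicator S y * \<phi> x) - (LINT y|lborel. indicator S y * \<phi> y)) / V"
      using V0 Sm by (simp add: cell_avg_def S_def[symmetric] V_def[symmetric] diff_divide_distrib)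
    also have "(LINT y|lborel. indicator S y * \<phi> x) - (LINT y|lborel. indicator S y * \<phi> y)
        = l2i lborel (\<lambda>y. indicator S y * (\<phi> x - \<phi> y)) (indicator S)"
      unfolding l2i_def
      by (subst Bochner_Integration.integral_diff[symmetric, OF i2 i1], rule Bochner_Integration.integral_cong)
         (auto simp: indicator_def)
    finally have "(\<phi> x - cell_avg k \<phi> x)\<^sup>2 = (l2i lborel (\<lambda>y. indicator S y * (\<phi> x - \<phi> y)) (indicator S))\<^sup>2 / V\<^sup>2"
      by (simp add: power_divide)
    also have "\<dots> \<le> ((l2n lborel (\<lambda>y. indicator S y * (\<phi> x - \<phi> y)))\<^sup>2 * V) / V\<^sup>2"
      using sqint_inner(2)[OF s1 s2] V0 unfolding n2[symmetric] power_mult_distrib[symmetric]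
      by (intro divide_right_mono abs_le_square_iff[THEN iffD1]) auto
    also have "\<dots> = (l2n lborel (\<lambda>y. indicator S y * (\<phi> x - \<phi> y)))\<^sup>2 * (1 / V)"
      using V0 by (simp add: power2_eq_square)
    also have "\<dots> \<le> (l2n lborel (\<lambda>y. indicator S y * (\<phi> x - \<phi> y)))\<^sup>2 * 2 ^ (k * n)"
    proof (rule mult_left_mono)
      have "1 / V \<le> 1 / (1/2) ^ (k * n)" using V by (intro divide_left_mono) (auto simp: V0)
      then show "1 / V \<le> 2 ^ (k * n)" by (simp add: power_one_over)
    qed simp
    finally have "ennreal ((\<phi> x - cell_avg k \<phi> x)\<^sup>2)
        \<le> ennreal (2 ^ (k * n)) * ennreal ((l2n lborel (\<lambda>y. indicator S y * (\<phi> x - \<phi> y)))\<^sup>2)"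
      by (simp add: ennreal_mult[symmetric] mult.commute ennreal_leI)
    also have "ennreal ((l2n lborel (\<lambda>y. indicator S y * (\<phi> x - \<phi> y)))\<^sup>2)
        = (\<integral>\<^sup>+y. ennreal ((norm (indicator S y * (\<phi> x - \<phi> y)))\<^sup>2) \<partial>lborel)"
      unfolding l2n_sq by (rule nn_integral_eq_integral[symmetric]) (use s1 in \<open>auto simp: sqint_def\<close>)
    also have "\<dots> = (\<integral>\<^sup>+z. ennreal ((norm (indicator S (x + z) * (\<phi> x - \<phi> (x + z))))\<^sup>2) \<partial>lborel)"
      by (rule nn_integral_lborel_translation[symmetric]) measurable
    also have "\<dots> \<le> (\<integral>\<^sup>+z. indicator C z * ennreal ((\<phi> (z + x) - \<phi> x)\<^sup>2) \<partial>lborel)"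
    proof (rule nn_integral_mono)
      fix z
      have "z \<in> C" if "x + z \<in> S"
      proof -
        have "cell k x = cell k (x + z)" using that by (simp add: S_def cellset_def)
        from cell_diff[OF this] show ?thesis
          by (auto simp: C_def mem_box c h_def abs_le_iff minus_le_iff)
      qed
      then show "ennreal ((norm (indicator S (x + z) * (\<phi> x - \<phi> (x + z))))\<^sup>2) \<le> indicator C z * ennreal ((\<phi> (z + x) - \<phi> x)\<^sup>2)"
        by (auto simp: indicator_def add.commute power2_commute)
    qed
    finally show ?thesis by (simp add: mult_left_mono)
  qed
  have [measurable]: "C \<in> sets borel" by (simp add: C_def)
  have mC: "emeasure lborel C = ennreal ((2 * h) ^ n)"
  proof -
    have "(\<Prod>b\<in>Basis. (c - - c) \<bullet> b) = (\<Prod>b\<in>(Basis::'a set). 2 * h)"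
      by (rule prod.cong) (auto simp: c inner_diff_left inner_add_left)
    moreover have "emeasure lborel C = ennreal (\<Prod>b\<in>Basis. (c - - c) \<bullet> b)"
      unfolding C_def by (rule emeasure_lborel_cbox) (use h in \<open>auto simp: c\<close>)
    ultimately show ?thesis by (simp add: n_def)
  qed
  have nC: "(norm z)\<^sup>2 \<le> real n * h\<^sup>2" if "z \<in> C" for z
  proof -
    have "(norm z)\<^sup>2 = (\<Sum>i\<in>Basis. (z \<bullet> i)\<^sup>2)"
      by (subst euclidean_inner[of z z, folded power2_eq_square, unfolded power2_norm_eq_inner[symmetric]])
         simp
    also have "\<dots> \<le> (\<Sum>i\<in>(Basis::'a set). h\<^sup>2)"
    proof (rule sum_mono)
      fix i :: 'a assume i: "i \<in> Basis"
      then have "- h \<le> z \<bullet> i" "z \<bullet> i \<le> h" using that by (auto simp: C_def mem_box c)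
      then show "(z \<bullet> i)\<^sup>2 \<le> h\<^sup>2" using h by (intro abs_le_square_iff[THEN iffD1]) auto
    qed
    finally show ?thesis by (simp add: n_def)
  qed
  have "(\<integral>\<^sup>+x. ennreal ((\<phi> x - cell_avg k \<phi> x)\<^sup>2) \<partial>lborel)
     \<le> (\<integral>\<^sup>+x. ennreal (2 ^ (k * n)) * (\<integral>\<^sup>+z. indicator C z * ennreal ((\<phi> (z + x) - \<phi> x)\<^sup>2) \<partial>lborel) \<partial>lborel)"
    by (intro nn_integral_mono pw)
  also have "\<dots> = ennreal (2 ^ (k * n)) * (\<integral>\<^sup>+x. \<integral>\<^sup>+z. indicator C z * ennreal ((\<phi> (z + x) - \<phi> x)\<^sup>2) \<partial>lborel \<partial>lborel)"
    by (rule nn_integral_cmult) measurable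
  also have "(\<integral>\<^sup>+x. \<integral>\<^sup>+z. indicator C z * ennreal ((\<phi> (z + x) - \<phi> x)\<^sup>2) \<partial>lborel \<partial>lborel)
      = (\<integral>\<^sup>+z. \<integral>\<^sup>+x. indicator C z * ennreal ((\<phi> (z + x) - \<phi> x)\<^sup>2) \<partial>lborel \<partial>lborel)"
    by (rule lborel_pair.Fubini') measurable
  also have "\<dots> = (\<integral>\<^sup>+z. indicator C z * (\<integral>\<^sup>+x. ennreal ((\<phi> (z + x) - \<phi> x)\<^sup>2) \<partial>lborel) \<partial>lborel)"
    by (intro nn_integral_cong nn_integral_cmult) measurable
  also have "\<dots> \<le> (\<integral>\<^sup>+z. ennreal (real n * h\<^sup>2 * G\<^sup>2) * indicator C z \<partial>lborel)"
  proof (rule nn_integral_mono)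
    fix z
    have "(\<integral>\<^sup>+x. ennreal ((\<phi> (z + x) - \<phi> x)\<^sup>2) \<partial>lborel) \<le> ennreal (real n * h\<^sup>2 * G\<^sup>2)" if "z \<in> C"
      using order_trans[OF translation_estimate[OF \<phi>, of z] ennreal_leI[OF mult_right_mono[OF nC[OF that]]]]
      by (simp add: G_def)
    then show "indicator C z * (\<integral>\<^sup>+x. ennreal ((\<phi> (z + x) - \<phi> x)\<^sup>2) \<partial>lborel) \<le> ennreal (real n * h\<^sup>2 * G\<^sup>2) * indicator C z"
      by (auto simp: indicator_def)
  qed
  also have "\<dots> = ennreal (real n * h\<^sup>2 * G\<^sup>2) * ennreal ((2 * h) ^ n)"
    by (subst nn_integral_cmult_indicator) (auto simp: mC)
  finally have "(\<integral>\<^sup>+x. ennreal ((\<phi> x - cell_avg k \<phi> x)\<^sup>2) \<partial>lborel)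
     \<le> ennreal (2 ^ (k * n)) * (ennreal (real n * h\<^sup>2 * G\<^sup>2) * ennreal ((2 * h) ^ n))"
    by (simp add: mult_left_mono)
  also have "\<dots> = ennreal (2 ^ (k * n) * (real n * h\<^sup>2 * G\<^sup>2 * (2 * h) ^ n))"
    using h by (simp add: ennreal_mult[symmetric])
  also have "2 ^ (k * n) * (real n * h\<^sup>2 * G\<^sup>2 * (2 * h) ^ n) = 2 ^ n * real n * h\<^sup>2 * G\<^sup>2"
  proof -
    have "2 ^ (k * n) * h ^ n = (1::real)"
      by (simp add: h_def power_mult[symmetric] power_one_over)
    then show ?thesis by (simp add: power_mult_distrib mult_ac)
  qed
  finally show ?thesis by (simp add: n_def h_def G_def)
qed

section \<open>Lebesgue measure on a bounded open set, and compactness for test functions\<close>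

locale bounded_open =
  fixes \<Omega> :: "'a::euclidean_space set"
  assumes open_Om: "open \<Omega>" and bounded_Om: "bounded \<Omega>" and nonempty_Om: "\<Omega> \<noteq> {}"
begin

abbreviation "M \<equiv> lebesgue_on \<Omega>"
abbreviation "T \<equiv> test_functions \<Omega>"

lemma sets_Om: "\<Omega> \<in> sets borel" "\<Omega> \<in> sets lebesgue"
  using open_Om by auto

lemma finite_measure_Om: "finite_measure M"
  by (intro finite_measure_lebesgue_on bounded_set_imp_lmeasurable bounded_Om sets_Om)

lemma borel_measurable_Om: "f \<in> borel_measurable borel \<Longrightarrow> f \<in> borel_measurable M"
  by (intro measurable_restrict_space1 measurable_completion) simp

lemma integral_Om:
  fixes f :: "'a \<Rightarrow> 'c::{banach, second_countable_topology}"
  assumes [measurable]: "f \<in> borel_measurable borel" and z: "\<And>x. x \<notin> \<Omega> \<Longrightarrow> f x = 0"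
  shows "integrable M f \<longleftrightarrow> integrable lborel f" "integral\<^sup>L M f = integral\<^sup>L lborel f"
proof -
  have eq: "(\<lambda>x. indicator \<Omega> x *\<^sub>R f x) = f" using z by (auto simp: indicator_def)
  show "integrable M f \<longleftrightarrow> integrable lborel f"
    using sets_Om eq by (simp add: integrable_restrict_space integrable_completion)
  show "integral\<^sup>L M f = integral\<^sup>L lborel f"
    using sets_Om eq by (simp add: integral_restrict_space integral_completion)
qed

lemma nn_integral_Om_le:
  assumes [measurable]: "f \<in> borel_measurable borel"
  shows "(\<integral>\<^sup>+x. f x \<partial>M) \<le> (\<integral>\<^sup>+x. f x \<partial>lborel)"
proof -
  have "(\<integral>\<^sup>+x. f x \<partial>M) = (\<integral>\<^sup>+x. f x * indicator \<Omega> x \<partial>lborel)"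
    using sets_Om by (simp add: nn_integral_restrict_space nn_integral_completion)
  also have "\<dots> \<le> (\<integral>\<^sup>+x. f x \<partial>lborel)"
    by (intro nn_integral_mono) (auto simp: indicator_def)
  finally show ?thesis .
qed

lemma sqint_Om:
  fixes g :: "'a \<Rightarrow> 'c::euclidean_space"
  assumes "sqint lborel g" "\<And>x. x \<notin> \<Omega> \<Longrightarrow> g x = 0"
  shows "sqint M g" "l2n M g = l2n lborel g"
proof -
  have [measurable]: "g \<in> borel_measurable borel" using assms(1) by (simp add: sqint_def)
  have "(\<lambda>x. (norm (g x))\<^sup>2) \<in> borel_measurable borel" by measurable
  note i = integral_Om[OF this]
  show "sqint M g" using assms i by (auto simp: sqint_def intro!: borel_measurable_Om)
  show "l2n M g = l2n lborel g" using assms i by (simp add: l2n_def)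
qed

lemma test_M:
  assumes "\<phi> \<in> T"
  shows "sqint M \<phi>" "l2n M \<phi> = l2n lborel \<phi>"
    "sqint M (cgrad \<phi>)" "l2n M (cgrad \<phi>) = l2n lborel (cgrad \<phi>)"
proof -
  have z: "\<phi> x = 0" "cgrad \<phi> x = 0" if "x \<notin> \<Omega>" for x
    using that test_supp(2)[OF assms] test_zero_outside[OF assms] by (auto intro!: cgrad_zero)
  show "sqint M \<phi>" "l2n M \<phi> = l2n lborel \<phi>" 
    using sqint_Om[OF sqint_test[OF assms] z(1)] by auto
  show "sqint M (cgrad \<phi>)" "l2n M (cgrad \<phi>) = l2n lborel (cgrad \<phi>)"
    using sqint_Om[OF sqint_cgrad[OF assms] z(2)] by auto
qed

lemma sqint_bounded:
  fixes g :: "'a \<Rightarrow> 'c::euclidean_space"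
  assumes [measurable]: "g \<in> borel_measurable M" and B: "\<And>x. x \<in> \<Omega> \<Longrightarrow> norm (g x) \<le> B"
  shows "sqint M g"
proof -
  interpret finite_measure M by (rule finite_measure_Om)
  have "integrable M (\<lambda>x. (norm (g x))\<^sup>2)"
    by (rule integrable_const_bound[where B="B\<^sup>2"]) (use B in \<open>auto intro!: AE_I2 power_mono\<close>)
  then show ?thesis by (simp add: sqint_def)
qed

lemma sqint_const: "sqint M (\<lambda>x. c)"
  by (rule sqint_bounded) auto

text \<open>At each scale the averages over dyadic cubes differ from the functions by at most a
  constant times \<open>(1/2) ^ k\<close>, uniformly in \<open>n\<close>, because the gradients are
  bounded. On a subsequence all averages converge pointwise; at a fixed scale they are uniformly
  bounded, hence they also converge in quadratic norm on \<open>\<Omega>\<close>. The two facts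
  together give the Cauchy property.\<close>

theorem Rellich_test:
  assumes T: "\<And>n. \<phi> n \<in> T" and B1: "\<And>n. l2n M (\<phi> n) \<le> B" and B2: "\<And>n. l2n M (cgrad (\<phi> n)) \<le> B"
  obtains r :: "nat \<Rightarrow> nat" where "strict_mono r"
    "\<And>e. e > 0 \<Longrightarrow> \<exists>N. \<forall>m\<ge>N. \<forall>n\<ge>N. l2n M (\<lambda>x. \<phi> (r m) x - \<phi> (r n) x) < e"
proof -
  interpret finite_measure M by (rule finite_measure_Om)
  define N where "N = DIM('a)"
  have B0: "B \<ge> 0" using B1[of 0] l2n_nonneg[of M "\<phi> 0"] by linarith
  define Q where "Q = B * l2n M (\<lambda>x. 1::real)"
  have Q0: "Q \<ge> 0" using B0 by (simp add: Q_def)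
  note tm[measurable] = test_measurable[OF T]
  have \<phi>i: "integrable lborel (\<phi> n)" for n
    by (rule integrable_compact_support[OF test_continuous[OF T] test_supp(1)[OF T]]) (rule not_in_supp)
  have abs1: "(LINT x|lborel. \<bar>\<phi> n x\<bar>) \<le> Q" for n
  proof -
    have "(LINT x|lborel. \<bar>\<phi> n x\<bar>) = (LINT x|M. \<bar>\<phi> n x\<bar>)"
      by (rule integral_Om(2)[symmetric]) (use test_zero_outside[OF T] in auto)
    also have "\<dots> \<le> l2n M (\<phi> n) * l2n M (\<lambda>x. 1::real)"
      using sqint_mult_norm(2)[OF test_M(1)[OF T] sqint_const, of n "1::real"] by simp
    also have "\<dots> \<le> Q" unfolding Q_def by (intro mult_right_mono B1) simp
    finally show ?thesis .
  qed
  \<comment> \<open>The integrals over all cubes of all scales form one countable family of bounded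
    sequences, so a single diagonal extraction makes every one of them converge.\<close>
  define f where "f n p = (LINT y|lborel. indicator (cellset (fst p) (snd p)) y * \<phi> n y)" for n and p :: "nat \<times> 'a"
  have fb: "norm (f n p) \<le> Q" for n p
  proof -
    have i: "integrable lborel (\<lambda>y. indicator (cellset (fst p) (snd p)) y * \<phi> n y)"
      using integrable_mult_indicator[OF _ \<phi>i, of "cellset (fst p) (snd p)" n] by simp
    have "norm (f n p) \<le> (LINT y|lborel. \<bar>indicator (cellset (fst p) (snd p)) y * \<phi> n y\<bar>)"
      unfolding f_def real_norm_def by (rule integral_abs_bound)
    also have "\<dots> \<le> (LINT y|lborel. \<bar>\<phi> n y\<bar>)"
      by (rule integral_mono) (use i \<phi>i in \<open>auto simp: indicator_def\<close>)
    finally show ?thesis using abs1[of n] by simp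
  qed
  have cnt: "countable (SIGMA k:(UNIV::nat set). range (cell k :: 'a \<Rightarrow> 'a))"
    by (intro countable_SIGMA countable_range_cell) auto
  obtain r where r: "strict_mono (r::nat \<Rightarrow> nat)"
    and rc: "\<And>p. p \<in> (SIGMA k:(UNIV::nat set). range (cell k :: 'a \<Rightarrow> 'a)) \<Longrightarrow> \<exists>l. (\<lambda>n. f (r n) p) \<longlonglongrightarrow> l"
    by (rule function_convergent_subsequence[where f=f and M=Q, OF cnt fb]) (rule that)
  define a where "a k x = lim (\<lambda>n. cell_avg k (\<phi> (r n)) x)" for k x
  have conv: "(\<lambda>n. cell_avg k (\<phi> (r n)) x) \<longlonglongrightarrow> a k x" for k x
  proof -
    obtain l where "(\<lambda>n. f (r n) (k, cell k x)) \<longlonglongrightarrow> l" using rc[of "(k, cell k x)"] by auto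
    moreover have "measure lborel (cellset k (cell k x)) \<noteq> 0"
    proof -
      have "(0::real) < (1/2) ^ (k * DIM('a))" by simp
      also note cellset_measure(2)[of k x]
      finally show ?thesis by simp
    qed
    ultimately have "(\<lambda>n. f (r n) (k, cell k x) / measure lborel (cellset k (cell k x))) \<longlonglongrightarrow> l / measure lborel (cellset k (cell k x))"
      by (intro tendsto_divide tendsto_const)
    then have "convergent (\<lambda>n. cell_avg k (\<phi> (r n)) x)"
      by (auto simp: f_def cell_avg_def convergent_def)
    then show ?thesis by (simp add: a_def convergent_LIMSEQ_iff)
  qed
  have avb: "\<bar>cell_avg k (\<phi> n) x\<bar> \<le> Q * 2 ^ (k * N)" for k n x
  proof -
    define V where "V = measure lborel (cellset k (cell k x))"
    have V: "V \<ge> (1/2) ^ (k * N)" using cellset_measure(2)[where k=k and x=x] by (simp add: V_def N_def)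
    have V0: "V > 0" by (rule less_le_trans[OF _ V]) simp
    have "1 / V \<le> 1 / (1/2) ^ (k * N)" using V by (intro divide_left_mono) (auto simp: V0)
    then have V1: "1 / V \<le> 2 ^ (k * N)" by (simp add: power_one_over)
    have "\<bar>cell_avg k (\<phi> n) x\<bar> = \<bar>f n (k, cell k x)\<bar> * (1 / V)"
      using V0 by (simp add: cell_avg_def f_def V_def)
    also have "\<dots> \<le> Q * 2 ^ (k * N)"
      using fb[of n "(k, cell k x)"] V1 V0 Q0 by (intro mult_mono) auto
    finally show ?thesis .
  qed
  have am: "a k \<in> borel_measurable M" for k
    by (rule borel_measurable_LIMSEQ_real[OF conv]) (intro borel_measurable_Om cell_avg_measurable)
  have ab: "\<bar>a k x\<bar> \<le> Q * 2 ^ (k * N)" for k x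
    by (rule LIMSEQ_le_const2[OF tendsto_rabs[OF conv]]) (use avb in auto)
  have sa: "sqint M (a k)" for k by (rule sqint_bounded[OF am]) (use ab in auto)
  have sc: "sqint M (cell_avg k (\<phi> n))" for k n
    by (rule sqint_bounded[OF borel_measurable_Om[OF cell_avg_measurable]]) (use avb in auto)
  have l2conv: "(\<lambda>n. l2n M (\<lambda>x. cell_avg k (\<phi> (r n)) x - a k x)) \<longlonglongrightarrow> 0" for k
  proof -
    note [measurable] = am borel_measurable_Om[OF cell_avg_measurable]
    have "(\<lambda>n. LINT x|M. (norm (cell_avg k (\<phi> (r n)) x - a k x))\<^sup>2) \<longlonglongrightarrow> (LINT x|M. 0)"
    proof (rule integral_dominated_convergence[where w="\<lambda>x. (2 * (Q * 2 ^ (k * N)))\<^sup>2"])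
      show "AE x in M. (\<lambda>n. (norm (cell_avg k (\<phi> (r n)) x - a k x))\<^sup>2) \<longlonglongrightarrow> 0"
      proof (rule AE_I2)
        fix x
        have "(\<lambda>n. (norm (cell_avg k (\<phi> (r n)) x - a k x))\<^sup>2) \<longlonglongrightarrow> (norm (a k x - a k x))\<^sup>2"
          by (intro tendsto_intros conv)
        then show "(\<lambda>n. (norm (cell_avg k (\<phi> (r n)) x - a k x))\<^sup>2) \<longlonglongrightarrow> 0" by simp
      qed
      show "AE x in M. norm ((norm (cell_avg k (\<phi> (r n)) x - a k x))\<^sup>2) \<le> (2 * (Q * 2 ^ (k * N)))\<^sup>2" for n
      proof (rule AE_I2)
        fix x
        have "\<bar>cell_avg k (\<phi> (r n)) x - a k x\<bar> \<le> 2 * (Q * 2 ^ (k * N))"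
          using avb[of k "r n" x] ab[of k x] by linarith
        then have "\<bar>cell_avg k (\<phi> (r n)) x - a k x\<bar>\<^sup>2 \<le> (2 * (Q * 2 ^ (k * N)))\<^sup>2"
          by (rule power_mono) simp
        then show "norm ((norm (cell_avg k (\<phi> (r n)) x - a k x))\<^sup>2) \<le> (2 * (Q * 2 ^ (k * N)))\<^sup>2"
          by simp
      qed
    qed auto
    from tendsto_real_sqrt[OF this] show ?thesis by (simp add: l2n_def)
  qed
  define c where "c = sqrt (2 ^ N * real N) * B"
  have c0: "c \<ge> 0" using B0 by (simp add: c_def)
  have est: "l2n M (\<lambda>x. \<phi> n x - cell_avg k (\<phi> n) x) \<le> c * (1/2) ^ k" for n k
  proof -
    have sd: "sqint M (\<lambda>x. \<phi> n x - cell_avg k (\<phi> n) x)" by (intro sqint_diff test_M T sc)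
    have "ennreal ((l2n M (\<lambda>x. \<phi> n x - cell_avg k (\<phi> n) x))\<^sup>2) = (\<integral>\<^sup>+x. ennreal ((\<phi> n x - cell_avg k (\<phi> n) x)\<^sup>2) \<partial>M)"
      unfolding l2n_sq by (subst nn_integral_eq_integral[symmetric]) (use sd in \<open>auto simp: sqint_def\<close>)
    also have "\<dots> \<le> (\<integral>\<^sup>+x. ennreal ((\<phi> n x - cell_avg k (\<phi> n) x)\<^sup>2) \<partial>lborel)"
      by (rule nn_integral_Om_le) measurable
    also have "\<dots> \<le> ennreal (2 ^ N * real N * ((1/2) ^ k)\<^sup>2 * (l2n lborel (cgrad (\<phi> n)))\<^sup>2)"
      unfolding N_def by (rule cell_avg_estimate[OF T])
    also have "\<dots> \<le> ennreal (2 ^ N * real N * ((1/2) ^ k)\<^sup>2 * B\<^sup>2)"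
      using B2[of n] test_M(4)[OF T, of n] by (intro ennreal_leI mult_left_mono power_mono) auto
    also have "2 ^ N * real N * ((1/2) ^ k)\<^sup>2 * B\<^sup>2 = (c * (1/2) ^ k)\<^sup>2"
      by (simp add: c_def power_mult_distrib)
    finally have "(l2n M (\<lambda>x. \<phi> n x - cell_avg k (\<phi> n) x))\<^sup>2 \<le> (c * (1/2) ^ k)\<^sup>2"
      by (subst (asm) ennreal_le_iff) auto
    then show ?thesis by (rule power2_le_imp_le) (use c0 in auto)
  qed
  have "\<exists>N. \<forall>m\<ge>N. \<forall>n\<ge>N. l2n M (\<lambda>x. \<phi> (r m) x - \<phi> (r n) x) < e" if e: "e > 0" for e
  proof -
    \<comment> \<open>Dividing by \<open>c + 1\<close> instead of \<open>c\<close> covers the case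
      \<open>c = 0\<close>.\<close>
    obtain k where k: "(1/2) ^ k < e / (4 * (c + 1))"
      using real_arch_pow_inv[of "e / (4 * (c + 1))" "1/2"] e c0 by auto
    have "c * (1/2) ^ k \<le> (c + 1) * (1/2) ^ k" by (intro mult_right_mono) auto
    also have "\<dots> < (c + 1) * (e / (4 * (c + 1)))" using k c0 by (intro mult_strict_left_mono) auto
    also have "(c + 1) * (e / (4 * (c + 1))) = e / 4" using c0 by (simp add: divide_simps)
    finally have ck: "c * (1/2) ^ k < e / 4" .
    obtain K where K: "\<And>n. n \<ge> K \<Longrightarrow> l2n M (\<lambda>x. cell_avg k (\<phi> (r n)) x - a k x) < e / 4"
      using LIMSEQ_D[OF l2conv[of k], of "e / 4"] e by auto
    have one: "l2n M (\<lambda>x. \<phi> (r n) x - a k x) < e / 2" if "n \<ge> K" for n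
      using l2n_triangle3[OF test_M(1)[OF T[of "r n"]] sc[of k "r n"] sa[of k]] est[of "r n" k] ck K[OF that] by linarith
    show ?thesis
    proof (intro exI allI impI)
      fix m n assume mn: "m \<ge> K" "n \<ge> K"
      show "l2n M (\<lambda>x. \<phi> (r m) x - \<phi> (r n) x) < e"
        using l2n_triangle3[OF test_M(1)[OF T[of "r m"]] sa[of k] test_M(1)[OF T[of "r n"]]]
          one[OF mn(1)] one[OF mn(2)] l2n_minus_commute[of M "a k" "\<phi> (r n)"] by linarith
    qed
  qed
  then show thesis using that r by blast
qed

text \<open>The fundamental lemma of the calculus of variations. Bumps approximate indicators of
  boxes, so \<open>g\<close> has integral \<open>0\<close> over every box whose closure lies in
  \<open>\<Omega>\<close>; this extends to all measurable parts of such a box, hence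
  \<open>g\<close> vanishes almost everywhere on each of them, and countably many cover
  \<open>\<Omega>\<close>.\<close>

lemma test_integral_zero_imp:
  assumes g: "integrable M g" and z: "\<And>\<phi>. \<phi> \<in> T \<Longrightarrow> (LINT x|M. g x * \<phi> x) = 0"
  shows "AE x in M. g x = 0"
proof -
  have [measurable]: "g \<in> borel_measurable M" using g by auto
  have im: "indicator A \<in> borel_measurable M" if "A \<in> sets borel" for A :: "'a set"
    using that by (intro borel_measurable_Om) auto
  have gi: "integrable M (\<lambda>x. g x * indicator A x)" if "A \<in> sets borel" for A
  proof (rule Bochner_Integration.integrable_bound[OF g])
    show "(\<lambda>x. g x * indicator A x) \<in> borel_measurable M"
      using im[OF that] by (intro borel_measurable_times) auto
  qed (auto simp: indicator_def)
  have box0: "(LINT x|M. g x * indicator (box l u) x) = 0" if lu: "cbox l u \<subseteq> \<Omega>" for l u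
  proof -
    have "(\<lambda>n. LINT x|M. g x * box_bump (1 / real (Suc n)) l u x) \<longlonglongrightarrow> (LINT x|M. g x * indicator (box l u) x)"
    proof (rule integral_dominated_convergence[where w="\<lambda>x. \<bar>g x\<bar>"])
      show "(\<lambda>x. g x * indicator (box l u) x) \<in> borel_measurable M"
        using gi[of "box l u"] by auto
      show "(\<lambda>x. g x * box_bump (1 / real (Suc n)) l u x) \<in> borel_measurable M" for n
        using borel_measurable_Om[OF test_measurable[OF box_bump_test[OF _ lu, of "1 / real (Suc n)"]]]
        by (intro borel_measurable_times) auto
      show "AE x in M. (\<lambda>n. g x * box_bump (1 / real (Suc n)) l u x) \<longlonglongrightarrow> g x * indicator (box l u) x"
        by (intro AE_I2 tendsto_mult_left box_bump_tendsto)
      show "AE x in M. norm (g x * box_bump (1 / real (Suc n)) l u x) \<le> \<bar>g x\<bar>" for n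
        using box_bump_nonneg[of "1 / real (Suc n)" l u] box_bump_le_1[of "1 / real (Suc n)" l u]
        by (intro AE_I2) (simp add: abs_mult mult_left_le)
    qed (use g in auto)
    moreover have "(LINT x|M. g x * box_bump (1 / real (Suc n)) l u x) = 0" for n
      by (intro z box_bump_test lu) auto
    ultimately show ?thesis by (simp add: LIMSEQ_const_iff)
  qed
  \<comment> \<open>A Dynkin-system argument with the boxes as intersection-stable generator.
    Intersecting with the fixed box keeps all integrals inside the region that test functions reach,
    and turns the complement step into a difference of two known integrals.\<close>
  have bor0: "(LINT x|M. g x * indicator (A \<inter> box l u) x) = 0" if lu: "cbox l u \<subseteq> \<Omega>" and A: "A \<in> sets borel" for A l u
  proof -
    have "Int_stable (range (\<lambda>(a, b). box a b :: 'a set))"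
      by (auto simp: Int_stable_def box_Int_box)
    moreover have "range (\<lambda>(a, b). box a b :: 'a set) \<subseteq> Pow UNIV" by auto
    moreover have "A \<in> sigma_sets UNIV (range (\<lambda>(a, b). box a b :: 'a set))"
      using A unfolding borel_eq_box by simp
    ultimately show ?thesis
    proof (induction rule: sigma_sets_induct_disjoint)
      case (basic A)
      then obtain a b where "A = box a b" by auto
      then have "\<exists>a' b'. A \<inter> box l u = box a' b'" unfolding \<open>A = box a b\<close> box_Int_box by blast
      then obtain a' b' where ab: "A \<inter> box l u = box a' b'" by blast
      then have sub: "box a' b' \<subseteq> box l u" by blast
      show ?case
      proof (cases "box a' b' = {}")
        case False
        then have "cbox a' b' \<subseteq> cbox l u"
          using sub by (metis closure_box closure_mono box_eq_empty(1) bot.extremum_uniqueI)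
        then show ?thesis using ab box0[of a' b'] lu by auto
      qed (simp add: ab)
    next
      case empty then show ?case by simp
    next
      case (compl A)
      have A: "A \<in> sets borel" using compl by (simp add: borel_eq_box)
      have "(LINT x|M. g x * indicator ((UNIV - A) \<inter> box l u) x)
          = (LINT x|M. g x * indicator (box l u) x - g x * indicator (A \<inter> box l u) x)"
        by (intro Bochner_Integration.integral_cong) (auto simp: indicator_def)
      also have "\<dots> = 0"
        using compl.IH box0[OF lu] gi[of "box l u"] gi[of "A \<inter> box l u"] A by simp
      finally show ?case .
    next
      case (union F)
      have F: "F i \<in> sets borel" for i using union by (auto simp: borel_eq_box)
      have "(\<lambda>n. LINT x|M. (\<Sum>i<n. g x * indicator (F i \<inter> box l u) x)) \<longlonglongrightarrow> (LINT x|M. g x * indicator ((\<Union>i. F i) \<inter> box l u) x)"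
      proof (rule integral_dominated_convergence[where w="\<lambda>x. \<bar>g x\<bar>"])
        have disj: "F i \<inter> F j = {}" if "i \<noteq> j" for i j
          using union(1) that by (auto simp: disjoint_family_on_def)
        have eq: "(\<Sum>i<n. g x * indicator (F i \<inter> box l u) x) = g x * indicator ((\<Union>i<n. F i) \<inter> box l u) x" for n x
        proof -
          have "(\<Sum>i<n. indicator (F i) x) = (indicator (\<Union>i<n. F i) x :: real)"
            by (rule indicator_UN_disjoint[symmetric]) (use disj in \<open>auto simp: disjoint_family_on_def\<close>)
          then show ?thesis
            by (simp add: indicator_inter_arith sum_distrib_left[symmetric] sum_distrib_right[symmetric])
        qed
        show "AE x in M. (\<lambda>n. \<Sum>i<n. g x * indicator (F i \<inter> box l u) x) \<longlonglongrightarrow> g x * indicator ((\<Union>i. F i) \<inter> box l u) x"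
        proof (intro AE_I2)
          fix x
          have "\<forall>\<^sub>F n in sequentially. g x * indicator ((\<Union>i<n. F i) \<inter> box l u) x = g x * indicator ((\<Union>i. F i) \<inter> box l u) x"
          proof (cases "\<exists>i. x \<in> F i")
            case True
            then obtain i where "x \<in> F i" by auto
            then show ?thesis
              by (intro eventually_sequentiallyI[of "Suc i"]) (auto simp: indicator_def)
          qed (auto simp: indicator_def)
          then show "(\<lambda>n. \<Sum>i<n. g x * indicator (F i \<inter> box l u) x) \<longlonglongrightarrow> g x * indicator ((\<Union>i. F i) \<inter> box l u) x"
            unfolding eq by (rule tendsto_eventually)
        qed
        show "AE x in M. norm (\<Sum>i<n. g x * indicator (F i \<inter> box l u) x) \<le> \<bar>g x\<bar>" for n
          unfolding eq by (auto simp: indicator_def)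
        show "(\<lambda>x. \<Sum>i<n. g x * indicator (F i \<inter> box l u) x) \<in> borel_measurable M" for n
          using gi[of "F _ \<inter> box l u"] F by (intro borel_measurable_sum borel_measurable_integrable) auto
        show "(\<lambda>x. g x * indicator ((\<Union>i. F i) \<inter> box l u) x) \<in> borel_measurable M"
          by (rule borel_measurable_integrable, rule gi) (use F in auto)
      qed (use g in auto)
      moreover have "(LINT x|M. (\<Sum>i<n. g x * indicator (F i \<inter> box l u) x)) = 0" for n
        using union(3) gi[of "F _ \<inter> box l u"] F by (subst Bochner_Integration.integral_sum) auto
      ultimately show ?case by (simp add: LIMSEQ_const_iff)
    qed
  qed
  have boxAE: "AE x in M. x \<in> box l u \<longrightarrow> g x = 0" if lu: "cbox l u \<subseteq> \<Omega>" for l u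
  proof -
    \<comment> \<open>Comparing densities requires all sets of \<open>M\<close>. These are Borel up
      to a subset of a null set, which does not change the integrals.\<close>
    have "AE x in M. g x * indicator (box l u) x = 0"
    proof (rule density_unique_real)
      show "integrable M (\<lambda>x. g x * indicator (box l u) x)" by (rule gi) simp
      fix A assume "A \<in> sets M"
      then have "A \<in> sets lebesgue" using sets_Om by (auto simp: sets_restrict_space)
      then obtain S N N' where SN: "A = S \<union> N" "N \<subseteq> N'" "N' \<in> null_sets lborel" "S \<in> sets lborel"
        by (rule sets_completionE)
      have "AE x in lebesgue. x \<notin> N'"
        using SN(3) by (intro AE_completion AE_not_in) auto
      then have N': "AE x in M. x \<notin> N'"
        by (subst AE_restrict_space_iff) (use sets_Om in auto)
      have "(\<integral>x\<in>A. g x * indicator (box l u) x \<partial>M) = (LINT x|M. g x * indicator (S \<inter> box l u) x)"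
        unfolding set_lebesgue_integral_def
      proof (rule integral_cong_AE)
        show "(\<lambda>x. indicator A x *\<^sub>R (g x * indicator (box l u) x)) \<in> borel_measurable M"
          using \<open>A \<in> sets M\<close> gi[of "box l u"] by (intro borel_measurable_scaleR borel_measurable_indicator) auto
        show "(\<lambda>x. g x * indicator (S \<inter> box l u) x) \<in> borel_measurable M"
          by (rule borel_measurable_integrable, rule gi) (use SN in auto)
        show "AE x in M. indicator A x *\<^sub>R (g x * indicator (box l u) x) = g x * indicator (S \<inter> box l u) x"
          using N' by eventually_elim (use SN in \<open>auto simp: indicator_def\<close>)
      qed
      also have "\<dots> = 0" by (rule bor0[OF lu]) (use SN in auto)
      finally show "(\<integral>x\<in>A. g x * indicator (box l u) x \<partial>M) = (\<integral>x\<in>A. 0 \<partial>M)" by simp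
    qed auto
    then show ?thesis by eventually_elim auto
  qed
  \<comment> \<open>Only countably many exceptional null sets may be united, so the cover of
    \<open>\<Omega>\<close> by boxes is reduced to a countable one.\<close>
  define \<F> where "\<F> = {box l u |l u :: 'a. cbox l u \<subseteq> \<Omega>}"
  have "\<And>S. S \<in> \<F> \<Longrightarrow> open S" by (auto simp: \<F>_def)
  then obtain \<F>' where F': "\<F>' \<subseteq> \<F>" "countable \<F>'" "\<Union>\<F>' = \<Union>\<F>" by (rule Lindelof)
  have "AE x in M. \<forall>S\<in>\<F>'. x \<in> S \<longrightarrow> g x = 0"
    using F'(1) by (subst AE_ball_countable[OF F'(2)]) (auto simp: \<F>_def intro!: boxAE)
  moreover have "AE x in M. x \<in> \<Omega>" by (intro AE_I2) simp
  ultimately show ?thesis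
  proof eventually_elim
    case (elim x)
    obtain l u where "cbox l u \<subseteq> \<Omega>" "x \<in> box l u"
      using open_contains_cbox[OF open_Om elim(2)] by metis
    then have "x \<in> \<Union>\<F>'" unfolding F'(3) \<F>_def by blast
    then show ?case using elim(1) by auto
  qed
qed

end

section \<open>The Sobolev space\<close>

context bounded_open
begin

lemma L2_iff: "u \<in> L2 \<Omega> \<longleftrightarrow> sqint M u"
  by (simp add: L2_def sqint_def)

lemma sqint_integrable1:
  fixes u :: "'a \<Rightarrow> real"
  assumes "sqint M u"
  shows "integrable M u"
  using sqint_inner(1)[OF assms sqint_const[of "1::real"]] by simp

lemma integrable_mult_sqint:
  fixes u v :: "'a \<Rightarrow> real"
  assumes "sqint M u" "sqint M v"
  shows "integrable M (\<lambda>x. u x * v x)"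
  using sqint_inner(1)[OF assms] by simp

lemma weak_gradient_unique:
  assumes g: "sqint M g" "is_weak_gradient \<Omega> u g" and h: "sqint M h" "is_weak_gradient \<Omega> u h"
  shows "AE x in M. g x = h x"
proof -
  have "AE x in M. \<forall>i\<in>Basis. (g x - h x) \<bullet> i = 0"
  proof (subst AE_finite_all[OF finite_Basis], rule ballI)
    fix i :: 'a assume i: "i \<in> Basis"
    have s: "sqint M (\<lambda>x. g x \<bullet> i)" "sqint M (\<lambda>x. h x \<bullet> i)"
      by (intro sqint_inner_right g h)+
    show "AE x in M. (g x - h x) \<bullet> i = 0"
    proof (rule test_integral_zero_imp)
      show "integrable M (\<lambda>x. (g x - h x) \<bullet> i)"
        by (intro sqint_integrable1 sqint_inner_right sqint_diff g h)
      fix \<phi> assume \<phi>: "\<phi> \<in> T"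
      have "(LINT x|M. (g x - h x) \<bullet> i * \<phi> x) = (LINT x|M. (g x \<bullet> i) * \<phi> x) - (LINT x|M. (h x \<bullet> i) * \<phi> x)"
        using integrable_mult_sqint[OF s(1) test_M(1)[OF \<phi>]] integrable_mult_sqint[OF s(2) test_M(1)[OF \<phi>]]
        by (simp add: inner_diff_left left_diff_distrib)
      also have "\<dots> = 0"
        using g(2) h(2) \<phi> i unfolding is_weak_gradient_def by (metis diff_self minus_equation_iff)
      finally show "(LINT x|M. (g x - h x) \<bullet> i * \<phi> x) = 0" .
    qed
  qed
  then show ?thesis
    by eventually_elim (metis euclidean_all_zero_iff eq_iff_diff_eq_0)
qed

lemma weak_gradient_add:
  assumes u: "sqint M u" "sqint M g" "is_weak_gradient \<Omega> u g" and v: "sqint M v" "sqint M h" "is_weak_gradient \<Omega> v h"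
  shows "is_weak_gradient \<Omega> (\<lambda>x. u x + v x) (\<lambda>x. g x + h x)"
  unfolding is_weak_gradient_def
proof (intro ballI)
  fix \<phi> and i :: 'a assume \<phi>: "\<phi> \<in> T" and i: "i \<in> Basis"
  note 1 = test_M(1)[OF \<phi>] and 2 = test_M(1)[OF test_partial[OF \<phi> i]]
  show "(LINT x|M. (u x + v x) * partial_deriv i \<phi> x) = - (LINT x|M. ((g x + h x) \<bullet> i) * \<phi> x)"
    using u(3) v(3) \<phi> i
      integrable_mult_sqint[OF u(1) 2] integrable_mult_sqint[OF v(1) 2]
      integrable_mult_sqint[OF sqint_inner_right[OF u(2)] 1] integrable_mult_sqint[OF sqint_inner_right[OF v(2)] 1]
    by (simp add: is_weak_gradient_def inner_add_left distrib_right)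
qed

lemma weak_gradient_cmult:
  assumes u: "is_weak_gradient \<Omega> u g"
  shows "is_weak_gradient \<Omega> (\<lambda>x. c * u x) (\<lambda>x. c *\<^sub>R g x)"
  using u unfolding is_weak_gradient_def by (simp add: mult.assoc)

lemma weak_gradient_test:
  assumes \<phi>: "\<phi> \<in> T"
  shows "is_weak_gradient \<Omega> \<phi> (cgrad \<phi>)"
  unfolding is_weak_gradient_def
proof (intro ballI)
  fix \<psi> and i :: 'a assume \<psi>: "\<psi> \<in> T" and i: "i \<in> Basis"
  note [measurable] = test_measurable[OF \<phi>] test_measurable[OF \<psi>] test_measurable[OF test_partial[OF \<phi> i]]
    test_measurable[OF test_partial[OF \<psi> i]]
  have "(LINT x|M. \<phi> x * partial_deriv i \<psi> x) = (LINT x|lborel. \<phi> x * partial_deriv i \<psi> x)"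
    by (rule integral_Om) (use test_zero_outside[OF \<phi>] in auto)
  also have "\<dots> = - (LINT x|lborel. partial_deriv i \<phi> x * \<psi> x)"
    by (rule integration_by_parts_test[OF \<phi> \<psi> i])
  also have "(LINT x|lborel. partial_deriv i \<phi> x * \<psi> x) = (LINT x|M. partial_deriv i \<phi> x * \<psi> x)"
    by (rule integral_Om[symmetric]) (use test_zero_outside[OF \<psi>] in auto)
  finally show "(LINT x|M. \<phi> x * partial_deriv i \<psi> x) = - (LINT x|M. (cgrad \<phi> x \<bullet> i) * \<psi> x)"
    by (simp add: cgrad_inner_Basis[OF i])
qed

text \<open>\<open>weak_grad\<close> is a choice, so it can be identified only up to null sets:
  exhibiting any square-integrable weak gradient determines it almost everywhere by uniqueness. All
  rules for sums, multiples and limits go through this.\<close>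

lemma H1I:
  assumes "sqint M u" "sqint M g" "is_weak_gradient \<Omega> u g"
  shows "u \<in> H1 \<Omega>" "AE x in M. weak_grad \<Omega> u x = g x"
proof -
  show "u \<in> H1 \<Omega>" using assms by (auto simp: H1_def L2_iff)
  have "weak_grad \<Omega> u \<in> L2 \<Omega> \<and> is_weak_gradient \<Omega> u (weak_grad \<Omega> u)"
    unfolding weak_grad_def by (rule someI[of _ g]) (use assms in \<open>auto simp: L2_iff\<close>)
  then show "AE x in M. weak_grad \<Omega> u x = g x"
    using assms by (intro weak_gradient_unique[of _ u]) (auto simp: L2_iff)
qed

lemma H1D:
  assumes "u \<in> H1 \<Omega>"
  shows "sqint M u" "sqint M (weak_grad \<Omega> u)" "is_weak_gradient \<Omega> u (weak_grad \<Omega> u)"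
proof -
  obtain g where g: "g \<in> L2 \<Omega> \<and> is_weak_gradient \<Omega> u g" and u: "u \<in> L2 \<Omega>"
    using assms by (auto simp: H1_def)
  have "weak_grad \<Omega> u \<in> L2 \<Omega> \<and> is_weak_gradient \<Omega> u (weak_grad \<Omega> u)"
    unfolding weak_grad_def by (rule someI[of _ g]) (rule g)
  then show "sqint M u" "sqint M (weak_grad \<Omega> u)" "is_weak_gradient \<Omega> u (weak_grad \<Omega> u)"
    using u by (auto simp: L2_iff)
qed

lemma H1_test: "\<phi> \<in> T \<Longrightarrow> \<phi> \<in> H1 \<Omega>" "\<phi> \<in> T \<Longrightarrow> AE x in M. weak_grad \<Omega> \<phi> x = cgrad \<phi> x"
  by (rule H1I[OF test_M(1) test_M(3) weak_gradient_test]; assumption)+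

lemma H1_add:
  assumes "u \<in> H1 \<Omega>" "v \<in> H1 \<Omega>"
  shows "(\<lambda>x. u x + v x) \<in> H1 \<Omega>" "AE x in M. weak_grad \<Omega> (\<lambda>x. u x + v x) x = weak_grad \<Omega> u x + weak_grad \<Omega> v x"
  using H1I[OF sqint_add[OF H1D(1)[OF assms(1)] H1D(1)[OF assms(2)]]
      sqint_add[OF H1D(2)[OF assms(1)] H1D(2)[OF assms(2)]]
      weak_gradient_add[OF H1D[OF assms(1)] H1D[OF assms(2)]]] by auto

lemma H1_cmult:
  assumes "u \<in> H1 \<Omega>"
  shows "(\<lambda>x. c * u x) \<in> H1 \<Omega>" "AE x in M. weak_grad \<Omega> (\<lambda>x. c * u x) x = c *\<^sub>R weak_grad \<Omega> u x"
  using H1I[OF sqint_cmult[OF H1D(1)[OF assms]] sqint_scaleR[OF H1D(2)[OF assms]] weak_gradient_cmult[OF H1D(3)[OF assms]]]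
  by auto

lemma H1_diff:
  assumes "u \<in> H1 \<Omega>" "v \<in> H1 \<Omega>"
  shows "(\<lambda>x. u x - v x) \<in> H1 \<Omega>" "AE x in M. weak_grad \<Omega> (\<lambda>x. u x - v x) x = weak_grad \<Omega> u x - weak_grad \<Omega> v x"
proof -
  note 1 = H1_cmult[OF assms(2), of "-1"]
  note 2 = H1_add[OF assms(1) 1(1)]
  show "(\<lambda>x. u x - v x) \<in> H1 \<Omega>" using 2(1) by simp
  show "AE x in M. weak_grad \<Omega> (\<lambda>x. u x - v x) x = weak_grad \<Omega> u x - weak_grad \<Omega> v x"
    using 1(2) 2(2) by eventually_elim simp
qed

lemma H10_norm_eq: "H10_norm \<Omega> u = l2n M (weak_grad \<Omega> u)"
  by (simp add: H10_norm_def l2n_def)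

lemma H1_norm_eq: "H1_norm \<Omega> u = sqrt ((l2n M u)\<^sup>2 + (l2n M (weak_grad \<Omega> u))\<^sup>2)"
  by (simp add: H1_norm_def l2n_sq)

lemma H10_imp_H1: "u \<in> H10 \<Omega> \<Longrightarrow> u \<in> H1 \<Omega>"
  by (simp add: H10_def)

lemma H10_approx:
  assumes "u \<in> H10 \<Omega>"
  obtains \<phi> where "\<And>n. \<phi> n \<in> T" "(\<lambda>n. l2n M (\<lambda>x. \<phi> n x - u x)) \<longlonglongrightarrow> 0"
    "(\<lambda>n. l2n M (\<lambda>x. cgrad (\<phi> n) x - weak_grad \<Omega> u x)) \<longlonglongrightarrow> 0"
proof -
  obtain \<phi> where \<phi>: "\<And>n. \<phi> n \<in> T" and lim: "(\<lambda>k. H1_norm \<Omega> (\<lambda>x. \<phi> k x - u x)) \<longlonglongrightarrow> 0"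
    and u: "u \<in> H1 \<Omega>" using assms by (auto simp: H10_def)
  have eq: "l2n M (\<lambda>x. cgrad (\<phi> n) x - weak_grad \<Omega> u x) = l2n M (weak_grad \<Omega> (\<lambda>x. \<phi> n x - u x))" for n
  proof (rule l2n_cong_AE)
    note d = H1_diff[OF H1_test(1)[OF \<phi>] u, of n]
    show "(\<lambda>x. cgrad (\<phi> n) x - weak_grad \<Omega> u x) \<in> borel_measurable M"
      by (intro sqint_measurable sqint_diff test_M(3)[OF \<phi>] H1D(2) u)
    show "weak_grad \<Omega> (\<lambda>x. \<phi> n x - u x) \<in> borel_measurable M"
      by (intro sqint_measurable H1D(2) d)
    show "AE x in M. cgrad (\<phi> n) x - weak_grad \<Omega> u x = weak_grad \<Omega> (\<lambda>x. \<phi> n x - u x) x"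
      using d(2) H1_test(2)[OF \<phi>, of n] by eventually_elim simp
  qed
  show thesis
  proof (rule that[OF \<phi>])
    show "(\<lambda>n. l2n M (\<lambda>x. \<phi> n x - u x)) \<longlonglongrightarrow> 0"
      by (rule Lim_null_comparison[OF always_eventually lim])
         (auto simp: H1_norm_eq intro!: real_le_rsqrt)
    show "(\<lambda>n. l2n M (\<lambda>x. cgrad (\<phi> n) x - weak_grad \<Omega> u x)) \<longlonglongrightarrow> 0"
      by (rule Lim_null_comparison[OF always_eventually lim])
         (auto simp: H1_norm_eq eq intro!: real_le_rsqrt)
  qed
qed

text \<open>The integration by parts identity passes to the limit, so the limit of the classical
  gradients is automatically a weak gradient of \<open>u\<close>. This reduces membership in
  \<open>H10 \<Omega>\<close> to two quadratic limits that do not mention the chosen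
  \<open>weak_grad\<close>.\<close>

lemma H10_closure:
  assumes \<phi>: "\<And>n. \<phi> n \<in> T" and u: "sqint M u" and g: "sqint M g"
    and l1: "(\<lambda>n. l2n M (\<lambda>x. \<phi> n x - u x)) \<longlonglongrightarrow> 0"
    and l2: "(\<lambda>n. l2n M (\<lambda>x. cgrad (\<phi> n) x - g x)) \<longlonglongrightarrow> 0"
  shows "u \<in> H10 \<Omega>" "AE x in M. weak_grad \<Omega> u x = g x"
proof -
  have w: "is_weak_gradient \<Omega> u g"
    unfolding is_weak_gradient_def
  proof (intro ballI)
    fix \<psi> and i :: 'a assume \<psi>: "\<psi> \<in> T" and i: "i \<in> Basis"
    have 1: "(\<lambda>n. LINT x|M. \<phi> n x * partial_deriv i \<psi> x) \<longlonglongrightarrow> (LINT x|M. u x * partial_deriv i \<psi> x)"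
      using l2i_tendsto[OF test_M(1)[OF \<phi>] u l1 test_M(1)[OF test_partial[OF \<psi> i]]] by (simp add: l2i_def)
    have s: "sqint M (\<lambda>x. \<psi> x *\<^sub>R i)"
    proof -
      have "sqint M (\<lambda>x. norm (\<psi> x))" by (rule sqint_norm[OF test_M(1)[OF \<psi>]])
      moreover have "(\<lambda>x. \<psi> x *\<^sub>R i) \<in> borel_measurable M"
        using sqint_measurable[OF test_M(1)[OF \<psi>]] by measurable
      ultimately show ?thesis using i by (simp add: sqint_def)
    qed
    have 2: "(\<lambda>n. LINT x|M. (cgrad (\<phi> n) x \<bullet> i) * \<psi> x) \<longlonglongrightarrow> (LINT x|M. (g x \<bullet> i) * \<psi> x)"
      using l2i_tendsto[OF test_M(3)[OF \<phi>] g l2 s] by (simp add: l2i_def mult.commute)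
    have "(LINT x|M. \<phi> n x * partial_deriv i \<psi> x) = - (LINT x|M. (cgrad (\<phi> n) x \<bullet> i) * \<psi> x)" for n
      using weak_gradient_test[OF \<phi>[of n]] \<psi> i by (auto simp: is_weak_gradient_def)
    with 1 have "(\<lambda>n. - (LINT x|M. (cgrad (\<phi> n) x \<bullet> i) * \<psi> x)) \<longlonglongrightarrow> (LINT x|M. u x * partial_deriv i \<psi> x)"
      by simp
    with tendsto_minus[OF 2] show "(LINT x|M. u x * partial_deriv i \<psi> x) = - (LINT x|M. (g x \<bullet> i) * \<psi> x)"
      using LIMSEQ_unique by blast
  qed
  note H = H1I[OF u g w]
  show "AE x in M. weak_grad \<Omega> u x = g x" by (rule H(2))
  have eq: "l2n M (weak_grad \<Omega> (\<lambda>x. \<phi> n x - u x)) = l2n M (\<lambda>x. cgrad (\<phi> n) x - g x)" for n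
  proof (rule l2n_cong_AE)
    note d = H1_diff[OF H1_test(1)[OF \<phi>] H(1), of n]
    show "(\<lambda>x. cgrad (\<phi> n) x - g x) \<in> borel_measurable M"
      by (intro sqint_measurable sqint_diff test_M(3)[OF \<phi>] g)
    show "weak_grad \<Omega> (\<lambda>x. \<phi> n x - u x) \<in> borel_measurable M"
      by (intro sqint_measurable H1D(2) d)
    show "AE x in M. weak_grad \<Omega> (\<lambda>x. \<phi> n x - u x) x = cgrad (\<phi> n) x - g x"
      using d(2) H1_test(2)[OF \<phi>, of n] H(2) by eventually_elim simp
  qed
  have "(\<lambda>n. H1_norm \<Omega> (\<lambda>x. \<phi> n x - u x)) \<longlonglongrightarrow> sqrt (0\<^sup>2 + 0\<^sup>2)"
    unfolding H1_norm_eq eq by (intro tendsto_intros l1 l2)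
  then show "u \<in> H10 \<Omega>" unfolding H10_def using H(1) \<phi> by auto
qed

lemma H10D:
  assumes "u \<in> H10 \<Omega>"
  shows "sqint M u" "sqint M (weak_grad \<Omega> u)"
  using H1D[OF H10_imp_H1[OF assms]] by auto

lemma test_H10: "\<phi> \<in> T \<Longrightarrow> \<phi> \<in> H10 \<Omega>"
  by (rule H10_closure(1)[of "\<lambda>_. \<phi>" \<phi> "cgrad \<phi>"]) (auto simp: test_M l2n_def)

lemma H10_add:
  assumes "u \<in> H10 \<Omega>" "v \<in> H10 \<Omega>"
  shows "(\<lambda>x. u x + v x) \<in> H10 \<Omega>"
proof -
  obtain \<phi> where \<phi>: "\<And>n. \<phi> n \<in> T" "(\<lambda>n. l2n M (\<lambda>x. \<phi> n x - u x)) \<longlonglongrightarrow> 0"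
    "(\<lambda>n. l2n M (\<lambda>x. cgrad (\<phi> n) x - weak_grad \<Omega> u x)) \<longlonglongrightarrow> 0" using H10_approx[OF assms(1)] by blast
  obtain \<psi> where \<psi>: "\<And>n. \<psi> n \<in> T" "(\<lambda>n. l2n M (\<lambda>x. \<psi> n x - v x)) \<longlonglongrightarrow> 0"
    "(\<lambda>n. l2n M (\<lambda>x. cgrad (\<psi> n) x - weak_grad \<Omega> v x)) \<longlonglongrightarrow> 0" using H10_approx[OF assms(2)] by blast
  show ?thesis
  proof (rule H10_closure(1)[of "\<lambda>n x. \<phi> n x + \<psi> n x" _ "\<lambda>x. weak_grad \<Omega> u x + weak_grad \<Omega> v x"])
    show "(\<lambda>x. \<phi> n x + \<psi> n x) \<in> T" for n by (intro test_add \<phi> \<psi>)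
    show "sqint M (\<lambda>x. u x + v x)" "sqint M (\<lambda>x. weak_grad \<Omega> u x + weak_grad \<Omega> v x)"
      by (intro sqint_add H10D assms)+
    show "(\<lambda>n. l2n M (\<lambda>x. \<phi> n x + \<psi> n x - (u x + v x))) \<longlonglongrightarrow> 0"
    proof (rule Lim_null_comparison[OF always_eventually])
      show "\<forall>n. norm (l2n M (\<lambda>x. \<phi> n x + \<psi> n x - (u x + v x))) \<le> l2n M (\<lambda>x. \<phi> n x - u x) + l2n M (\<lambda>x. \<psi> n x - v x)"
      proof
        fix n
        show "norm (l2n M (\<lambda>x. \<phi> n x + \<psi> n x - (u x + v x))) \<le> l2n M (\<lambda>x. \<phi> n x - u x) + l2n M (\<lambda>x. \<psi> n x - v x)"
          using l2n_triangle[OF sqint_diff[OF test_M(1)[OF \<phi>(1)[of n]] H10D(1)[OF assms(1)]] sqint_diff[OF test_M(1)[OF \<psi>(1)[of n]] H10D(1)[OF assms(2)]]]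
          by (simp add: algebra_simps)
      qed
      show "(\<lambda>n. l2n M (\<lambda>x. \<phi> n x - u x) + l2n M (\<lambda>x. \<psi> n x - v x)) \<longlonglongrightarrow> 0"
        using tendsto_add[OF \<phi>(2) \<psi>(2)] by simp
    qed
    show "(\<lambda>n. l2n M (\<lambda>x. cgrad (\<lambda>x. \<phi> n x + \<psi> n x) x - (weak_grad \<Omega> u x + weak_grad \<Omega> v x))) \<longlonglongrightarrow> 0"
    proof (rule Lim_null_comparison[OF always_eventually])
      show "\<forall>n. norm (l2n M (\<lambda>x. cgrad (\<lambda>x. \<phi> n x + \<psi> n x) x - (weak_grad \<Omega> u x + weak_grad \<Omega> v x)))
          \<le> l2n M (\<lambda>x. cgrad (\<phi> n) x - weak_grad \<Omega> u x) + l2n M (\<lambda>x. cgrad (\<psi> n) x - weak_grad \<Omega> v x)"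
      proof
        fix n
        show "norm (l2n M (\<lambda>x. cgrad (\<lambda>x. \<phi> n x + \<psi> n x) x - (weak_grad \<Omega> u x + weak_grad \<Omega> v x)))
          \<le> l2n M (\<lambda>x. cgrad (\<phi> n) x - weak_grad \<Omega> u x) + l2n M (\<lambda>x. cgrad (\<psi> n) x - weak_grad \<Omega> v x)"
          using l2n_triangle[OF sqint_diff[OF test_M(3)[OF \<phi>(1)[of n]] H10D(2)[OF assms(1)]] sqint_diff[OF test_M(3)[OF \<psi>(1)[of n]] H10D(2)[OF assms(2)]]]
          by (simp add: cgrad_add[OF \<phi>(1) \<psi>(1)] algebra_simps)
      qed
      show "(\<lambda>n. l2n M (\<lambda>x. cgrad (\<phi> n) x - weak_grad \<Omega> u x) + l2n M (\<lambda>x. cgrad (\<psi> n) x - weak_grad \<Omega> v x)) \<longlonglongrightarrow> 0"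
        using tendsto_add[OF \<phi>(3) \<psi>(3)] by simp
    qed
  qed
qed

lemma H10_cmult:
  assumes "u \<in> H10 \<Omega>"
  shows "(\<lambda>x. c * u x) \<in> H10 \<Omega>"
proof -
  obtain \<phi> where \<phi>: "\<And>n. \<phi> n \<in> T" "(\<lambda>n. l2n M (\<lambda>x. \<phi> n x - u x)) \<longlonglongrightarrow> 0"
    "(\<lambda>n. l2n M (\<lambda>x. cgrad (\<phi> n) x - weak_grad \<Omega> u x)) \<longlonglongrightarrow> 0" using H10_approx[OF assms(1)] by blast
  have 1: "l2n M (\<lambda>x. c * \<phi> n x - c * u x) = \<bar>c\<bar> * l2n M (\<lambda>x. \<phi> n x - u x)" for n
    using l2n_scaleR[of M c "\<lambda>x. \<phi> n x - u x"] by (simp add: right_diff_distrib)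
  have 2: "l2n M (\<lambda>x. cgrad (\<lambda>x. c * \<phi> n x) x - c *\<^sub>R weak_grad \<Omega> u x) = \<bar>c\<bar> * l2n M (\<lambda>x. cgrad (\<phi> n) x - weak_grad \<Omega> u x)" for n
    using l2n_scaleR[of M c "\<lambda>x. cgrad (\<phi> n) x - weak_grad \<Omega> u x"]
    by (simp add: cgrad_cmult[OF \<phi>(1)] scaleR_diff_right)
  show ?thesis
  proof (rule H10_closure(1)[of "\<lambda>n x. c * \<phi> n x" _ "\<lambda>x. c *\<^sub>R weak_grad \<Omega> u x"])
    show "(\<lambda>n. l2n M (\<lambda>x. c * \<phi> n x - c * u x)) \<longlonglongrightarrow> 0"
      unfolding 1 by (rule tendsto_mult_right_zero[OF \<phi>(2)])
    show "(\<lambda>n. l2n M (\<lambda>x. cgrad (\<lambda>x. c * \<phi> n x) x - c *\<^sub>R weak_grad \<Omega> u x)) \<longlonglongrightarrow> 0"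
      unfolding 2 by (rule tendsto_mult_right_zero[OF \<phi>(3)])
  qed (intro test_cmult \<phi> sqint_cmult sqint_scaleR H10D assms)+
qed

lemma H10_diff: "u \<in> H10 \<Omega> \<Longrightarrow> v \<in> H10 \<Omega> \<Longrightarrow> (\<lambda>x. u x - v x) \<in> H10 \<Omega>"
  using H10_add[OF _ H10_cmult[of v "-1"], of u] by simp

definition ip :: "('a \<Rightarrow> real) \<Rightarrow> ('a \<Rightarrow> real) \<Rightarrow> real" where
  "ip u v = l2i M (weak_grad \<Omega> u) (weak_grad \<Omega> v)"

abbreviation "nrm \<equiv> H10_norm \<Omega>"

lemma nrm_nonneg[simp]: "nrm u \<ge> 0"
  by (simp add: H10_norm_eq)

lemma ip_commute: "ip u v = ip v u"
  by (simp add: ip_def l2i_commute)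

lemma ip_self: "ip u u = (nrm u)\<^sup>2"
  by (simp add: ip_def l2i_self H10_norm_eq)

lemma ip_bound: "u \<in> H10 \<Omega> \<Longrightarrow> v \<in> H10 \<Omega> \<Longrightarrow> \<bar>ip u v\<bar> \<le> nrm u * nrm v"
  unfolding ip_def H10_norm_eq by (intro sqint_inner H10D)

lemma ip_add_left:
  assumes "u \<in> H10 \<Omega>" "v \<in> H10 \<Omega>" "w \<in> H10 \<Omega>"
  shows "ip (\<lambda>x. u x + v x) w = ip u w + ip v w"
proof -
  have "ip (\<lambda>x. u x + v x) w = l2i M (\<lambda>x. weak_grad \<Omega> u x + weak_grad \<Omega> v x) (weak_grad \<Omega> w)"
    unfolding ip_def
    by (rule l2i_cong_AE)
       (use H1_add(2)[OF H10_imp_H1 H10_imp_H1, OF assms(1,2)] assms in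
         \<open>auto intro!: sqint_measurable sqint_add H10D H10_add\<close>)
  also have "\<dots> = ip u w + ip v w"
    unfolding ip_def by (intro l2i_add_left H10D assms)
  finally show ?thesis .
qed

lemma ip_cmult_left:
  assumes "u \<in> H10 \<Omega>" "w \<in> H10 \<Omega>"
  shows "ip (\<lambda>x. c * u x) w = c * ip u w"
proof -
  have "ip (\<lambda>x. c * u x) w = l2i M (\<lambda>x. c *\<^sub>R weak_grad \<Omega> u x) (weak_grad \<Omega> w)"
    unfolding ip_def
    by (rule l2i_cong_AE)
       (use H1_cmult(2)[OF H10_imp_H1, OF assms(1)] assms in
         \<open>auto intro!: sqint_measurable sqint_scaleR H10D H10_cmult\<close>)
  then show ?thesis by (simp add: l2i_scaleR_left ip_def)
qed

lemma ip_add_right: "u \<in> H10 \<Omega> \<Longrightarrow> v \<in> H10 \<Omega> \<Longrightarrow> w \<in> H10 \<Omega> \<Longrightarrow> ip w (\<lambda>x. u x + v x) = ip w u + ip w v"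
  using ip_add_left[of u v w] ip_commute[of w] by presburger

lemma ip_cmult_right: "u \<in> H10 \<Omega> \<Longrightarrow> w \<in> H10 \<Omega> \<Longrightarrow> ip w (\<lambda>x. c * u x) = c * ip w u"
  using ip_cmult_left[of u w c] ip_commute[of w] by presburger

lemma ip_diff_left:
  assumes "u \<in> H10 \<Omega>" "v \<in> H10 \<Omega>" "w \<in> H10 \<Omega>"
  shows "ip (\<lambda>x. u x - v x) w = ip u w - ip v w"
  using ip_add_left[OF assms(1) H10_cmult[OF assms(2), of "-1"] assms(3)] ip_cmult_left[OF assms(2,3), of "-1"] by simp

lemma nrm_add_sq:
  assumes "u \<in> H10 \<Omega>" "v \<in> H10 \<Omega>"
  shows "(nrm (\<lambda>x. u x + v x))\<^sup>2 = (nrm u)\<^sup>2 + 2 * ip u v + (nrm v)\<^sup>2"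
proof -
  have "(nrm (\<lambda>x. u x + v x))\<^sup>2 = ip u (\<lambda>x. u x + v x) + ip v (\<lambda>x. u x + v x)"
    unfolding ip_self[symmetric] by (rule ip_add_left) (use assms H10_add in auto)
  then show ?thesis
    using assms ip_commute[of v u] by (simp add: ip_add_right ip_self)
qed

lemma nrm_cmult:
  assumes "u \<in> H10 \<Omega>"
  shows "nrm (\<lambda>x. c * u x) = \<bar>c\<bar> * nrm u"
proof -
  have "ip (\<lambda>x. c * u x) (\<lambda>x. c * u x) = c * (c * ip u u)"
    using assms H10_cmult[OF assms, of c] by (simp only: ip_cmult_left ip_cmult_right)
  then have "(nrm (\<lambda>x. c * u x))\<^sup>2 = (\<bar>c\<bar> * nrm u)\<^sup>2"
    by (simp add: ip_self power_mult_distrib power2_eq_square)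
  then show ?thesis by (rule power2_eq_imp_eq) auto
qed

lemma nrm_test: "\<phi> \<in> T \<Longrightarrow> nrm \<phi> = l2n M (cgrad \<phi>)"
  unfolding H10_norm_eq
  by (rule l2n_cong_AE) (auto intro!: sqint_measurable test_M(3) H10D test_H10 H1_test(2))

end

section \<open>The Sobolev embedding, the constant \<open>S\<close>, and weak compactness\<close>

lemma l2_AE_subseq:
  fixes u :: "nat \<Rightarrow> 'a \<Rightarrow> real"
  assumes u: "\<And>n. sqint M (u n)" and v: "sqint M v" and l: "(\<lambda>n. l2n M (\<lambda>x. u n x - v x)) \<longlonglongrightarrow> 0"
  obtains r where "strict_mono (r :: nat \<Rightarrow> nat)" "AE x in M. (\<lambda>n. u (r n) x) \<longlonglongrightarrow> v x"
proof -
  have "\<exists>r::nat\<Rightarrow>nat. strict_mono r \<and> (AE x in M. (\<lambda>n. (u (r n) x - v x)\<^sup>2) \<longlonglongrightarrow> 0)"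
  proof (rule tendsto_L1_AE_subseq)
    show "integrable M (\<lambda>x. (u n x - v x)\<^sup>2)" for n
      using sqint_integrable[OF sqint_diff[OF u v]] by simp
    have "(\<lambda>n. (l2n M (\<lambda>x. u n x - v x))\<^sup>2) \<longlonglongrightarrow> 0\<^sup>2" by (intro tendsto_intros l)
    then show "(\<lambda>n. LINT x|M. norm ((u n x - v x)\<^sup>2)) \<longlonglongrightarrow> 0" by (simp add: l2n_sq)
  qed
  then obtain r where r: "strict_mono (r::nat\<Rightarrow>nat)" "AE x in M. (\<lambda>n. (u (r n) x - v x)\<^sup>2) \<longlonglongrightarrow> 0" by blast
  from r(2) have "AE x in M. (\<lambda>n. u (r n) x) \<longlonglongrightarrow> v x"
  proof eventually_elim
    case (elim x)
    have "(\<lambda>n. sqrt ((u (r n) x - v x)\<^sup>2)) \<longlonglongrightarrow> sqrt 0" by (intro tendsto_intros elim)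
    then have "(\<lambda>n. \<bar>u (r n) x - v x\<bar>) \<longlonglongrightarrow> 0" by simp
    then show ?case by (simp add: tendsto_rabs_zero_iff LIM_zero_iff)
  qed
  with r(1) show thesis by (rule that)
qed

lemma square_powr_half:
  fixes x p :: real
  assumes "x \<ge> 0"
  shows "(x\<^sup>2) powr (p / 2) = x powr p"
proof (cases "x = 0")
  case False
  with assms have "x\<^sup>2 = x powr 2" by simp
  then show ?thesis by (simp only: powr_powr) simp
qed simp

locale sobolev_domain = bounded_open \<Omega> for \<Omega> :: "'a::euclidean_space set" +
  fixes q :: real
  assumes dim: "DIM('a) > 2" and q_eq: "q = crit_exp DIM('a)"
begin

lemma q_gt_2: "q > 2"
  using dim by (simp add: q_eq crit_exp_def field_simps)

text \<open>Approximating test functions converge almost everywhere on a subsequence, and Fatou's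
  lemma carries \<open>Sobolev_test\<close> over to the limit; \<open>q\<close>-integrability of
  \<open>u\<close> comes out of the same bound.\<close>

lemma Sobolev_H10:
  obtains K where "K > 0"
    "\<And>u. u \<in> H10 \<Omega> \<Longrightarrow> integrable M (\<lambda>x. \<bar>u x\<bar> powr q) \<and> (LINT x|M. \<bar>u x\<bar> powr q) \<le> (K * nrm u) powr q"
proof -
  define K where "K = 2 * (real DIM('a) - 1) / (real DIM('a) - 2)"
  have K: "K > 0" using dim by (simp add: K_def)
  have "integrable M (\<lambda>x. \<bar>u x\<bar> powr q) \<and> (LINT x|M. \<bar>u x\<bar> powr q) \<le> (K * nrm u) powr q" if u: "u \<in> H10 \<Omega>" for u
  proof -
    obtain \<phi> where \<phi>: "\<And>n. \<phi> n \<in> T" "(\<lambda>n. l2n M (\<lambda>x. \<phi> n x - u x)) \<longlonglongrightarrow> 0"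
      "(\<lambda>n. l2n M (\<lambda>x. cgrad (\<phi> n) x - weak_grad \<Omega> u x)) \<longlonglongrightarrow> 0" using H10_approx[OF u] by blast
    obtain r where r: "strict_mono (r :: nat \<Rightarrow> nat)" "AE x in M. (\<lambda>n. \<phi> (r n) x) \<longlonglongrightarrow> u x"
      using l2_AE_subseq[OF test_M(1)[OF \<phi>(1)] H10D(1)[OF u] \<phi>(2)] by blast
    have um[measurable]: "u \<in> borel_measurable M" using H10D(1)[OF u] by (rule sqint_measurable)
    have pm[measurable]: "\<phi> n \<in> borel_measurable M" for n using test_M(1)[OF \<phi>(1)] by (rule sqint_measurable)
    have "(\<lambda>n. l2n M (cgrad (\<phi> n))) \<longlonglongrightarrow> nrm u"
      unfolding H10_norm_eq by (rule l2n_tendsto[OF test_M(3)[OF \<phi>(1)] H10D(2)[OF u] \<phi>(3)])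
    then have nl: "(\<lambda>n. l2n M (cgrad (\<phi> (r n)))) \<longlonglongrightarrow> nrm u"
      using LIMSEQ_subseq_LIMSEQ[OF _ r(1)] by (simp add: o_def)
    have "(\<integral>\<^sup>+x. ennreal (\<bar>u x\<bar> powr q) \<partial>M) = (\<integral>\<^sup>+x. liminf (\<lambda>n. ennreal (\<bar>\<phi> (r n) x\<bar> powr q)) \<partial>M)"
    proof (rule nn_integral_cong_AE)
      show "AE x in M. ennreal (\<bar>u x\<bar> powr q) = liminf (\<lambda>n. ennreal (\<bar>\<phi> (r n) x\<bar> powr q))"
        using r(2)
      proof eventually_elim
        case (elim x)
        have "(\<lambda>n. ennreal (\<bar>\<phi> (r n) x\<bar> powr q)) \<longlonglongrightarrow> ennreal (\<bar>u x\<bar> powr q)"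
          by (intro tendsto_ennrealI tendsto_powr' tendsto_rabs elim tendsto_const) (use q_gt_2 in auto)
        then show ?case by (intro lim_imp_Liminf[symmetric]) auto
      qed
    qed
    also have "\<dots> \<le> liminf (\<lambda>n. \<integral>\<^sup>+x. ennreal (\<bar>\<phi> (r n) x\<bar> powr q) \<partial>M)"
      by (rule nn_integral_liminf) measurable
    also have "\<dots> \<le> liminf (\<lambda>n. ennreal ((K * l2n M (cgrad (\<phi> (r n)))) powr q))"
    proof (intro Liminf_mono always_eventually allI)
      fix n
      have [measurable]: "\<phi> (r n) \<in> borel_measurable borel" by (rule test_measurable[OF \<phi>(1)])
      have z: "\<bar>\<phi> (r n) x\<bar> powr q = 0" if "x \<notin> \<Omega>" for x using test_zero_outside[OF \<phi>(1) that] by simp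
      have i: "integrable lborel (\<lambda>x. \<bar>\<phi> (r n) x\<bar> powr q)"
        by (rule test_powr_integrable[OF \<phi>(1)]) (use q_gt_2 in auto)
      have "(\<integral>\<^sup>+x. ennreal (\<bar>\<phi> (r n) x\<bar> powr q) \<partial>M) = ennreal (LINT x|M. \<bar>\<phi> (r n) x\<bar> powr q)"
        by (rule nn_integral_eq_integral) (use i z in \<open>auto simp: integral_Om\<close>)
      also have "(LINT x|M. \<bar>\<phi> (r n) x\<bar> powr q) = (LINT x|lborel. \<bar>\<phi> (r n) x\<bar> powr q)"
        by (rule integral_Om) (use z in auto)
      also have "\<dots> \<le> (K * l2n M (cgrad (\<phi> (r n)))) powr q"
        using Sobolev_test[OF dim \<phi>(1)[of "r n"]] test_M(4)[OF \<phi>(1)[of "r n"]] by (simp add: K_def q_eq)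
      finally show "(\<integral>\<^sup>+x. ennreal (\<bar>\<phi> (r n) x\<bar> powr q) \<partial>M) \<le> ennreal ((K * l2n M (cgrad (\<phi> (r n)))) powr q)"
        using ennreal_leI by blast
    qed
    also have "\<dots> = ennreal ((K * nrm u) powr q)"
      by (intro lim_imp_Liminf tendsto_ennrealI tendsto_powr' tendsto_mult_left nl tendsto_const)
         (use K q_gt_2 in auto)
    finally have b: "(\<integral>\<^sup>+x. ennreal (\<bar>u x\<bar> powr q) \<partial>M) \<le> ennreal ((K * nrm u) powr q)" .
    have i: "integrable M (\<lambda>x. \<bar>u x\<bar> powr q)"
      by (rule integrableI_bounded) (use le_less_trans[OF b ennreal_less_top] in auto)
    moreover have "(LINT x|M. \<bar>u x\<bar> powr q) \<le> (K * nrm u) powr q"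
      using b by (subst (asm) nn_integral_eq_integral[OF i]) auto
    ultimately show ?thesis by simp
  qed
  with K show thesis by (rule that)
qed

lemma H10_powr_q_integrable: "u \<in> H10 \<Omega> \<Longrightarrow> integrable M (\<lambda>x. \<bar>u x\<bar> powr q)"
  using Sobolev_H10 by blast

lemma powr_integral_le:
  assumes p: "0 < p" "p < q" and [measurable]: "u \<in> borel_measurable M" and i: "integrable M (\<lambda>x. \<bar>u x\<bar> powr q)"
  shows "integrable M (\<lambda>x. \<bar>u x\<bar> powr p)"
    "(LINT x|M. \<bar>u x\<bar> powr p) \<le> (LINT x|M. \<bar>u x\<bar> powr q) powr (p / q) * (measure M \<Omega>) powr (1 - p / q)"
proof -
  interpret finite_measure M by (rule finite_measure_Om)
  \<comment> \<open>Hoelder against the constant \<open>1\<close>, with the exponent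
    \<open>q / p\<close> and its conjugate.\<close>
  define s where "s = q / p"
  define t where "t = q / (q - p)"
  have st: "s > 1" "t > 1" "1 / s + 1 / t = 1"
    using p by (auto simp: s_def t_def field_simps)
  have eq: "(\<bar>y\<bar> powr p) powr s = \<bar>y\<bar> powr q" for y :: real
    using p by (simp add: powr_powr s_def)
  have 1: "integrable M (\<lambda>x. \<bar>\<bar>u x\<bar> powr p\<bar> powr s)" using i by (simp add: eq)
  have 2: "integrable M (\<lambda>x. \<bar>1::real\<bar> powr t)" by simp
  show "integrable M (\<lambda>x. \<bar>u x\<bar> powr p)"
    using Holder_integral(1)[OF st _ _ 1 2] by simp
  have "1 / s = p / q" "1 / t = 1 - p / q" using p by (auto simp: s_def t_def field_simps)
  then show "(LINT x|M. \<bar>u x\<bar> powr p) \<le> (LINT x|M. \<bar>u x\<bar> powr q) powr (p / q) * (measure M \<Omega>) powr (1 - p / q)"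
    using Holder_integral(2)[OF st _ _ 1 2] by (simp add: eq)
qed

lemma Lp_bound:
  assumes p: "0 < p" "p < q"
  obtains C where "C > 0"
    "\<And>u. u \<in> H10 \<Omega> \<Longrightarrow> integrable M (\<lambda>x. \<bar>u x\<bar> powr p) \<and> (LINT x|M. \<bar>u x\<bar> powr p) \<le> C * nrm u powr p"
proof -
  obtain K where K: "K > 0"
    "\<And>u. u \<in> H10 \<Omega> \<Longrightarrow> integrable M (\<lambda>x. \<bar>u x\<bar> powr q) \<and> (LINT x|M. \<bar>u x\<bar> powr q) \<le> (K * nrm u) powr q"
    using Sobolev_H10 by blast
  define m where "m = (measure M \<Omega>) powr (1 - p / q)"
  have "m \<ge> 0" by (simp add: m_def)
  \<comment> \<open>The summand \<open>1\<close> makes the constant positive without a lower bound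
    on the measure of \<open>\<Omega>\<close>.\<close>
  show thesis
  proof (rule that[of "K powr p * m + 1"])
    show "K powr p * m + 1 > 0" using \<open>m \<ge> 0\<close> by (simp add: add_nonneg_pos)
    fix u assume u: "u \<in> H10 \<Omega>"
    note um = sqint_measurable[OF H10D(1)[OF u]]
    note P = powr_integral_le[OF p um conjunct1[OF K(2)[OF u]]]
    have "(LINT x|M. \<bar>u x\<bar> powr q) powr (p / q) \<le> ((K * nrm u) powr q) powr (p / q)"
      using K(2)[OF u] p by (intro powr_mono2) auto
    also have "\<dots> = K powr p * nrm u powr p"
      using p K(1) by (simp add: powr_powr powr_mult)
    finally have "(LINT x|M. \<bar>u x\<bar> powr p) \<le> (K powr p * nrm u powr p) * m"
      using P(2) \<open>m \<ge> 0\<close> unfolding m_def by (meson mult_right_mono order_trans powr_ge_zero)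
    also have "\<dots> \<le> (K powr p * m + 1) * nrm u powr p" by (simp add: algebra_simps)
    finally show "integrable M (\<lambda>x. \<bar>u x\<bar> powr p) \<and> (LINT x|M. \<bar>u x\<bar> powr p) \<le> (K powr p * m + 1) * nrm u powr p"
      using P(1) by simp
  qed
qed

lemma Poincare:
  obtains C where "C > 0" "\<And>u. u \<in> H10 \<Omega> \<Longrightarrow> l2n M u \<le> C * nrm u"
proof -
  obtain C where C: "C > 0"
    "\<And>u. u \<in> H10 \<Omega> \<Longrightarrow> integrable M (\<lambda>x. \<bar>u x\<bar> powr 2) \<and> (LINT x|M. \<bar>u x\<bar> powr 2) \<le> C * nrm u powr 2"
    using Lp_bound[of 2] q_gt_2 by auto
  show thesis
  proof (rule that[of "sqrt C"])
    fix u assume "u \<in> H10 \<Omega>"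
    then have "(LINT x|M. (norm (u x))\<^sup>2) \<le> C * (nrm u)\<^sup>2" using C(2)[of u] by simp
    then have "l2n M u \<le> sqrt (C * (nrm u)\<^sup>2)" unfolding l2n_def by (rule real_sqrt_le_mono)
    then show "l2n M u \<le> sqrt C * nrm u" by (simp add: real_sqrt_mult)
  qed (use C in auto)
qed

text \<open>A nonzero element has a positive \<open>q\<close>-integral, and the Sobolev inequality
  then excludes a vanishing gradient norm.\<close>

lemma nrm_pos:
  assumes "u \<in> H10_nonzero \<Omega>"
  shows "nrm u > 0" "(LINT x|M. \<bar>u x\<bar> powr q) > 0"
proof -
  have u: "u \<in> H10 \<Omega>" and nz: "\<not> (AE x in M. u x = 0)" using assms by (auto simp: H10_nonzero_def)
  note i = H10_powr_q_integrable[OF u]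
  have "(LINT x|M. \<bar>u x\<bar> powr q) \<noteq> 0"
    using nz integral_nonneg_eq_0_iff_AE[OF i] by auto
  then show P: "(LINT x|M. \<bar>u x\<bar> powr q) > 0" by (simp add: less_le)
  obtain K where "(LINT x|M. \<bar>u x\<bar> powr q) \<le> (K * nrm u) powr q" using Sobolev_H10 u by blast
  with P have "nrm u \<noteq> 0" by auto
  then show "nrm u > 0" by (simp add: less_le)
qed

lemma H10_nonzero_cmult:
  assumes "u \<in> H10_nonzero \<Omega>" "t \<noteq> 0"
  shows "(\<lambda>x. t * u x) \<in> H10_nonzero \<Omega>"
  using assms H10_cmult[of u t] by (simp add: H10_nonzero_def)

lemma H10_nonzero_nonempty: "H10_nonzero \<Omega> \<noteq> {}"
proof -
  obtain x where "x \<in> \<Omega>" using nonempty_Om by auto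
  then obtain l u where lu: "cbox l u \<subseteq> \<Omega>" "x \<in> box l u" using open_contains_cbox[OF open_Om] by metis
  define \<phi> where "\<phi> = box_bump 1 l u"
  have \<phi>: "\<phi> \<in> T" unfolding \<phi>_def by (rule box_bump_test[OF _ lu(1)]) simp
  have "\<not> (AE x in M. \<phi> x = 0)"
  proof
    assume "AE x in M. \<phi> x = 0"
    then have "AE x in lebesgue. x \<in> \<Omega> \<longrightarrow> \<phi> x = 0"
      by (subst (asm) AE_restrict_space_iff) (use sets_Om in auto)
    then have "AE x in lebesgue. x \<notin> box l u"
    proof eventually_elim
      case (elim x)
      then show ?case using box_bump_pos_iff[of 1 l u x] lu(1) box_subset_cbox[of l u] by (auto simp: \<phi>_def)
    qed
    then have "box l u \<in> null_sets lebesgue" by (subst AE_iff_null_sets) auto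
    then have "negligible (box l u)" by (simp add: negligible_iff_null_sets)
    then show False using open_not_negligible[of "box l u"] lu(2) by auto
  qed
  then show ?thesis using test_H10[OF \<phi>] by (auto simp: H10_nonzero_def)
qed

definition "S \<equiv> Sobolev_const \<Omega>"

lemma Lq_norm_powr: "Lq_norm \<Omega> q u powr q = (LINT x|M. \<bar>u x\<bar> powr q)"
  using q_gt_2 by (simp add: Lq_norm_def powr_powr)

text \<open>The Sobolev inequality bounds all quotients in the infimum below by
  \<open>1 / K\<^sup>2\<close>, so that the infimum is positive and really a lower bound. In the
  product form of \<open>S_ineq\<close> the functions that vanish almost everywhere, whose quotient
  is meaningless, are treated separately.\<close>

lemma S_pos: "S > 0"
  and S_ineq: "u \<in> H10 \<Omega> \<Longrightarrow> (LINT x|M. \<bar>u x\<bar> powr q) \<le> S powr (- (q / 2)) * nrm u powr q"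
proof -
  obtain K where K: "K > 0"
    "\<And>u. u \<in> H10 \<Omega> \<Longrightarrow> integrable M (\<lambda>x. \<bar>u x\<bar> powr q) \<and> (LINT x|M. \<bar>u x\<bar> powr q) \<le> (K * nrm u) powr q"
    using Sobolev_H10 by blast
  have ratio: "1 / K\<^sup>2 \<le> (nrm u)\<^sup>2 / (Lq_norm \<Omega> q u)\<^sup>2" "Lq_norm \<Omega> q u > 0" if u: "u \<in> H10_nonzero \<Omega>" for u
  proof -
    have H: "u \<in> H10 \<Omega>" using u by (simp add: H10_nonzero_def)
    show L: "Lq_norm \<Omega> q u > 0" using nrm_pos(2)[OF u] by (simp add: Lq_norm_def)
    have "Lq_norm \<Omega> q u \<le> ((K * nrm u) powr q) powr (1 / q)"
      unfolding Lq_norm_def using K(2)[OF H] q_gt_2 by (intro powr_mono2) auto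
    also have "\<dots> = K * nrm u" using q_gt_2 K(1) by (simp add: powr_powr)
    finally have "(Lq_norm \<Omega> q u)\<^sup>2 \<le> (K * nrm u)\<^sup>2" using L by (intro power_mono) auto
    then show "1 / K\<^sup>2 \<le> (nrm u)\<^sup>2 / (Lq_norm \<Omega> q u)\<^sup>2"
      using L K(1) by (simp add: field_simps power_mult_distrib)
  qed
  have "1 / K\<^sup>2 \<le> S"
    unfolding S_def Sobolev_const_def q_eq[symmetric]
    by (rule cINF_greatest[OF H10_nonzero_nonempty]) (rule ratio(1))
  then show S: "S > 0" using K(1) by (smt (verit) zero_less_divide_1_iff zero_less_power)
  show "(LINT x|M. \<bar>u x\<bar> powr q) \<le> S powr (- (q / 2)) * nrm u powr q" if u: "u \<in> H10 \<Omega>"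
  proof (cases "u \<in> H10_nonzero \<Omega>")
    case True
    have "S \<le> (nrm u)\<^sup>2 / (Lq_norm \<Omega> q u)\<^sup>2"
      unfolding S_def Sobolev_const_def q_eq[symmetric]
    proof (rule cINF_lower[OF _ True])
      show "bdd_below ((\<lambda>u. (nrm u)\<^sup>2 / (Lq_norm \<Omega> q u)\<^sup>2) ` H10_nonzero \<Omega>)"
        by (rule bdd_belowI[of _ "1 / K\<^sup>2"]) (use ratio(1) in auto)
    qed
    then have "(Lq_norm \<Omega> q u)\<^sup>2 \<le> (nrm u)\<^sup>2 / S"
      using ratio(2)[OF True] S by (simp add: field_simps)
    then have "((Lq_norm \<Omega> q u)\<^sup>2) powr (q / 2) \<le> ((nrm u)\<^sup>2 / S) powr (q / 2)"
      using q_gt_2 by (intro powr_mono2) auto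
    moreover have "((Lq_norm \<Omega> q u)\<^sup>2) powr (q / 2) = (LINT x|M. \<bar>u x\<bar> powr q)"
      using ratio(2)[OF True] Lq_norm_powr[of u] by (simp add: square_powr_half)
    moreover have "((nrm u)\<^sup>2 / S) powr (q / 2) = S powr (- (q / 2)) * nrm u powr q"
      using S by (simp add: powr_divide powr_minus square_powr_half divide_simps)
    ultimately show ?thesis by simp
  next
    case False
    then have "AE x in M. u x = 0" using u by (simp add: H10_nonzero_def)
    then have "(LINT x|M. \<bar>u x\<bar> powr q) = 0" by (intro integral_eq_zero_AE) auto
    then show ?thesis by simp
  qed
qed

text \<open>Against a test function the gradient product is the integral of \<open>u n\<close> times
  minus a Laplacian, so quadratic convergence of the functions themselves suffices. A general
  \<open>w\<close> is approximated by test functions, uniformly in \<open>n\<close> because the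
  gradients are bounded.\<close>

lemma ip_tendsto_of_L2:
  assumes u: "\<And>n. u n \<in> H10 \<Omega>" and B: "\<And>n. nrm (u n) \<le> B" and v: "v \<in> H10 \<Omega>"
    and l: "(\<lambda>n. l2n M (\<lambda>x. u n x - v x)) \<longlonglongrightarrow> 0" and w: "w \<in> H10 \<Omega>"
  shows "(\<lambda>n. ip (u n) w) \<longlonglongrightarrow> ip v w"
proof -
  have B0: "B \<ge> 0" using B[of 0] nrm_nonneg[of "u 0"] by linarith
  have lap: "l2i M (weak_grad \<Omega> z) (cgrad \<psi>) = - (\<Sum>i\<in>Basis. LINT x|M. z x * partial_deriv i (partial_deriv i \<psi>) x)"
    if z: "z \<in> H10 \<Omega>" and \<psi>: "\<psi> \<in> T" for z \<psi>
  proof -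
    have p: "partial_deriv i \<psi> \<in> T" if "i \<in> Basis" for i by (rule test_partial[OF \<psi> that])
    have "weak_grad \<Omega> z x \<bullet> cgrad \<psi> x = (\<Sum>i\<in>Basis. (weak_grad \<Omega> z x \<bullet> i) * partial_deriv i \<psi> x)" for x
      by (simp add: cgrad_def inner_sum_right mult.commute)
    then have "l2i M (weak_grad \<Omega> z) (cgrad \<psi>) = (\<Sum>i\<in>Basis. LINT x|M. (weak_grad \<Omega> z x \<bullet> i) * partial_deriv i \<psi> x)"
      unfolding l2i_def
      by (simp, intro Bochner_Integration.integral_sum integrable_mult_sqint sqint_inner_right H10D z test_M p)
    also have "\<dots> = (\<Sum>i\<in>Basis. - (LINT x|M. z x * partial_deriv i (partial_deriv i \<psi>) x))"
      by (rule sum.cong) (use H1D(3)[OF H10_imp_H1[OF z]] p in \<open>auto simp: is_weak_gradient_def\<close>)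
    finally show ?thesis by (simp add: sum_negf)
  qed
  show ?thesis
  proof (rule LIMSEQ_I)
    fix e :: real assume e: "e > 0"
    obtain \<psi> where \<psi>: "\<And>n. \<psi> n \<in> T" "(\<lambda>n. l2n M (\<lambda>x. \<psi> n x - w x)) \<longlonglongrightarrow> 0"
      "(\<lambda>n. l2n M (\<lambda>x. cgrad (\<psi> n) x - weak_grad \<Omega> w x)) \<longlonglongrightarrow> 0" using H10_approx[OF w] by blast
    define c where "c = B + nrm v + 1"
    have c: "c > 0" unfolding c_def using B0 nrm_nonneg[of v] by linarith
    obtain k where k: "l2n M (\<lambda>x. cgrad (\<psi> k) x - weak_grad \<Omega> w x) < e / (2 * c)"
      using LIMSEQ_D[OF \<psi>(3), of "e / (2 * c)"] e c by auto
    have "(\<lambda>n. l2i M (weak_grad \<Omega> (u n)) (cgrad (\<psi> k))) \<longlonglongrightarrow> l2i M (weak_grad \<Omega> v) (cgrad (\<psi> k))"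
      unfolding lap[OF u \<psi>(1)] lap[OF v \<psi>(1)]
    proof (intro tendsto_minus tendsto_sum)
      fix i :: 'a assume i: "i \<in> Basis"
      show "(\<lambda>n. LINT x|M. u n x * partial_deriv i (partial_deriv i (\<psi> k)) x) \<longlonglongrightarrow> (LINT x|M. v x * partial_deriv i (partial_deriv i (\<psi> k)) x)"
        using l2i_tendsto[OF H10D(1)[OF u] H10D(1)[OF v] l test_M(1)[OF test_partial[OF test_partial[OF \<psi>(1) i] i]]]
        by (simp add: l2i_def)
    qed
    from LIMSEQ_D[OF this, of "e/2"] e obtain n0 where
      n0: "\<And>n. n \<ge> n0 \<Longrightarrow> \<bar>l2i M (weak_grad \<Omega> (u n)) (cgrad (\<psi> k)) - l2i M (weak_grad \<Omega> v) (cgrad (\<psi> k))\<bar> < e / 2" by auto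
    have "norm (ip (u n) w - ip v w) < e" if n: "n \<ge> n0" for n
    proof -
      let ?d = "\<lambda>x. weak_grad \<Omega> (u n) x - weak_grad \<Omega> v x"
      let ?h = "\<lambda>x. cgrad (\<psi> k) x - weak_grad \<Omega> w x"
      have sd: "sqint M ?d" and sh: "sqint M ?h"
        by (intro sqint_diff H10D u v w test_M \<psi>)+
      have 1: "ip (u n) w - ip v w = l2i M ?d (weak_grad \<Omega> w)"
        unfolding ip_def by (rule l2i_diff_left[symmetric]) (intro H10D u v w)+
      have 2: "l2i M ?h ?d = l2i M (cgrad (\<psi> k)) ?d - l2i M (weak_grad \<Omega> w) ?d"
        by (intro l2i_diff_left H10D w test_M \<psi> sd)
      have 3: "l2i M ?d (cgrad (\<psi> k)) = l2i M (weak_grad \<Omega> (u n)) (cgrad (\<psi> k)) - l2i M (weak_grad \<Omega> v) (cgrad (\<psi> k))"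
        by (intro l2i_diff_left H10D u v test_M \<psi>)
      have "l2n M ?d \<le> B + nrm v"
      proof -
        have "l2n M ?d \<le> l2n M (weak_grad \<Omega> (u n)) + l2n M (\<lambda>x. (-1) *\<^sub>R weak_grad \<Omega> v x)"
          using l2n_triangle[OF H10D(2)[OF u[of n]] sqint_scaleR[OF H10D(2)[OF v], of "-1"]] by simp
        also have "l2n M (\<lambda>x. (-1) *\<^sub>R weak_grad \<Omega> v x) = nrm v"
          unfolding l2n_scaleR H10_norm_eq by simp
        finally show ?thesis using B[of n] by (simp add: H10_norm_eq)
      qed
      then have dc: "l2n M ?d \<le> c" by (simp add: c_def)
      have "\<bar>l2i M ?h ?d\<bar> \<le> l2n M ?h * l2n M ?d" by (rule sqint_inner(2)[OF sh sd])
      also have "\<dots> \<le> (e / (2 * c)) * c" using k dc c e by (intro mult_mono) auto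
      finally have "\<bar>l2i M ?h ?d\<bar> \<le> e / 2" using c by simp
      then show ?thesis
        using n0[OF n] 1 2 3 l2i_commute[of M ?d "cgrad (\<psi> k)"] l2i_commute[of M ?d "weak_grad \<Omega> w"]
        unfolding real_norm_def by linarith
    qed
    then show "\<exists>no. \<forall>n\<ge>no. norm (ip (u n) w - ip v w) < e" by blast
  qed
qed

text \<open>The weak limit is obtained without the Banach--Alaoglu theorem: near-minimizers of the norm in
  the decreasing convex sets \<open>{w. l2n (w - u) \<le> 1/(n+1)}\<close> are Cauchy by the parallelogram law.\<close>

lemma H10_of_L2_limit:
  assumes \<phi>: "\<And>n. \<phi> n \<in> T" and B: "\<And>n. l2n M (cgrad (\<phi> n)) \<le> B" and u: "sqint M u"
    and l: "(\<lambda>n. l2n M (\<lambda>x. \<phi> n x - u x)) \<longlonglongrightarrow> 0"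
  shows "u \<in> H10 \<Omega>"
proof -
  define \<epsilon> where "\<epsilon> n = 1 / real (Suc n)" for n
  have \<epsilon>0: "\<epsilon> \<longlonglongrightarrow> 0" unfolding \<epsilon>_def by (intro LIMSEQ_Suc lim_1_over_n)
  have \<epsilon>pos: "\<epsilon> n > 0" for n by (simp add: \<epsilon>_def)
  have \<epsilon>mono: "\<epsilon> m \<le> \<epsilon> n" if "n \<le> m" for m n using that by (simp add: \<epsilon>_def frac_le)
  \<comment> \<open>Only test functions compete, so that the limit of their gradients can be fed
    into \<open>H10_closure\<close>; the sequence \<open>\<phi>\<close> shows that every
    \<open>K n\<close> is nonempty and that the infima \<open>d n\<close> are at most
    \<open>B\<^sup>2\<close>.\<close>
  define K where "K n = {w \<in> T. l2n M (\<lambda>x. w x - u x) \<le> \<epsilon> n}" for n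
  have Kmono: "K m \<subseteq> K n" if "n \<le> m" for m n using \<epsilon>mono[OF that] by (auto simp: K_def)
  define E where "E w = (l2n M (cgrad w))\<^sup>2" for w
  define d where "d n = (INF w\<in>K n. E w)" for n
  have Kne: "\<exists>w\<in>K n. E w \<le> B\<^sup>2" for n
  proof -
    obtain m where "l2n M (\<lambda>x. \<phi> m x - u x) < \<epsilon> n"
      using LIMSEQ_D[OF l \<epsilon>pos[of n]] by auto
    then show ?thesis using \<phi> B[of m] by (intro bexI[of _ "\<phi> m"]) (auto simp: K_def E_def intro!: power_mono)
  qed
  have bdd: "bdd_below (E ` K n)" for n by (rule bdd_belowI[of _ 0]) (auto simp: E_def)
  have d_le: "d n \<le> E w" if "w \<in> K n" for n w unfolding d_def by (rule cINF_lower[OF bdd that])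
  have dB: "d n \<le> B\<^sup>2" for n using Kne[of n] d_le by (meson order_trans)
  have dmono: "d n \<le> d m" if "n \<le> m" for n m
    unfolding d_def[of m] by (rule cINF_greatest) (use Kne[of m] d_le Kmono[OF that] in auto)
  have d0: "0 \<le> d n" for n
    unfolding d_def by (rule cINF_greatest) (use Kne[of n] in \<open>auto simp: E_def\<close>)
  have "convergent d"
    by (rule Bseq_mono_convergent) (use dB d0 dmono in \<open>auto intro!: BseqI'[of _ "B\<^sup>2"]\<close>)
  then obtain D where D: "d \<longlonglongrightarrow> D" by (auto simp: convergent_def)
  have "\<exists>w\<in>K n. E w < d n + \<epsilon> n" for n
  proof (rule ccontr)
    assume "\<not> ?thesis"
    then have "d n + \<epsilon> n \<le> d n" unfolding d_def[of n] using Kne[of n]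
      by (intro cINF_greatest) (auto simp: not_less d_def)
    then show False using \<epsilon>pos[of n] by simp
  qed
  then obtain w where w: "\<And>n. w n \<in> K n" "\<And>n. E (w n) < d n + \<epsilon> n" by metis
  have wT: "w n \<in> T" for n using w(1)[of n] by (simp add: K_def)
  have key: "(l2n M (\<lambda>x. cgrad (w m) x - cgrad (w n) x))\<^sup>2 \<le> 2 * (d m + \<epsilon> m) + 2 * (d n + \<epsilon> n) - 4 * d k"
    if "k \<le> m" "k \<le> n" for k m n
  proof -
    define h where "h x = (1/2) * (w m x + w n x)" for x
    have hT: "h \<in> T" unfolding h_def by (intro test_cmult test_add wT)
    have hK: "h \<in> K k"
    proof -
      have "l2n M (\<lambda>x. h x - u x) = l2n M (\<lambda>x. (1/2) *\<^sub>R ((w m x - u x) + (w n x - u x)))"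
        by (rule arg_cong[where f="l2n M"]) (auto simp: h_def field_simps)
      also have "\<dots> = (1/2) * l2n M (\<lambda>x. (w m x - u x) + (w n x - u x))" unfolding l2n_scaleR by simp
      also have "\<dots> \<le> (1/2) * (l2n M (\<lambda>x. w m x - u x) + l2n M (\<lambda>x. w n x - u x))"
        by (intro mult_left_mono l2n_triangle sqint_diff test_M wT u) simp
      also have "\<dots> \<le> \<epsilon> k"
      proof -
        have "w m \<in> K k" "w n \<in> K k"
          using w(1)[of m] w(1)[of n] Kmono[OF that(1)] Kmono[OF that(2)] by blast+
        then show ?thesis by (simp add: K_def)
      qed
      finally show ?thesis using hT by (simp add: K_def)
    qed
    have sm: "sqint M (cgrad (w m))" and sn: "sqint M (cgrad (w n))" by (intro test_M wT)+
    have "cgrad h x = (1/2) *\<^sub>R (cgrad (w m) x + cgrad (w n) x)" for x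
      unfolding h_def using cgrad_cmult[OF test_add[OF wT wT], of "1/2"] cgrad_add[OF wT wT] by simp
    then have "cgrad h = (\<lambda>x. (1/2) *\<^sub>R (cgrad (w m) x + cgrad (w n) x))" by (rule ext)
    then have hn: "l2n M (cgrad h) = \<bar>1/2\<bar> * l2n M (\<lambda>x. cgrad (w m) x + cgrad (w n) x)"
      by (simp only: l2n_scaleR)
    have "E h = (1/4) * (l2n M (\<lambda>x. cgrad (w m) x + cgrad (w n) x))\<^sup>2"
      unfolding E_def hn power_mult_distrib by (simp add: power2_eq_square)
    then have "(l2n M (\<lambda>x. cgrad (w m) x - cgrad (w n) x))\<^sup>2 = 2 * E (w m) + 2 * E (w n) - 4 * E h"
      unfolding l2n_diff_sq[OF sm sn] using l2n_add_sq[OF sm sn] by (simp add: E_def)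
    then show ?thesis using w(2)[of m] w(2)[of n] d_le[OF hK] by simp
  qed
  have Cauchy: "\<exists>N. \<forall>m\<ge>N. \<forall>n\<ge>N. l2n M (\<lambda>x. cgrad (w m) x - cgrad (w n) x) < e" if e: "e > 0" for e
  proof -
    \<comment> \<open>The infima increase to \<open>D\<close>, so \<open>key\<close> with
      \<open>k = N\<close> is at most \<open>4 * (D + \<epsilon> N) - 4 * d N\<close> for all later
      indices.\<close>
    have "(\<lambda>k. 4 * (D + \<epsilon> k) - 4 * d k) \<longlonglongrightarrow> 4 * (D + 0) - 4 * D"
      by (intro tendsto_intros \<epsilon>0 D)
    then have "(\<lambda>k. 4 * (D + \<epsilon> k) - 4 * d k) \<longlonglongrightarrow> 0" by simp
    then obtain N where N: "4 * (D + \<epsilon> N) - 4 * d N < e\<^sup>2"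
      using LIMSEQ_D[of _ 0 "e\<^sup>2"] e by (force simp: abs_less_iff)
    show ?thesis
    proof (intro exI allI impI)
      fix m n assume mn: "m \<ge> N" "n \<ge> N"
      have dD: "d i \<le> D" for i by (rule LIMSEQ_le_const[OF D]) (use dmono in auto)
      have "(l2n M (\<lambda>x. cgrad (w m) x - cgrad (w n) x))\<^sup>2 \<le> 2 * (d m + \<epsilon> m) + 2 * (d n + \<epsilon> n) - 4 * d N"
        by (rule key[OF mn])
      also have "\<dots> \<le> 4 * (D + \<epsilon> N) - 4 * d N"
        using dD[of m] dD[of n] \<epsilon>mono[OF mn(1)] \<epsilon>mono[OF mn(2)] by simp
      also have "\<dots> < e\<^sup>2" by (rule N)
      finally show "l2n M (\<lambda>x. cgrad (w m) x - cgrad (w n) x) < e"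
        by (rule power_less_imp_less_base) (use e in simp)
    qed
  qed
  interpret finite_measure M by (rule finite_measure_Om)
  obtain g r where g: "sqint M g" "(\<lambda>n. l2n M (\<lambda>x. cgrad (w n) x - g x)) \<longlonglongrightarrow> 0"
    using l2_complete[of "\<lambda>n. cgrad (w n)", OF test_M(3)[OF wT] Cauchy] by blast
  have "(\<lambda>n. l2n M (\<lambda>x. w n x - u x)) \<longlonglongrightarrow> 0"
    by (rule Lim_null_comparison[OF always_eventually \<epsilon>0]) (use w(1) in \<open>auto simp: K_def\<close>)
  then show ?thesis using H10_closure(1)[OF wT u g(1) _ g(2)] by blast
qed

text \<open>Each \<open>u n\<close> is replaced by a test function that is
  \<open>1 / Suc n\<close>-close together with its gradient. \<open>Rellich_test\<close> and
  completeness give a quadratic limit on a subsequence, \<open>H10_of_L2_limit\<close> puts it into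
  \<open>H10 \<Omega>\<close>, and closeness transfers the convergence back. A further subsequence
  converges almost everywhere; convergence of the products \<open>ip\<close> follows from the
  quadratic one.\<close>

theorem H10_compact:
  assumes u: "\<And>n. u n \<in> H10 \<Omega>" and B: "\<And>n. nrm (u n) \<le> B"
  obtains v r where "v \<in> H10 \<Omega>" "strict_mono (r :: nat \<Rightarrow> nat)" "AE x in M. (\<lambda>n. u (r n) x) \<longlonglongrightarrow> v x"
    "\<And>w. w \<in> H10 \<Omega> \<Longrightarrow> (\<lambda>n. ip (u (r n)) w) \<longlonglongrightarrow> ip v w"
proof -
  interpret finite_measure M by (rule finite_measure_Om)
  have "\<exists>\<phi>\<in>T. l2n M (\<lambda>x. \<phi> x - u n x) < 1 / real (Suc n) \<and> l2n M (\<lambda>x. cgrad \<phi> x - weak_grad \<Omega> (u n) x) < 1 / real (Suc n)" for n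
  proof -
    obtain \<phi> where \<phi>: "\<And>k. \<phi> k \<in> T" "(\<lambda>k. l2n M (\<lambda>x. \<phi> k x - u n x)) \<longlonglongrightarrow> 0"
      "(\<lambda>k. l2n M (\<lambda>x. cgrad (\<phi> k) x - weak_grad \<Omega> (u n) x)) \<longlonglongrightarrow> 0" using H10_approx[OF u] by blast
    have "\<forall>\<^sub>F k in sequentially. l2n M (\<lambda>x. \<phi> k x - u n x) < 1 / real (Suc n) \<and> l2n M (\<lambda>x. cgrad (\<phi> k) x - weak_grad \<Omega> (u n) x) < 1 / real (Suc n)"
      by (intro eventually_conj order_tendstoD(2)[OF \<phi>(2)] order_tendstoD(2)[OF \<phi>(3)]) auto
    then obtain k where "l2n M (\<lambda>x. \<phi> k x - u n x) < 1 / real (Suc n) \<and> l2n M (\<lambda>x. cgrad (\<phi> k) x - weak_grad \<Omega> (u n) x) < 1 / real (Suc n)"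
      by (auto dest: eventually_happens)
    then show ?thesis using \<phi>(1) by blast
  qed
  then obtain \<phi> where \<phi>: "\<And>n. \<phi> n \<in> T" "\<And>n. l2n M (\<lambda>x. \<phi> n x - u n x) < 1 / real (Suc n)"
    "\<And>n. l2n M (\<lambda>x. cgrad (\<phi> n) x - weak_grad \<Omega> (u n) x) < 1 / real (Suc n)" by metis
  obtain C where C: "C > 0" "\<And>u. u \<in> H10 \<Omega> \<Longrightarrow> l2n M u \<le> C * nrm u" using Poincare by blast
  have gB: "l2n M (cgrad (\<phi> n)) \<le> B + 1" for n
  proof -
    have "l2n M (cgrad (\<phi> n)) \<le> l2n M (\<lambda>x. cgrad (\<phi> n) x - weak_grad \<Omega> (u n) x) + l2n M (weak_grad \<Omega> (u n))"
      using l2n_diff_abs[OF test_M(3)[OF \<phi>(1)[of n]] H10D(2)[OF u[of n]]] by linarith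
    moreover have "1 / real (Suc n) \<le> 1" by simp
    ultimately show ?thesis using \<phi>(3)[of n] B[of n] by (simp only: H10_norm_eq)
  qed
  have B0: "B + 1 \<ge> 0" using gB[of 0] l2n_nonneg[of M "cgrad (\<phi> 0)"] by linarith
  \<comment> \<open>\<open>Rellich_test\<close> takes one bound for functions and gradients; this
    value exceeds both the Poincare bound and \<open>B + 1\<close>.\<close>
  define B' where "B' = (C + 1) * (B + 1)"
  have B': "B + 1 \<le> B'" "C * (B + 1) \<le> B'" using C(1) B0 mult_nonneg_nonneg[of C "B + 1"] by (auto simp: B'_def algebra_simps)
  have fB: "l2n M (\<phi> n) \<le> B'" for n
  proof -
    have "l2n M (\<phi> n) \<le> C * nrm (\<phi> n)" by (rule C(2)[OF test_H10[OF \<phi>(1)]])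
    also have "\<dots> \<le> C * (B + 1)" using gB[of n] C(1) by (simp add: nrm_test[OF \<phi>(1)])
    finally show ?thesis using B' by simp
  qed
  obtain r where r: "strict_mono (r :: nat \<Rightarrow> nat)"
    and rC: "\<And>e. e > 0 \<Longrightarrow> \<exists>N. \<forall>m\<ge>N. \<forall>n\<ge>N. l2n M (\<lambda>x. \<phi> (r m) x - \<phi> (r n) x) < e"
    by (rule Rellich_test[OF \<phi>(1) fB order_trans[OF gB B'(1)]]) (rule that)
  obtain v where v: "sqint M v" "(\<lambda>n. l2n M (\<lambda>x. \<phi> (r n) x - v x)) \<longlonglongrightarrow> 0"
    using l2_complete[of "\<lambda>n. \<phi> (r n)", OF test_M(1)[OF \<phi>(1)] rC] by blast
  have vH: "v \<in> H10 \<Omega>" by (rule H10_of_L2_limit[OF \<phi>(1) gB v])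
  have ul: "(\<lambda>n. l2n M (\<lambda>x. u (r n) x - v x)) \<longlonglongrightarrow> 0"
  proof (rule Lim_null_comparison[OF always_eventually])
    show "\<forall>n. norm (l2n M (\<lambda>x. u (r n) x - v x)) \<le> 1 / real (Suc n) + l2n M (\<lambda>x. \<phi> (r n) x - v x)"
    proof
      fix n
      have "l2n M (\<lambda>x. u (r n) x - v x) \<le> l2n M (\<lambda>x. u (r n) x - \<phi> (r n) x) + l2n M (\<lambda>x. \<phi> (r n) x - v x)"
        by (intro l2n_triangle3 H10D u test_M \<phi> v)
      moreover have "l2n M (\<lambda>x. u (r n) x - \<phi> (r n) x) < 1 / real (Suc (r n))"
        using \<phi>(2)[of "r n"] by (simp only: l2n_minus_commute[of M "u (r n)"])
      moreover have "1 / real (Suc (r n)) \<le> 1 / real (Suc n)"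
        using seq_suble[OF r, of n] by (intro divide_left_mono) auto
      ultimately show "norm (l2n M (\<lambda>x. u (r n) x - v x)) \<le> 1 / real (Suc n) + l2n M (\<lambda>x. \<phi> (r n) x - v x)"
        by simp
    qed
    show "(\<lambda>n. 1 / real (Suc n) + l2n M (\<lambda>x. \<phi> (r n) x - v x)) \<longlonglongrightarrow> 0"
      using tendsto_add[OF LIMSEQ_Suc[OF lim_1_over_n] v(2)] by simp
  qed
  obtain s where s: "strict_mono (s :: nat \<Rightarrow> nat)" "AE x in M. (\<lambda>n. u (r (s n)) x) \<longlonglongrightarrow> v x"
    using l2_AE_subseq[OF H10D(1)[OF u] v(1) ul] by blast
  have ul': "(\<lambda>n. l2n M (\<lambda>x. u (r (s n)) x - v x)) \<longlonglongrightarrow> 0"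
    using LIMSEQ_subseq_LIMSEQ[OF ul s(1)] by (simp add: o_def)
  show thesis
  proof (rule that[OF vH])
    show "strict_mono (r \<circ> s)" by (rule strict_mono_o[OF r s(1)])
    show "AE x in M. (\<lambda>n. u ((r \<circ> s) n) x) \<longlonglongrightarrow> v x" using s(2) by simp
    show "(\<lambda>n. ip (u ((r \<circ> s) n)) w) \<longlonglongrightarrow> ip v w" if "w \<in> H10 \<Omega>" for w
      using ip_tendsto_of_L2[OF u B vH ul' that] by simp
  qed
qed

end

section \<open>Nemytskii operators\<close>

text \<open>Rounding the second argument down to multiples of \<open>1 / 2 ^ n\<close> leaves
  countably many sections, each measurable, and continuity recovers \<open>f\<close> in the limit.
  Joint measurability is needed because \<open>primitive\<close> integrates over the second
  argument.\<close>

lemma caratheodory_joint_measurable: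
  fixes f :: "'a \<Rightarrow> real \<Rightarrow> real"
  assumes m: "\<And>v. (\<lambda>x. f x v) \<in> borel_measurable M"
    and c: "\<And>x. x \<in> space M \<Longrightarrow> continuous_on UNIV (f x)"
  shows "(\<lambda>(x, t). f x t) \<in> borel_measurable (M \<Otimes>\<^sub>M borel)"
proof -
  define c where "c n t = real_of_int \<lfloor>2 ^ n * t\<rfloor> / 2 ^ n" for n :: nat and t :: real
  have "(\<lambda>p. f (fst p) (c n (snd p))) \<in> borel_measurable (M \<Otimes>\<^sub>M borel)" for n
  proof -
    have "(\<lambda>p. f (fst p) (real_of_int \<lfloor>2 ^ n * (snd p :: real)\<rfloor> / 2 ^ n)) \<in> borel_measurable (M \<Otimes>\<^sub>M borel)"
    proof (rule measurable_compose_countable'[where f="\<lambda>i p. f (fst p) (real_of_int i / 2 ^ n)" and I=UNIV])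
      show "(\<lambda>p. f (fst p) (real_of_int i / 2 ^ n)) \<in> borel_measurable (M \<Otimes>\<^sub>M borel)" for i
        by (rule measurable_compose[OF measurable_fst m])
    qed auto
    then show ?thesis by (simp add: c_def)
  qed
  then have "(\<lambda>p. f (fst p) (snd p)) \<in> borel_measurable (M \<Otimes>\<^sub>M borel)"
  proof (rule borel_measurable_LIMSEQ_real[rotated])
    fix p assume p: "p \<in> space (M \<Otimes>\<^sub>M (borel :: real measure))"
    have "(\<lambda>n. c n (snd p)) \<longlonglongrightarrow> snd p"
    proof -
      have "(\<lambda>n. c n (snd p) - snd p) \<longlonglongrightarrow> 0"
      proof (rule Lim_null_comparison[OF always_eventually])
        show "\<forall>n. norm (c n (snd p) - snd p) \<le> (1/2) ^ n"
        proof
          fix n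
          have "\<bar>real_of_int \<lfloor>2 ^ n * snd p\<rfloor> - 2 ^ n * snd p\<bar> \<le> 1" by linarith
          moreover have "c n (snd p) - snd p = (real_of_int \<lfloor>2 ^ n * snd p\<rfloor> - 2 ^ n * snd p) / 2 ^ n"
            by (simp add: c_def field_simps)
          ultimately show "norm (c n (snd p) - snd p) \<le> (1/2) ^ n"
            by (simp add: power_one_over divide_right_mono)
        qed
      qed (simp add: LIMSEQ_realpow_zero)
      then show ?thesis by (simp add: LIM_zero_iff)
    qed
    moreover have "isCont (f (fst p)) (snd p)"
      using c[of "fst p"] p by (auto simp: space_pair_measure continuous_on_eq_continuous_at)
    ultimately show "(\<lambda>n. f (fst p) (c n (snd p))) \<longlonglongrightarrow> f (fst p) (snd p)"
      by (rule isCont_tendsto_compose[rotated])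
  qed
  then show ?thesis by (simp add: case_prod_beta')
qed

lemma primitive_has_derivative:
  assumes "continuous_on UNIV (f x)"
  shows "(primitive f x has_real_derivative f x v) (at v)"
proof -
  define r where "r = \<bar>v\<bar> + 1"
  have r: "- r \<le> 0" "0 \<le> r" "- r \<le> v" "v \<le> r" by (auto simp: r_def)
  have "continuous_on {- r..r} (f x)" by (rule continuous_on_subset[OF assms]) simp
  from interval_integral_FTC2[OF r(1,2) this r(3,4)]
  have "((\<lambda>u. LBINT y=ereal 0..ereal u. f x y) has_vector_derivative f x v) (at v within {-r..r})" .
  then have "(primitive f x has_vector_derivative f x v) (at v within {-r..r})"
    by (simp add: primitive_def[abs_def] zero_ereal_def)
  moreover have "at v within {-r..r} = at v"
    by (rule at_within_interior) (auto simp: r_def)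
  ultimately show ?thesis
    unfolding has_real_derivative_iff_has_vector_derivative by metis
qed

lemma primitive_0[simp]: "primitive f x 0 = 0"
  by (simp add: primitive_def zero_ereal_def[symmetric])

context bounded_open
begin

text \<open>This rests on the completeness of Lebesgue measure: every subset of a null set is
  measurable.\<close>

lemma borel_measurable_AE_cong:
  fixes f g :: "'a \<Rightarrow> real"
  assumes f: "f \<in> borel_measurable M" and eq: "AE x in M. f x = g x"
  shows "g \<in> borel_measurable M"
proof -
  obtain N where N: "{x \<in> space M. f x \<noteq> g x} \<subseteq> N" "N \<in> null_sets M"
    using eq by (auto elim!: AE_E simp: null_sets_def)
  have sub: "B \<in> sets M" if "B \<subseteq> N" for B
  proof -
    have "N \<in> null_sets lebesgue" using N(2) sets_Om by (subst (asm) null_sets_restrict_space) auto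
    then have "B \<in> sets lebesgue" using completion.complete2[OF that] by auto
    moreover have "B \<subseteq> \<Omega>" using that N(2) sets.sets_into_space[of N M] by (auto simp: null_sets_def)
    ultimately show ?thesis using sets_Om by (subst sets_restrict_space_iff) auto
  qed
  have "g -` A \<inter> space M \<in> sets M" if A: "A \<in> sets borel" for A
  proof -
    have "g -` A \<inter> space M = (f -` A \<inter> space M - N) \<union> (g -` A \<inter> N \<inter> space M)"
      using N(1) by auto
    moreover have "f -` A \<inter> space M - N \<in> sets M"
      using measurable_sets[OF f A] N(2) by auto
    ultimately show ?thesis using sub[of "g -` A \<inter> N \<inter> space M"] by (simp add: sets.Un inf.coboundedI1)
  qed
  then show ?thesis by (auto simp: measurable_def)
qed

text \<open>Continuity in the second argument is known only for almost every \<open>x\<close>;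
  setting \<open>f\<close> to \<open>0\<close> on the exceptional null set makes it hold
  everywhere.\<close>

lemma caratheodory_modification:
  fixes f :: "'a \<Rightarrow> real \<Rightarrow> real"
  assumes m: "\<And>v. (\<lambda>x. f x v) \<in> borel_measurable M" and c: "AE x in M. continuous_on UNIV (f x)"
  obtains f' where "(\<lambda>(x, t). f' x t) \<in> borel_measurable (M \<Otimes>\<^sub>M borel)" "AE x in M. f' x = f x"
proof -
  obtain N where N: "{x \<in> space M. \<not> continuous_on UNIV (f x)} \<subseteq> N" "N \<in> null_sets M"
    using c by (auto elim!: AE_E simp: null_sets_def)
  have [measurable]: "N \<in> sets M" using N(2) by auto
  note [measurable] = m
  define f' where "f' x v = (if x \<in> N then 0 else f x v)" for x v
  have "(\<lambda>(x, t). f' x t) \<in> borel_measurable (M \<Otimes>\<^sub>M borel)"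
  proof (rule caratheodory_joint_measurable)
    show "(\<lambda>x. f' x v) \<in> borel_measurable M" for v unfolding f'_def by measurable
    show "continuous_on UNIV (f' x)" if "x \<in> space M" for x
      using that N(1) by (cases "x \<in> N") (auto simp: f'_def[abs_def])
  qed
  moreover have "AE x in M. f' x = f x"
    using AE_not_in[OF N(2)] by eventually_elim (auto simp: f'_def)
  ultimately show thesis by (rule that)
qed

lemma caratheodory_measurable:
  fixes f :: "'a \<Rightarrow> real \<Rightarrow> real"
  assumes m: "\<And>v. (\<lambda>x. f x v) \<in> borel_measurable M" and c: "AE x in M. continuous_on UNIV (f x)"
    and [measurable]: "u \<in> borel_measurable M"
  shows "(\<lambda>x. f x (u x)) \<in> borel_measurable M" "(\<lambda>x. primitive f x (u x)) \<in> borel_measurable M"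
proof -
  obtain f' where j[measurable]: "(\<lambda>(x, t). f' x t) \<in> borel_measurable (M \<Otimes>\<^sub>M borel)" and eq: "AE x in M. f' x = f x"
    using caratheodory_modification[OF m c] by blast
  have 1: "(\<lambda>x. f' x (u x)) \<in> borel_measurable M"
    using measurable_compose[OF _ j, of "\<lambda>x. (x, u x)" M] by simp
  show "(\<lambda>x. f x (u x)) \<in> borel_measurable M"
    by (rule borel_measurable_AE_cong[OF 1]) (use eq in auto)
  have [measurable]: "(\<lambda>(x, t). f' x t) \<in> borel_measurable (M \<Otimes>\<^sub>M lborel)" using j by simp
  \<comment> \<open>Both signs of \<open>v\<close> are merged into one integral over the whole line
    with a jointly measurable integrand, to which measurability of parameter integrals
    applies.\<close>
  have "primitive f' x v = (LINT t|lborel. (if 0 < t \<and> t < v then f' x t else 0) - (if v < t \<and> t < 0 then f' x t else 0))" for x v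
  proof (cases "0 \<le> v")
    case True
    then have "primitive f' x v = (LINT t|lborel. indicator {0<..<v} t *\<^sub>R f' x t)"
      by (simp add: primitive_def interval_lebesgue_integral_def set_lebesgue_integral_def zero_ereal_def)
    also have "\<dots> = (LINT t|lborel. (if 0 < t \<and> t < v then f' x t else 0) - (if v < t \<and> t < 0 then f' x t else 0))"
      using True by (intro Bochner_Integration.integral_cong) (auto simp: indicator_def)
    finally show ?thesis .
  next
    case False
    then have "primitive f' x v = - (LINT t|lborel. indicator {v<..<0} t *\<^sub>R f' x t)"
      by (simp add: primitive_def interval_lebesgue_integral_def set_lebesgue_integral_def zero_ereal_def)
    also have "\<dots> = (LINT t|lborel. - (indicator {v<..<0} t *\<^sub>R f' x t))" by simp
    also have "\<dots> = (LINT t|lborel. (if 0 < t \<and> t < v then f' x t else 0) - (if v < t \<and> t < 0 then f' x t else 0))"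
      using False by (intro Bochner_Integration.integral_cong) (auto simp: indicator_def)
    finally show ?thesis .
  qed
  then have 2: "(\<lambda>x. primitive f' x (u x)) \<in> borel_measurable M"
    by simp
  show "(\<lambda>x. primitive f x (u x)) \<in> borel_measurable M"
    by (rule borel_measurable_AE_cong[OF 2]) (use eq in \<open>auto simp: primitive_def\<close>)
qed

end

lemma powr_add_le:
  fixes a b p :: real
  assumes "a \<ge> 0" "b \<ge> 0" "p \<ge> 0"
  shows "(a + b) powr p \<le> 2 powr p * (a powr p + b powr p)"
proof -
  have "(a + b) powr p \<le> (2 * max a b) powr p"
    using assms by (intro powr_mono2) auto
  also have "\<dots> = 2 powr p * (max a b) powr p" using assms by (simp add: powr_mult)
  also have "(max a b) powr p \<le> a powr p + b powr p" by (auto simp: max_def)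
  finally show ?thesis by simp
qed

text \<open>A nonlinearity \<open>k\<close> of at most critical growth with primitive
  \<open>K\<close>. These hypotheses suffice for the integral of \<open>K x (u x)\<close> to be
  Frechet differentiable on \<open>H10 \<Omega>\<close>, with remainder controlled by
  \<open>rem_small\<close>.\<close>

locale nemytskii = sobolev_domain \<Omega> q for \<Omega> :: "'a::euclidean_space set" and q :: real +
  fixes k K :: "'a \<Rightarrow> real \<Rightarrow> real" and C :: real
  assumes k_meas: "\<And>u. u \<in> borel_measurable M \<Longrightarrow> (\<lambda>x. k x (u x)) \<in> borel_measurable M"
    and K_meas: "\<And>u. u \<in> borel_measurable M \<Longrightarrow> (\<lambda>x. K x (u x)) \<in> borel_measurable M"
    and K_0: "AE x in M. K x 0 = 0"
    and K_deriv: "AE x in M. \<forall>v. (K x has_real_derivative k x v) (at v)"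
    and C_pos: "C > 0"
    and growth: "AE x in M. \<forall>v. \<bar>k x v\<bar> \<le> C * (1 + \<bar>v\<bar> powr (q - 1))"
begin

text \<open>The conjugate exponent of \<open>q\<close>: growth of order \<open>q - 1\<close> makes
  \<open>k x (u x)\<close> integrable to the power \<open>q'\<close>, just enough to be paired with
  a \<open>q\<close>-integrable \<open>v\<close>.\<close>

definition "q' = q / (q - 1)"

lemma q': "q' > 1" "1 / q' + 1 / q = 1" "(q - 1) * q' = q"
  using q_gt_2 by (auto simp: q'_def field_simps)

lemma growth_powr:
  fixes s t :: real
  assumes "s \<ge> 0" "\<bar>t\<bar> \<le> C * (1 + s powr (q - 1))"
  shows "\<bar>t\<bar> powr q' \<le> (2 * C) powr q' * (1 + s powr q)"
proof -
  have "\<bar>t\<bar> powr q' \<le> (C * (1 + s powr (q - 1))) powr q'"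
    using assms q' by (intro powr_mono2) auto
  also have "\<dots> = C powr q' * (1 + s powr (q - 1)) powr q'" using C_pos by (simp add: powr_mult)
  also have "\<dots> \<le> C powr q' * (2 powr q' * (1 powr q' + (s powr (q - 1)) powr q'))"
    using q' by (intro mult_left_mono powr_add_le) auto
  also have "\<dots> = (2 * C) powr q' * (1 + s powr q)" using C_pos q' by (simp add: powr_mult powr_powr)
  finally show ?thesis .
qed

lemma K_mvt:
  assumes d: "\<forall>v. (K x has_real_derivative k x v) (at v)"
  obtains z where "\<bar>z\<bar> \<le> \<bar>u\<bar> + \<bar>v\<bar>" "K x (u + v) - K x u = v * k x z"
proof -
  have "\<exists>z. \<bar>z - u\<bar> \<le> \<bar>v\<bar> \<and> K x (u + v) - K x u = v * k x z"
  proof -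
    consider "v = 0" | "v > 0" | "v < 0" by linarith
    then show ?thesis
    proof cases
      case 1 then show ?thesis by (intro exI[of _ u]) auto
    next
      case 2
      have "\<exists>z>u. z < u + v \<and> K x (u + v) - K x u = (u + v - u) * k x z"
        by (rule MVT2) (use 2 d in auto)
      then obtain z where "z > u" "z < u + v" "K x (u + v) - K x u = (u + v - u) * k x z" by auto
      then show ?thesis by (intro exI[of _ z]) auto
    next
      case 3
      have "\<exists>z>u+v. z < u \<and> K x u - K x (u + v) = (u - (u + v)) * k x z"
        by (rule MVT2) (use 3 d in auto)
      then obtain z where "z > u + v" "z < u" "K x u - K x (u + v) = (u - (u + v)) * k x z" by auto
      then show ?thesis by (intro exI[of _ z]) auto
    qed
  qed
  then obtain z where "\<bar>z - u\<bar> \<le> \<bar>v\<bar>" "K x (u + v) - K x u = v * k x z" by auto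
  then show thesis by (intro that[of z]) auto
qed

lemma k_powr_integrable:
  assumes [measurable]: "u \<in> borel_measurable M" and i: "integrable M (\<lambda>x. \<bar>u x\<bar> powr q)"
  shows "integrable M (\<lambda>x. \<bar>k x (u x)\<bar> powr q')"
proof -
  interpret finite_measure M by (rule finite_measure_Om)
  note [measurable] = k_meas[of u]
  show ?thesis
  proof (rule Bochner_Integration.integrable_bound)
    show "integrable M (\<lambda>x. (2 * C) powr q' * (1 + \<bar>u x\<bar> powr q))" using i by auto
    show "AE x in M. norm (\<bar>k x (u x)\<bar> powr q') \<le> norm ((2 * C) powr q' * (1 + \<bar>u x\<bar> powr q))"
      using growth
    proof eventually_elim
      case (elim x)
      have "\<bar>k x (u x)\<bar> powr q' \<le> (2 * C) powr q' * (1 + \<bar>u x\<bar> powr q)"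
        by (rule growth_powr) (use elim in auto)
      then show ?case by simp
    qed
  qed measurable
qed

lemma k_mult_integrable:
  assumes "u \<in> H10 \<Omega>" "v \<in> H10 \<Omega>"
  shows "integrable M (\<lambda>x. k x (u x) * v x)"
    "(LINT x|M. \<bar>k x (u x) * v x\<bar>) \<le> (LINT x|M. \<bar>k x (u x)\<bar> powr q') powr (1 / q') * (LINT x|M. \<bar>v x\<bar> powr q) powr (1 / q)"
proof -
  have m: "u \<in> borel_measurable M" "v \<in> borel_measurable M"
    by (intro sqint_measurable H10D assms)+
  have "q > 1" using q_gt_2 by simp
  note H = Holder_integral[OF q'(1) this q'(2) k_meas[OF m(1)] m(2)
    k_powr_integrable[OF m(1) H10_powr_q_integrable[OF assms(1)]] H10_powr_q_integrable[OF assms(2)]]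
  show "integrable M (\<lambda>x. k x (u x) * v x)"
    "(LINT x|M. \<bar>k x (u x) * v x\<bar>) \<le> (LINT x|M. \<bar>k x (u x)\<bar> powr q') powr (1 / q') * (LINT x|M. \<bar>v x\<bar> powr q) powr (1 / q)"
    by (fact H)+
qed

lemma K_integrable:
  assumes u: "u \<in> H10 \<Omega>"
  shows "integrable M (\<lambda>x. K x (u x))"
proof -
  have um[measurable]: "u \<in> borel_measurable M" by (rule sqint_measurable[OF H10D(1)[OF u]])
  note [measurable] = K_meas[of u]
  have "integrable M (\<lambda>x. C * (\<bar>u x\<bar> + \<bar>u x\<bar> powr q))"
    using sqint_integrable1[OF H10D(1)[OF u]] H10_powr_q_integrable[OF u] by auto
  then show ?thesis
  proof (rule Bochner_Integration.integrable_bound)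
    show "AE x in M. norm (K x (u x)) \<le> norm (C * (\<bar>u x\<bar> + \<bar>u x\<bar> powr q))"
      using growth K_0 K_deriv
    proof eventually_elim
      case (elim x)
      obtain z where z: "\<bar>z\<bar> \<le> \<bar>0\<bar> + \<bar>u x\<bar>" "K x (0 + u x) - K x 0 = u x * k x z"
        using K_mvt[OF elim(3)] by blast
      have "\<bar>k x z\<bar> \<le> C * (1 + \<bar>z\<bar> powr (q - 1))" using elim(1) by blast
      also have "\<dots> \<le> C * (1 + \<bar>u x\<bar> powr (q - 1))"
        using z(1) C_pos q_gt_2 by (intro mult_left_mono add_left_mono powr_mono2) auto
      finally have "\<bar>u x\<bar> * \<bar>k x z\<bar> \<le> \<bar>u x\<bar> * (C * (1 + \<bar>u x\<bar> powr (q - 1)))"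
        by (rule mult_left_mono) simp
      also have "\<dots> = C * (\<bar>u x\<bar> + \<bar>u x\<bar> * \<bar>u x\<bar> powr (q - 1))" by (simp add: algebra_simps)
      also have "\<bar>u x\<bar> * \<bar>u x\<bar> powr (q - 1) = \<bar>u x\<bar> powr q" by (simp add: powr_mult_base)
      finally show ?case using z(2) elim(2) C_pos by (simp add: abs_mult)
    qed
  qed measurable
qed

definition rem :: "('a \<Rightarrow> real) \<Rightarrow> ('a \<Rightarrow> real) \<Rightarrow> real" where
  "rem u v = (LINT x|M. K x (u x + v x)) - (LINT x|M. K x (u x)) - (LINT x|M. k x (u x) * v x)"

text \<open>The remainder is the integral of \<open>Q n * v n\<close>, where \<open>Q n\<close> is
  the difference quotient of \<open>K\<close> minus its limit \<open>k\<close>. By Hoelder it is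
  enough that the \<open>q'\<close>-norm of \<open>Q n\<close> becomes small. On a subsequence
  \<open>v n\<close> tends to \<open>0\<close> almost everywhere, hence so does \<open>Q n\<close>,
  and its \<open>q'\<close>-th power is bounded by a fixed function plus a multiple of
  \<open>\<bar>v n x\<bar> powr q\<close>, whose integral vanishes in the limit. A single good index
  suffices, since \<open>rem_small\<close> argues by contradiction.\<close>

lemma rem_subseq:
  assumes u: "u \<in> H10 \<Omega>" and v: "\<And>n. v n \<in> H10 \<Omega>" and l: "(\<lambda>n. nrm (v n)) \<longlonglongrightarrow> 0" and \<epsilon>: "\<epsilon> > 0"
  shows "\<exists>n. \<bar>rem u (v n)\<bar> \<le> \<epsilon> * nrm (v n)"
proof -
  interpret finite_measure M by (rule finite_measure_Om)
  obtain A where A: "A > 0"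
    "\<And>u. u \<in> H10 \<Omega> \<Longrightarrow> integrable M (\<lambda>x. \<bar>u x\<bar> powr q) \<and> (LINT x|M. \<bar>u x\<bar> powr q) \<le> (A * nrm u) powr q"
    using Sobolev_H10 by blast
  have um[measurable]: "u \<in> borel_measurable M" by (rule sqint_measurable[OF H10D(1)[OF u]])
  have vm[measurable]: "v n \<in> borel_measurable M" for n by (rule sqint_measurable[OF H10D(1)[OF v]])
  have vl: "(\<lambda>n. LINT x|M. \<bar>v n x\<bar> powr q) \<longlonglongrightarrow> 0"
  proof (rule Lim_null_comparison[OF always_eventually])
    show "\<forall>n. norm (LINT x|M. \<bar>v n x\<bar> powr q) \<le> (A * nrm (v n)) powr q" using A(2)[OF v] by simp
    have "(\<lambda>n. (A * nrm (v n)) powr q) \<longlonglongrightarrow> (A * 0) powr q"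
      by (intro tendsto_powr' tendsto_mult_left l tendsto_const) (use A q_gt_2 in auto)
    then show "(\<lambda>n. (A * nrm (v n)) powr q) \<longlonglongrightarrow> 0" by simp
  qed
  have "\<exists>r::nat\<Rightarrow>nat. strict_mono r \<and> (AE x in M. (\<lambda>n. \<bar>v (r n) x\<bar> powr q) \<longlonglongrightarrow> 0)"
    by (rule tendsto_L1_AE_subseq) (use A(2)[OF v] vl in auto)
  then obtain r where r: "strict_mono (r :: nat \<Rightarrow> nat)" and rl: "AE x in M. (\<lambda>n. \<bar>v (r n) x\<bar> powr q) \<longlonglongrightarrow> 0" by blast
  define Q where "Q n x = (if v (r n) x = 0 then 0 else (K x (u x + v (r n) x) - K x (u x)) / v (r n) x - k x (u x))" for n x
  have [measurable]: "(\<lambda>x. K x (u x + v n x)) \<in> borel_measurable M" for n by (rule K_meas) measurable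
  have [measurable]: "(\<lambda>x. K x (u x)) \<in> borel_measurable M" "(\<lambda>x. k x (u x)) \<in> borel_measurable M"
    by (rule K_meas k_meas, measurable)+
  have Qm[measurable]: "Q n \<in> borel_measurable M" for n unfolding Q_def by measurable
  define G where "G = (4 * C) powr q' * 2 powr q + 1"
  define H where "H = (4 * C) powr q' + 1"
  have Qb: "AE x in M. \<bar>Q n x\<bar> powr q' \<le> G * \<bar>v (r n) x\<bar> powr q + (H + G * \<bar>u x\<bar> powr q)" for n
    using growth K_deriv
  proof eventually_elim
    case (elim x)
    define s where "s = \<bar>u x\<bar> + \<bar>v (r n) x\<bar>"
    have s0: "s \<ge> 0" by (simp add: s_def)
    have b: "\<bar>Q n x\<bar> \<le> 2 * (C * (1 + s powr (q - 1)))"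
    proof (cases "v (r n) x = 0")
      case True then show ?thesis using C_pos by (simp add: Q_def)
    next
      case False
      obtain z where z: "\<bar>z\<bar> \<le> s" "K x (u x + v (r n) x) - K x (u x) = v (r n) x * k x z"
        using K_mvt[OF elim(2)] unfolding s_def by blast
      have "\<bar>k x z\<bar> \<le> C * (1 + \<bar>z\<bar> powr (q - 1))" "\<bar>k x (u x)\<bar> \<le> C * (1 + \<bar>u x\<bar> powr (q - 1))" using elim(1) by blast+
      moreover have "C * (1 + \<bar>z\<bar> powr (q - 1)) \<le> C * (1 + s powr (q - 1))" "C * (1 + \<bar>u x\<bar> powr (q - 1)) \<le> C * (1 + s powr (q - 1))"
        using z(1) C_pos q_gt_2 by (intro mult_left_mono add_left_mono powr_mono2; simp add: s_def)+
      moreover have "Q n x = k x z - k x (u x)" using z(2) False by (simp add: Q_def)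
      ultimately show ?thesis by linarith
    qed
    \<comment> \<open>\<open>Q n x\<close> is a difference of two values of \<open>k\<close>, each
      with the growth bound; halving brings it into the form of \<open>growth_powr\<close>, and
      undoing this turns \<open>2 * C\<close> into \<open>4 * C\<close>.\<close>
    have "\<bar>Q n x / 2\<bar> powr q' \<le> (2 * C) powr q' * (1 + s powr q)"
      by (rule growth_powr[OF s0]) (use b in auto)
    then have "2 powr q' * \<bar>Q n x / 2\<bar> powr q' \<le> 2 powr q' * ((2 * C) powr q' * (1 + s powr q))"
      by (rule mult_left_mono) simp
    then have "\<bar>Q n x\<bar> powr q' \<le> (4 * C) powr q' * (1 + s powr q)"
      using C_pos by (simp add: powr_mult[symmetric] mult.assoc[symmetric])
    also have "\<dots> \<le> (4 * C) powr q' * (1 + 2 powr q * (\<bar>u x\<bar> powr q + \<bar>v (r n) x\<bar> powr q))"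
      unfolding s_def using q_gt_2 by (intro mult_left_mono add_left_mono powr_add_le) auto
    also have "\<dots> \<le> G * \<bar>v (r n) x\<bar> powr q + (H + G * \<bar>u x\<bar> powr q)"
      by (simp add: G_def H_def algebra_simps)
    finally show ?case .
  qed
  have Ql: "AE x in M. (\<lambda>n. \<bar>Q n x\<bar> powr q') \<longlonglongrightarrow> 0"
    using rl K_deriv
  proof eventually_elim
    case (elim x)
    have "(\<lambda>n. (\<bar>v (r n) x\<bar> powr q) powr (1 / q)) \<longlonglongrightarrow> 0 powr (1 / q)"
      by (intro tendsto_powr' elim tendsto_const) (use q_gt_2 in auto)
    then have vx: "(\<lambda>n. v (r n) x) \<longlonglongrightarrow> 0" using q_gt_2 by (simp add: powr_powr tendsto_rabs_zero_iff)
    define D where "D h = (if h = 0 then 0 else (K x (u x + h) - K x (u x)) / h - k x (u x))" for h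
    have "((\<lambda>h. (K x (u x + h) - K x (u x)) / h) \<longlongrightarrow> k x (u x)) (at 0)"
      using elim(2) by (simp add: DERIV_def)
    then have "((\<lambda>h. (K x (u x + h) - K x (u x)) / h - k x (u x)) \<longlongrightarrow> 0) (at 0)"
      by (simp add: LIM_zero)
    then have "(D \<longlongrightarrow> 0) (at 0)"
      by (rule Lim_transform_eventually) (auto simp: D_def eventually_at_filter)
    then have "isCont D 0" by (simp add: isCont_def D_def)
    from isCont_tendsto_compose[OF this vx] have "(\<lambda>n. Q n x) \<longlonglongrightarrow> 0" by (simp add: D_def Q_def)
    then have "(\<lambda>n. \<bar>Q n x\<bar> powr q') \<longlonglongrightarrow> \<bar>0\<bar> powr q'"
      by (intro tendsto_powr' tendsto_rabs tendsto_const) (use q' in auto)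
    then show ?case by simp
  qed
  have G: "G > 0" "H > 0" by (auto simp: G_def H_def add_nonneg_pos)
  have dom: "\<exists>k' G'. integrable M G' \<and>
       (\<forall>n. integrable M (k' n) \<and> (AE x in M. 0 \<le> k' n x \<and> \<bar>\<bar>Q n x\<bar> powr q'\<bar> \<le> k' n x + G' x)) \<and>
       (\<forall>\<^sub>F n in sequentially. (LINT x|M. k' n x) \<le> e)" if e: "e > 0" for e
  proof (intro exI conjI allI)
    show "integrable M (\<lambda>x. H + G * \<bar>u x\<bar> powr q)" using A(2)[OF u] by auto
    show "integrable M (\<lambda>x. G * \<bar>v (r n) x\<bar> powr q)" for n using A(2)[OF v] by auto
    show "AE x in M. 0 \<le> G * \<bar>v (r n) x\<bar> powr q \<and> \<bar>\<bar>Q n x\<bar> powr q'\<bar> \<le> G * \<bar>v (r n) x\<bar> powr q + (H + G * \<bar>u x\<bar> powr q)" for n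
      using Qb[of n] by eventually_elim (use G in auto)
    have "(\<lambda>n. G * (LINT x|M. \<bar>v (r n) x\<bar> powr q)) \<longlonglongrightarrow> G * 0"
      by (intro tendsto_mult_left) (use LIMSEQ_subseq_LIMSEQ[OF vl r] in \<open>simp add: o_def\<close>)
    then have "(\<lambda>n. LINT x|M. G * \<bar>v (r n) x\<bar> powr q) \<longlonglongrightarrow> 0" by simp
    from order_tendstoD(2)[OF this e]
    show "\<forall>\<^sub>F n in sequentially. (LINT x|M. G * \<bar>v (r n) x\<bar> powr q) \<le> e"
      by eventually_elim simp
  qed
  have Qi: "integrable M (\<lambda>x. \<bar>Q n x\<bar> powr q')" for n
    by (rule tendsto_integral_abs_0(1)[OF _ Ql dom]) measurable
  have "(\<lambda>n. LINT x|M. \<bar>\<bar>Q n x\<bar> powr q'\<bar>) \<longlonglongrightarrow> 0"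
    by (rule tendsto_integral_abs_0(2)[OF _ Ql dom]) measurable
  then have "(\<lambda>n. LINT x|M. \<bar>Q n x\<bar> powr q') \<longlonglongrightarrow> 0" by simp
  then have "(\<lambda>n. (LINT x|M. \<bar>Q n x\<bar> powr q') powr (1 / q')) \<longlonglongrightarrow> 0 powr (1 / q')"
    by (intro tendsto_powr' tendsto_const) (use q' in auto)
  then have "(\<lambda>n. (LINT x|M. \<bar>Q n x\<bar> powr q') powr (1 / q')) \<longlonglongrightarrow> 0" by simp
  from order_tendstoD(2)[OF this, of "\<epsilon> / A"] \<epsilon> A(1)
  obtain n where n: "(LINT x|M. \<bar>Q n x\<bar> powr q') powr (1 / q') < \<epsilon> / A"
    by (auto dest: eventually_happens)
  let ?v = "v (r n)"
  have "rem u ?v = (LINT x|M. K x (u x + ?v x) - K x (u x) - k x (u x) * ?v x)"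
    unfolding rem_def using K_integrable[OF H10_add[OF u v]] K_integrable[OF u] k_mult_integrable(1)[OF u v] by simp
  also have "\<dots> = (LINT x|M. Q n x * ?v x)"
    by (rule Bochner_Integration.integral_cong) (auto simp: Q_def field_simps)
  finally have "\<bar>rem u ?v\<bar> \<le> (LINT x|M. \<bar>Q n x * ?v x\<bar>)"
    using integral_abs_bound by metis
  also have "\<dots> \<le> (LINT x|M. \<bar>Q n x\<bar> powr q') powr (1 / q') * (LINT x|M. \<bar>?v x\<bar> powr q) powr (1 / q)"
    by (rule Holder_integral(2)) (use q' q_gt_2 Qi A(2)[OF v] in auto)
  also have "\<dots> \<le> (\<epsilon> / A) * ((A * nrm ?v) powr q) powr (1 / q)"
    using n A \<epsilon> q_gt_2 A(2)[OF v] by (intro mult_mono powr_mono2) auto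
  also have "\<dots> = \<epsilon> * nrm ?v" using A(1) q_gt_2 by (simp add: powr_powr)
  finally show ?thesis by blast
qed

lemma rem_small:
  assumes u: "u \<in> H10 \<Omega>" and \<epsilon>: "\<epsilon> > 0"
  shows "\<exists>\<delta>>0. \<forall>v\<in>H10 \<Omega>. nrm v < \<delta> \<longrightarrow> \<bar>rem u v\<bar> \<le> \<epsilon> * nrm v"
proof (rule ccontr)
  assume neg: "\<not> ?thesis"
  have "\<exists>v\<in>H10 \<Omega>. nrm v < 1 / real (Suc n) \<and> \<not> \<bar>rem u v\<bar> \<le> \<epsilon> * nrm v" for n
    using neg by (metis of_nat_0_less_iff zero_less_Suc zero_less_divide_1_iff)
  then obtain v where v: "\<And>n. v n \<in> H10 \<Omega>" "\<And>n. nrm (v n) < 1 / real (Suc n)" "\<And>n. \<not> \<bar>rem u (v n)\<bar> \<le> \<epsilon> * nrm (v n)"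
    by metis
  have "(\<lambda>n. nrm (v n)) \<longlonglongrightarrow> 0"
    by (rule Lim_null_comparison[OF always_eventually LIMSEQ_Suc[OF lim_1_over_n]]) (use v(2) in \<open>auto intro: less_imp_le\<close>)
  from rem_subseq[OF u v(1) this \<epsilon>] v(3) show False by blast
qed

end

section \<open>The energy functional\<close>

text \<open>A Frechet derivative determines the derivatives along lines. This gives the derivative
  of the fibers, and it shows that any two derivatives at \<open>u\<close> take the same value in
  direction \<open>u\<close>.\<close>

lemma has_H10_derivative_line:
  assumes d: "has_H10_derivative \<Omega> \<Phi> L u" and w: "w \<in> H10 \<Omega>"
    and sc: "\<And>c. (\<lambda>x. c * w x) \<in> H10 \<Omega>" "\<And>c. H10_norm \<Omega> (\<lambda>x. c * w x) = \<bar>c\<bar> * H10_norm \<Omega> w"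
  shows "((\<lambda>s. \<Phi> (\<lambda>x. u x + s * w x)) has_real_derivative L w) (at 0)"
proof -
  define W where "W = H10_norm \<Omega> w"
  have W0: "W \<ge> 0" by (simp add: W_def H10_norm_def)
  have Lc: "L (\<lambda>x. c * w x) = c * L w" for c
    using d w by (simp add: has_H10_derivative_def)
  have "((\<lambda>h. (\<Phi> (\<lambda>x. u x + (0 + h) * w x) - \<Phi> (\<lambda>x. u x + 0 * w x)) / h) \<longlongrightarrow> L w) (at 0)"
  proof (rule LIM_I)
    fix e :: real assume e: "e > 0"
    \<comment> \<open>The denominator \<open>W + 1\<close> instead of \<open>W\<close> also covers
      directions of norm \<open>0\<close>.\<close>
    define \<epsilon> where "\<epsilon> = e / (2 * (W + 1))"
    have \<epsilon>: "\<epsilon> > 0" "\<epsilon> * W < e"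
    proof -
      show "\<epsilon> > 0" using e W0 by (simp add: \<epsilon>_def)
      have "\<epsilon> * W \<le> \<epsilon> * (W + 1)" using \<open>\<epsilon> > 0\<close> by (intro mult_left_mono) auto
      also have "\<dots> = e / 2" using W0 by (simp add: \<epsilon>_def divide_simps)
      finally show "\<epsilon> * W < e" using e by simp
    qed
    obtain \<delta> where \<delta>: "\<delta> > 0" "\<And>v. v \<in> H10 \<Omega> \<Longrightarrow> H10_norm \<Omega> v < \<delta> \<Longrightarrow>
        \<bar>\<Phi> (\<lambda>x. u x + v x) - \<Phi> u - L v\<bar> \<le> \<epsilon> * H10_norm \<Omega> v"
      using d \<epsilon>(1) unfolding has_H10_derivative_def by blast
    show "\<exists>s>0. \<forall>h. h \<noteq> 0 \<and> norm (h - 0) < s \<longrightarrow>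
        norm ((\<Phi> (\<lambda>x. u x + (0 + h) * w x) - \<Phi> (\<lambda>x. u x + 0 * w x)) / h - L w) < e"
    proof (intro exI[of _ "\<delta> / (W + 1)"] conjI allI impI)
      show "\<delta> / (W + 1) > 0" using \<delta>(1) W0 by simp
      fix h :: real assume h: "h \<noteq> 0 \<and> norm (h - 0) < \<delta> / (W + 1)"
      have "\<bar>h\<bar> * W \<le> \<bar>h\<bar> * (W + 1)" by (intro mult_left_mono) auto
      also have "\<dots> < \<delta>" using h W0 by (simp add: pos_less_divide_eq)
      finally have "H10_norm \<Omega> (\<lambda>x. h * w x) < \<delta>" by (simp add: sc W_def)
      from \<delta>(2)[OF sc(1) this] have b: "\<bar>\<Phi> (\<lambda>x. u x + h * w x) - \<Phi> u - h * L w\<bar> \<le> \<epsilon> * (\<bar>h\<bar> * W)"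
        by (simp add: Lc sc(2) W_def)
      have "(\<Phi> (\<lambda>x. u x + (0 + h) * w x) - \<Phi> (\<lambda>x. u x + 0 * w x)) / h - L w = (\<Phi> (\<lambda>x. u x + h * w x) - \<Phi> u - h * L w) / h"
        using h by (simp add: diff_divide_distrib)
      then have "norm ((\<Phi> (\<lambda>x. u x + (0 + h) * w x) - \<Phi> (\<lambda>x. u x + 0 * w x)) / h - L w) = \<bar>\<Phi> (\<lambda>x. u x + h * w x) - \<Phi> u - h * L w\<bar> / \<bar>h\<bar>"
        by (simp add: abs_divide)
      also have "\<dots> \<le> \<epsilon> * (\<bar>h\<bar> * W) / \<bar>h\<bar>" using b by (intro divide_right_mono) auto
      also have "\<dots> = \<epsilon> * W" using h by simp
      also have "\<dots> < e" by (rule \<epsilon>(2))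
      finally show "norm ((\<Phi> (\<lambda>x. u x + (0 + h) * w x) - \<Phi> (\<lambda>x. u x + 0 * w x)) / h - L w) < e" .
    qed
  qed
  then show ?thesis by (simp add: DERIV_def)
qed

text \<open>The parameters \<open>c\<close> and \<open>p\<close> are the witnesses of
  \<open>F3\<close>, fixed once so that all growth estimates share them.\<close>

locale kirchhoff = sobolev_domain \<Omega> q for \<Omega> :: "'a::euclidean_space set" and q :: real +
  fixes a b :: real and f :: "'a \<Rightarrow> real \<Rightarrow> real" and c p :: real
  assumes dim4: "DIM('a) > 4" and a_pos: "a > 0" and b_pos: "b > 0"
    and F1: "F1 \<Omega> f" and F2: "F2 \<Omega> f" and F4: "F4 \<Omega> f"
    and c_pos: "c > 0" and p: "2 < p" "p < q"
    and f_growth: "AE x in M. \<forall>v. \<bar>f x v\<bar> \<le> c * (1 + \<bar>v\<bar> powr (p - 1))"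
    and C2_less: "a powr ((real DIM('a) - 4) / 2) * b > C2 \<Omega>"
begin

lemma q_lt_4: "q < 4"
  using dim4 by (simp add: q_eq crit_exp_def field_simps)

lemma f_meas: "(\<lambda>x. f x v) \<in> borel_measurable M"
  and f_cont: "AE x in M. continuous_on UNIV (f x)"
  using F1 by (auto simp: F1_def)

definition "k lam x v = \<bar>v\<bar> powr (q - 1) * sgn v + lam * f x v"
definition "K lam x v = \<bar>v\<bar> powr q / q + lam * primitive f x v"

text \<open>Since \<open>p < q\<close>, \<open>\<bar>v\<bar> powr (p - 1)\<close> is at most
  \<open>1 + \<bar>v\<bar> powr (q - 1)\<close>, so the subcritical term costs at most
  \<open>2 * \<bar>lam\<bar> * c\<close> times \<open>1 + \<bar>v\<bar> powr (q - 1)\<close>; the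
  remaining \<open>1\<close> is the critical term.\<close>

lemma nemytskii_k: "nemytskii \<Omega> q (k lam) (K lam) (1 + 2 * \<bar>lam\<bar> * c)"
proof unfold_locales
  show "(\<lambda>x. k lam x (u x)) \<in> borel_measurable M" if [measurable]: "u \<in> borel_measurable M" for u
  proof -
    note [measurable] = caratheodory_measurable(1)[OF f_meas f_cont that]
    show ?thesis unfolding k_def by measurable
  qed
  show "(\<lambda>x. K lam x (u x)) \<in> borel_measurable M" if [measurable]: "u \<in> borel_measurable M" for u
  proof -
    note [measurable] = caratheodory_measurable(2)[OF f_meas f_cont that]
    show ?thesis unfolding K_def by measurable
  qed
  show "AE x in M. K lam x 0 = 0" by (simp add: K_def)
  show "AE x in M. \<forall>v. (K lam x has_real_derivative k lam x v) (at v)"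
    using f_cont
  proof eventually_elim
    case (elim x)
    show ?case
    proof
      fix v
      have "((\<lambda>v. \<bar>v\<bar> powr q / q + lam * primitive f x v) has_real_derivative
          (q * (\<bar>v\<bar> powr (q - 1) * sgn v)) / q + lam * f x v) (at v)"
        by (intro DERIV_add DERIV_cdivide DERIV_cmult primitive_has_derivative elim abs_powr_deriv) (use q_gt_2 in auto)
      then show "(K lam x has_real_derivative k lam x v) (at v)"
        using q_gt_2 by (simp add: K_def[abs_def] k_def)
    qed
  qed
  show "0 < 1 + 2 * \<bar>lam\<bar> * c" using c_pos by (intro add_pos_nonneg) auto
  show "AE x in M. \<forall>v. \<bar>k lam x v\<bar> \<le> (1 + 2 * \<bar>lam\<bar> * c) * (1 + \<bar>v\<bar> powr (q - 1))"
    using f_growth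
  proof eventually_elim
    case (elim x)
    show ?case
    proof
      fix v :: real
      define y where "y = \<bar>v\<bar> powr (q - 1)"
      have y0: "y \<ge> 0" by (simp add: y_def)
      have "\<bar>v\<bar> powr (p - 1) \<le> 1 + y"
      proof (cases "\<bar>v\<bar> \<le> 1")
        case True
        then have "\<bar>v\<bar> powr (p - 1) \<le> 1" using p by (intro powr_le1) auto
        then show ?thesis using y0 by simp
      next
        case False
        then have "\<bar>v\<bar> powr (p - 1) \<le> y" unfolding y_def using p by (intro powr_mono) auto
        then show ?thesis by simp
      qed
      then have "c * (1 + \<bar>v\<bar> powr (p - 1)) \<le> c * (2 * (1 + y))"
        using c_pos y0 by (intro mult_left_mono) auto
      with elim have "\<bar>f x v\<bar> \<le> c * (2 * (1 + y))" by (meson order_trans)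
      then have "\<bar>lam\<bar> * \<bar>f x v\<bar> \<le> \<bar>lam\<bar> * (c * (2 * (1 + y)))" by (rule mult_left_mono) simp
      moreover have "\<bar>k lam x v\<bar> \<le> y + \<bar>lam\<bar> * \<bar>f x v\<bar>"
      proof -
        have "\<bar>k lam x v\<bar> \<le> \<bar>y * sgn v\<bar> + \<bar>lam * f x v\<bar>" unfolding k_def y_def by (rule abs_triangle_ineq)
        also have "\<bar>y * sgn v\<bar> \<le> y" using y0 by (simp add: abs_mult sgn_if)
        finally show ?thesis by (simp add: abs_mult)
      qed
      ultimately show "\<bar>k lam x v\<bar> \<le> (1 + 2 * \<bar>lam\<bar> * c) * (1 + \<bar>v\<bar> powr (q - 1))"
        unfolding y_def[symmetric] by (simp add: algebra_simps)
    qed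
  qed
qed

definition "Pq u = (LINT x|M. \<bar>u x\<bar> powr q)"
definition "G u = (LINT x|M. primitive f x (u x))"
definition "D u = (LINT x|M. f x (u x) * u x)"
definition "num u = a * (nrm u)\<^sup>2 + b * (nrm u) ^ 4 - Pq u"
text \<open>The derivative of the energy at \<open>u\<close> in direction \<open>v\<close>, as
  \<open>energy_has_derivative\<close> shows; setting it to \<open>0\<close> for all
  \<open>v\<close> is the weak form of the equation.\<close>

definition "L lam u v = (a + b * (nrm u)\<^sup>2) * ip u v - (LINT x|M. k lam x (u x) * v x)"

abbreviation "\<Phi> lam \<equiv> energy \<Omega> a b f lam"

lemma Pq_integrable: "u \<in> H10 \<Omega> \<Longrightarrow> integrable M (\<lambda>x. \<bar>u x\<bar> powr q)"
  by (rule H10_powr_q_integrable)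

text \<open>Removing the critical power from the integrable \<open>K 1 x (u x)\<close> leaves the
  primitive. The same device, with the instances at parameters \<open>1\<close> and
  \<open>0\<close>, isolates \<open>f\<close> below.\<close>

lemma primitive_integrable:
  assumes "u \<in> H10 \<Omega>" shows "integrable M (\<lambda>x. primitive f x (u x))"
proof -
  interpret N: nemytskii \<Omega> q "k 1" "K 1" "1 + 2 * \<bar>1\<bar> * c" by (rule nemytskii_k)
  have "integrable M (\<lambda>x. K 1 x (u x) - \<bar>u x\<bar> powr q / q)"
    using N.K_integrable[OF assms] Pq_integrable[OF assms] by auto
  then show ?thesis by (simp add: K_def)
qed

lemma f_mult_integrable:
  assumes "u \<in> H10 \<Omega>" "v \<in> H10 \<Omega>" shows "integrable M (\<lambda>x. f x (u x) * v x)"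
proof -
  interpret N1: nemytskii \<Omega> q "k 1" "K 1" "1 + 2 * \<bar>1\<bar> * c" by (rule nemytskii_k)
  interpret N0: nemytskii \<Omega> q "k 0" "K 0" "1 + 2 * \<bar>0\<bar> * c" by (rule nemytskii_k)
  have "integrable M (\<lambda>x. k 1 x (u x) * v x - k 0 x (u x) * v x)"
    using N1.k_mult_integrable(1)[OF assms] N0.k_mult_integrable(1)[OF assms] by auto
  then show ?thesis by (simp add: k_def algebra_simps)
qed

lemma energy_eq:
  "\<Phi> lam u = a / 2 * (nrm u)\<^sup>2 + b / 4 * (nrm u) ^ 4 - Pq u / q - lam * G u"
  by (simp add: energy_def q_eq[symmetric] Lq_norm_powr Pq_def G_def)

lemma energy_eq_K:
  assumes "u \<in> H10 \<Omega>"
  shows "\<Phi> lam u = a / 2 * (nrm u)\<^sup>2 + b / 4 * (nrm u) ^ 4 - (LINT x|M. K lam x (u x))"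
  using primitive_integrable[OF assms] Pq_integrable[OF assms]
  by (simp add: energy_eq K_def Pq_def G_def)

lemma energy_diff: "\<Phi> lam u = \<Phi> lam' u - (lam - lam') * G u"
  by (simp add: energy_eq algebra_simps)

text \<open>The Kirchhoff part is a polynomial in \<open>U = nrm u\<close>, \<open>V = nrm v\<close>
  and \<open>i = ip u v\<close>; after removal of its linear part all terms are of order
  \<open>V\<^sup>2\<close>. The rest of the error is the remainder of the Nemytskii
  functional.\<close>

theorem energy_has_derivative:
  assumes u: "u \<in> H10 \<Omega>"
  shows "has_H10_derivative \<Omega> (\<Phi> lam) (L lam u) u"
proof -
  define C where "C = 1 + 2 * \<bar>lam\<bar> * c"
  interpret N: nemytskii \<Omega> q "k lam" "K lam" C unfolding C_def by (rule nemytskii_k)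
  obtain A where A: "A > 0"
    "\<And>u. u \<in> H10 \<Omega> \<Longrightarrow> integrable M (\<lambda>x. \<bar>u x\<bar> powr q) \<and> (LINT x|M. \<bar>u x\<bar> powr q) \<le> (A * nrm u) powr q"
    using Sobolev_H10 by blast
  define U where "U = nrm u"
  have U0: "U \<ge> 0" by (simp add: U_def)
  define \<alpha> where "\<alpha> = a + b * U\<^sup>2"
  have \<alpha>: "\<alpha> > 0" unfolding \<alpha>_def using a_pos b_pos by (intro add_pos_nonneg) auto
  show ?thesis
    unfolding has_H10_derivative_def
  proof (intro conjI ballI allI impI)
    fix v w assume v: "v \<in> H10 \<Omega>" and w: "w \<in> H10 \<Omega>"
    show "L lam u (\<lambda>x. v x + w x) = L lam u v + L lam u w"
      using N.k_mult_integrable(1)[OF u v] N.k_mult_integrable(1)[OF u w]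
      by (simp add: L_def ip_add_right[OF v w u] distrib_left)
  next
    fix e v assume v: "v \<in> H10 \<Omega>"
    have "(LINT x|M. k lam x (u x) * (e * v x)) = e * (LINT x|M. k lam x (u x) * v x)"
      by (subst Bochner_Integration.integral_mult_right_zero[symmetric]) (simp add: mult_ac)
    then show "L lam u (\<lambda>x. e * v x) = e * L lam u v"
      by (simp add: L_def ip_cmult_right[OF v u] algebra_simps)
  next
    define \<kappa> where "\<kappa> = (LINT x|M. \<bar>k lam x (u x)\<bar> powr N.q') powr (1 / N.q')"
    have k0: "\<kappa> \<ge> 0" by (simp add: \<kappa>_def)
    have "\<bar>L lam u v\<bar> \<le> (\<alpha> * U + \<kappa> * A) * nrm v" if v: "v \<in> H10 \<Omega>" for v
    proof -
      have "\<bar>LINT x|M. k lam x (u x) * v x\<bar> \<le> (LINT x|M. \<bar>k lam x (u x) * v x\<bar>)" by (rule integral_abs_bound)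
      also have "\<dots> \<le> \<kappa> * (LINT x|M. \<bar>v x\<bar> powr q) powr (1 / q)"
        unfolding \<kappa>_def by (rule N.k_mult_integrable(2)[OF u v])
      also have "\<dots> \<le> \<kappa> * ((A * nrm v) powr q) powr (1 / q)"
        using A(2)[OF v] k0 q_gt_2 by (intro mult_left_mono powr_mono2) auto
      also have "\<dots> = \<kappa> * A * nrm v" using A(1) q_gt_2 by (simp add: powr_powr)
      finally have 1: "\<bar>LINT x|M. k lam x (u x) * v x\<bar> \<le> \<kappa> * A * nrm v" .
      have 2: "\<bar>\<alpha> * ip u v\<bar> \<le> \<alpha> * (U * nrm v)"
        using ip_bound[OF u v] \<alpha> by (simp add: abs_mult U_def)
      have "\<bar>L lam u v\<bar> \<le> \<bar>\<alpha> * ip u v\<bar> + \<bar>LINT x|M. k lam x (u x) * v x\<bar>"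
        unfolding L_def \<alpha>_def U_def by (rule abs_triangle_ineq4)
      also have "\<dots> \<le> \<alpha> * (U * nrm v) + \<kappa> * A * nrm v" using 1 2 by (rule add_mono[rotated])
      finally show ?thesis by (simp add: algebra_simps)
    qed
    then show "\<exists>B. \<forall>v\<in>H10 \<Omega>. \<bar>L lam u v\<bar> \<le> B * nrm v" by blast
  next
    fix \<epsilon> :: real assume \<epsilon>: "\<epsilon> > 0"
    obtain \<delta>1 where \<delta>1: "\<delta>1 > 0" "\<And>v. v \<in> H10 \<Omega> \<Longrightarrow> nrm v < \<delta>1 \<Longrightarrow> \<bar>N.rem u v\<bar> \<le> \<epsilon> / 2 * nrm v"
      using N.rem_small[OF u, of "\<epsilon> / 2"] \<epsilon> by auto
    \<comment> \<open>For \<open>V \<le> 1\<close> each quadratic or higher term is a multiple of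
      \<open>V\<^sup>2\<close>: \<open>\<bar>i\<bar> \<le> U * V\<close> makes
      \<open>4 * i\<^sup>2\<close> and \<open>2 * U\<^sup>2 * V\<^sup>2\<close> contribute
      \<open>6 * U\<^sup>2\<close>, the fourth power contributes \<open>1\<close>, and
      \<open>4 * i * V\<^sup>2\<close> contributes \<open>4 * U\<close>.\<close>
    define m where "m = a / 2 + b / 4 * (6 * U\<^sup>2 + 1 + 4 * U)"
    have m: "m > 0" unfolding m_def using a_pos b_pos U0 by (intro add_pos_nonneg mult_nonneg_nonneg add_nonneg_nonneg) auto
    define \<delta> where "\<delta> = min \<delta>1 (min 1 (\<epsilon> / (2 * m)))"
    show "\<exists>\<delta>>0. \<forall>v\<in>H10 \<Omega>. nrm v < \<delta> \<longrightarrow> \<bar>\<Phi> lam (\<lambda>x. u x + v x) - \<Phi> lam u - L lam u v\<bar> \<le> \<epsilon> * nrm v"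
    proof (intro exI[of _ \<delta>] conjI ballI impI)
      show "\<delta> > 0" using \<delta>1 \<epsilon> m by (simp add: \<delta>_def)
      fix v assume v: "v \<in> H10 \<Omega>" and vd: "nrm v < \<delta>"
      define V where "V = nrm v"
      have V: "V \<ge> 0" "V < \<delta>1" "V \<le> 1" "V \<le> \<epsilon> / (2 * m)" using vd by (auto simp: \<delta>_def V_def)
      define i where "i = ip u v"
      have i: "\<bar>i\<bar> \<le> U * V" unfolding i_def U_def V_def by (rule ip_bound[OF u v])
      have sq: "(nrm (\<lambda>x. u x + v x))\<^sup>2 = U\<^sup>2 + 2 * i + V\<^sup>2"
        unfolding U_def V_def i_def by (rule nrm_add_sq[OF u v])
      have p4: "x ^ 4 = (x\<^sup>2)\<^sup>2" for x :: real by (simp add: power_mult[symmetric])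
      have "\<Phi> lam (\<lambda>x. u x + v x) - \<Phi> lam u - L lam u v
          = (a / 2 * V\<^sup>2 + b / 4 * (4 * i\<^sup>2 + (V\<^sup>2)\<^sup>2 + 2 * U\<^sup>2 * V\<^sup>2 + 4 * i * V\<^sup>2)) - N.rem u v"
        unfolding energy_eq_K[OF H10_add[OF u v]] energy_eq_K[OF u] p4 sq L_def N.rem_def
          U_def[symmetric] V_def[symmetric] i_def[symmetric]
        by (simp add: power2_eq_square algebra_simps)
      moreover have "\<bar>a / 2 * V\<^sup>2 + b / 4 * (4 * i\<^sup>2 + (V\<^sup>2)\<^sup>2 + 2 * U\<^sup>2 * V\<^sup>2 + 4 * i * V\<^sup>2)\<bar> \<le> m * V\<^sup>2"
      proof -
        have V2: "V\<^sup>2 \<le> 1" using V by (simp add: power_le_one)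
        have "i\<^sup>2 \<le> U\<^sup>2 * V\<^sup>2"
          using i U0 V(1) by (metis abs_le_square_iff abs_mult abs_of_nonneg power_mult_distrib)
        moreover have "(V\<^sup>2)\<^sup>2 \<le> V\<^sup>2" using V2 by (simp add: power2_eq_square mult_left_le)
        moreover have "\<bar>i * V\<^sup>2\<bar> \<le> U * V\<^sup>2"
        proof -
          have "\<bar>i\<bar> \<le> U" using i V(3) U0 by (meson mult_left_le order_trans)
          then show ?thesis by (simp add: abs_mult mult_right_mono)
        qed
        ultimately have "\<bar>4 * i\<^sup>2 + (V\<^sup>2)\<^sup>2 + 2 * U\<^sup>2 * V\<^sup>2 + 4 * i * V\<^sup>2\<bar> \<le> (6 * U\<^sup>2 + 1 + 4 * U) * V\<^sup>2"
        proof -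
          have "(6 * U\<^sup>2 + 1 + 4 * U) * V\<^sup>2 = 4 * (U\<^sup>2 * V\<^sup>2) + V\<^sup>2 + 2 * (U\<^sup>2 * V\<^sup>2) + 4 * (U * V\<^sup>2)"
            by (simp add: algebra_simps)
          moreover have "0 \<le> i\<^sup>2" "0 \<le> (V\<^sup>2)\<^sup>2" "0 \<le> U\<^sup>2 * V\<^sup>2" by auto
          moreover assume "i\<^sup>2 \<le> U\<^sup>2 * V\<^sup>2" "(V\<^sup>2)\<^sup>2 \<le> V\<^sup>2" "\<bar>i * V\<^sup>2\<bar> \<le> U * V\<^sup>2"
          moreover have "2 * U\<^sup>2 * V\<^sup>2 = 2 * (U\<^sup>2 * V\<^sup>2)" "4 * i * V\<^sup>2 = 4 * (i * V\<^sup>2)" by auto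
          ultimately show ?thesis unfolding abs_le_iff by linarith
        qed
        then have "b / 4 * \<bar>4 * i\<^sup>2 + (V\<^sup>2)\<^sup>2 + 2 * U\<^sup>2 * V\<^sup>2 + 4 * i * V\<^sup>2\<bar> \<le> b / 4 * ((6 * U\<^sup>2 + 1 + 4 * U) * V\<^sup>2)"
          using b_pos by (intro mult_left_mono) auto
        moreover have "\<bar>a / 2 * V\<^sup>2 + b / 4 * (4 * i\<^sup>2 + (V\<^sup>2)\<^sup>2 + 2 * U\<^sup>2 * V\<^sup>2 + 4 * i * V\<^sup>2)\<bar>
            \<le> a / 2 * V\<^sup>2 + b / 4 * \<bar>4 * i\<^sup>2 + (V\<^sup>2)\<^sup>2 + 2 * U\<^sup>2 * V\<^sup>2 + 4 * i * V\<^sup>2\<bar>"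
          using a_pos b_pos
          by (intro order_trans[OF abs_triangle_ineq]) (simp add: abs_mult)
        ultimately show ?thesis by (simp add: m_def algebra_simps)
      qed
      moreover have "m * V\<^sup>2 \<le> \<epsilon> / 2 * V"
      proof -
        have "m * V \<le> \<epsilon> / 2" using V(4) m by (simp add: field_simps)
        then show ?thesis using mult_right_mono[of "m * V" "\<epsilon> / 2" V] V(1) by (simp add: power2_eq_square mult.assoc)
      qed
      moreover have "\<bar>N.rem u v\<bar> \<le> \<epsilon> / 2 * V" unfolding V_def by (rule \<delta>1(2)[OF v]) (use V in \<open>simp add: V_def\<close>)
      ultimately show "\<bar>\<Phi> lam (\<lambda>x. u x + v x) - \<Phi> lam u - L lam u v\<bar> \<le> \<epsilon> * nrm v"
        unfolding V_def[symmetric] by linarith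
    qed
  qed
qed

lemma L_self: "u \<in> H10 \<Omega> \<Longrightarrow> L lam u u = num u - lam * D u"
proof -
  assume u: "u \<in> H10 \<Omega>"
  have e: "k lam x (u x) * u x = \<bar>u x\<bar> powr q + lam * (f x (u x) * u x)" for x
  proof -
    have "\<bar>u x\<bar> powr (q - 1) * sgn (u x) * u x = \<bar>u x\<bar> * \<bar>u x\<bar> powr (q - 1)"
      by (simp add: sgn_if abs_if)
    then show ?thesis by (simp add: k_def distrib_right powr_mult_base mult.assoc)
  qed
  have "(LINT x|M. k lam x (u x) * u x) = Pq u + lam * D u"
    unfolding e Pq_def D_def using Pq_integrable[OF u] f_mult_integrable[OF u u] by simp
  then show ?thesis
    by (simp add: L_def num_def ip_self power2_eq_square power4_eq_xxxx algebra_simps)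
qed

lemma fiber_deriv:
  assumes u: "u \<in> H10 \<Omega>"
  shows "(fiber \<Omega> a b f lam u has_real_derivative L lam (\<lambda>x. t * u x) u) (at t)"
proof -
  have "((\<lambda>s. \<Phi> lam (\<lambda>x. t * u x + s * u x)) has_real_derivative L lam (\<lambda>x. t * u x) u) (at 0)"
    by (rule has_H10_derivative_line[OF energy_has_derivative[OF H10_cmult[OF u]] u H10_cmult[OF u] nrm_cmult[OF u]])
  moreover have "(\<lambda>x. t * u x + s * u x) = (\<lambda>x. (t + s) * u x)" for s by (simp add: distrib_right)
  ultimately show ?thesis by (simp add: DERIV_def fiber_def)
qed

lemma L_fiber:
  assumes u: "u \<in> H10 \<Omega>" and t: "t \<noteq> 0"
  shows "L lam (\<lambda>x. t * u x) u = (num (\<lambda>x. t * u x) - lam * D (\<lambda>x. t * u x)) / t"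
proof -
  have tu: "(\<lambda>x. t * u x) \<in> H10 \<Omega>" by (rule H10_cmult[OF u])
  have "L lam (\<lambda>x. t * u x) (\<lambda>x. t * u x) = t * L lam (\<lambda>x. t * u x) u"
    using energy_has_derivative[OF tu, of lam] u by (simp add: has_H10_derivative_def)
  then show ?thesis using L_self[OF tu, of lam] t by (simp add: field_simps)
qed

text \<open>Whatever derivative is chosen, its value at \<open>u\<close> is the derivative along the
  line through \<open>u\<close>, hence equals \<open>L lam u u\<close>.\<close>

lemma critical_iff:
  assumes u: "u \<in> H10 \<Omega>"
  shows "(\<exists>L'. has_H10_derivative \<Omega> (\<Phi> lam) L' u \<and> L' u = 0) \<longleftrightarrow> num u = lam * D u"
proof
  assume "\<exists>L'. has_H10_derivative \<Omega> (\<Phi> lam) L' u \<and> L' u = 0"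
  then obtain L' where L': "has_H10_derivative \<Omega> (\<Phi> lam) L' u" "L' u = 0" by blast
  have "L' u = L lam u u"
    by (rule DERIV_unique[OF has_H10_derivative_line[OF L'(1) u H10_cmult[OF u] nrm_cmult[OF u]]
          has_H10_derivative_line[OF energy_has_derivative[OF u] u H10_cmult[OF u] nrm_cmult[OF u]]])
  then show "num u = lam * D u" using L'(2) L_self[OF u] by simp
next
  assume "num u = lam * D u"
  then have "L lam u u = 0" using L_self[OF u] by simp
  then show "\<exists>L'. has_H10_derivative \<Omega> (\<Phi> lam) L' u \<and> L' u = 0"
    using energy_has_derivative[OF u] by blast
qed

section \<open>Positivity and growth of \<open>D\<close> and \<open>G\<close>\<close>

lemma D_pos:
  assumes "u \<in> H10_nonzero \<Omega>"
  shows "D u > 0"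
proof -
  have u: "u \<in> H10 \<Omega>" and nz: "\<not> (AE x in M. u x = 0)" using assms by (auto simp: H10_nonzero_def)
  have s: "AE x in M. \<forall>v>0. f x v > 0" "AE x in M. \<forall>v<0. f x v < 0" using F2 by (auto simp: F2_def)
  have nn: "AE x in M. 0 \<le> f x (u x) * u x"
    using s
  proof eventually_elim
    case (elim x)
    consider "u x = 0" | "u x > 0" | "u x < 0" by linarith
    then show ?case
    proof cases
      case 2
      then have "f x (u x) > 0" using elim(1) by blast
      with 2 show ?thesis by simp
    next
      case 3
      then have "f x (u x) < 0" using elim(2) by blast
      with 3 show ?thesis by (simp add: mult_neg_neg less_imp_le)
    qed simp
  qed
  have "D u \<noteq> 0"
  proof
    assume "D u = 0"
    then have "AE x in M. f x (u x) * u x = 0"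
      unfolding D_def using integral_nonneg_eq_0_iff_AE[OF f_mult_integrable[OF u u] nn] by simp
    then have "AE x in M. u x = 0" using s
    proof eventually_elim
      case (elim x)
      show ?case
      proof (rule ccontr)
        assume "u x \<noteq> 0"
        then have "f x (u x) = 0" "u x > 0 \<or> u x < 0" using elim(1) by auto
        then show False using elim(2,3) by auto
      qed
    qed
    with nz show False by simp
  qed
  moreover have "D u \<ge> 0" unfolding D_def by (rule integral_nonneg_AE[OF nn])
  ultimately show ?thesis by simp
qed

lemma f_bound:
  assumes \<eta>: "\<eta> > 0"
  obtains B where "B \<ge> 0" "AE x in M. \<forall>v. \<bar>f x v * v\<bar> \<le> \<eta> * v\<^sup>2 + B * \<bar>v\<bar> powr p"
proof -
  have "\<forall>\<^sub>F v in at 0. \<forall>x\<in>\<Omega>. dist (f x v / \<bar>v\<bar>) 0 < \<eta>"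
    using F4 \<eta> unfolding F4_def uniform_limit_iff by blast
  then obtain d where d: "d > 0" "\<And>v x. v \<noteq> 0 \<Longrightarrow> \<bar>v\<bar> < d \<Longrightarrow> x \<in> \<Omega> \<Longrightarrow> \<bar>f x v\<bar> / \<bar>v\<bar> < \<eta>"
    by (auto simp: eventually_at dist_real_def)
  \<comment> \<open>For \<open>\<bar>v\<bar> \<ge> d\<close> the constant \<open>1\<close> in the
    growth condition is at most \<open>\<bar>v\<bar> powr (p - 1) / d powr (p - 1)\<close>, so the
    whole bound becomes a multiple of \<open>\<bar>v\<bar> powr (p - 1)\<close>.\<close>
  define B where "B = c * (1 / d powr (p - 1) + 1)"
  have B: "B \<ge> 0" using c_pos by (simp add: B_def)
  have "AE x in M. x \<in> \<Omega>" by (intro AE_I2) simp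
  then have "AE x in M. \<forall>v. \<bar>f x v * v\<bar> \<le> \<eta> * v\<^sup>2 + B * \<bar>v\<bar> powr p"
    using f_growth
  proof eventually_elim
    case (elim x)
    show ?case
    proof
      fix v :: real
      consider "v = 0" | "v \<noteq> 0" "\<bar>v\<bar> < d" | "\<bar>v\<bar> \<ge> d" by linarith
      then show "\<bar>f x v * v\<bar> \<le> \<eta> * v\<^sup>2 + B * \<bar>v\<bar> powr p"
      proof cases
        case 2
        then have "\<bar>f x v\<bar> \<le> \<eta> * \<bar>v\<bar>" using d(2)[OF 2 elim(1)] by (simp add: field_simps)
        then have "\<bar>f x v\<bar> * \<bar>v\<bar> \<le> \<eta> * \<bar>v\<bar> * \<bar>v\<bar>" by (rule mult_right_mono) simp
        then have "\<bar>f x v * v\<bar> \<le> \<eta> * v\<^sup>2" by (simp add: abs_mult power2_eq_square mult.assoc)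
        moreover have "0 \<le> B * \<bar>v\<bar> powr p" using B by simp
        ultimately show ?thesis by linarith
      next
        case 3
        have "d powr (p - 1) \<le> \<bar>v\<bar> powr (p - 1)" using 3 d(1) p by (intro powr_mono2) auto
        then have "1 \<le> \<bar>v\<bar> powr (p - 1) / d powr (p - 1)" using d(1) by simp
        then have "c * (1 + \<bar>v\<bar> powr (p - 1)) \<le> c * (\<bar>v\<bar> powr (p - 1) / d powr (p - 1) + \<bar>v\<bar> powr (p - 1))"
          using c_pos by (intro mult_left_mono) auto
        also have "\<dots> = B * \<bar>v\<bar> powr (p - 1)" by (simp add: B_def algebra_simps)
        finally have "\<bar>f x v\<bar> \<le> B * \<bar>v\<bar> powr (p - 1)" using elim(2) by (meson order_trans)
        then have "\<bar>v\<bar> * \<bar>f x v\<bar> \<le> \<bar>v\<bar> * (B * \<bar>v\<bar> powr (p - 1))" by (rule mult_left_mono) simp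
        also have "\<dots> = B * (\<bar>v\<bar> * \<bar>v\<bar> powr (p - 1))" by simp
        also have "\<bar>v\<bar> * \<bar>v\<bar> powr (p - 1) = \<bar>v\<bar> powr p" by (simp add: powr_mult_base)
        finally have "\<bar>f x v * v\<bar> \<le> B * \<bar>v\<bar> powr p" by (simp add: abs_mult mult.commute)
        then show ?thesis using \<eta> by (simp add: add_increasing)
      qed (use B in auto)
    qed
  qed
  with B show thesis by (rule that)
qed

lemma D_bound:
  assumes \<eta>: "\<eta> > 0"
  obtains B where "B > 0" "\<And>u. u \<in> H10 \<Omega> \<Longrightarrow> D u \<le> \<eta> * (nrm u)\<^sup>2 + B * nrm u powr p"
proof -
  obtain C where C: "C > 0" "\<And>u. u \<in> H10 \<Omega> \<Longrightarrow> l2n M u \<le> C * nrm u" using Poincare by blast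
  obtain C' where C': "C' > 0"
    "\<And>u. u \<in> H10 \<Omega> \<Longrightarrow> integrable M (\<lambda>x. \<bar>u x\<bar> powr p) \<and> (LINT x|M. \<bar>u x\<bar> powr p) \<le> C' * nrm u powr p"
    using Lp_bound[of p] p by auto
  \<comment> \<open>Chosen so that the Poincare constant cancels and exactly \<open>\<eta>\<close>
    remains in front of \<open>(nrm u)\<^sup>2\<close>.\<close>
  define e where "e = \<eta> / C\<^sup>2"
  have e: "e > 0" using \<eta> C by (simp add: e_def)
  obtain B where B: "B \<ge> 0" "AE x in M. \<forall>v. \<bar>f x v * v\<bar> \<le> e * v\<^sup>2 + B * \<bar>v\<bar> powr p"
    using f_bound[OF e] by blast
  show thesis
  proof (rule that[of "B * C' + 1"])
    show "B * C' + 1 > 0" using B C' by (simp add: add_nonneg_pos)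
    fix u assume u: "u \<in> H10 \<Omega>"
    have i2: "integrable M (\<lambda>x. (u x)\<^sup>2)" using sqint_integrable[OF H10D(1)[OF u]] by simp
    have "D u \<le> (LINT x|M. e * (u x)\<^sup>2 + B * \<bar>u x\<bar> powr p)"
      unfolding D_def
    proof (rule integral_mono_AE)
      show "AE x in M. f x (u x) * u x \<le> e * (u x)\<^sup>2 + B * \<bar>u x\<bar> powr p"
        using B(2) by eventually_elim (metis abs_le_D1)
    qed (use f_mult_integrable[OF u u] i2 C'(2)[OF u] in auto)
    also have "\<dots> = e * (LINT x|M. (u x)\<^sup>2) + B * (LINT x|M. \<bar>u x\<bar> powr p)"
      using i2 C'(2)[OF u] by simp
    also have "(LINT x|M. (u x)\<^sup>2) = (l2n M u)\<^sup>2" by (simp add: l2n_sq)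
    also have "e * (l2n M u)\<^sup>2 \<le> e * (C * nrm u)\<^sup>2"
      using e C(2)[OF u] by (intro mult_left_mono power_mono) auto
    also have "e * (C * nrm u)\<^sup>2 = \<eta> * (nrm u)\<^sup>2" using C(1) by (simp add: e_def power_mult_distrib)
    also have "B * (LINT x|M. \<bar>u x\<bar> powr p) \<le> B * (C' * nrm u powr p)"
      using B C'(2)[OF u] by (intro mult_left_mono) auto
    also have "\<dots> \<le> (B * C' + 1) * nrm u powr p" by (simp add: algebra_simps)
    finally show "D u \<le> \<eta> * (nrm u)\<^sup>2 + (B * C' + 1) * nrm u powr p" by simp
  qed
qed

text \<open>The energy is affine in the parameter, so \<open>G\<close> is the difference of the
  energies at parameters \<open>0\<close> and \<open>1\<close>, whose fiber derivatives are
  known.\<close>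

lemma G_fiber:
  assumes u: "u \<in> H10 \<Omega>"
  shows "((\<lambda>t. G (\<lambda>x. t * u x)) has_real_derivative (LINT x|M. f x (t * u x) * u x)) (at t)"
proof -
  have "((\<lambda>t. fiber \<Omega> a b f 0 u t - fiber \<Omega> a b f 1 u t) has_real_derivative
      L 0 (\<lambda>x. t * u x) u - L 1 (\<lambda>x. t * u x) u) (at t)"
    by (intro DERIV_diff fiber_deriv u)
  moreover have "fiber \<Omega> a b f 0 u t - fiber \<Omega> a b f 1 u t = G (\<lambda>x. t * u x)" for t
    by (simp add: fiber_def energy_eq)
  moreover have "L 0 (\<lambda>x. t * u x) u - L 1 (\<lambda>x. t * u x) u = (LINT x|M. f x (t * u x) * u x)"
  proof -
    interpret N1: nemytskii \<Omega> q "k 1" "K 1" "1 + 2 * \<bar>1\<bar> * c" by (rule nemytskii_k)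
    interpret N0: nemytskii \<Omega> q "k 0" "K 0" "1 + 2 * \<bar>0\<bar> * c" by (rule nemytskii_k)
    have "L 0 (\<lambda>x. t * u x) u - L 1 (\<lambda>x. t * u x) u = (LINT x|M. k 1 x (t * u x) * u x - k 0 x (t * u x) * u x)"
      unfolding L_def using N1.k_mult_integrable(1)[OF H10_cmult[OF u, of t] u] N0.k_mult_integrable(1)[OF H10_cmult[OF u, of t] u]
      by simp
    also have "\<dots> = (LINT x|M. f x (t * u x) * u x)"
      by (intro Bochner_Integration.integral_cong) (auto simp: k_def algebra_simps)
    finally show ?thesis .
  qed
  ultimately show ?thesis by simp
qed

text \<open>The mean value theorem on the segment from \<open>0\<close> to \<open>u\<close>. It
  transfers positivity and bounds from \<open>D\<close> to \<open>G\<close> without estimating the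
  primitive itself.\<close>

lemma G_mvt:
  assumes u: "u \<in> H10 \<Omega>"
  obtains z where "0 < z" "z < 1" "G u = D (\<lambda>x. z * u x) / z"
proof -
  have "\<exists>z>0. z < 1 \<and> G (\<lambda>x. 1 * u x) - G (\<lambda>x. 0 * u x) = (1 - 0) * (LINT x|M. f x (z * u x) * u x)"
    by (rule MVT2) (use G_fiber[OF u] in auto)
  then obtain z where z: "0 < z" "z < 1" "G u - G (\<lambda>x. 0) = (LINT x|M. f x (z * u x) * u x)" by auto
  have "G (\<lambda>x. 0) = 0" by (simp add: G_def)
  moreover have "D (\<lambda>x. z * u x) = z * (LINT x|M. f x (z * u x) * u x)"
    unfolding D_def by (subst Bochner_Integration.integral_mult_right_zero[symmetric]) (simp add: mult_ac)
  ultimately show thesis using that[of z] z by simp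
qed

lemma G_pos:
  assumes "u \<in> H10_nonzero \<Omega>"
  shows "G u > 0"
proof -
  have u: "u \<in> H10 \<Omega>" using assms by (simp add: H10_nonzero_def)
  obtain z where z: "0 < z" "z < 1" "G u = D (\<lambda>x. z * u x) / z" by (rule G_mvt[OF u])
  have "D (\<lambda>x. z * u x) > 0" by (rule D_pos[OF H10_nonzero_cmult[OF assms]]) (use z in simp)
  then show ?thesis using z by simp
qed

lemma G_bound:
  assumes "\<And>u. u \<in> H10 \<Omega> \<Longrightarrow> D u \<le> \<eta> * (nrm u)\<^sup>2 + B * nrm u powr p" "\<eta> \<ge> 0" "B \<ge> 0" and u: "u \<in> H10 \<Omega>"
  shows "G u \<le> \<eta> * (nrm u)\<^sup>2 + B * nrm u powr p"
proof -
  obtain z where z: "0 < z" "z < 1" "G u = D (\<lambda>x. z * u x) / z" by (rule G_mvt[OF u])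
  have "D (\<lambda>x. z * u x) \<le> \<eta> * (z * nrm u)\<^sup>2 + B * (z * nrm u) powr p"
    using assms(1)[OF H10_cmult[OF u, of z]] z by (simp add: nrm_cmult[OF u])
  also have "\<dots> = z * (z * (\<eta> * (nrm u)\<^sup>2) + z powr (p - 1) * (B * nrm u powr p))"
    using z by (simp add: power2_eq_square powr_mult powr_diff algebra_simps)
  also have "\<dots> \<le> z * (1 * (\<eta> * (nrm u)\<^sup>2) + 1 * (B * nrm u powr p))"
    using z p assms(2,3) by (intro mult_left_mono add_mono mult_right_mono powr_le1) auto
  finally show ?thesis using z by (simp add: pos_divide_le_eq mult.commute)
qed

end

section \<open>The extremal parameter\<close>

text \<open>If \<open>y\<close> is small against \<open>x\<close>, at most
  \<open>t * \<bar>x\<bar>\<close>, the sum costs the factor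
  \<open>(1 + t) powr q = 1 + \<delta>\<close>; otherwise \<open>x\<close> is controlled by
  \<open>y\<close> and everything goes into \<open>C\<close>.\<close>

lemma abs_add_powr_le:
  fixes q \<delta> :: real
  assumes "\<delta> > 0" "q > 0"
  obtains C where "C \<ge> 0" "\<And>x y :: real. \<bar>x + y\<bar> powr q \<le> (1 + \<delta>) * \<bar>x\<bar> powr q + C * \<bar>y\<bar> powr q"
proof -
  define t where "t = (1 + \<delta>) powr (1 / q) - 1"
  have "1 powr (1 / q) < (1 + \<delta>) powr (1 / q)" using assms by (intro powr_less_mono2) auto
  then have t: "t > 0" by (simp add: t_def)
  have tq: "(1 + t) powr q = 1 + \<delta>" using assms by (simp add: t_def powr_powr)
  define C where "C = (1 / t + 1) powr q"
  show thesis
  proof (rule that[of C])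
    fix x y :: real
    show "\<bar>x + y\<bar> powr q \<le> (1 + \<delta>) * \<bar>x\<bar> powr q + C * \<bar>y\<bar> powr q"
    proof (cases "\<bar>y\<bar> \<le> t * \<bar>x\<bar>")
      case True
      then have "\<bar>x + y\<bar> \<le> (1 + t) * \<bar>x\<bar>" by (simp add: algebra_simps)
      then have "\<bar>x + y\<bar> powr q \<le> ((1 + t) * \<bar>x\<bar>) powr q" using assms by (intro powr_mono2) auto
      also have "\<dots> = (1 + \<delta>) * \<bar>x\<bar> powr q" using t by (simp add: powr_mult tq)
      finally show ?thesis by (simp add: C_def add_increasing2)
    next
      case False
      then have "\<bar>x\<bar> \<le> \<bar>y\<bar> / t" using t by (simp add: field_simps)
      then have "\<bar>x + y\<bar> \<le> (1 / t + 1) * \<bar>y\<bar>" by (simp add: algebra_simps)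
      then have "\<bar>x + y\<bar> powr q \<le> ((1 / t + 1) * \<bar>y\<bar>) powr q" using assms by (intro powr_mono2) auto
      also have "\<dots> = C * \<bar>y\<bar> powr q" using t by (simp add: powr_mult C_def)
      finally show ?thesis using assms by (simp add: add_increasing)
    qed
  qed (simp add: C_def)
qed

text \<open>As \<open>2 < p < 4\<close>, the square beats \<open>V powr p\<close> near
  \<open>0\<close> and the fourth power beats it at infinity; each comparison alone gives one end of
  the band.\<close>

lemma quartic_band:
  fixes c C p :: real
  assumes c: "c > 0" "C > 0" and p: "2 < p" "p < 4"
  obtains r R where "r > 0" "\<And>V. V > 0 \<Longrightarrow> c * (V\<^sup>2 + V ^ 4) \<le> C * V powr p \<Longrightarrow> r \<le> V \<and> V \<le> R"
proof (rule that[of "(c / C) powr (1 / (p - 2))" "(C / c) powr (1 / (4 - p))"])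
  fix V :: real assume V: "V > 0" and le: "c * (V\<^sup>2 + V ^ 4) \<le> C * V powr p"
  have V2: "V\<^sup>2 = V powr 2" and V4: "V ^ 4 = V powr 4" using V by simp_all
  have le': "c * V powr 2 + c * V powr 4 \<le> C * V powr p" using le unfolding V2 V4 distrib_left .
  have nn: "0 \<le> c * V powr 2" "0 \<le> c * V powr 4" using c(1) by auto
  have "c * V powr 2 \<le> C * V powr p" using le' nn by linarith
  then have "c / C \<le> V powr (p - 2)"
    using c V by (simp add: powr_diff field_simps)
  then have "(c / C) powr (1 / (p - 2)) \<le> (V powr (p - 2)) powr (1 / (p - 2))"
    using c p by (intro powr_mono2) auto
  moreover have "c * V powr 4 \<le> C * V powr p" using le' nn by linarith
  then have "V powr (4 - p) \<le> C / c"
    using c V by (simp add: powr_diff field_simps)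
  then have "(V powr (4 - p)) powr (1 / (4 - p)) \<le> (C / c) powr (1 / (4 - p))"
    using c p by (intro powr_mono2) auto
  ultimately show "(c / C) powr (1 / (p - 2)) \<le> V \<and> V \<le> (C / c) powr (1 / (4 - p))"
    using V p by (simp add: powr_powr)
qed (use c in auto)

context kirchhoff
begin

text \<open>The constant \<open>C2\<close> is the one for which \<open>a + b A \<ge> S powr (- q / 2) * A powr (2 / (N - 2))\<close>
  by the weighted arithmetic-geometric mean inequality; the strict inequality leaves room for \<open>\<delta>\<close>.\<close>

lemma quadratic_lower_bound:
  obtains \<delta> where "\<delta> > 0"
    "\<And>A. A \<ge> 0 \<Longrightarrow> \<delta> * (A + A\<^sup>2) + (1 + \<delta>) * (S powr (- (q / 2)) * A powr (q / 2)) \<le> a * A + b * A\<^sup>2"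
proof -
  define N where "N = real DIM('a)"
  have N: "N > 4" using dim4 by (simp add: N_def)
  define \<tau> where "\<tau> = 2 / (N - 2)"
  have \<tau>: "\<tau> > 0" "\<tau> < 1" using N by (auto simp: \<tau>_def)
  have \<tau>1: "1 - \<tau> = (N - 4) / (N - 2)" using N by (simp add: \<tau>_def field_simps)
  have half: "x / 2 * (2 / y) = x / y" for x y :: real by simp
  have q2: "q / 2 = 1 + \<tau>" "q / 2 = N / 2 * \<tau>"
    using N by (simp_all add: q_eq crit_exp_def N_def[symmetric] \<tau>_def field_simps)
  define \<kappa> where "\<kappa> = S powr (- (q / 2))"
  have \<kappa>: "\<kappa> > 0" using S_pos by (simp add: \<kappa>_def)
  \<comment> \<open>\<open>h \<delta> \<ge> 0\<close> is what Young's inequality needs once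
    \<open>\<delta>\<close> has been taken from both \<open>a\<close> and \<open>b\<close> and
    \<open>\<kappa>\<close> enlarged by \<open>1 + \<delta>\<close>. The assumption on
    \<open>C2\<close>, raised to the power \<open>\<tau>\<close>, says exactly
    \<open>h 0 > 0\<close>, and continuity supplies a small positive
    \<open>\<delta>\<close>.\<close>
  define h where "h \<delta> = ((a - \<delta>) / (1 - \<tau>)) powr (1 - \<tau>) * ((b - \<delta>) / \<tau>) powr \<tau> - (1 + \<delta>) * \<kappa>" for \<delta>
  have "h 0 > 0"
  proof -
    have C2: "C2 \<Omega> = 2 * (N - 4) powr ((N - 4) / 2) / ((N - 2) powr ((N - 2) / 2) * S powr (N / 2))"
      by (simp add: C2_def Let_def N_def S_def)
    have "C2 \<Omega> powr \<tau> < (a powr ((N - 4) / 2) * b) powr \<tau>"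
      using C2_less \<tau> N S_pos unfolding N_def[symmetric]
      by (intro powr_less_mono2) (auto simp: C2)
    also have "(a powr ((N - 4) / 2) * b) powr \<tau> = a powr ((N - 4) / 2 * \<tau>) * b powr \<tau>"
      using b_pos by (simp add: powr_mult powr_powr)
    also have "(N - 4) / 2 * \<tau> = 1 - \<tau>" unfolding \<tau>1 unfolding \<tau>_def by (rule half)
    finally have 1: "C2 \<Omega> powr \<tau> < a powr (1 - \<tau>) * b powr \<tau>" .
    have "C2 \<Omega> powr \<tau> = 2 powr \<tau> * (N - 4) powr ((N - 4) / 2 * \<tau>) / ((N - 2) powr ((N - 2) / 2 * \<tau>) * S powr (N / 2 * \<tau>))"
      unfolding C2 using N S_pos by (simp add: powr_mult powr_divide powr_powr)
    also have "(N - 4) / 2 * \<tau> = 1 - \<tau>" unfolding \<tau>1 unfolding \<tau>_def by (rule half)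
    also have "(N - 2) / 2 * \<tau> = 1" using N by (simp add: \<tau>_def)
    also have "N / 2 * \<tau> = q / 2" using q2 by simp
    also have "2 powr \<tau> * (N - 4) powr (1 - \<tau>) / ((N - 2) powr 1 * S powr (q / 2)) = (1 - \<tau>) powr (1 - \<tau>) * \<tau> powr \<tau> * \<kappa>"
    proof -
      have "(1 - \<tau>) powr (1 - \<tau>) * \<tau> powr \<tau> = (N - 4) powr (1 - \<tau>) / (N - 2) powr (1 - \<tau>) * (2 powr \<tau> / (N - 2) powr \<tau>)"
        using N by (simp add: \<tau>1[symmetric] powr_divide[symmetric]) (simp add: \<tau>1 \<tau>_def)
      also have "\<dots> = (N - 4) powr (1 - \<tau>) * 2 powr \<tau> / ((N - 2) powr (1 - \<tau>) * (N - 2) powr \<tau>)" by simp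
      also have "(N - 2) powr (1 - \<tau>) * (N - 2) powr \<tau> = (N - 2) powr 1" by (simp add: powr_add[symmetric])
      finally show ?thesis by (simp add: \<kappa>_def powr_minus divide_simps)
    qed
    finally have "(1 - \<tau>) powr (1 - \<tau>) * \<tau> powr \<tau> * \<kappa> < a powr (1 - \<tau>) * b powr \<tau>" using 1 by simp
    then have "\<kappa> < a powr (1 - \<tau>) * b powr \<tau> / ((1 - \<tau>) powr (1 - \<tau>) * \<tau> powr \<tau>)"
      using \<tau> by (simp add: pos_less_divide_eq mult.commute)
    then show ?thesis using \<tau> a_pos b_pos by (simp add: h_def powr_divide)
  qed
  moreover have "(h \<longlongrightarrow> h 0) (at_right 0)"
    unfolding h_def using \<tau> a_pos b_pos by (intro tendsto_intros) auto
  ultimately have "\<forall>\<^sub>F \<delta> in at_right 0. 0 < h \<delta>" by (rule order_tendstoD(1)[rotated])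
  moreover have "\<forall>\<^sub>F \<delta> in at_right 0. \<delta> \<in> {0<..<min a b}"
    by (rule eventually_at_right_real) (use a_pos b_pos in auto)
  ultimately have "\<forall>\<^sub>F \<delta> in at_right 0. 0 < h \<delta> \<and> \<delta> \<in> {0<..<min a b}" by (rule eventually_conj)
  then obtain \<delta> where \<delta>: "0 < h \<delta>" "\<delta> > 0" "\<delta> < a" "\<delta> < b"
    by (auto dest!: eventually_happens simp: trivial_limit_at_right_real)
  show thesis
  proof (rule that[OF \<delta>(2)])
    fix A :: real assume "A \<ge> 0"
    show "\<delta> * (A + A\<^sup>2) + (1 + \<delta>) * (S powr (- (q / 2)) * A powr (q / 2)) \<le> a * A + b * A\<^sup>2"
    proof (cases "A = 0")
      case False
      with \<open>A \<ge> 0\<close> have A: "A > 0" by simp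
      have "((a - \<delta>) / (1 - \<tau>)) powr (1 - \<tau>) * ((b - \<delta>) * A / \<tau>) powr \<tau>
          \<le> (1 - \<tau>) * ((a - \<delta>) / (1 - \<tau>)) + \<tau> * ((b - \<delta>) * A / \<tau>)"
        by (rule Youngs_inequality_0) (use \<tau> \<delta> A in auto)
      also have "\<dots> = (a - \<delta>) + (b - \<delta>) * A" using \<tau> by simp
      finally have y: "((a - \<delta>) / (1 - \<tau>)) powr (1 - \<tau>) * ((b - \<delta>) * A / \<tau>) powr \<tau> \<le> (a - \<delta>) + (b - \<delta>) * A" .
      have "(1 + \<delta>) * \<kappa> * A powr \<tau> \<le> ((a - \<delta>) / (1 - \<tau>)) powr (1 - \<tau>) * ((b - \<delta>) / \<tau>) powr \<tau> * A powr \<tau>"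
        using \<delta>(1) by (intro mult_right_mono) (auto simp: h_def)
      also have "\<dots> = ((a - \<delta>) / (1 - \<tau>)) powr (1 - \<tau>) * ((b - \<delta>) * A / \<tau>) powr \<tau>"
        using A \<delta> \<tau> by (simp add: powr_mult powr_divide)
      finally have "(1 + \<delta>) * \<kappa> * A powr \<tau> \<le> (a - \<delta>) + (b - \<delta>) * A" using y by linarith
      then have "(1 + \<delta>) * \<kappa> * A powr \<tau> * A \<le> ((a - \<delta>) + (b - \<delta>) * A) * A"
        using A by (intro mult_right_mono) auto
      moreover have e: "A powr \<tau> * A = A powr (q / 2)" unfolding q2(1) using A by (simp add: powr_add)
      have "(1 + \<delta>) * \<kappa> * A powr \<tau> * A = (1 + \<delta>) * (\<kappa> * A powr (q / 2))"
        unfolding e[symmetric] by simp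
      moreover have "((a - \<delta>) + (b - \<delta>) * A) * A = a * A + b * A\<^sup>2 - \<delta> * (A + A\<^sup>2)"
        by (simp add: algebra_simps power2_eq_square)
      ultimately show ?thesis unfolding \<kappa>_def[symmetric] by linarith
    qed simp
  qed
qed

lemma num_lower_bound:
  obtains \<delta> where "\<delta> > 0"
    "\<And>u. u \<in> H10 \<Omega> \<Longrightarrow> \<delta> * ((nrm u)\<^sup>2 + nrm u ^ 4) + (1 + \<delta>) * Pq u \<le> a * (nrm u)\<^sup>2 + b * nrm u ^ 4"
proof -
  obtain \<delta> where \<delta>: "\<delta> > 0"
    "\<And>A. A \<ge> 0 \<Longrightarrow> \<delta> * (A + A\<^sup>2) + (1 + \<delta>) * (S powr (- (q / 2)) * A powr (q / 2)) \<le> a * A + b * A\<^sup>2"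
    using quadratic_lower_bound by blast
  show thesis
  proof (rule that[OF \<delta>(1)])
    fix u assume u: "u \<in> H10 \<Omega>"
    have "((nrm u)\<^sup>2)\<^sup>2 = nrm u ^ 4" by (simp add: power_mult[symmetric])
    then have 1: "\<delta> * ((nrm u)\<^sup>2 + nrm u ^ 4) + (1 + \<delta>) * (S powr (- (q / 2)) * nrm u powr q) \<le> a * (nrm u)\<^sup>2 + b * nrm u ^ 4"
      using \<delta>(2)[of "(nrm u)\<^sup>2"] by (simp add: square_powr_half)
    have "(1 + \<delta>) * Pq u \<le> (1 + \<delta>) * (S powr (- (q / 2)) * nrm u powr q)"
      using S_ineq[OF u] \<delta>(1) unfolding Pq_def by (intro mult_left_mono) auto
    with 1 show "\<delta> * ((nrm u)\<^sup>2 + nrm u ^ 4) + (1 + \<delta>) * Pq u \<le> a * (nrm u)\<^sup>2 + b * nrm u ^ 4" by linarith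
  qed
qed

lemma Pq_nonneg: "Pq u \<ge> 0"
  by (simp add: Pq_def)

lemma num_coercive:
  obtains \<delta> where "\<delta> > 0" "\<And>u. u \<in> H10 \<Omega> \<Longrightarrow> \<delta> * ((nrm u)\<^sup>2 + nrm u ^ 4) \<le> num u"
proof -
  obtain \<delta> where \<delta>: "\<delta> > 0"
    "\<And>u. u \<in> H10 \<Omega> \<Longrightarrow> \<delta> * ((nrm u)\<^sup>2 + nrm u ^ 4) + (1 + \<delta>) * Pq u \<le> a * (nrm u)\<^sup>2 + b * nrm u ^ 4"
    using num_lower_bound by blast
  show thesis
  proof (rule that[OF \<delta>(1)])
    fix u assume u: "u \<in> H10 \<Omega>"
    have "Pq u \<le> (1 + \<delta>) * Pq u" using \<delta>(1) Pq_nonneg[of u] by (simp add: algebra_simps)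
    then show "\<delta> * ((nrm u)\<^sup>2 + nrm u ^ 4) \<le> num u" using \<delta>(2)[OF u] unfolding num_def by linarith
  qed
qed

lemma H10_nonzeroD: "u \<in> H10_nonzero \<Omega> \<Longrightarrow> u \<in> H10 \<Omega>"
  by (simp add: H10_nonzero_def)

text \<open>With \<open>\<eta> = e / (2 * lam)\<close> the quadratic part of the bound for
  \<open>D\<close> or \<open>G\<close> is absorbed by half of the left side, and
  \<open>quartic_band\<close> applies to the other half. The case with \<open>D\<close> confines
  minimizing sequences of \<open>num / D\<close>, the case with \<open>G\<close> the zeros of the
  energy.\<close>

lemma norm_band:
  assumes e: "e > 0" and lam: "lam > 0"
  obtains r R where "r > 0"
    "\<And>u. u \<in> H10_nonzero \<Omega> \<Longrightarrow> e * ((nrm u)\<^sup>2 + nrm u ^ 4) \<le> lam * D u \<or> e * ((nrm u)\<^sup>2 + nrm u ^ 4) \<le> lam * G u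
       \<Longrightarrow> r \<le> nrm u \<and> nrm u \<le> R"
proof -
  define \<eta> where "\<eta> = e / (2 * lam)"
  have \<eta>: "\<eta> > 0" using e lam by (simp add: \<eta>_def)
  obtain B where B: "B > 0" "\<And>u. u \<in> H10 \<Omega> \<Longrightarrow> D u \<le> \<eta> * (nrm u)\<^sup>2 + B * nrm u powr p"
    using D_bound[OF \<eta>] by blast
  have GB: "G u \<le> \<eta> * (nrm u)\<^sup>2 + B * nrm u powr p" if "u \<in> H10 \<Omega>" for u
    by (rule G_bound[OF B(2) _ _ that]) (use \<eta> B in auto)
  obtain r R where r: "r > 0" "\<And>V. V > 0 \<Longrightarrow> e / 2 * (V\<^sup>2 + V ^ 4) \<le> lam * B * V powr p \<Longrightarrow> r \<le> V \<and> V \<le> R"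
    using quartic_band[of "e / 2" "lam * B" p] e lam B p q_lt_4 by auto
  show thesis
  proof (rule that[OF r(1)])
    fix u assume u: "u \<in> H10_nonzero \<Omega>"
      and "e * ((nrm u)\<^sup>2 + nrm u ^ 4) \<le> lam * D u \<or> e * ((nrm u)\<^sup>2 + nrm u ^ 4) \<le> lam * G u"
    moreover have "lam * D u \<le> lam * (\<eta> * (nrm u)\<^sup>2 + B * nrm u powr p)" "lam * G u \<le> lam * (\<eta> * (nrm u)\<^sup>2 + B * nrm u powr p)"
      using B(2)[OF H10_nonzeroD[OF u]] GB[OF H10_nonzeroD[OF u]] lam by (auto intro: mult_left_mono)
    ultimately have "e * ((nrm u)\<^sup>2 + nrm u ^ 4) \<le> lam * (\<eta> * (nrm u)\<^sup>2 + B * nrm u powr p)" by linarith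
    also have "\<dots> = e / 2 * (nrm u)\<^sup>2 + lam * B * nrm u powr p" using lam by (simp add: \<eta>_def algebra_simps)
    also have "\<dots> \<le> e / 2 * ((nrm u)\<^sup>2 + nrm u ^ 4) + lam * B * nrm u powr p"
      using e by simp
    finally have "e / 2 * ((nrm u)\<^sup>2 + nrm u ^ 4) \<le> lam * B * nrm u powr p" by simp
    then show "r \<le> nrm u \<and> nrm u \<le> R" using r(2)[OF nrm_pos(1)[OF u]] by blast
  qed
qed

section \<open>The infimum of \<open>num / D\<close> and its attainment\<close>

definition "Lam = (INF u\<in>H10_nonzero \<Omega>. num u / D u)"

text \<open>Because \<open>2 < p < 4\<close>, the bound of \<open>D\<close> is at most
  \<open>1 + B\<close> times \<open>V\<^sup>2 + V ^ 4\<close>, the quantity that coercivity puts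
  below \<open>num\<close>. The common lower bound \<open>\<delta> / (1 + B)\<close> of the
  quotients also makes the real infimum a genuine lower bound.\<close>

lemma Lam_pos: "Lam > 0"
  and Lam_le: "u \<in> H10_nonzero \<Omega> \<Longrightarrow> Lam * D u \<le> num u"
proof -
  obtain \<delta> where \<delta>: "\<delta> > 0" "\<And>u. u \<in> H10 \<Omega> \<Longrightarrow> \<delta> * ((nrm u)\<^sup>2 + nrm u ^ 4) \<le> num u"
    using num_coercive by blast
  obtain B where B: "B > 0" "\<And>u. u \<in> H10 \<Omega> \<Longrightarrow> D u \<le> 1 * (nrm u)\<^sup>2 + B * nrm u powr p"
    using D_bound[of 1] by auto
  have lower: "\<delta> / (1 + B) \<le> num u / D u" if u: "u \<in> H10_nonzero \<Omega>" for u
  proof -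
    define V where "V = nrm u"
    have V: "V > 0" using nrm_pos(1)[OF u] by (simp add: V_def)
    have "V powr p \<le> V\<^sup>2 + V ^ 4"
    proof (cases "V \<le> 1")
      case True
      then have "V powr p \<le> V powr 2" using V p by (intro powr_mono') auto
      then show ?thesis using V by (simp add: add_increasing2)
    next
      case False
      then have "V powr p \<le> V powr 4" using p q_lt_4 by (intro powr_mono) auto
      then show ?thesis using V by (simp add: add_increasing)
    qed
    then have "B * V powr p \<le> B * (V\<^sup>2 + V ^ 4)" using B(1) by (intro mult_left_mono) auto
    moreover have "D u \<le> V\<^sup>2 + B * V powr p" using B(2)[OF H10_nonzeroD[OF u]] by (simp add: V_def)
    moreover have "V\<^sup>2 \<le> V\<^sup>2 + V ^ 4" by simp
    ultimately have "D u \<le> (V\<^sup>2 + V ^ 4) + B * (V\<^sup>2 + V ^ 4)" by linarith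
    then have "D u \<le> (1 + B) * (V\<^sup>2 + V ^ 4)" by (simp add: distrib_right)
    then have "\<delta> / (1 + B) * D u \<le> \<delta> / (1 + B) * ((1 + B) * (V\<^sup>2 + V ^ 4))"
      using \<delta>(1) B(1) by (intro mult_left_mono) auto
    also have "\<dots> = \<delta> * (V\<^sup>2 + V ^ 4)" using B(1) by simp
    also have "\<dots> \<le> num u" using \<delta>(2)[OF H10_nonzeroD[OF u]] by (simp add: V_def)
    finally show ?thesis using D_pos[OF u] by (simp add: pos_le_divide_eq)
  qed
  have "\<delta> / (1 + B) \<le> Lam"
    unfolding Lam_def by (rule cINF_greatest[OF H10_nonzero_nonempty lower])
  moreover have "\<delta> / (1 + B) > 0" using \<delta> B by simp
  ultimately show "Lam > 0" by linarith
  show "Lam * D u \<le> num u" if u: "u \<in> H10_nonzero \<Omega>"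
  proof -
    have "Lam \<le> num u / D u"
      unfolding Lam_def by (rule cINF_lower[OF bdd_belowI[of _ "\<delta> / (1 + B)"] u]) (use lower in auto)
    then show ?thesis using D_pos[OF u] by (simp add: pos_le_divide_eq)
  qed
qed

text \<open>Subcriticality replaces compactness at the critical exponent: as \<open>p < q\<close>,
  the integrand is bounded by a constant plus a small multiple of
  \<open>\<bar>u n x\<bar> powr q\<close>, and the integrals of the latter are bounded by the
  Sobolev inequality. This is the moving majorant of \<open>tendsto_integral_abs_0\<close>.\<close>

lemma D_tendsto:
  assumes u: "\<And>n. u n \<in> H10 \<Omega>" and B: "\<And>n. nrm (u n) \<le> B" and v: "v \<in> H10 \<Omega>"
    and l: "AE x in M. (\<lambda>n. u n x) \<longlonglongrightarrow> v x"
  shows "(\<lambda>n. D (u n)) \<longlonglongrightarrow> D v"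
proof -
  interpret finite_measure M by (rule finite_measure_Om)
  obtain A where A: "A > 0"
    "\<And>u. u \<in> H10 \<Omega> \<Longrightarrow> integrable M (\<lambda>x. \<bar>u x\<bar> powr q) \<and> (LINT x|M. \<bar>u x\<bar> powr q) \<le> (A * nrm u) powr q"
    using Sobolev_H10 by blast
  define g where "g n x = f x (u n x) * u n x - f x (v x) * v x" for n x
  have gi: "integrable M (g n)" for n
    unfolding g_def by (intro Bochner_Integration.integrable_diff f_mult_integrable u v)
  have gm[measurable]: "g n \<in> borel_measurable M" for n using gi by auto
  have vi: "integrable M (\<lambda>x. \<bar>f x (v x) * v x\<bar>)" by (intro integrable_abs f_mult_integrable v)
  have g0: "AE x in M. (\<lambda>n. g n x) \<longlonglongrightarrow> 0"
    using l f_cont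
  proof eventually_elim
    case (elim x)
    have "isCont (f x) (v x)" using elim(2) by (simp add: continuous_on_eq_continuous_at)
    from isCont_tendsto_compose[OF this elim(1)]
    have "(\<lambda>n. g n x) \<longlonglongrightarrow> f x (v x) * v x - f x (v x) * v x"
      unfolding g_def by (intro tendsto_intros elim(1))
    then show ?case by simp
  qed
  have dom: "\<exists>k' G'. integrable M G' \<and>
       (\<forall>n. integrable M (k' n) \<and> (AE x in M. 0 \<le> k' n x \<and> \<bar>g n x\<bar> \<le> k' n x + G' x)) \<and>
       (\<forall>\<^sub>F n in sequentially. (LINT x|M. k' n x) \<le> e)" if e: "e > 0" for e
  proof -
    \<comment> \<open>\<open>Y\<close> bounds all integrals of
      \<open>\<bar>u n x\<bar> powr q\<close>; the summand \<open>1\<close> keeps it positive, and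
      \<open>\<epsilon>\<close> is then such that \<open>2 * c * \<epsilon> * Y = e\<close>.\<close>
    define Y where "Y = (A * B) powr q + 1"
    have Y: "Y > 0" by (simp add: Y_def add_nonneg_pos)
    define \<epsilon> where "\<epsilon> = e / (2 * c * Y)"
    have \<epsilon>: "\<epsilon> > 0" using e c_pos Y by (simp add: \<epsilon>_def)
    \<comment> \<open>The point at which \<open>s powr p\<close> and
      \<open>\<epsilon> * s powr q\<close> coincide; beyond it the critical power dominates, below
      it \<open>s0 powr p\<close> does.\<close>
    define s0 where "s0 = (1 / \<epsilon>) powr (1 / (q - p))"
    have s0: "s0 > 0" using \<epsilon> by (simp add: s0_def)
    have pq: "s powr p \<le> \<epsilon> * s powr q + s0 powr p" if s: "s \<ge> 0" for s
    proof (cases "s \<le> s0")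
      case True
      then have "s powr p \<le> s0 powr p" using s p by (intro powr_mono2) auto
      then show ?thesis using \<epsilon> by (simp add: add_increasing)
    next
      case False
      then have "s0 powr (q - p) \<le> s powr (q - p)" using s0 p by (intro powr_mono2) auto
      moreover have "s0 powr (q - p) = 1 / \<epsilon>" using p \<epsilon> by (simp add: s0_def powr_powr)
      ultimately have "1 \<le> \<epsilon> * s powr (q - p)" using \<epsilon> by (simp add: field_simps)
      then have "s powr p * 1 \<le> s powr p * (\<epsilon> * s powr (q - p))" by (intro mult_left_mono) auto
      also have "\<dots> = \<epsilon> * s powr q" using False s0 by (simp add: powr_diff)
      finally show ?thesis by (simp add: add_increasing2)
    qed
    have s1: "s \<le> 1 + s powr p" if "s \<ge> 0" for s :: real
    proof (cases "s \<le> 1")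
      case False
      then have "s powr 1 \<le> s powr p" using p by (intro powr_mono) auto
      then show ?thesis using False by simp
    qed (simp add: add_increasing2)
    show ?thesis
    proof (intro exI conjI allI)
      show "integrable M (\<lambda>x. c * (1 + 2 * s0 powr p) + \<bar>f x (v x) * v x\<bar>)" using vi by auto
      show "integrable M (\<lambda>x. 2 * c * \<epsilon> * \<bar>u n x\<bar> powr q)" for n using A(2)[OF u] by auto
      show "AE x in M. 0 \<le> 2 * c * \<epsilon> * \<bar>u n x\<bar> powr q \<and>
          \<bar>g n x\<bar> \<le> 2 * c * \<epsilon> * \<bar>u n x\<bar> powr q + (c * (1 + 2 * s0 powr p) + \<bar>f x (v x) * v x\<bar>)" for n
        using f_growth
      proof eventually_elim
        case (elim x)
        define s where "s = \<bar>u n x\<bar>"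
        have s: "s \<ge> 0" by (simp add: s_def)
        have "\<bar>f x (u n x) * u n x\<bar> \<le> c * (1 + s powr (p - 1)) * s"
          unfolding abs_mult s_def using elim by (intro mult_right_mono) auto
        also have "\<dots> = c * (s + s * s powr (p - 1))" by (simp add: algebra_simps)
        also have "s * s powr (p - 1) = s powr p" using s by (simp add: powr_mult_base)
        also have "c * (s + s powr p) \<le> c * (1 + 2 * (\<epsilon> * s powr q + s0 powr p))"
          using s1[OF s] pq[OF s] c_pos by (intro mult_left_mono) auto
        finally have "\<bar>f x (u n x) * u n x\<bar> \<le> 2 * c * \<epsilon> * s powr q + c * (1 + 2 * s0 powr p)"
          by (simp add: algebra_simps)
        moreover have "\<bar>g n x\<bar> \<le> \<bar>f x (u n x) * u n x\<bar> + \<bar>f x (v x) * v x\<bar>"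
          unfolding g_def by (rule abs_triangle_ineq4)
        ultimately show ?case using c_pos \<epsilon> by (simp add: s_def)
      qed
      have "(LINT x|M. 2 * c * \<epsilon> * \<bar>u n x\<bar> powr q) \<le> e" for n
      proof -
        have "(LINT x|M. 2 * c * \<epsilon> * \<bar>u n x\<bar> powr q) = 2 * c * \<epsilon> * (LINT x|M. \<bar>u n x\<bar> powr q)" by simp
        also have "\<dots> \<le> 2 * c * \<epsilon> * Y"
        proof (intro mult_left_mono)
          have "(LINT x|M. \<bar>u n x\<bar> powr q) \<le> (A * nrm (u n)) powr q" using A(2)[OF u] by blast
          also have "\<dots> \<le> (A * B) powr q" using A(1) B q_gt_2 by (intro powr_mono2 mult_left_mono) auto
          finally show "(LINT x|M. \<bar>u n x\<bar> powr q) \<le> Y" by (simp add: Y_def)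
        qed (use c_pos \<epsilon> in auto)
        also have "\<dots> = e" using c_pos Y by (simp add: \<epsilon>_def)
        finally show ?thesis .
      qed
      then show "\<forall>\<^sub>F n in sequentially. (LINT x|M. 2 * c * \<epsilon> * \<bar>u n x\<bar> powr q) \<le> e" by simp
    qed
  qed
  have "(\<lambda>n. LINT x|M. \<bar>g n x\<bar>) \<longlonglongrightarrow> 0"
    by (rule tendsto_integral_abs_0(2)[OF gm g0 dom])
  moreover have "norm (D (u n) - D v) \<le> (LINT x|M. \<bar>g n x\<bar>)" for n
  proof -
    have "D (u n) - D v = (LINT x|M. g n x)"
      unfolding D_def g_def by (intro Bochner_Integration.integral_diff[symmetric] f_mult_integrable u v)
    then show ?thesis using integral_abs_bound[of M "g n"] by simp
  qed
  ultimately have "(\<lambda>n. D (u n) - D v) \<longlonglongrightarrow> 0"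
    by (intro Lim_null_comparison[where f="\<lambda>n. D (u n) - D v" and g="\<lambda>n. LINT x|M. \<bar>g n x\<bar>"] always_eventually allI)
  then show ?thesis by (simp add: LIM_zero_iff)
qed

text \<open>A one-sided Brezis--Lieb lemma: the loss \<open>\<delta>\<close> makes \<open>|u n| powr q - (1 + \<delta>) |u n - v| powr q\<close>
  dominated from above.\<close>

lemma Pq_split:
  assumes u: "\<And>n. u n \<in> H10 \<Omega>" and v: "v \<in> H10 \<Omega>"
    and l: "AE x in M. (\<lambda>n. u n x) \<longlonglongrightarrow> v x" and \<delta>: "\<delta> > 0"
  obtains Y where "Y \<longlonglongrightarrow> Pq v" "\<And>n. Pq (u n) \<le> (1 + \<delta>) * Pq (\<lambda>x. u n x - v x) + Y n"
proof -
  obtain C where C: "C \<ge> 0" "\<And>x y :: real. \<bar>x + y\<bar> powr q \<le> (1 + \<delta>) * \<bar>x\<bar> powr q + C * \<bar>y\<bar> powr q"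
    using abs_add_powr_le[OF \<delta>, of q] q_gt_2 by auto
  define g where "g n x = \<bar>u n x\<bar> powr q - (1 + \<delta>) * \<bar>u n x - v x\<bar> powr q" for n x
  have gi: "integrable M (g n)" for n
    unfolding g_def using Pq_integrable[OF u] Pq_integrable[OF H10_diff[OF u v]] by auto
  have gm: "(\<lambda>x. max 0 (g n x)) \<in> borel_measurable M" for n
    using gi[of n] by auto
  have vi: "integrable M (\<lambda>x. C * \<bar>v x\<bar> powr q)" using Pq_integrable[OF v] by auto
  have gb: "norm (max 0 (g n x)) \<le> C * \<bar>v x\<bar> powr q" for n x
    using C(2)[of "u n x - v x" "v x"] C(1) by (simp add: g_def)
  have mi: "integrable M (\<lambda>x. max 0 (g n x))" for n
    by (rule Bochner_Integration.integrable_bound[OF vi gm]) (use gb C(1) in \<open>auto intro!: AE_I2\<close>)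
  have "(\<lambda>n. LINT x|M. max 0 (g n x)) \<longlonglongrightarrow> (LINT x|M. \<bar>v x\<bar> powr q)"
  proof (rule integral_dominated_convergence[OF _ gm vi])
    show "AE x in M. (\<lambda>n. max 0 (g n x)) \<longlonglongrightarrow> \<bar>v x\<bar> powr q"
      using l
    proof eventually_elim
      case (elim x)
      have "(\<lambda>n. max 0 (g n x)) \<longlonglongrightarrow> max 0 (\<bar>v x\<bar> powr q - (1 + \<delta>) * \<bar>v x - v x\<bar> powr q)"
        unfolding g_def
        by (intro tendsto_max tendsto_diff tendsto_mult_left tendsto_powr' tendsto_rabs tendsto_const elim) (use q_gt_2 in auto)
      then show ?case by simp
    qed
    show "AE x in M. norm (max 0 (g n x)) \<le> C * \<bar>v x\<bar> powr q" for n using gb by auto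
    show "(\<lambda>x. \<bar>v x\<bar> powr q) \<in> borel_measurable M" using Pq_integrable[OF v] by auto
  qed
  then have Y: "(\<lambda>n. LINT x|M. max 0 (g n x)) \<longlonglongrightarrow> Pq v" by (simp add: Pq_def)
  show thesis
  proof (rule that[OF Y])
    fix n
    have "Pq (u n) - (1 + \<delta>) * Pq (\<lambda>x. u n x - v x) = (LINT x|M. g n x)"
      unfolding g_def Pq_def using Pq_integrable[OF u] Pq_integrable[OF H10_diff[OF u v]] by simp
    also have "\<dots> \<le> (LINT x|M. max 0 (g n x))" by (rule integral_mono[OF gi mi]) simp
    finally show "Pq (u n) \<le> (1 + \<delta>) * Pq (\<lambda>x. u n x - v x) + (LINT x|M. max 0 (g n x))" by simp
  qed
qed

lemma AE_zero_num:
  assumes v: "v \<in> H10 \<Omega>" and z: "AE x in M. v x = 0"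
  shows "num v = 0" "D v = 0"
proof -
  have "is_weak_gradient \<Omega> v (\<lambda>x. 0)"
    unfolding is_weak_gradient_def
    by (intro ballI) (simp, intro integral_eq_zero_AE, use z in auto)
  from H1I(2)[OF H10D(1)[OF v] sqint_zero this]
  have "l2n M (weak_grad \<Omega> v) = l2n M (\<lambda>x. 0 :: 'a)"
    by (intro l2n_cong_AE sqint_measurable H10D v) auto
  then have "nrm v = 0" by (simp add: H10_norm_eq l2n_def)
  moreover have "Pq v = 0" unfolding Pq_def by (rule integral_eq_zero_AE) (use z in auto)
  ultimately show "num v = 0" by (simp add: num_def)
  show "D v = 0" unfolding D_def by (rule integral_eq_zero_AE) (use z in auto)
qed

theorem Lam_attained: "\<exists>v\<in>H10_nonzero \<Omega>. num v = Lam * D v"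
proof -
  obtain \<delta> where \<delta>: "\<delta> > 0"
    "\<And>u. u \<in> H10 \<Omega> \<Longrightarrow> \<delta> * ((nrm u)\<^sup>2 + nrm u ^ 4) + (1 + \<delta>) * Pq u \<le> a * (nrm u)\<^sup>2 + b * nrm u ^ 4"
    using num_lower_bound by blast
  have co: "\<delta> * ((nrm u)\<^sup>2 + nrm u ^ 4) \<le> num u" if "u \<in> H10 \<Omega>" for u
  proof -
    have "Pq u \<le> (1 + \<delta>) * Pq u" using \<delta>(1) Pq_nonneg[of u] by (simp add: algebra_simps)
    then show ?thesis using \<delta>(2)[OF that] unfolding num_def by linarith
  qed
  have "\<exists>u\<in>H10_nonzero \<Omega>. num u / D u < Lam + 1 / real (Suc n)" for n
  proof (rule ccontr)
    assume "\<not> ?thesis"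
    then have "Lam + 1 / real (Suc n) \<le> Lam"
      unfolding Lam_def by (intro cINF_greatest[OF H10_nonzero_nonempty]) (auto simp: not_less)
    then show False by simp
  qed
  then obtain u0 where u0: "\<And>n. u0 n \<in> H10_nonzero \<Omega>" "\<And>n. num (u0 n) / D (u0 n) < Lam + 1 / real (Suc n)" by metis
  have nd0: "num (u0 n) \<le> (Lam + 1 / real (Suc n)) * D (u0 n)" for n
    using u0(2)[of n] D_pos[OF u0(1)[of n]] by (simp add: pos_divide_less_eq less_imp_le)
  \<comment> \<open>The parameter \<open>Lam + 1\<close> lies above all the values
    \<open>Lam + 1 / real (Suc n)\<close>, so one band serves the whole sequence.\<close>
  obtain r R where r: "r > 0"
    "\<And>u. u \<in> H10_nonzero \<Omega> \<Longrightarrow> \<delta> * ((nrm u)\<^sup>2 + nrm u ^ 4) \<le> (Lam + 1) * D u \<or> \<delta> * ((nrm u)\<^sup>2 + nrm u ^ 4) \<le> (Lam + 1) * G u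
       \<Longrightarrow> r \<le> nrm u \<and> nrm u \<le> R"
    using norm_band[OF \<delta>(1), of "Lam + 1"] Lam_pos by auto
  have band0: "r \<le> nrm (u0 n) \<and> nrm (u0 n) \<le> R" for n
  proof (rule r(2)[OF u0(1)], rule disjI1)
    have "(Lam + 1 / real (Suc n)) * D (u0 n) \<le> (Lam + 1) * D (u0 n)"
      using D_pos[OF u0(1)[of n]] by (intro mult_right_mono) auto
    then show "\<delta> * ((nrm (u0 n))\<^sup>2 + nrm (u0 n) ^ 4) \<le> (Lam + 1) * D (u0 n)"
      using nd0[of n] co[OF H10_nonzeroD[OF u0(1)[of n]]] by linarith
  qed
  obtain v s where v: "v \<in> H10 \<Omega>" and s: "strict_mono (s :: nat \<Rightarrow> nat)" "AE x in M. (\<lambda>n. u0 (s n) x) \<longlonglongrightarrow> v x"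
    and ips: "\<And>w. w \<in> H10 \<Omega> \<Longrightarrow> (\<lambda>n. ip (u0 (s n)) w) \<longlonglongrightarrow> ip v w"
    using H10_compact[of u0 R] H10_nonzeroD[OF u0(1)] band0 by blast
  define u where "u n = u0 (s n)" for n
  have uH: "u n \<in> H10 \<Omega>" for n unfolding u_def by (rule H10_nonzeroD[OF u0(1)])
  have ub: "r \<le> nrm (u n)" "nrm (u n) \<le> R" for n using band0[of "s n"] by (auto simp: u_def)
  have ul: "AE x in M. (\<lambda>n. u n x) \<longlonglongrightarrow> v x" using s(2) by (simp add: u_def)
  have Dl: "(\<lambda>n. D (u n)) \<longlonglongrightarrow> D v" by (rule D_tendsto[OF uH ub(2) v ul])
  have "(\<lambda>n. 1 / real (Suc (s n))) \<longlonglongrightarrow> 0"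
    using LIMSEQ_subseq_LIMSEQ[OF LIMSEQ_Suc[OF lim_1_over_n] s(1)] by (simp add: o_def)
  then have "(\<lambda>n. (Lam + 1 / real (Suc (s n))) * D (u n)) \<longlonglongrightarrow> (Lam + 0) * D v"
    by (intro tendsto_intros Dl)
  then have upper: "(\<lambda>n. (Lam + 1 / real (Suc (s n))) * D (u n)) \<longlonglongrightarrow> Lam * D v" by simp
  have nd: "num (u n) \<le> (Lam + 1 / real (Suc (s n))) * D (u n)" for n using nd0[of "s n"] by (simp add: u_def)
  \<comment> \<open>Coercivity and the lower end \<open>r\<close> of the band keep
    \<open>num (u n)\<close> above \<open>\<delta> * r\<^sup>2\<close>, whereas a vanishing limit
    would force its upper bounds to tend to \<open>Lam * D v = 0\<close>.\<close>
  have "\<not> (AE x in M. v x = 0)"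
  proof
    assume "AE x in M. v x = 0"
    then have "D v = 0" by (rule AE_zero_num(2)[OF v])
    have "\<delta> * r\<^sup>2 \<le> Lam * D v"
    proof (rule LIMSEQ_le_const[OF upper])
      show "\<exists>N. \<forall>n\<ge>N. \<delta> * r\<^sup>2 \<le> (Lam + 1 / real (Suc (s n))) * D (u n)"
      proof (intro exI allI impI)
        fix n
        have "\<delta> * r\<^sup>2 \<le> \<delta> * ((nrm (u n))\<^sup>2 + nrm (u n) ^ 4)"
          using \<delta>(1) r(1) ub(1)[of n] by (intro mult_left_mono add_increasing2 power_mono) auto
        also have "\<dots> \<le> num (u n)" by (rule co[OF uH])
        also have "\<dots> \<le> (Lam + 1 / real (Suc (s n))) * D (u n)" by (rule nd)
        finally show "\<delta> * r\<^sup>2 \<le> (Lam + 1 / real (Suc (s n))) * D (u n)" .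
      qed
    qed
    then have "\<delta> * r\<^sup>2 \<le> 0" using \<open>D v = 0\<close> by simp
    moreover have "\<delta> * r\<^sup>2 > 0" using \<delta>(1) r(1) by simp
    ultimately show False by simp
  qed
  then have vn: "v \<in> H10_nonzero \<Omega>" using v by (simp add: H10_nonzero_def)
  obtain Y where Y: "Y \<longlonglongrightarrow> Pq v" "\<And>n. Pq (u n) \<le> (1 + \<delta>) * Pq (\<lambda>x. u n x - v x) + Y n"
    using Pq_split[OF uH v ul \<delta>(1)] by blast
  \<comment> \<open>The squared norm of \<open>u n\<close> is exactly \<open>A n + U + e n\<close>;
    weak convergence, tested with \<open>v\<close>, sends \<open>e n\<close> to \<open>0\<close>,
    while \<open>A n\<close> need not tend to \<open>0\<close>.\<close>
  define U where "U = (nrm v)\<^sup>2"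
  define A where "A n = (nrm (\<lambda>x. u n x - v x))\<^sup>2" for n
  define e where "e n = 2 * (ip (u n) v - U)" for n
  have A0: "A n \<ge> 0" for n by (simp add: A_def)
  have e0: "e \<longlonglongrightarrow> 0"
  proof -
    have "e \<longlonglongrightarrow> 2 * (ip v v - U)"
      unfolding e_def u_def by (intro tendsto_intros ips v)
    then show ?thesis by (simp add: ip_self U_def)
  qed
  have nu: "(nrm (u n))\<^sup>2 = A n + U + e n" for n
  proof -
    have 1: "A n = ip (u n) (\<lambda>x. u n x - v x) - ip v (\<lambda>x. u n x - v x)"
      unfolding A_def ip_self[symmetric] by (rule ip_diff_left) (intro uH v H10_diff)+
    have 2: "ip (u n) (\<lambda>x. u n x - v x) = (nrm (u n))\<^sup>2 - ip (u n) v"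
      using ip_diff_left[OF uH[of n] v uH[of n]] ip_commute[of "u n" "\<lambda>x. u n x - v x"] ip_commute[of "u n" v]
      by (simp add: ip_self)
    have 3: "ip v (\<lambda>x. u n x - v x) = ip (u n) v - U"
      using ip_diff_left[OF uH[of n] v v] ip_commute[of v "\<lambda>x. u n x - v x"] by (simp add: ip_self U_def)
    show ?thesis using 1 2 3 by (simp add: e_def)
  qed
  have AB: "A n \<le> R\<^sup>2 + \<bar>e n\<bar>" for n
  proof -
    have "(nrm (u n))\<^sup>2 \<le> R\<^sup>2" using ub(2)[of n] by (intro power_mono) auto
    then show ?thesis using nu[of n] by (simp add: U_def) (smt (verit) zero_le_power2)
  qed
  have p4: "x ^ 4 = (x\<^sup>2)\<^sup>2" for x :: real by (simp add: power_mult[symmetric])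
  \<comment> \<open>The terms \<open>a * A n + b * (A n)\<^sup>2\<close> pay for the critical mass
    \<open>(1 + \<delta>) * Pq (u n - v)\<close>, the cross term \<open>2 * (A n * U)\<close> is
    nonnegative and dropped, and all terms with \<open>e n\<close> are collected in the subtracted
    error. What is left tends to \<open>num v\<close>.\<close>
  have lower: "num v + (Pq v - Y n) - (a * \<bar>e n\<bar> + 2 * b * \<bar>e n\<bar> * (R\<^sup>2 + \<bar>e n\<bar> + U)) \<le> num (u n)" for n
  proof -
    have "(1 + \<delta>) * Pq (\<lambda>x. u n x - v x) \<le> a * A n + b * (A n)\<^sup>2"
    proof -
      have "0 \<le> \<delta> * ((nrm (\<lambda>x. u n x - v x))\<^sup>2 + nrm (\<lambda>x. u n x - v x) ^ 4)" using \<delta>(1) by simp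
      then show ?thesis using \<delta>(2)[OF H10_diff[OF uH[of n] v]] unfolding A_def p4 by linarith
    qed
    then have P: "Pq (u n) \<le> a * A n + b * (A n)\<^sup>2 + Y n" using Y(2)[of n] by linarith
    have "num (u n) = a * (A n + U + e n) + b * (A n + U + e n)\<^sup>2 - Pq (u n)"
      unfolding num_def p4 nu ..
    also have "(A n + U + e n)\<^sup>2 = (A n)\<^sup>2 + U\<^sup>2 + 2 * (A n * U) + 2 * (e n * (A n + U)) + (e n)\<^sup>2"
      by (simp add: power2_eq_square algebra_simps)
    finally have N: "num (u n) = a * (A n + U + e n) + b * ((A n)\<^sup>2 + U\<^sup>2 + 2 * (A n * U) + 2 * (e n * (A n + U)) + (e n)\<^sup>2) - Pq (u n)" .
    have U0: "U \<ge> 0" by (simp add: U_def)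
    have "b * (U\<^sup>2 - 2 * (\<bar>e n\<bar> * (R\<^sup>2 + \<bar>e n\<bar> + U))) \<le> b * (U\<^sup>2 + 2 * (A n * U) + 2 * (e n * (A n + U)) + (e n)\<^sup>2)"
    proof (rule mult_left_mono)
      have "- (e n * (A n + U)) \<le> \<bar>e n\<bar> * (A n + U)"
        using A0[of n] U0 by (metis abs_ge_minus_self abs_mult abs_of_nonneg add_nonneg_nonneg minus_mult_left mult_right_mono)
      also have "\<dots> \<le> \<bar>e n\<bar> * (R\<^sup>2 + \<bar>e n\<bar> + U)" using AB[of n] by (intro mult_left_mono) auto
      finally have "- (e n * (A n + U)) \<le> \<bar>e n\<bar> * (R\<^sup>2 + \<bar>e n\<bar> + U)" .
      moreover have "0 \<le> A n * U" "0 \<le> (e n)\<^sup>2" using A0[of n] U0 by auto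
      ultimately show "U\<^sup>2 - 2 * (\<bar>e n\<bar> * (R\<^sup>2 + \<bar>e n\<bar> + U)) \<le> U\<^sup>2 + 2 * (A n * U) + 2 * (e n * (A n + U)) + (e n)\<^sup>2" by linarith
    qed (use b_pos in simp)
    moreover have "- (a * \<bar>e n\<bar>) \<le> a * e n" using a_pos by (simp add: abs_if)
    moreover have "num v = a * U + b * U\<^sup>2 - Pq v" unfolding num_def p4 U_def ..
    ultimately show ?thesis using P unfolding N by (simp add: algebra_simps)
  qed
  have "(\<lambda>n. num v + (Pq v - Y n) - (a * \<bar>e n\<bar> + 2 * b * \<bar>e n\<bar> * (R\<^sup>2 + \<bar>e n\<bar> + U)))
      \<longlonglongrightarrow> num v + (Pq v - Pq v) - (a * \<bar>0\<bar> + 2 * b * \<bar>0\<bar> * (R\<^sup>2 + \<bar>0\<bar> + U))"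
    by (intro tendsto_intros e0 Y(1))
  then have "(\<lambda>n. num v + (Pq v - Y n) - (a * \<bar>e n\<bar> + 2 * b * \<bar>e n\<bar> * (R\<^sup>2 + \<bar>e n\<bar> + U))) \<longlonglongrightarrow> num v" by simp
  from LIMSEQ_le[OF this upper] have "num v \<le> Lam * D v" using order_trans[OF lower nd] by blast
  then show ?thesis using Lam_le[OF vn] vn by (intro bexI[of _ v]) auto
qed

section \<open>Rays, fibers and the comparison with \<open>lambda0_star\<close>\<close>

lemma D_ray_continuous:
  assumes u: "u \<in> H10 \<Omega>"
  shows "continuous_on Z (\<lambda>t. D (\<lambda>x. t * u x))"
  unfolding continuous_on_sequentially
proof (intro allI ballI impI, elim conjE)
  fix X t assume "t \<in> Z" "\<forall>n. X n \<in> Z" and X: "X \<longlonglongrightarrow> t"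
  then obtain B where B: "\<And>n. norm (X n) \<le> B"
    using convergent_imp_Bseq[OF convergentI[OF X]] by (auto simp: Bseq_def)
  show "((\<lambda>t. D (\<lambda>x. t * u x)) \<circ> X) \<longlonglongrightarrow> D (\<lambda>x. t * u x)"
    unfolding o_def
  proof (rule D_tendsto[where B="B * nrm u"])
    show "nrm (\<lambda>x. X n * u x) \<le> B * nrm u" for n
      using B[of n] by (simp add: nrm_cmult[OF u] mult_right_mono)
    show "AE x in M. (\<lambda>n. X n * u x) \<longlonglongrightarrow> t * u x"
      by (intro AE_I2 tendsto_mult_right X)
  qed (intro H10_cmult u)+
qed

lemma Pq_cmult: "t \<ge> 0 \<Longrightarrow> Pq (\<lambda>x. t * u x) = t powr q * Pq u"
  by (simp add: Pq_def abs_mult powr_mult)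

lemma exists_critical:
  assumes "lam \<ge> Lam"
  shows "\<exists>u\<in>H10_nonzero \<Omega>. num u = lam * D u"
proof -
  obtain v where v: "v \<in> H10_nonzero \<Omega>" "num v = Lam * D v" using Lam_attained by blast
  have vH: "v \<in> H10 \<Omega>" by (rule H10_nonzeroD[OF v(1)])
  have lam: "lam > 0" using assms Lam_pos by linarith
  obtain \<delta> where \<delta>: "\<delta> > 0" "\<And>u. u \<in> H10 \<Omega> \<Longrightarrow> \<delta> * ((nrm u)\<^sup>2 + nrm u ^ 4) \<le> num u"
    using num_coercive by blast
  obtain r R where r: "r > 0"
    "\<And>u. u \<in> H10_nonzero \<Omega> \<Longrightarrow> \<delta> * ((nrm u)\<^sup>2 + nrm u ^ 4) \<le> lam * D u \<or> \<delta> * ((nrm u)\<^sup>2 + nrm u ^ 4) \<le> lam * G u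
       \<Longrightarrow> r \<le> nrm u \<and> nrm u \<le> R"
    using norm_band[OF \<delta>(1) lam] by blast
  have V: "nrm v > 0" by (rule nrm_pos(1)[OF v(1)])
  \<comment> \<open>So large that \<open>t * nrm v\<close> lies beyond \<open>R\<close>: outside the
    band \<open>num\<close> exceeds \<open>lam * D\<close>, so \<open>h t \<ge> 0\<close>, while
    \<open>h 1 \<le> 0\<close> because \<open>lam \<ge> Lam\<close>; the intermediate value theorem
    applies.\<close>
  define t where "t = (\<bar>R\<bar> + 1) / nrm v + 1"
  have t: "t \<ge> 1" using V by (simp add: t_def)
  define h where "h s = num (\<lambda>x. s * v x) - lam * D (\<lambda>x. s * v x)" for s
  have tn: "(\<lambda>x. t * v x) \<in> H10_nonzero \<Omega>" by (rule H10_nonzero_cmult[OF v(1)]) (use t in auto)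
  have "h t \<ge> 0"
  proof (rule ccontr)
    assume "\<not> ?thesis"
    then have "num (\<lambda>x. t * v x) \<le> lam * D (\<lambda>x. t * v x)" by (simp add: h_def)
    with \<delta>(2)[OF H10_nonzeroD[OF tn]] have "nrm (\<lambda>x. t * v x) \<le> R" using r(2)[OF tn] by linarith
    then have "t * nrm v \<le> R" using t by (simp add: nrm_cmult[OF vH])
    moreover have "t * nrm v = \<bar>R\<bar> + 1 + nrm v" using V by (simp add: t_def field_simps)
    ultimately show False using V by linarith
  qed
  moreover have "h 1 \<le> 0" using v(2) assms D_pos[OF v(1)] by (simp add: h_def mult_right_mono)
  moreover have "continuous_on {1..t} h"
  proof -
    have "continuous_on {1..t} (\<lambda>s. a * (s * nrm v)\<^sup>2 + b * (s * nrm v) ^ 4 - s powr q * Pq v - lam * D (\<lambda>x. s * v x))"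
      by (intro continuous_intros D_ray_continuous vH) auto
    then show ?thesis
      by (rule continuous_on_cong[THEN iffD1, rotated 2]) (auto simp: h_def num_def nrm_cmult[OF vH] Pq_cmult)
  qed
  ultimately obtain s where s: "1 \<le> s" "s \<le> t" "h s = 0"
    using IVT'[of h 1 0 t] t by auto
  then show ?thesis
    by (intro bexI[of _ "\<lambda>x. s * v x"] H10_nonzero_cmult[OF v(1)]) (auto simp: h_def)
qed

text \<open>The fiber at parameter \<open>0\<close> has derivative \<open>num (s u) / s\<close>,
  which coercivity bounds below by \<open>\<delta> * (s * V\<^sup>2 + s ^ 3 * V ^ 4)\<close>.
  Integration over \<open>s\<close> gives the factors \<open>1/2\<close> and \<open>1/4\<close>, and
  the smaller one is kept for both terms.\<close>

lemma energy_lower_bound: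
  obtains \<delta> where "\<delta> > 0" "\<And>u. u \<in> H10 \<Omega> \<Longrightarrow> \<delta> * ((nrm u)\<^sup>2 + nrm u ^ 4) \<le> \<Phi> 0 u"
proof -
  obtain \<delta> where \<delta>: "\<delta> > 0" "\<And>u. u \<in> H10 \<Omega> \<Longrightarrow> \<delta> * ((nrm u)\<^sup>2 + nrm u ^ 4) \<le> num u"
    using num_coercive by blast
  show thesis
  proof (rule that[of "\<delta> / 4"])
    fix u assume u: "u \<in> H10 \<Omega>"
    define V where "V = nrm u"
    define h where "h s = fiber \<Omega> a b f 0 u s - \<delta> / 4 * ((s * V)\<^sup>2 + (s * V) ^ 4)" for s
    have hd: "(h has_real_derivative L 0 (\<lambda>x. s * u x) u - \<delta> / 4 * (2 * s * V\<^sup>2 + 4 * s ^ 3 * V ^ 4)) (at s)" for s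
      unfolding h_def by (rule derivative_eq_intros fiber_deriv[OF u] refl)+ (simp add: power2_eq_square power4_eq_xxxx power3_eq_cube)
    have "h 0 \<le> h 1"
    proof (rule DERIV_nonneg_imp_increasing_open[where f=h and a=0 and b=1])
      show "continuous_on {0..1} h"
        using hd DERIV_isCont by (intro continuous_at_imp_continuous_on) blast
      fix s :: real assume s: "0 < s" "s < 1"
      have "\<delta> * ((s * V)\<^sup>2 + (s * V) ^ 4) \<le> num (\<lambda>x. s * u x)"
        using \<delta>(2)[OF H10_cmult[OF u, of s]] s by (simp add: nrm_cmult[OF u] V_def)
      then have "\<delta> * ((s * V)\<^sup>2 + (s * V) ^ 4) / s \<le> L 0 (\<lambda>x. s * u x) u"
        using s by (simp add: L_fiber[OF u] divide_right_mono)
      moreover have "\<delta> * ((s * V)\<^sup>2 + (s * V) ^ 4) / s = \<delta> * (s * V\<^sup>2) + \<delta> * (s ^ 3 * V ^ 4)"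
        using s by (simp add: field_simps power2_eq_square power4_eq_xxxx power3_eq_cube)
      moreover have "0 \<le> \<delta> * (s * V\<^sup>2)" using \<delta>(1) s by simp
      moreover have "\<delta> / 4 * (2 * s * V\<^sup>2 + 4 * s ^ 3 * V ^ 4) = \<delta> * (s * V\<^sup>2) / 2 + \<delta> * (s ^ 3 * V ^ 4)" by (simp add: algebra_simps)
      ultimately have "0 \<le> L 0 (\<lambda>x. s * u x) u - \<delta> / 4 * (2 * s * V\<^sup>2 + 4 * s ^ 3 * V ^ 4)" by linarith
      then show "\<exists>y. (h has_real_derivative y) (at s) \<and> 0 \<le> y" using hd by blast
    qed simp
    moreover have "h 0 = 0"
      using nrm_cmult[OF u, of 0] by (simp add: h_def fiber_def energy_eq Pq_def)
    moreover have "h 1 = \<Phi> 0 u - \<delta> / 4 * (V\<^sup>2 + V ^ 4)" by (simp add: h_def fiber_def)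
    ultimately show "\<delta> / 4 * ((nrm u)\<^sup>2 + nrm u ^ 4) \<le> \<Phi> 0 u" by (simp add: V_def)
  qed (use \<delta> in simp)
qed

text \<open>The derivative along the ray is \<open>(num - Lam * D) / t\<close> at the point
  \<open>t * u\<close>, nonnegative since \<open>Lam\<close> is a lower bound of the
  quotients.\<close>

lemma fiber_Lam_mono:
  assumes u: "u \<in> H10_nonzero \<Omega>" and s: "0 < s" "s \<le> 1"
  shows "\<Phi> Lam (\<lambda>x. s * u x) \<le> \<Phi> Lam u"
proof -
  have uH: "u \<in> H10 \<Omega>" by (rule H10_nonzeroD[OF u])
  have "fiber \<Omega> a b f Lam u s \<le> fiber \<Omega> a b f Lam u 1"
  proof (rule DERIV_nonneg_imp_nondecreasing[OF s(2)])
    fix t assume t: "s \<le> t" "t \<le> 1"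
    have "0 \<le> L Lam (\<lambda>x. t * u x) u"
      using Lam_le[OF H10_nonzero_cmult[OF u, of t]] t s by (simp add: L_fiber[OF uH])
    then show "\<exists>y. (fiber \<Omega> a b f Lam u has_real_derivative y) (at t) \<and> 0 \<le> y"
      using fiber_deriv[OF uH] by blast
  qed
  then show ?thesis by (simp add: fiber_def)
qed

text \<open>The fiber is \<open>n t - lam * g t\<close> with \<open>g > 0\<close>, so it is
  nonnegative for all \<open>t\<close> and zero somewhere exactly when \<open>lam\<close> is the
  minimum of \<open>\<rho> = n / g\<close>. Hence existence amounts to attaining this minimum, and
  uniqueness is immediate; the derivative vanishes there as at any interior minimum.\<close>

lemma lambda0_ex1:
  assumes u: "u \<in> H10_nonzero \<Omega>"
  shows "\<exists>!lam. lam > 0 \<and> (\<exists>t>0. fiber \<Omega> a b f lam u t = 0 \<and>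
     (fiber \<Omega> a b f lam u has_real_derivative 0) (at t) \<and>
     ereal (fiber \<Omega> a b f lam u t) = (INF s\<in>{0<..}. ereal (fiber \<Omega> a b f lam u s)))"
proof -
  have uH: "u \<in> H10 \<Omega>" by (rule H10_nonzeroD[OF u])
  define n where "n t = fiber \<Omega> a b f 0 u t" for t
  define g where "g t = G (\<lambda>x. t * u x)" for t
  have fib: "fiber \<Omega> a b f lam u t = n t - lam * g t" for lam t
    using energy_diff[of lam "\<lambda>x. t * u x" 0] by (simp add: n_def g_def fiber_def)
  have g: "g t > 0" if "t > 0" for t unfolding g_def by (rule G_pos[OF H10_nonzero_cmult[OF u]]) (use that in simp)
  obtain \<delta> where \<delta>: "\<delta> > 0" "\<And>u. u \<in> H10 \<Omega> \<Longrightarrow> \<delta> * ((nrm u)\<^sup>2 + nrm u ^ 4) \<le> \<Phi> 0 u"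
    using energy_lower_bound by blast
  have V: "nrm u > 0" by (rule nrm_pos(1)[OF u])
  have nt: "n t \<ge> \<delta> * ((nrm (\<lambda>x. t * u x))\<^sup>2 + nrm (\<lambda>x. t * u x) ^ 4)" for t
    using \<delta>(2)[OF H10_cmult[OF uH, of t]] by (simp add: n_def fiber_def)
  have n: "n t > 0" if "t > 0" for t
  proof -
    have "0 < \<delta> * ((nrm (\<lambda>x. t * u x))\<^sup>2 + nrm (\<lambda>x. t * u x) ^ 4)"
      using \<delta>(1) V that by (intro mult_pos_pos add_pos_nonneg) (auto simp: nrm_cmult[OF uH])
    then show ?thesis using nt[of t] by linarith
  qed
  define \<rho> where "\<rho> t = n t / g t" for t
  have \<rho>pos: "\<rho> t > 0" if "t > 0" for t using n[OF that] g[OF that] by (simp add: \<rho>_def)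
  obtain r R where r: "r > 0"
    "\<And>w. w \<in> H10_nonzero \<Omega> \<Longrightarrow> \<delta> * ((nrm w)\<^sup>2 + nrm w ^ 4) \<le> \<rho> 1 * D w \<or> \<delta> * ((nrm w)\<^sup>2 + nrm w ^ 4) \<le> \<rho> 1 * G w
       \<Longrightarrow> r \<le> nrm w \<and> nrm w \<le> R"
    using norm_band[OF \<delta>(1) \<rho>pos[OF zero_less_one]] by blast
  \<comment> \<open>The sublevel set of \<open>\<rho>\<close> at the value \<open>\<rho> 1\<close>
    lies in a compact interval away from \<open>0\<close>, so the minimum over all
    \<open>t > 0\<close> is the minimum over that interval.\<close>
  have band: "r / nrm u \<le> t \<and> t \<le> R / nrm u" if t: "t > 0" and le: "\<rho> t \<le> \<rho> 1" for t
  proof -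
    have w: "(\<lambda>x. t * u x) \<in> H10_nonzero \<Omega>" by (rule H10_nonzero_cmult[OF u]) (use t in simp)
    have "n t \<le> \<rho> 1 * g t" using le g[OF t] by (simp add: \<rho>_def[of t] pos_divide_le_eq)
    then have "\<delta> * ((nrm (\<lambda>x. t * u x))\<^sup>2 + nrm (\<lambda>x. t * u x) ^ 4) \<le> \<rho> 1 * G (\<lambda>x. t * u x)"
      using nt[of t] by (simp add: g_def)
    then have "r \<le> nrm (\<lambda>x. t * u x) \<and> nrm (\<lambda>x. t * u x) \<le> R" using r(2)[OF w] by blast
    then show ?thesis using t V by (simp add: nrm_cmult[OF uH] field_simps)
  qed
  define I where "I = {r / nrm u..R / nrm u}"
  have one: "1 \<in> I" using band[of 1] by (simp add: I_def)
  have Ipos: "t > 0" if "t \<in> I" for t using that r(1) V by (auto simp: I_def intro: less_le_trans[of 0 "r / nrm u"])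
  have "continuous_on I \<rho>"
    unfolding \<rho>_def
  proof (rule continuous_on_divide)
    show "continuous_on I n" unfolding n_def
      using fiber_deriv[OF uH] DERIV_isCont by (intro continuous_at_imp_continuous_on) blast
    show "continuous_on I g" unfolding g_def
      using G_fiber[OF uH] DERIV_isCont by (intro continuous_at_imp_continuous_on) blast
    show "\<forall>x\<in>I. g x \<noteq> 0" using g Ipos by force
  qed
  then obtain t where t: "t \<in> I" "\<And>s. s \<in> I \<Longrightarrow> \<rho> t \<le> \<rho> s"
    using continuous_attains_inf[of I \<rho>] one by (auto simp: I_def)
  have t0: "t > 0" by (rule Ipos[OF t(1)])
  have min: "\<rho> t \<le> \<rho> s" if "s > 0" for s
  proof (cases "\<rho> s \<le> \<rho> 1")
    case True then show ?thesis using band[OF that] t(2) by (simp add: I_def)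
  next
    case False then show ?thesis using t(2)[OF one] by simp
  qed
  have f0: "fiber \<Omega> a b f (\<rho> t) u t = 0" using g[OF t0] by (simp add: fib \<rho>_def)
  have fge: "fiber \<Omega> a b f (\<rho> t) u s \<ge> 0" if "s > 0" for s
    using min[OF that] g[OF that] by (simp add: fib \<rho>_def[of s] pos_le_divide_eq)
  have d0: "(fiber \<Omega> a b f (\<rho> t) u has_real_derivative 0) (at t)"
  proof -
    have "L (\<rho> t) (\<lambda>x. t * u x) u = 0"
      by (rule DERIV_local_min[OF fiber_deriv[OF uH] t0]) (use f0 fge in auto)
    then show ?thesis using fiber_deriv[OF uH, of "\<rho> t" t] by simp
  qed
  show ?thesis
  proof (rule ex1I[of _ "\<rho> t"], intro conjI exI[of _ t])
    show "ereal (fiber \<Omega> a b f (\<rho> t) u t) = (INF s\<in>{0<..}. ereal (fiber \<Omega> a b f (\<rho> t) u s))"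
      by (rule antisym) (use f0 fge t0 in \<open>auto intro!: INF_greatest INF_lower2[of t]\<close>)
    fix lam assume "lam > 0 \<and> (\<exists>t>0. fiber \<Omega> a b f lam u t = 0 \<and>
     (fiber \<Omega> a b f lam u has_real_derivative 0) (at t) \<and>
     ereal (fiber \<Omega> a b f lam u t) = (INF s\<in>{0<..}. ereal (fiber \<Omega> a b f lam u s)))"
    then obtain t' where t': "t' > 0" "fiber \<Omega> a b f lam u t' = 0"
      "ereal (fiber \<Omega> a b f lam u t') = (INF s\<in>{0<..}. ereal (fiber \<Omega> a b f lam u s))" by blast
    have "ereal (fiber \<Omega> a b f lam u t') \<le> ereal (fiber \<Omega> a b f lam u t)"
      unfolding t'(3) by (rule INF_lower) (use t0 in simp)
    then have "lam * g t \<le> n t" using t'(2) by (simp add: fib)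
    then have "lam \<le> \<rho> t" using g[OF t0] by (simp add: \<rho>_def pos_le_divide_eq)
    moreover have "\<rho> t \<le> lam"
    proof -
      have "\<rho> t' = lam" using t'(2) g[OF t'(1)] by (simp add: fib \<rho>_def)
      then show ?thesis using min[OF t'(1)] by simp
    qed
    ultimately show "lam = \<rho> t" by simp
  qed (use t0 f0 d0 \<rho>pos in auto)
qed

text \<open>If \<open>\<Phi>\<close> at parameter \<open>\<lambda>0(u)\<close> vanishes at \<open>v = t u\<close>, then \<open>(\<lambda>0(u) - Lam) G v\<close> is the energy of \<open>v\<close> at
  parameter \<open>Lam\<close>. This energy is nondecreasing along the ray through \<open>v\<close>, hence bounded below by its value
  on a small sphere; as the norm of \<open>v\<close> is bounded, the gap is uniform in \<open>u\<close>.\<close>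

theorem Lam_less_lambda0_star: "Lam < lambda0_star \<Omega> a b f"
proof -
  obtain \<delta> where \<delta>: "\<delta> > 0" "\<And>u. u \<in> H10 \<Omega> \<Longrightarrow> \<delta> * ((nrm u)\<^sup>2 + nrm u ^ 4) \<le> \<Phi> 0 u"
    using energy_lower_bound by blast
  obtain r R where r: "r > 0"
    "\<And>w. w \<in> H10_nonzero \<Omega> \<Longrightarrow> \<delta> * ((nrm w)\<^sup>2 + nrm w ^ 4) \<le> (Lam + 1) * D w \<or> \<delta> * ((nrm w)\<^sup>2 + nrm w ^ 4) \<le> (Lam + 1) * G w
       \<Longrightarrow> r \<le> nrm w \<and> nrm w \<le> R"
    using norm_band[OF \<delta>(1), of "Lam + 1"] Lam_pos by auto
  \<comment> \<open>Half of the coercivity constant is spent on dominating \<open>Lam * G\<close> on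
    the small sphere; the other half remains as the positive lower bound there.\<close>
  define \<delta>' where "\<delta>' = \<delta> / 2"
  have \<delta>': "\<delta>' > 0" using \<delta> by (simp add: \<delta>'_def)
  obtain r' R' where r': "r' > 0"
    "\<And>w. w \<in> H10_nonzero \<Omega> \<Longrightarrow> \<delta>' * ((nrm w)\<^sup>2 + nrm w ^ 4) \<le> Lam * D w \<or> \<delta>' * ((nrm w)\<^sup>2 + nrm w ^ 4) \<le> Lam * G w
       \<Longrightarrow> r' \<le> nrm w \<and> nrm w \<le> R'"
    using norm_band[OF \<delta>' Lam_pos] by auto
  obtain B where B: "B > 0" "\<And>u. u \<in> H10 \<Omega> \<Longrightarrow> D u \<le> 1 * (nrm u)\<^sup>2 + B * nrm u powr p"
    using D_bound[of 1] by auto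
  \<comment> \<open>\<open>\<sigma> \<le> r\<close> puts the sphere between \<open>0\<close> and
    \<open>v\<close> on the ray, so the scaling factor \<open>s\<close> is at most \<open>1\<close>;
    \<open>\<sigma> < r'\<close> puts it below the second band, so \<open>Lam * G w\<close> is
    dominated there.\<close>
  define \<sigma> where "\<sigma> = min r (r' / 2)"
  have \<sigma>: "\<sigma> > 0" "\<sigma> \<le> r" "\<sigma> < r'" using r(1) r'(1) by (auto simp: \<sigma>_def)
  define Gm where "Gm = R\<^sup>2 + B * R powr p + 1"
  have Gm: "Gm > 0" using B(1) by (simp add: Gm_def add_nonneg_pos)
  \<comment> \<open>The bound \<open>1\<close> places \<open>lam\<close> below
    \<open>Lam + 1\<close>, so that the first band applies to \<open>v\<close>; the other bound is
    the energy on the sphere divided by an upper bound for \<open>G v\<close>.\<close>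
  define \<gamma> where "\<gamma> = min 1 (\<delta>' * \<sigma>\<^sup>2 / Gm)"
  have \<gamma>: "\<gamma> > 0" using \<delta>' \<sigma> Gm by (simp add: \<gamma>_def)
  have gap: "Lam + \<gamma> \<le> lambda0 \<Omega> a b f u" if u: "u \<in> H10_nonzero \<Omega>" for u
  proof (rule ccontr)
    define lam where "lam = lambda0 \<Omega> a b f u"
    assume "\<not> ?thesis"
    then have less: "lam < Lam + \<gamma>" by (simp add: lam_def)
    then have lam1: "lam \<le> Lam + 1" by (simp add: \<gamma>_def)
    \<comment> \<open>\<open>lambda0_ex1\<close> gives the definite description its meaning, so the
      fiber at parameter \<open>lam\<close> really has a zero.\<close>
    from theI'[OF lambda0_ex1[OF u]] obtain t where t: "t > 0" "fiber \<Omega> a b f lam u t = 0"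
      unfolding lam_def lambda0_def by blast
    define v where "v x = t * u x" for x
    have vn: "v \<in> H10_nonzero \<Omega>" unfolding v_def by (rule H10_nonzero_cmult[OF u]) (use t in simp)
    have vH: "v \<in> H10 \<Omega>" by (rule H10_nonzeroD[OF vn])
    have "\<Phi> lam v = 0" using t(2) by (simp add: fiber_def v_def[abs_def])
    then have E0: "\<Phi> 0 v = lam * G v" and EL: "\<Phi> Lam v = (lam - Lam) * G v"
      using energy_diff[of lam v 0] energy_diff[of lam v Lam] by simp_all
    have Gv: "G v > 0" by (rule G_pos[OF vn])
    have "\<delta> * ((nrm v)\<^sup>2 + nrm v ^ 4) \<le> (Lam + 1) * G v"
      using \<delta>(2)[OF vH] mult_right_mono[OF lam1, of "G v"] Gv E0 by linarith
    then have V: "r \<le> nrm v" "nrm v \<le> R" using r(2)[OF vn] by blast+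
    have V0: "nrm v > 0" using V(1) r(1) by linarith
    define s where "s = \<sigma> / nrm v"
    have s: "0 < s" "s \<le> 1" using \<sigma> V by (auto simp: s_def intro: order_trans)
    define w where "w x = s * v x" for x
    have wn: "w \<in> H10_nonzero \<Omega>" unfolding w_def by (rule H10_nonzero_cmult[OF vn]) (use s in simp)
    have nw: "nrm w = \<sigma>" using nrm_cmult[OF vH, of s] s V0 \<sigma>(1) by (simp add: w_def[abs_def] s_def)
    have "\<not> \<delta>' * ((nrm w)\<^sup>2 + nrm w ^ 4) \<le> Lam * G w"
      using r'(2)[OF wn] \<sigma>(3) nw by auto
    then have Gw: "Lam * G w < \<delta>' * (\<sigma>\<^sup>2 + \<sigma> ^ 4)" by (simp add: nw)
    have "\<delta>' * \<sigma>\<^sup>2 \<le> \<delta>' * (\<sigma>\<^sup>2 + \<sigma> ^ 4)" using \<delta>' by simp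
    also have "\<dots> < \<delta> * (\<sigma>\<^sup>2 + \<sigma> ^ 4) - Lam * G w" using Gw by (simp add: \<delta>'_def)
    also have "\<dots> \<le> \<Phi> 0 w - Lam * G w" using \<delta>(2)[OF H10_nonzeroD[OF wn]] by (simp add: nw)
    also have "\<dots> = \<Phi> Lam w" using energy_diff[of Lam w 0] by simp
    also have "\<dots> \<le> \<Phi> Lam v" unfolding w_def by (rule fiber_Lam_mono[OF vn s])
    finally have low: "\<delta>' * \<sigma>\<^sup>2 < (lam - Lam) * G v" by (simp add: EL)
    then have pos: "lam - Lam > 0" using Gv \<delta>' \<sigma>(1) by (smt (verit) mult_nonpos_nonneg mult_pos_pos zero_less_power)
    have "G v \<le> 1 * (nrm v)\<^sup>2 + B * nrm v powr p" by (rule G_bound[OF B(2) _ _ vH]) (use B in auto)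
    also have "\<dots> \<le> 1 * R\<^sup>2 + B * R powr p"
      using V V0 B(1) p by (intro add_mono mult_left_mono power_mono powr_mono2) auto
    also have "\<dots> \<le> Gm" by (simp add: Gm_def)
    finally have "(lam - Lam) * G v \<le> (lam - Lam) * Gm" using pos by (intro mult_left_mono) auto
    also have "\<dots> < \<gamma> * Gm" using less Gm by (intro mult_strict_right_mono) auto
    also have "\<dots> \<le> \<delta>' * \<sigma>\<^sup>2 / Gm * Gm" using Gm by (intro mult_right_mono) (auto simp: \<gamma>_def)
    also have "\<dots> = \<delta>' * \<sigma>\<^sup>2" using Gm by simp
    finally show False using low by simp
  qed
  have "Lam + \<gamma> \<le> lambda0_star \<Omega> a b f"
    unfolding lambda0_star_def by (rule cINF_greatest[OF H10_nonzero_nonempty gap])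
  then show ?thesis using \<gamma> by linarith
qed

lemma critical_exists_iff:
  "(\<exists>u\<in>H10_nonzero \<Omega>. \<exists>L'. has_H10_derivative \<Omega> (\<Phi> lam) L' u \<and> L' u = 0) \<longleftrightarrow> Lam \<le> lam"
proof
  assume "\<exists>u\<in>H10_nonzero \<Omega>. \<exists>L'. has_H10_derivative \<Omega> (\<Phi> lam) L' u \<and> L' u = 0"
  then obtain u where u: "u \<in> H10_nonzero \<Omega>" "num u = lam * D u"
    using critical_iff[OF H10_nonzeroD] by blast
  then have "Lam * D u \<le> lam * D u" using Lam_le[OF u(1)] by simp
  then show "Lam \<le> lam" using D_pos[OF u(1)] by simp
next
  assume "Lam \<le> lam"
  then obtain u where "u \<in> H10_nonzero \<Omega>" "num u = lam * D u" using exists_critical by blast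
  then show "\<exists>u\<in>H10_nonzero \<Omega>. \<exists>L'. has_H10_derivative \<Omega> (\<Phi> lam) L' u \<and> L' u = 0"
    using critical_iff[OF H10_nonzeroD] by blast
qed

end

theorem theorem1p4:
  fixes \<Omega> :: "'a::euclidean_space set"
    and a b :: real
    and f :: "'a \<Rightarrow> real \<Rightarrow> real"
  assumes "DIM('a) > 4"
    and "bounded_domain \<Omega>"
    and "a > 0" and "b > 0"
    and "F1 \<Omega> f" and "F2 \<Omega> f" and "F3 \<Omega> f" and "F4 \<Omega> f" and "F5 \<Omega> f"
    and "a powr ((real DIM('a) - 4) / 2) * b > C2 \<Omega>"
  shows "\<exists>\<Lambda>. 0 < \<Lambda> \<and> \<Lambda> < lambda0_star \<Omega> a b f \<and>
     (\<forall>lam. 0 < lam \<and> lam < \<Lambda> \<longrightarrow> \<not> (\<exists>u\<in>H10_nonzero \<Omega>. weak_solution \<Omega> a b f lam u)) \<and>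
     (\<forall>lam>0. (\<exists>u\<in>H10_nonzero \<Omega>. \<exists>L. has_H10_derivative \<Omega> (energy \<Omega> a b f lam) L u \<and> L u = 0)
            \<longleftrightarrow> lam \<ge> \<Lambda>)"
proof -
  obtain c p where cp: "c > 0" "2 < p" "p < crit_exp DIM('a)"
    "AE x in lebesgue_on \<Omega>. \<forall>v. \<bar>f x v\<bar> \<le> c * (1 + \<bar>v\<bar> powr (p - 1))"
    using assms(7) by (auto simp: F3_def)
  interpret kirchhoff \<Omega> "crit_exp DIM('a)" a b f c p
    by unfold_locales (use assms cp in \<open>auto simp: bounded_domain_def\<close>)
  have "\<not> weak_solution \<Omega> a b f lam u" if "lam < Lam" "u \<in> H10_nonzero \<Omega>" for lam u
  proof
    assume "weak_solution \<Omega> a b f lam u"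
    \<comment> \<open>A weak solution has the zero functional as derivative, which in particular
      vanishes in direction \<open>u\<close>.\<close>
    then have "has_H10_derivative \<Omega> (energy \<Omega> a b f lam) (\<lambda>v. 0) u" by (simp add: weak_solution_def)
    then have "Lam \<le> lam" using critical_exists_iff[of lam] that(2) by blast
    with that(1) show False by simp
  qed
  then show ?thesis
    using Lam_pos Lam_less_lambda0_star critical_exists_iff by (intro exI[of _ Lam]) blast
qed

end
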